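(* In the setting described in the context, there are $\mathbb K[[\nu]]$-linear maps $\boldsymbol\Phi:C^\bullet(\mathfrak g,\mathcal C^\infty(Z)[[\nu]])\to\mathscr A^\bullet[[\nu]]$ and $\boldsymbol H:\mathscr A^\bullet[[\nu]]\to\mathscr A^{\bullet-1}[[\nu]]$, which are formal power series in $\nu$ of Fréchet continuous maps, such that $(\boldsymbol{\operatorname{res}},\boldsymbol\Phi,\boldsymbol H)$ is a contraction of $(\mathscr A^\bullet[[\nu]],\boldsymbol D)$ onto $(C^\bullet(\mathfrak g,\mathcal C^\infty(Z)[[\nu]]),\boldsymbol d)$; that is, $\boldsymbol{\operatorname{res}}$ and $\boldsymbol\Phi$ are chain maps, $\boldsymbol{\operatorname{res}}\,\boldsymbol\Phi=\operatorname{id}$ and $\operatorname{id}-\boldsymbol\Phi\,\boldsymbol{\operatorname{res}}=\boldsymbol D\boldsymbol H+\boldsymbol H\boldsymbol D$.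
   Context: Let $\mathbb K=\mathbb R$ or $\mathbb C$. $M$ is a symplectic manifold with a Hamiltonian action of a compact connected Lie group $G$ with Lie algebra $\mathfrak g$ and equivariant moment map $J:M\to\mathfrak g^*$. Fix a basis $e_1,\dots,e_\ell$ of $\mathfrak g$ with structure constants $f_{ab}^c$, $J_a=\langle J,e_a\rangle$, $\{J_a,J_b\}=\sum_cf_{ab}^cJ_c$. Let $Z=J^{-1}(0)$, $I_Z$ the ideal of smooth functions vanishing on $Z$, $\mathcal C^\infty(Z)=\mathcal C^\infty(M)/I_Z$. Standing assumptions: $J_1,\dots,J_\ell$ generate $I_Z$, and the Koszul complex $K_\bullet=\mathcal C^\infty(M)\otimes\wedge^\bullet\mathfrak g$, with $\mathcal C^\infty(M)$-linear superderivation $\partial e_a=J_a$, has vanishing homology in positive degrees. Let $\operatorname{res}:\mathcal C^\infty(M)\to\mathcal C^\infty(Z)$ be restriction, and fix continuous linear maps $\operatorname{prol}:\mathcal C^\infty(Z)\to\mathcal C^\infty(M)$, $h_i:K_i\to K_{i+1}$ with $\operatorname{res}\operatorname{prol}=\operatorname{id}$, $\operatorname{id}-\operatorname{prol}\operatorname{res}=\partial h+h\partial$, $h_0\operatorname{prol}=0$, $h_{i+1}h_i=0$. $\star$ is a star product on $M$: an associative $\mathbb K[[\nu]]$-bilinear product $f\star g=fg+\sum_{i\ge1}\nu^i\mu_i(f,g)$ on $\mathcal C^\infty(M)[[\nu]]$ with unit $1$, $\mu_i$ bidifferential operators and $\mu_1(f,g)-\mu_1(g,f)=\{f,g\}$.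 $\boldsymbol J=J+\sum_{i\ge1}\nu^iJ_i:\mathfrak g\to\mathcal C^\infty(M)[[\nu]]$ is a quantum moment map: linear with $\boldsymbol J(X)\star\boldsymbol J(Y)-\boldsymbol J(Y)\star\boldsymbol J(X)=\nu\boldsymbol J([X,Y])$; $\boldsymbol J_a=\boldsymbol J(e_a)$. BRST algebra: $\mathscr A=\mathcal C^\infty(M)\otimes\wedge(\mathfrak g^*\oplus\mathfrak g)$, generated over $\mathcal C^\infty(M)$ by odd ghosts $\xi^a$ (degree $1$, dual basis of $\mathfrak g^*$) and antighosts $\xi_a$ (degree $-1$, basis of $\mathfrak g$). The product on $\mathscr A[[\nu]]$ is $(fv)*(gw)=(f\star g)(v\cdot w)$, where $v\cdot w=\mu\big(\exp(-2\nu\sum_a\frac{\partial}{\partial\xi_a}\otimes\frac{\partial}{\partial\xi^a})(v\otimes w)\big)$, $\mu$ is the supercommutative product, $\otimes$ is graded, derivatives are left derivations. With $\boldsymbol\theta=-\frac14\sum f_{ab}^c\xi^a\xi^b\xi_c+\sum_a\boldsymbol J_a\xi^a+\frac\nu2\sum_{a,b}f_{ab}^b\xi^a$ the quantum BRST differential is $\boldsymbol D=\frac1\nu[\boldsymbol\theta,\cdot]_*$ (graded commutator). The deformed Koszul differential on $K_\bullet[[\nu]]$ is $\boldsymbol\partial(fv)=\sum_af\star\boldsymbol J_a\frac{\partial v}{\partial\xi_a}+\frac\nu2\sum_{a,b}f_{ab}^bf\frac{\partial v}{\partial\xi_a}+\frac\nu2\sum f_{ab}^cf\,\xi_c\frac{\partial^2v}{\partial\xi_a\partial\xi_b}$.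 Put $\boldsymbol{\operatorname{res}}=\operatorname{res}(\operatorname{id}+(\boldsymbol\partial_1-\partial_1)h_0)^{-1}:\mathcal C^\infty(M)[[\nu]]\to\mathcal C^\infty(Z)[[\nu]]$ ($\partial_1,\boldsymbol\partial_1$ the components $K_1[[\nu]]\to K_0[[\nu]]$), extended to $\mathscr A[[\nu]]\to C^\bullet(\mathfrak g,\mathcal C^\infty(Z)[[\nu]])=\wedge^\bullet\mathfrak g^*\otimes\mathcal C^\infty(Z)[[\nu]]$ coefficientwise and by zero on terms containing antighosts. The formula $\boldsymbol L^z_X=\boldsymbol{\operatorname{res}}\circ\frac1\nu[\boldsymbol J(X),\cdot]_\star\circ\operatorname{prol}$, $X\in\mathfrak g$, defines a representation of $\mathfrak g$ on $\mathcal C^\infty(Z)[[\nu]]$; $\boldsymbol d$ is its Lie algebra cohomology differential. *)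

theory Defs
  imports
    "HOL-Analysis.Analysis"
    "HOL-Algebra.Group_Action"
    "HOL-Library.Function_Algebras"
    "HOL-Computational_Algebra.Formal_Power_Series"
begin

section \<open>Smooth manifolds and smooth functions\<close>

text \<open>
  Manifolds live on a Hausdorff, second countable topological space (a type). A chart is a pair
  of a domain and a coordinate map into \<^term>\<open>Euclidean_space n\<close>, the space of real sequences
  that vanish from index \<open>n\<close> on; dimension \<open>0\<close> is allowed.
\<close>

type_synonym 'm chart = "'m set \<times> ('m \<Rightarrow> nat \<Rightarrow> real)"

definition partial :: "nat \<Rightarrow> ((nat \<Rightarrow> real) \<Rightarrow> 'v::real_normed_vector) \<Rightarrow> (nat \<Rightarrow> real) \<Rightarrow> 'v" where
  "partial i F x = vector_derivative (\<lambda>t. F (x(i := t))) (at (x i))"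

definition partials :: "nat list \<Rightarrow> ((nat \<Rightarrow> real) \<Rightarrow> 'v::real_normed_vector) \<Rightarrow> (nat \<Rightarrow> real) \<Rightarrow> 'v" where
  "partials is F = foldr partial is F"

text \<open>\<open>V\<close> is meant to be open in \<^term>\<open>Euclidean_space n\<close>; all iterated partial derivatives exist
  and are continuous there.\<close>

definition smooth_on :: "nat \<Rightarrow> (nat \<Rightarrow> real) set \<Rightarrow> ((nat \<Rightarrow> real) \<Rightarrow> 'v::real_normed_vector) \<Rightarrow> bool" where
  "smooth_on n V F \<longleftrightarrow>
     (\<forall>is. set is \<subseteq> {..<n} \<longrightarrow>
        continuous_on V (partials is F) \<and>
        (\<forall>x\<in>V. \<forall>i<n. (\<lambda>t. partials is F (x(i := t))) differentiable at (x i)))"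

definition chart_on :: "nat \<Rightarrow> 'm::topological_space chart \<Rightarrow> bool" where
  "chart_on n = (\<lambda>(U, \<phi>). open U \<and> openin (Euclidean_space n) (\<phi> ` U) \<and>
     homeomorphic_map (top_of_set U) (subtopology (Euclidean_space n) (\<phi> ` U)) \<phi>)"

text \<open>Transition maps and local representatives use the inverse \<^term>\<open>inv_into U \<phi>\<close> of the
  coordinate map \<open>\<phi>\<close> on its domain \<open>U\<close>.\<close>

definition local_rep :: "'m chart \<Rightarrow> ('m \<Rightarrow> 'v) \<Rightarrow> (nat \<Rightarrow> real) \<Rightarrow> 'v" where
  "local_rep c f = f \<circ> inv_into (fst c) (snd c)"

definition smooth_map ::
  "nat \<Rightarrow> 'm::topological_space chart set \<Rightarrow> nat \<Rightarrow> 'n::topological_space chart set \<Rightarrow> ('m \<Rightarrow> 'n) \<Rightarrow> bool" where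
  "smooth_map p A q B F \<longleftrightarrow> continuous_on UNIV F \<and>
     (\<forall>c\<in>A. \<forall>d\<in>B. \<forall>i<q.
        smooth_on p (snd c ` (fst c \<inter> F -` fst d)) (local_rep c (\<lambda>m. snd d (F m) i)))"

definition smooth_atlas :: "nat \<Rightarrow> 'm::{t2_space, second_countable_topology} chart set \<Rightarrow> bool" where
  "smooth_atlas n A \<longleftrightarrow>
     (\<forall>c\<in>A. chart_on n c) \<and> (\<Union>c\<in>A. fst c) = UNIV \<and>
     (\<forall>c\<in>A. \<forall>d\<in>A. \<forall>i<n. smooth_on n (snd c ` (fst c \<inter> fst d)) (local_rep c (\<lambda>m. snd d m i)))"

definition prod_atlas :: "nat \<Rightarrow> 'm chart set \<Rightarrow> 'n chart set \<Rightarrow> ('m \<times> 'n) chart set" where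
  "prod_atlas p A B =
     {(U \<times> V, \<lambda>(a, b) i. if i < p then \<phi> a i else \<psi> b (i - p)) | U \<phi> V \<psi>. (U, \<phi>) \<in> A \<and> (V, \<psi>) \<in> B}"

definition Cinf :: "nat \<Rightarrow> 'm chart set \<Rightarrow> ('m \<Rightarrow> 'v::real_normed_vector) set" where
  "Cinf n A = {f. \<forall>c\<in>A. smooth_on n (snd c ` fst c) (local_rep c f)}"

text \<open>The Frechet topology: uniform convergence of all partial derivatives on compact subsets of
  chart domains.\<close>

definition Cinf_top :: "nat \<Rightarrow> 'm::topological_space chart set \<Rightarrow> ('m \<Rightarrow> 'v::real_normed_vector) topology" where
  "Cinf_top n A = topology_generated_by
     {{g \<in> Cinf n A. \<forall>m\<in>C. norm (partials is (local_rep c g) (snd c m)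
                               - partials is (local_rep c f) (snd c m)) < \<epsilon>}
      | f c C is \<epsilon>. f \<in> Cinf n A \<and> c \<in> A \<and> compact C \<and> C \<subseteq> fst c \<and> set is \<subseteq> {..<n} \<and> \<epsilon> > (0::real)}"

text \<open>The quotient of the smooth functions by the ideal of functions vanishing on \<open>Z\<close> is realised
  by restrictions to \<open>Z\<close>, extended by \<open>0\<close> off \<open>Z\<close>; it carries the quotient topology.\<close>

definition res0 :: "'m set \<Rightarrow> ('m \<Rightarrow> 'v::zero) \<Rightarrow> 'm \<Rightarrow> 'v" where
  "res0 Z f = (\<lambda>m. if m \<in> Z then f m else 0)"

definition CinfZ :: "nat \<Rightarrow> 'm chart set \<Rightarrow> 'm set \<Rightarrow> ('m \<Rightarrow> 'v::real_normed_vector) set" where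
  "CinfZ n A Z = res0 Z ` Cinf n A"

definition CinfZ_top ::
  "nat \<Rightarrow> 'm::topological_space chart set \<Rightarrow> 'm set \<Rightarrow> ('m \<Rightarrow> 'v::real_normed_vector) topology" where
  "CinfZ_top n A Z = topology (\<lambda>W. W \<subseteq> CinfZ n A Z \<and> openin (Cinf_top n A) {f \<in> Cinf n A. res0 Z f \<in> W})"

lemma openin_CinfZ_top:
  fixes W :: "('m::topological_space \<Rightarrow> 'v::real_normed_vector) set"
  shows "openin (CinfZ_top n A Z) W \<longleftrightarrow>
     W \<subseteq> CinfZ n A Z \<and> openin (Cinf_top n A) {f \<in> Cinf n A. res0 Z f \<in> W}"
proof -
  have "istopology (\<lambda>W :: ('m \<Rightarrow> 'v) set. W \<subseteq> CinfZ n A Z \<and> openin (Cinf_top n A) {f \<in> Cinf n A. res0 Z f \<in> W})"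
    unfolding istopology_def
  proof (intro conjI allI impI)
    fix S T :: "('m \<Rightarrow> 'v) set" assume a: "S \<subseteq> CinfZ n A Z \<and> openin (Cinf_top n A) {f \<in> Cinf n A. res0 Z f \<in> S}"
      "T \<subseteq> CinfZ n A Z \<and> openin (Cinf_top n A) {f \<in> Cinf n A. res0 Z f \<in> T}"
    have "{f \<in> Cinf n A. res0 Z f \<in> S \<inter> T} =
      {f \<in> Cinf n A. res0 Z f \<in> S} \<inter> {f \<in> Cinf n A. res0 Z f \<in> T}" by blast
    then show "openin (Cinf_top n A) {f \<in> Cinf n A. res0 Z f \<in> S \<inter> T}"
      using a by (simp add: openin_Int)
    show "S \<inter> T \<subseteq> CinfZ n A Z" using a by blast
  next
    fix \<K> :: "('m \<Rightarrow> 'v) set set" assume a: "\<forall>K\<in>\<K>. K \<subseteq> CinfZ n A Z \<and> openin (Cinf_top n A) {f \<in> Cinf n A. res0 Z f \<in> K}"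
    have "{f \<in> Cinf n A. res0 Z f \<in> \<Union>\<K>} = \<Union>((\<lambda>K. {f \<in> Cinf n A. res0 Z f \<in> K}) ` \<K>)" by blast
    then show "openin (Cinf_top n A) {f \<in> Cinf n A. res0 Z f \<in> \<Union>\<K>}"
      using a by auto
    show "\<Union>\<K> \<subseteq> CinfZ n A Z" using a by blast
  qed
  then show ?thesis by (simp add: CinfZ_top_def topology_inverse')
qed

section \<open>Vector fields, Lie groups, symplectic forms and moment maps\<close>

text \<open>Vector fields are derivations of the real smooth functions. They are set to \<open>0\<close> on
  non-smooth functions, so that each derivation is represented by exactly one function.\<close>

definition vector_fields :: "nat \<Rightarrow> 'm chart set \<Rightarrow> (('m \<Rightarrow> real) \<Rightarrow> 'm \<Rightarrow> real) set" where
  "vector_fields n A = {X.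
     (\<forall>f\<in>Cinf n A. X f \<in> Cinf n A) \<and> (\<forall>f. f \<notin> Cinf n A \<longrightarrow> X f = 0) \<and>
     (\<forall>f\<in>Cinf n A. \<forall>g\<in>Cinf n A. X (f + g) = X f + X g \<and> X (f * g) = X f * g + f * X g) \<and>
     (\<forall>r. \<forall>f\<in>Cinf n A. X (\<lambda>m. r * f m) = (\<lambda>m. r * X f m))}"

definition vf_scale :: "real \<Rightarrow> (('m \<Rightarrow> real) \<Rightarrow> 'm \<Rightarrow> real) \<Rightarrow> ('m \<Rightarrow> real) \<Rightarrow> 'm \<Rightarrow> real" where
  "vf_scale r X = (\<lambda>f m. r * X f m)"

definition vf_bracket ::
  "(('m \<Rightarrow> real) \<Rightarrow> 'm \<Rightarrow> real) \<Rightarrow> (('m \<Rightarrow> real) \<Rightarrow> 'm \<Rightarrow> real) \<Rightarrow> ('m \<Rightarrow> real) \<Rightarrow> 'm \<Rightarrow> real" where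
  "vf_bracket X Y = (\<lambda>f. X (Y f) - Y (X f))"

text \<open>\<open>vf_push \<psi> \<psi>' X\<close> is the push-forward of \<open>X\<close> along the diffeomorphism \<open>\<psi>\<close> with inverse \<open>\<psi>'\<close>.\<close>

definition vf_push ::
  "('m \<Rightarrow> 'm) \<Rightarrow> ('m \<Rightarrow> 'm) \<Rightarrow> (('m \<Rightarrow> real) \<Rightarrow> 'm \<Rightarrow> real) \<Rightarrow> ('m \<Rightarrow> real) \<Rightarrow> 'm \<Rightarrow> real" where
  "vf_push \<psi> \<psi>' X = (\<lambda>f m. X (f \<circ> \<psi>) (\<psi>' m))"

definition lie_group ::
  "nat \<Rightarrow> 'g::{t2_space, second_countable_topology} chart set \<Rightarrow> 'g monoid \<Rightarrow> bool" where
  "lie_group p B G \<longleftrightarrow>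
     smooth_atlas p B \<and> group G \<and> carrier G = UNIV \<and>
     smooth_map (p + p) (prod_atlas p B B) p B (\<lambda>(g, h). g \<otimes>\<^bsub>G\<^esub> h) \<and>
     smooth_map p B p B (\<lambda>g. inv\<^bsub>G\<^esub> g)"

text \<open>The Lie algebra consists of the left invariant vector fields.\<close>

definition lie_algebra :: "nat \<Rightarrow> 'g chart set \<Rightarrow> 'g monoid \<Rightarrow> (('g \<Rightarrow> real) \<Rightarrow> 'g \<Rightarrow> real) set" where
  "lie_algebra p B G = {X \<in> vector_fields p B.
     \<forall>g. \<forall>f\<in>Cinf p B. X (\<lambda>h. f (g \<otimes>\<^bsub>G\<^esub> h)) = (\<lambda>h. X f (g \<otimes>\<^bsub>G\<^esub> h))}"

definition Ad :: "'g monoid \<Rightarrow> 'g \<Rightarrow> (('g \<Rightarrow> real) \<Rightarrow> 'g \<Rightarrow> real) \<Rightarrow> ('g \<Rightarrow> real) \<Rightarrow> 'g \<Rightarrow> real" where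
  "Ad G g = vf_push (\<lambda>h. g \<otimes>\<^bsub>G\<^esub> h \<otimes>\<^bsub>G\<^esub> inv\<^bsub>G\<^esub> g) (\<lambda>h. inv\<^bsub>G\<^esub> g \<otimes>\<^bsub>G\<^esub> h \<otimes>\<^bsub>G\<^esub> g)"

definition lie_basis ::
  "(('g \<Rightarrow> real) \<Rightarrow> 'g \<Rightarrow> real) set \<Rightarrow> nat \<Rightarrow> (nat \<Rightarrow> ('g \<Rightarrow> real) \<Rightarrow> 'g \<Rightarrow> real) \<Rightarrow> bool" where
  "lie_basis L l e \<longleftrightarrow>
     (\<forall>a<l. e a \<in> L) \<and>
     (\<forall>X\<in>L. \<exists>r. X = (\<Sum>a<l. vf_scale (r a) (e a))) \<and>
     (\<forall>r. (\<Sum>a<l. vf_scale (r a) (e a)) = 0 \<longrightarrow> (\<forall>a<l. r a = 0))"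

text \<open>A two-form is an alternating function-bilinear map on vector fields; closedness is the
  invariant formula for its exterior derivative.\<close>

definition symplectic_form ::
  "nat \<Rightarrow> 'm chart set \<Rightarrow>
   ((('m \<Rightarrow> real) \<Rightarrow> 'm \<Rightarrow> real) \<Rightarrow> (('m \<Rightarrow> real) \<Rightarrow> 'm \<Rightarrow> real) \<Rightarrow> 'm \<Rightarrow> real) \<Rightarrow> bool" where
  "symplectic_form n A \<omega> \<longleftrightarrow> (let V = vector_fields n A in
     (\<forall>X\<in>V. \<forall>Y\<in>V. \<omega> X Y \<in> Cinf n A \<and> \<omega> X X = 0 \<and> \<omega> X Y = - \<omega> Y X) \<and>
     (\<forall>X\<in>V. \<forall>X'\<in>V. \<forall>Y\<in>V. \<omega> (X + X') Y = \<omega> X Y + \<omega> X' Y) \<and>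
     (\<forall>f\<in>Cinf n A. \<forall>X\<in>V. \<forall>Y\<in>V. \<omega> (\<lambda>g. f * X g) Y = f * \<omega> X Y) \<and>
     (\<forall>X\<in>V. \<forall>Y\<in>V. \<forall>W\<in>V.
        X (\<omega> Y W) - Y (\<omega> X W) + W (\<omega> X Y)
        - \<omega> (vf_bracket X Y) W + \<omega> (vf_bracket X W) Y - \<omega> (vf_bracket Y W) X = 0) \<and>
     (\<forall>X\<in>V. \<forall>m. (\<forall>Y\<in>V. \<omega> X Y m = 0) \<longrightarrow> (\<forall>f\<in>Cinf n A. X f m = 0)))"

text \<open>Conventions: the Hamiltonian vector field satisfies \<open>\<omega>(X\<^sub>f, Y) = Y f\<close>, and
  \<open>{f, g} = \<omega>(X\<^sub>f, X\<^sub>g)\<close>.\<close>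

definition ham_field ::
  "nat \<Rightarrow> 'm chart set \<Rightarrow>
   ((('m \<Rightarrow> real) \<Rightarrow> 'm \<Rightarrow> real) \<Rightarrow> (('m \<Rightarrow> real) \<Rightarrow> 'm \<Rightarrow> real) \<Rightarrow> 'm \<Rightarrow> real) \<Rightarrow>
   ('m \<Rightarrow> real) \<Rightarrow> ('m \<Rightarrow> real) \<Rightarrow> 'm \<Rightarrow> real" where
  "ham_field n A \<omega> f = (THE X. X \<in> vector_fields n A \<and> (\<forall>Y\<in>vector_fields n A. \<omega> X Y = Y f))"

definition poisson ::
  "nat \<Rightarrow> 'm chart set \<Rightarrow>
   ((('m \<Rightarrow> real) \<Rightarrow> 'm \<Rightarrow> real) \<Rightarrow> (('m \<Rightarrow> real) \<Rightarrow> 'm \<Rightarrow> real) \<Rightarrow> 'm \<Rightarrow> real) \<Rightarrow>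
   ('m \<Rightarrow> real) \<Rightarrow> ('m \<Rightarrow> real) \<Rightarrow> 'm \<Rightarrow> real" where
  "poisson n A \<omega> f g = \<omega> (ham_field n A \<omega> f) (ham_field n A \<omega> g)"

text \<open>
  The scalar field is a type \<open>'k\<close> of sort \<open>{real_normed_field, euclidean_space}\<close>. A finite
  dimensional commutative real division algebra with multiplicative norm is the real or the complex
  field, so these are exactly the two intended cases. Below is the extension of the Poisson bracket
  to \<open>'k\<close>-valued functions that is \<open>'k\<close>-bilinear.
\<close>

definition poissonK ::
  "nat \<Rightarrow> 'm chart set \<Rightarrow>
   ((('m \<Rightarrow> real) \<Rightarrow> 'm \<Rightarrow> real) \<Rightarrow> (('m \<Rightarrow> real) \<Rightarrow> 'm \<Rightarrow> real) \<Rightarrow> 'm \<Rightarrow> real) \<Rightarrow>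
   ('m \<Rightarrow> 'k) \<Rightarrow> ('m \<Rightarrow> 'k) \<Rightarrow> 'm \<Rightarrow> 'k::{real_normed_field, euclidean_space}" where
  "poissonK n A \<omega> f g = (\<lambda>m. \<Sum>b\<in>Basis. \<Sum>c\<in>Basis.
     poisson n A \<omega> (\<lambda>x. f x \<bullet> b) (\<lambda>x. g x \<bullet> c) m *\<^sub>R (b * c))"

definition linear_map_on ::
  "('s \<Rightarrow> 'a \<Rightarrow> 'a) \<Rightarrow> ('s \<Rightarrow> 'b \<Rightarrow> 'b) \<Rightarrow> 'a::plus set \<Rightarrow> 'b::plus set \<Rightarrow> ('a \<Rightarrow> 'b) \<Rightarrow> bool" where
  "linear_map_on sa sb V W T \<longleftrightarrow>
     (\<forall>x\<in>V. T x \<in> W) \<and> (\<forall>x\<in>V. \<forall>y\<in>V. T (x + y) = T x + T y) \<and>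
     (\<forall>c. \<forall>x\<in>V. T (sa c x) = sb c (T x))"

definition symplectic_action ::
  "nat \<Rightarrow> 'm::{t2_space, second_countable_topology} chart set \<Rightarrow>
   ((('m \<Rightarrow> real) \<Rightarrow> 'm \<Rightarrow> real) \<Rightarrow> (('m \<Rightarrow> real) \<Rightarrow> 'm \<Rightarrow> real) \<Rightarrow> 'm \<Rightarrow> real) \<Rightarrow>
   nat \<Rightarrow> 'g::{t2_space, second_countable_topology} chart set \<Rightarrow> 'g monoid \<Rightarrow> ('g \<Rightarrow> 'm \<Rightarrow> 'm) \<Rightarrow> bool" where
  "symplectic_action n A \<omega> p B G act \<longleftrightarrow>
     group_action G UNIV act \<and>
     smooth_map (p + n) (prod_atlas p B A) n A (\<lambda>(g, m). act g m) \<and>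
     (\<forall>g. \<forall>X\<in>vector_fields n A. \<forall>Y\<in>vector_fields n A. \<forall>m.
        \<omega> (vf_push (act g) (act (inv\<^bsub>G\<^esub> g)) X) (vf_push (act g) (act (inv\<^bsub>G\<^esub> g)) Y) (act g m) = \<omega> X Y m)"

text \<open>
  \<open>J m X\<close> is the pairing of the value of the moment map at \<open>m\<close> with the Lie algebra element \<open>X\<close>.
  Evaluating the left invariant field \<open>X\<close> at the unit on \<open>g \<mapsto> f (g m)\<close> gives the derivative
  of \<open>f (exp (t X) m)\<close> at \<open>t = 0\<close>. The minus sign makes \<open>f \<mapsto> {J\<^sub>X, f}\<close> a left action of the Lie
  algebra, in accordance with \<open>{J\<^sub>X, J\<^sub>Y} = J\<^sub>[\<^sub>X\<^sub>,\<^sub>Y\<^sub>]\<close>.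
\<close>

definition equivariant_moment_map ::
  "nat \<Rightarrow> 'm chart set \<Rightarrow>
   ((('m \<Rightarrow> real) \<Rightarrow> 'm \<Rightarrow> real) \<Rightarrow> (('m \<Rightarrow> real) \<Rightarrow> 'm \<Rightarrow> real) \<Rightarrow> 'm \<Rightarrow> real) \<Rightarrow>
   nat \<Rightarrow> 'g chart set \<Rightarrow> 'g monoid \<Rightarrow> ('g \<Rightarrow> 'm \<Rightarrow> 'm) \<Rightarrow>
   ('m \<Rightarrow> (('g \<Rightarrow> real) \<Rightarrow> 'g \<Rightarrow> real) \<Rightarrow> real) \<Rightarrow> bool" where
  "equivariant_moment_map n A \<omega> p B G act J \<longleftrightarrow>
     (\<forall>m. linear_map_on vf_scale (*) (lie_algebra p B G) UNIV (J m)) \<and>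
     (\<forall>X\<in>lie_algebra p B G. (\<lambda>m. J m X) \<in> Cinf n A) \<and>
     (\<forall>X\<in>lie_algebra p B G. \<forall>f\<in>Cinf n A. \<forall>m.
        poisson n A \<omega> (\<lambda>x. J x X) f m = - X (\<lambda>g. f (act g m)) \<one>\<^bsub>G\<^esub>) \<and>
     (\<forall>g. \<forall>m. \<forall>X\<in>lie_algebra p B G. J (act g m) X = J m (Ad G (inv\<^bsub>G\<^esub> g) X))"

section \<open>Star products and quantum moment maps\<close>

definition bidifferential ::
  "nat \<Rightarrow> 'm chart set \<Rightarrow> (('m \<Rightarrow> 'k) \<Rightarrow> ('m \<Rightarrow> 'k) \<Rightarrow> 'm \<Rightarrow> 'k::real_normed_field) \<Rightarrow> bool" where
  "bidifferential n A b \<longleftrightarrow>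
     (\<forall>f\<in>Cinf n A. \<forall>g\<in>Cinf n A. b f g \<in> Cinf n A) \<and>
     (\<exists>k. \<forall>c\<in>A. \<exists>w. (\<forall>is js. smooth_on n (snd c ` fst c) (w is js)) \<and>
        (\<forall>f\<in>Cinf n A. \<forall>g\<in>Cinf n A. \<forall>x\<in>snd c ` fst c.
           local_rep c (b f g) x =
             (\<Sum>is\<in>{is. set is \<subseteq> {..<n} \<and> length is \<le> k}.
              \<Sum>js\<in>{js. set js \<subseteq> {..<n} \<and> length js \<le> k}.
                w is js x * partials is (local_rep c f) x * partials js (local_rep c g) x)))"

definition series_in :: "'a::zero set \<Rightarrow> 'a fps set" where
  "series_in V = {F. \<forall>n. fps_nth F n \<in> V}"

text \<open>The extension of \<open>\<Sum>i. \<nu>\<^sup>i \<mu>\<^sub>i\<close> to formal power series; \<open>\<nu>\<close> is \<^term>\<open>fps_X\<close>.\<close>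

definition star ::
  "(nat \<Rightarrow> ('m \<Rightarrow> 'k) \<Rightarrow> ('m \<Rightarrow> 'k) \<Rightarrow> 'm \<Rightarrow> 'k) \<Rightarrow> ('m \<Rightarrow> 'k) fps \<Rightarrow> ('m \<Rightarrow> 'k) fps \<Rightarrow>
   ('m \<Rightarrow> 'k::comm_ring_1) fps" where
  "star \<mu> F G = Abs_fps (\<lambda>n. \<Sum>i\<le>n. \<Sum>j\<le>n - i. \<mu> i (fps_nth F j) (fps_nth G (n - i - j)))"

definition star_product ::
  "nat \<Rightarrow> 'm chart set \<Rightarrow>
   ((('m \<Rightarrow> real) \<Rightarrow> 'm \<Rightarrow> real) \<Rightarrow> (('m \<Rightarrow> real) \<Rightarrow> 'm \<Rightarrow> real) \<Rightarrow> 'm \<Rightarrow> real) \<Rightarrow>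
   (nat \<Rightarrow> ('m \<Rightarrow> 'k) \<Rightarrow> ('m \<Rightarrow> 'k) \<Rightarrow> 'm \<Rightarrow> 'k::{real_normed_field, euclidean_space}) \<Rightarrow> bool" where
  "star_product n A \<omega> \<mu> \<longleftrightarrow>
     (\<forall>f\<in>Cinf n A. \<forall>g\<in>Cinf n A. \<mu> 0 f g = f * g) \<and>
     (\<forall>i\<ge>1. bidifferential n A (\<mu> i)) \<and>
     (\<forall>F\<in>series_in (Cinf n A). \<forall>G\<in>series_in (Cinf n A). \<forall>H\<in>series_in (Cinf n A).
        star \<mu> (star \<mu> F G) H = star \<mu> F (star \<mu> G H)) \<and>
     (\<forall>F\<in>series_in (Cinf n A). star \<mu> 1 F = F \<and> star \<mu> F 1 = F) \<and>
     (\<forall>f\<in>Cinf n A. \<forall>g\<in>Cinf n A. \<mu> 1 f g - \<mu> 1 g f = poissonK n A \<omega> f g)"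

definition cst :: "'k \<Rightarrow> ('m \<Rightarrow> 'k::zero) fps" where
  "cst r = fps_const (\<lambda>_. r)"

definition quantum_moment_map ::
  "nat \<Rightarrow> 'm chart set \<Rightarrow> nat \<Rightarrow> 'g chart set \<Rightarrow> 'g monoid \<Rightarrow>
   ('m \<Rightarrow> (('g \<Rightarrow> real) \<Rightarrow> 'g \<Rightarrow> real) \<Rightarrow> real) \<Rightarrow>
   (nat \<Rightarrow> ('m \<Rightarrow> 'k) \<Rightarrow> ('m \<Rightarrow> 'k) \<Rightarrow> 'm \<Rightarrow> 'k) \<Rightarrow>
   ((('g \<Rightarrow> real) \<Rightarrow> 'g \<Rightarrow> real) \<Rightarrow> ('m \<Rightarrow> 'k::{real_normed_field, euclidean_space}) fps) \<Rightarrow> bool" where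
  "quantum_moment_map n A p B G J \<mu> qJ \<longleftrightarrow>
     linear_map_on vf_scale (\<lambda>r F. cst (of_real r) * F) (lie_algebra p B G) (series_in (Cinf n A)) qJ \<and>
     (\<forall>X\<in>lie_algebra p B G. fps_nth (qJ X) 0 = (\<lambda>m. of_real (J m X))) \<and>
     (\<forall>X\<in>lie_algebra p B G. \<forall>Y\<in>lie_algebra p B G.
        star \<mu> (qJ X) (qJ Y) - star \<mu> (qJ Y) (qJ X) = fps_X * qJ (vf_bracket X Y))"

section \<open>Grassmann algebra\<close>

text \<open>
  The generators are numbered: ghost \<open>\<xi>\<^sup>a\<close> has number \<open>a\<close> and antighost \<open>\<xi>\<^sub>a\<close> has number \<open>l + a\<close>,
  for \<open>a < l\<close>. An element \<open>x\<close> of the Grassmann algebra with coefficients in \<open>'c\<close> maps a set \<open>S\<close> of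
  numbers to the coefficient of the monomial of the generators in \<open>S\<close> in increasing order.
  The following are left derivatives, left multiplication by a generator, and the linear map
  \<open>\<mu>\<close> induced by the product on tensors (\<open>t S T\<close> is the coefficient of the tensor of the monomials
  of \<open>S\<close> and \<open>T\<close>).
\<close>

definition gder :: "nat \<Rightarrow> (nat set \<Rightarrow> 'c::comm_ring_1) \<Rightarrow> nat set \<Rightarrow> 'c" where
  "gder i x = (\<lambda>S. if i \<in> S then 0 else (-1) ^ card {s \<in> S. s < i} * x (insert i S))"

definition gwedge :: "nat \<Rightarrow> (nat set \<Rightarrow> 'c::comm_ring_1) \<Rightarrow> nat set \<Rightarrow> 'c" where
  "gwedge i x = (\<lambda>S. if i \<in> S then (-1) ^ card {s \<in> S. s < i} * x (S - {i}) else 0)"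

definition gmult :: "(nat set \<Rightarrow> nat set \<Rightarrow> 'c::comm_ring_1) \<Rightarrow> nat set \<Rightarrow> 'c" where
  "gmult t = (\<lambda>U. \<Sum>S\<in>Pow U. (-1) ^ card {(s, s'). s \<in> S \<and> s' \<in> U - S \<and> s' < s} * t S (U - S))"

definition gemb :: "'c \<Rightarrow> nat set \<Rightarrow> 'c::zero" where
  "gemb f = (\<lambda>S. if S = {} then f else 0)"

text \<open>\<open>gelems V I\<close>: elements with coefficients in \<open>V\<close>, all monomials of which lie in \<open>I\<close>. For finite
  \<open>I\<close> this is a finite power of \<open>V\<close> and \<open>gtop\<close> is the product topology.\<close>

definition gelems :: "'c::zero set \<Rightarrow> nat set set \<Rightarrow> (nat set \<Rightarrow> 'c) set" where
  "gelems V I = {x. (\<forall>S. x S \<in> V) \<and> (\<forall>S. S \<notin> I \<longrightarrow> x S = 0)}"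

definition gtop :: "'c::zero topology \<Rightarrow> nat set set \<Rightarrow> (nat set \<Rightarrow> 'c) topology" where
  "gtop X I = subtopology (product_topology (\<lambda>_. X) UNIV) {x. \<forall>S. S \<notin> I \<longrightarrow> x S = 0}"

definition all_monomials :: "nat \<Rightarrow> nat set set" where
  "all_monomials l = Pow {..<2 * l}"

definition ghost_monomials :: "nat \<Rightarrow> nat set set" where
  "ghost_monomials l = Pow {..<l}"

definition antighost_monomials :: "nat \<Rightarrow> nat \<Rightarrow> nat set set" where
  "antighost_monomials l i = {S. S \<subseteq> {l..<2 * l} \<and> card S = i}"

definition gdeg :: "nat \<Rightarrow> nat set \<Rightarrow> int" where
  "gdeg l S = int (card (S \<inter> {..<l})) - int (card (S \<inter> {l..}))"

definition fscale :: "'k \<Rightarrow> ('m \<Rightarrow> 'k) \<Rightarrow> 'm \<Rightarrow> 'k::times" where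
  "fscale c f = (\<lambda>m. c * f m)"

definition gscale :: "'k \<Rightarrow> (nat set \<Rightarrow> 'm \<Rightarrow> 'k) \<Rightarrow> nat set \<Rightarrow> 'm \<Rightarrow> 'k::times" where
  "gscale c x = (\<lambda>S. fscale c (x S))"

definition nuscale :: "'k fps \<Rightarrow> (nat set \<Rightarrow> ('m \<Rightarrow> 'k) fps) \<Rightarrow> nat set \<Rightarrow> ('m \<Rightarrow> 'k::comm_ring_1) fps" where
  "nuscale c x = (\<lambda>S. Abs_fps (\<lambda>n _. fps_nth c n) * x S)"

section \<open>Koszul complex and contraction data\<close>

text \<open>The superderivation over the coefficient ring that maps \<open>\<xi>\<^sub>a\<close> to \<open>j a\<close>.\<close>

definition koszul :: "nat \<Rightarrow> (nat \<Rightarrow> 'c) \<Rightarrow> (nat set \<Rightarrow> 'c) \<Rightarrow> nat set \<Rightarrow> 'c::comm_ring_1" where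
  "koszul l j x = (\<Sum>a<l. (\<lambda>S. j a * gder (l + a) x S))"

definition koszul_space ::
  "nat \<Rightarrow> 'm chart set \<Rightarrow> nat \<Rightarrow> nat \<Rightarrow> (nat set \<Rightarrow> 'm \<Rightarrow> 'k::real_normed_field) set" where
  "koszul_space n A l i = gelems (Cinf n A) (antighost_monomials l i)"

definition generates_ideal :: "nat \<Rightarrow> 'm chart set \<Rightarrow> 'm set \<Rightarrow> nat \<Rightarrow> (nat \<Rightarrow> 'm \<Rightarrow> 'k::real_normed_field) \<Rightarrow> bool" where
  "generates_ideal n A Z l j \<longleftrightarrow>
     (\<forall>f\<in>Cinf n A. (\<forall>m\<in>Z. f m = 0) \<longrightarrow>
        (\<exists>g. (\<forall>a<l. g a \<in> Cinf n A) \<and> f = (\<Sum>a<l. g a * j a)))"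

definition koszul_acyclic :: "nat \<Rightarrow> 'm chart set \<Rightarrow> nat \<Rightarrow> (nat \<Rightarrow> 'm \<Rightarrow> 'k::real_normed_field) \<Rightarrow> bool" where
  "koszul_acyclic n A l j \<longleftrightarrow>
     (\<forall>i\<ge>1. \<forall>v\<in>koszul_space n A l i. koszul l j v = 0 \<longrightarrow>
        (\<exists>w\<in>koszul_space n A l (i + 1). koszul l j w = v))"

definition koszul_contraction ::
  "nat \<Rightarrow> 'm::topological_space chart set \<Rightarrow> 'm set \<Rightarrow> nat \<Rightarrow> (nat \<Rightarrow> 'm \<Rightarrow> 'k) \<Rightarrow>
   (('m \<Rightarrow> 'k) \<Rightarrow> 'm \<Rightarrow> 'k) \<Rightarrow>
   (nat \<Rightarrow> (nat set \<Rightarrow> 'm \<Rightarrow> 'k) \<Rightarrow> nat set \<Rightarrow> 'm \<Rightarrow> 'k::real_normed_field) \<Rightarrow> bool" where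
  "koszul_contraction n A Z l j prol h \<longleftrightarrow>
     linear_map_on fscale fscale (CinfZ n A Z) (Cinf n A) prol \<and>
     continuous_map (CinfZ_top n A Z) (Cinf_top n A) prol \<and>
     (\<forall>i. linear_map_on gscale gscale (koszul_space n A l i) (koszul_space n A l (Suc i)) (h i) \<and>
          continuous_map (gtop (Cinf_top n A) (antighost_monomials l i))
            (gtop (Cinf_top n A) (antighost_monomials l (Suc i))) (h i)) \<and>
     (\<forall>z\<in>CinfZ n A Z. res0 Z (prol z) = z) \<and>
     (\<forall>f\<in>Cinf n A. gemb (f - prol (res0 Z f)) = koszul l j (h 0 (gemb f))) \<and>
     (\<forall>i. \<forall>v\<in>koszul_space n A l (Suc i). v = koszul l j (h (Suc i) v) + h i (koszul l j v)) \<and>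
     (\<forall>z\<in>CinfZ n A Z. h 0 (gemb (prol z)) = 0) \<and>
     (\<forall>i. \<forall>v\<in>koszul_space n A l i. h (Suc i) (h i v) = 0)"

section \<open>The quantum BRST algebra\<close>

text \<open>The graded tensor \<open>\<Sum>a. \<partial>/\<partial>\<xi>\<^sub>a \<otimes> \<partial>/\<partial>\<xi>\<^sup>a\<close>: passing the odd second factor over a monomial \<open>S\<close>
  in the first slot gives the sign.\<close>

definition contract :: "nat \<Rightarrow> (nat set \<Rightarrow> nat set \<Rightarrow> 'c) \<Rightarrow> nat set \<Rightarrow> nat set \<Rightarrow> 'c::comm_ring_1" where
  "contract l t = (\<Sum>a<l. (\<lambda>S T. gder (l + a) (\<lambda>S'. (-1) ^ card S' * gder a (t S') T) S))"

text \<open>\<open>exp (-2 \<nu> contract)\<close>; \<open>contract\<close> is a sum of \<open>l\<close> commuting operators of square zero, so that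
  its powers beyond the \<open>l\<close>-th vanish.\<close>

definition exp_contract ::
  "nat \<Rightarrow> (nat set \<Rightarrow> nat set \<Rightarrow> ('m \<Rightarrow> 'k) fps) \<Rightarrow> nat set \<Rightarrow> nat set \<Rightarrow> ('m \<Rightarrow> 'k::field_char_0) fps" where
  "exp_contract l t = (\<Sum>k\<le>l. (\<lambda>S T. cst ((-2) ^ k / fact k) * fps_X ^ k * (contract l ^^ k) t S T))"

definition brst_prod ::
  "nat \<Rightarrow> (nat \<Rightarrow> ('m \<Rightarrow> 'k) \<Rightarrow> ('m \<Rightarrow> 'k) \<Rightarrow> 'm \<Rightarrow> 'k) \<Rightarrow> (nat set \<Rightarrow> ('m \<Rightarrow> 'k) fps) \<Rightarrow>
   (nat set \<Rightarrow> ('m \<Rightarrow> 'k) fps) \<Rightarrow> nat set \<Rightarrow> ('m \<Rightarrow> 'k::field_char_0) fps" where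
  "brst_prod l \<mu> x y = gmult (exp_contract l (\<lambda>S T. star \<mu> (x S) (y T)))"

definition parity_part :: "nat \<Rightarrow> (nat set \<Rightarrow> 'c) \<Rightarrow> nat set \<Rightarrow> 'c::zero" where
  "parity_part p x = (\<lambda>S. if card S mod 2 = p then x S else 0)"

definition graded_commutator ::
  "nat \<Rightarrow> (nat \<Rightarrow> ('m \<Rightarrow> 'k) \<Rightarrow> ('m \<Rightarrow> 'k) \<Rightarrow> 'm \<Rightarrow> 'k) \<Rightarrow> (nat set \<Rightarrow> ('m \<Rightarrow> 'k) fps) \<Rightarrow>
   (nat set \<Rightarrow> ('m \<Rightarrow> 'k) fps) \<Rightarrow> nat set \<Rightarrow> ('m \<Rightarrow> 'k::field_char_0) fps" where
  "graded_commutator l \<mu> x y = (\<Sum>p\<in>{0, 1}. \<Sum>q\<in>{0, 1}.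
     brst_prod l \<mu> (parity_part p x) (parity_part q y)
     - (-1) ^ (p * q) * brst_prod l \<mu> (parity_part q y) (parity_part p x))"

definition theta ::
  "nat \<Rightarrow> (nat \<Rightarrow> nat \<Rightarrow> nat \<Rightarrow> real) \<Rightarrow> (nat \<Rightarrow> ('m \<Rightarrow> 'k) fps) \<Rightarrow>
   nat set \<Rightarrow> ('m \<Rightarrow> 'k::real_normed_field) fps" where
  "theta l f Jb =
     (\<Sum>a<l. \<Sum>b<l. \<Sum>c<l. gwedge a (gwedge b (gwedge (l + c) (gemb (cst (of_real (- (f a b c) / 4)))))))
     + (\<Sum>a<l. gwedge a (gemb (Jb a)))
     + (\<Sum>a<l. \<Sum>b<l. gwedge a (gemb (fps_X * cst (of_real (f a b b / 2)))))"

text \<open>Here and below, division by \<open>\<nu>\<close> is \<^term>\<open>fps_shift 1\<close>; the (graded) commutators it is applied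
  to have no constant term, because the products are (graded) commutative modulo \<open>\<nu>\<close>.\<close>

definition brst_differential ::
  "nat \<Rightarrow> (nat \<Rightarrow> ('m \<Rightarrow> 'k) \<Rightarrow> ('m \<Rightarrow> 'k) \<Rightarrow> 'm \<Rightarrow> 'k) \<Rightarrow> (nat \<Rightarrow> nat \<Rightarrow> nat \<Rightarrow> real) \<Rightarrow>
   (nat \<Rightarrow> ('m \<Rightarrow> 'k) fps) \<Rightarrow> (nat set \<Rightarrow> ('m \<Rightarrow> 'k) fps) \<Rightarrow>
   nat set \<Rightarrow> ('m \<Rightarrow> 'k::real_normed_field) fps" where
  "brst_differential l \<mu> f Jb x = (\<lambda>S. fps_shift 1 (graded_commutator l \<mu> (theta l f Jb) x S))"

definition quantum_koszul ::
  "nat \<Rightarrow> (nat \<Rightarrow> ('m \<Rightarrow> 'k) \<Rightarrow> ('m \<Rightarrow> 'k) \<Rightarrow> 'm \<Rightarrow> 'k) \<Rightarrow> (nat \<Rightarrow> nat \<Rightarrow> nat \<Rightarrow> real) \<Rightarrow>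
   (nat \<Rightarrow> ('m \<Rightarrow> 'k) fps) \<Rightarrow> (nat set \<Rightarrow> ('m \<Rightarrow> 'k) fps) \<Rightarrow>
   nat set \<Rightarrow> ('m \<Rightarrow> 'k::real_normed_field) fps" where
  "quantum_koszul l \<mu> f Jb x =
     (\<Sum>a<l. (\<lambda>S. star \<mu> (gder (l + a) x S) (Jb a)))
     + (\<Sum>a<l. \<Sum>b<l. (\<lambda>S. fps_X * cst (of_real (f a b b / 2)) * gder (l + a) x S))
     + (\<Sum>a<l. \<Sum>b<l. \<Sum>c<l. (\<lambda>S. fps_X * cst (of_real (f a b c / 2))
          * gwedge (l + c) (gder (l + a) (gder (l + b) x)) S))"

definition fps_ext :: "('a \<Rightarrow> 'b) \<Rightarrow> 'a fps \<Rightarrow> 'b::zero fps" where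
  "fps_ext T F = Abs_fps (\<lambda>n. T (fps_nth F n))"

text \<open>The operator \<open>id + (\<^bold>\<partial>\<^sub>1 - \<partial>\<^sub>1) h\<^sub>0\<close> on formal series of smooth functions, and the deformed
  restriction. \<open>j\<close> are the components of the moment map, \<open>Jb\<close> those of the quantum moment map.\<close>

definition res_operator ::
  "nat \<Rightarrow> (nat \<Rightarrow> ('m \<Rightarrow> 'k) \<Rightarrow> ('m \<Rightarrow> 'k) \<Rightarrow> 'm \<Rightarrow> 'k) \<Rightarrow> (nat \<Rightarrow> nat \<Rightarrow> nat \<Rightarrow> real) \<Rightarrow>
   (nat \<Rightarrow> 'm \<Rightarrow> 'k) \<Rightarrow> (nat \<Rightarrow> ('m \<Rightarrow> 'k) fps) \<Rightarrow>
   (nat \<Rightarrow> (nat set \<Rightarrow> 'm \<Rightarrow> 'k) \<Rightarrow> nat set \<Rightarrow> 'm \<Rightarrow> 'k) \<Rightarrow>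
   ('m \<Rightarrow> 'k) fps \<Rightarrow> ('m \<Rightarrow> 'k::real_normed_field) fps" where
  "res_operator l \<mu> f j Jb h F =
     (let w = (\<lambda>S. fps_ext (\<lambda>u. h 0 (gemb u) S) F)
      in F + (quantum_koszul l \<mu> f Jb w {} - koszul l (\<lambda>a. fps_const (j a)) w {}))"

definition quantum_res ::
  "nat \<Rightarrow> 'm chart set \<Rightarrow> 'm set \<Rightarrow> nat \<Rightarrow> (nat \<Rightarrow> ('m \<Rightarrow> 'k) \<Rightarrow> ('m \<Rightarrow> 'k) \<Rightarrow> 'm \<Rightarrow> 'k) \<Rightarrow>
   (nat \<Rightarrow> nat \<Rightarrow> nat \<Rightarrow> real) \<Rightarrow> (nat \<Rightarrow> 'm \<Rightarrow> 'k) \<Rightarrow> (nat \<Rightarrow> ('m \<Rightarrow> 'k) fps) \<Rightarrow>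
   (nat \<Rightarrow> (nat set \<Rightarrow> 'm \<Rightarrow> 'k) \<Rightarrow> nat set \<Rightarrow> 'm \<Rightarrow> 'k) \<Rightarrow>
   ('m \<Rightarrow> 'k) fps \<Rightarrow> ('m \<Rightarrow> 'k::real_normed_field) fps" where
  "quantum_res n A Z l \<mu> f j Jb h F =
     fps_ext (res0 Z) (inv_into (series_in (Cinf n A)) (res_operator l \<mu> f j Jb h) F)"

definition quantum_res_ext ::
  "nat \<Rightarrow> 'm chart set \<Rightarrow> 'm set \<Rightarrow> nat \<Rightarrow> (nat \<Rightarrow> ('m \<Rightarrow> 'k) \<Rightarrow> ('m \<Rightarrow> 'k) \<Rightarrow> 'm \<Rightarrow> 'k) \<Rightarrow>
   (nat \<Rightarrow> nat \<Rightarrow> nat \<Rightarrow> real) \<Rightarrow> (nat \<Rightarrow> 'm \<Rightarrow> 'k) \<Rightarrow> (nat \<Rightarrow> ('m \<Rightarrow> 'k) fps) \<Rightarrow>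
   (nat \<Rightarrow> (nat set \<Rightarrow> 'm \<Rightarrow> 'k) \<Rightarrow> nat set \<Rightarrow> 'm \<Rightarrow> 'k) \<Rightarrow>
   (nat set \<Rightarrow> ('m \<Rightarrow> 'k) fps) \<Rightarrow> nat set \<Rightarrow> ('m \<Rightarrow> 'k::real_normed_field) fps" where
  "quantum_res_ext n A Z l \<mu> f j Jb h x =
     (\<lambda>S. if S \<in> ghost_monomials l then quantum_res n A Z l \<mu> f j Jb h (x S) else 0)"

text \<open>The operator \<open>\<^bold>L\<^sup>z\<^sub>X\<close>, where \<open>JX\<close> is the value of the quantum moment map at \<open>X\<close>.\<close>

definition quantum_rep ::
  "nat \<Rightarrow> 'm chart set \<Rightarrow> 'm set \<Rightarrow> nat \<Rightarrow> (nat \<Rightarrow> ('m \<Rightarrow> 'k) \<Rightarrow> ('m \<Rightarrow> 'k) \<Rightarrow> 'm \<Rightarrow> 'k) \<Rightarrow>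
   (nat \<Rightarrow> nat \<Rightarrow> nat \<Rightarrow> real) \<Rightarrow> (nat \<Rightarrow> 'm \<Rightarrow> 'k) \<Rightarrow> (nat \<Rightarrow> ('m \<Rightarrow> 'k) fps) \<Rightarrow>
   (('m \<Rightarrow> 'k) \<Rightarrow> 'm \<Rightarrow> 'k) \<Rightarrow>
   (nat \<Rightarrow> (nat set \<Rightarrow> 'm \<Rightarrow> 'k) \<Rightarrow> nat set \<Rightarrow> 'm \<Rightarrow> 'k) \<Rightarrow>
   ('m \<Rightarrow> 'k) fps \<Rightarrow> ('m \<Rightarrow> 'k) fps \<Rightarrow> ('m \<Rightarrow> 'k::real_normed_field) fps" where
  "quantum_rep n A Z l \<mu> f j Jb prol h JX z =
     quantum_res n A Z l \<mu> f j Jb h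
       (fps_shift 1 (star \<mu> JX (fps_ext prol z) - star \<mu> (fps_ext prol z) JX))"

text \<open>The Chevalley-Eilenberg differential of the Lie algebra with structure constants \<open>f\<close> and
  coefficients in the representation \<open>L a\<close> of the basis vectors, on cochains written in ghosts:
  \<open>\<xi>\<^sup>c \<mapsto> -1/2 \<Sum> f\<^sub>a\<^sub>b\<^sup>c \<xi>\<^sup>a \<xi>\<^sup>b\<close> and \<open>z \<mapsto> \<Sum> \<xi>\<^sup>a L\<^sub>a z\<close>.\<close>

definition ce_differential ::
  "nat \<Rightarrow> (nat \<Rightarrow> nat \<Rightarrow> nat \<Rightarrow> real) \<Rightarrow> (nat \<Rightarrow> ('m \<Rightarrow> 'k) fps \<Rightarrow> ('m \<Rightarrow> 'k) fps) \<Rightarrow>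
   (nat set \<Rightarrow> ('m \<Rightarrow> 'k) fps) \<Rightarrow> nat set \<Rightarrow> ('m \<Rightarrow> 'k::real_normed_field) fps" where
  "ce_differential l f L z =
     (\<Sum>a<l. gwedge a (\<lambda>S. L a (z S)))
     - (\<Sum>a<l. \<Sum>b<l. \<Sum>c<l. (\<lambda>S. cst (of_real (f a b c / 2)) * gwedge a (gwedge b (gder c z)) S))"

section \<open>Graded spaces, continuity and contractions\<close>

definition brst_space ::
  "nat \<Rightarrow> 'm chart set \<Rightarrow> nat \<Rightarrow> (nat set \<Rightarrow> ('m \<Rightarrow> 'k::real_normed_field) fps) set" where
  "brst_space n A l = gelems (series_in (Cinf n A)) (all_monomials l)"

definition brst_space_deg ::
  "nat \<Rightarrow> 'm chart set \<Rightarrow> nat \<Rightarrow> int \<Rightarrow> (nat set \<Rightarrow> ('m \<Rightarrow> 'k::real_normed_field) fps) set" where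
  "brst_space_deg n A l d = gelems (series_in (Cinf n A)) {S \<in> all_monomials l. gdeg l S = d}"

definition cochains ::
  "nat \<Rightarrow> 'm chart set \<Rightarrow> 'm set \<Rightarrow> nat \<Rightarrow> (nat set \<Rightarrow> ('m \<Rightarrow> 'k::real_normed_field) fps) set" where
  "cochains n A Z l = gelems (series_in (CinfZ n A Z)) (ghost_monomials l)"

definition cochains_deg ::
  "nat \<Rightarrow> 'm chart set \<Rightarrow> 'm set \<Rightarrow> nat \<Rightarrow> int \<Rightarrow> (nat set \<Rightarrow> ('m \<Rightarrow> 'k::real_normed_field) fps) set" where
  "cochains_deg n A Z l d = gelems (series_in (CinfZ n A Z)) {S \<in> ghost_monomials l. gdeg l S = d}"

text \<open>\<open>T = \<Sum>i. \<nu>\<^sup>i T\<^sub>i\<close> with continuous linear maps \<open>T\<^sub>i\<close> from \<open>gelems (topspace X) I\<close> to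
  \<open>gelems (topspace Y) K\<close>.\<close>

definition series_of_continuous ::
  "('m \<Rightarrow> 'k) topology \<Rightarrow> nat set set \<Rightarrow> ('m \<Rightarrow> 'k) topology \<Rightarrow> nat set set \<Rightarrow>
   ((nat set \<Rightarrow> ('m \<Rightarrow> 'k) fps) \<Rightarrow> nat set \<Rightarrow> ('m \<Rightarrow> 'k::real_normed_field) fps) \<Rightarrow> bool" where
  "series_of_continuous X I Y K T \<longleftrightarrow>
     (\<exists>Ts :: nat \<Rightarrow> (nat set \<Rightarrow> 'm \<Rightarrow> 'k) \<Rightarrow> nat set \<Rightarrow> 'm \<Rightarrow> 'k.
        (\<forall>i. linear_map_on gscale gscale (gelems (topspace X) I) (gelems (topspace Y) K) (Ts i) \<and>
             continuous_map (gtop X I) (gtop Y K) (Ts i)) \<and>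
        (\<forall>x\<in>gelems (series_in (topspace X)) I. \<forall>S n.
           fps_nth (T x S) n = (\<Sum>i\<le>n. Ts i (\<lambda>S'. fps_nth (x S') (n - i)) S)))"

definition contraction ::
  "'a set \<Rightarrow> ('a \<Rightarrow> 'a) \<Rightarrow> 'c set \<Rightarrow> ('c \<Rightarrow> 'c) \<Rightarrow> ('a \<Rightarrow> 'c) \<Rightarrow> ('c \<Rightarrow> 'a) \<Rightarrow> ('a \<Rightarrow> 'a::ab_group_add) \<Rightarrow> bool" where
  "contraction A D C d r \<Phi> H \<longleftrightarrow>
     (\<forall>x\<in>A. r x \<in> C) \<and> (\<forall>z\<in>C. \<Phi> z \<in> A) \<and> (\<forall>x\<in>A. H x \<in> A) \<and>
     (\<forall>x\<in>A. r (D x) = d (r x)) \<and>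
     (\<forall>z\<in>C. D (\<Phi> z) = \<Phi> (d z)) \<and>
     (\<forall>z\<in>C. r (\<Phi> z) = z) \<and>
     (\<forall>x\<in>A. x - \<Phi> (r x) = D (H x) + H (D x))"

end

theory Submission imports Defs begin

text \<open>
  The contraction arises from the classical Koszul contraction of the functions on \<open>M\<close> onto those on
  \<open>Z\<close> by homological perturbation.

  Multiplication by \<open>\<theta>\<close> from the left and graded multiplication by \<open>\<theta>\<close> from the right have the same
  shape. In a Clifford algebra with odd generators \<open>c\<^sub>a\<close>, \<open>\<Lambda>\<^sub>a\<close> and relations
  \<open>\<Lambda>\<^sub>a c\<^sub>b + c\<^sub>b \<Lambda>\<^sub>a = \<kappa> \<delta>\<^sub>a\<^sub>b\<close> they are
  \<open>\<Sum> g a b e c\<^sub>a c\<^sub>b \<Lambda>\<^sub>e - \<kappa> \<Sum> g a b b c\<^sub>a + \<Sum> c\<^sub>a G\<^sub>a\<close>, where \<open>G\<^sub>a\<close> is left or right star multiplication by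
  the component \<open>a\<close> of the quantum moment map. Such an operator squares to zero by the Jacobi identity and the
  commutation relations of the \<open>G\<^sub>a\<close> (\<open>charge_charge\<close>, \<open>moment_charge_square\<close>). The left and the
  right operator anticommute (\<open>left_right_charge\<close>), and their difference is \<open>\<nu> D\<close>; since \<open>\<nu>\<close> is not
  a zero divisor, \<open>D\<close> squares to zero (\<open>D_D\<close>). Expanding the difference shows that \<open>D\<close> is \<open>\<delta>\<close>, which
  preserves the number of antighosts, plus twice the deformed Koszul differential, which lowers it by one
  (\<open>D_altdef\<close>).

  Let \<open>D0\<close> be twice the classical Koszul differential and \<open>k\<close> half the given homotopy, both extended to
  elements with ghosts. The perturbation lemma (\<open>perturbed_contraction\<close>) needs an inverse \<open>U\<close> of
  \<open>id + (D - D0) k\<close> and yields the contraction with maps \<open>res U\<close>,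
  \<open>\<Phi> = prol - k U (D - D0) prol\<close> and \<open>H = k U\<close>. Now \<open>(D - D0) k\<close> is the sum of \<open>\<delta> k\<close>, which raises the number
  of antighosts and is therefore nilpotent, and of an operator that vanishes modulo \<open>\<nu>\<close>. Hence the
  geometric series is finite modulo \<open>\<nu>\<close> and the inverse is found order by order
  (\<open>series_op_inverse\<close>, \<open>ex_inverse\<close>).

  It remains to recognise the perturbed data. On the components without antighosts the operator
  \<open>id + (D - D0) k\<close> is the one inverted in the deformed restriction, whence \<open>res U\<close> is that restriction
  (\<open>R_altdef\<close>). The terms of \<open>D\<close> that contain an antighost derivative vanish on \<open>prol z\<close>, and
  what the others induce on \<open>z\<close> is the Chevalley-Eilenberg differential (\<open>R_D_prolS\<close>).

  Continuity propagates through the whole construction: star multiplication by a fixed series has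
  differential operators as coefficients, these are continuous (\<open>continuous_map_local_diff_op\<close>), and
  formal series of continuous linear maps are closed under sums, composition and the inversion above.
  Such series are automatically linear over the formal power series (\<open>series_op_linear_map\<close>). The degrees
  are correct because all operators involved are homogeneous.
\<close>

section \<open>Smooth functions in local coordinates\<close>

text \<open>The ambient topology is that of all real sequences; the condition that cuts out Euclidean space concerns
  only the coordinates from \<open>n\<close> on, which the update at \<open>i < n\<close> leaves alone.\<close>

lemma eventually_fun_upd_in_openin:
  assumes V: "openin (Euclidean_space n) V" and x: "x \<in> V" and i: "i < n"
  shows "eventually (\<lambda>t. x(i := t) \<in> V) (nhds (x i))"
proof -
  obtain U where "openin (powertop_real UNIV) U" and U2: "V = U \<inter> {x. \<forall>i\<ge>n. x i = 0}"
    using V unfolding Euclidean_space_def openin_subtopology by blast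
  then have U: "open U" "V = U \<inter> {x. \<forall>i\<ge>n. x i = 0}"
    by (simp_all add: euclidean_product_topology)
  have "continuous (at t) (\<lambda>t. x(i := t))" for t
  proof -
    have "continuous_on UNIV (\<lambda>t. (x(i := t)) k)" for k
      by (cases "k = i") auto
    then have "continuous_on UNIV (\<lambda>t. x(i := t))"
      by (rule continuous_on_coordinatewise_then_product)
    then show ?thesis by (simp add: continuous_on_eq_continuous_at)
  qed
  then have "((\<lambda>t. x(i := t)) \<longlongrightarrow> x(i := x i)) (nhds (x i))"
    using tendsto_at_iff_tendsto_nhds[of "\<lambda>t. x(i := t)" "x i"] unfolding continuous_at by blast
  then have "eventually (\<lambda>t. x(i := t) \<in> U) (nhds (x i))"
    using U x by (auto elim!: topological_tendstoD)
  then show ?thesis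
    using U x i by (auto elim!: eventually_mono)
qed

text \<open>Partial derivatives only depend on the germ of a function.\<close>

lemma partial_cong:
  assumes "openin (Euclidean_space n) V" "x \<in> V" "i < n" "\<And>y. y \<in> V \<Longrightarrow> F y = G y"
  shows "partial i F x = partial i G x"
  unfolding partial_def
  by (rule vector_derivative_cong_eq[OF eventually_mono[OF eventually_fun_upd_in_openin[OF assms(1-3)]]])
    (use assms in auto)

lemma differentiable_cong_openin:
  assumes "openin (Euclidean_space n) V" "x \<in> V" "i < n" "\<And>y. y \<in> V \<Longrightarrow> F y = G y"
    and "(\<lambda>t. G (x(i := t))) differentiable at (x i)"
  shows "(\<lambda>t. F (x(i := t))) differentiable at (x i)"
proof -
  have "eventually (\<lambda>t. G (x(i := t)) = F (x(i := t))) (nhds (x i))"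
    by (rule eventually_mono[OF eventually_fun_upd_in_openin[OF assms(1-3)]]) (use assms in auto)
  then have ev: "eventually (\<lambda>t. G (x(i := t)) = F (x(i := t))) (at (x i))"
    by (simp add: eventually_at_filter eventually_mono)
  obtain D where "((\<lambda>t. G (x(i := t))) has_derivative D) (at (x i))"
    using assms(5) unfolding differentiable_def by blast
  then have "((\<lambda>t. F (x(i := t))) has_derivative D) (at (x i))"
    by (rule has_derivative_transform_eventually[OF _ ev]) (use assms in auto)
  then show ?thesis unfolding differentiable_def by blast
qed

lemma partials_Nil [simp]: "partials [] F = F"
  and partials_Cons: "partials (i # is) F = partial i (partials is F)"
  and partials_append: "partials (is @ js) F = partials is (partials js F)"
  by (simp_all add: partials_def)

lemma partials_cong:
  assumes V: "openin (Euclidean_space n) V" and "set is \<subseteq> {..<n}" "\<And>y. y \<in> V \<Longrightarrow> F y = G y"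
  shows "x \<in> V \<Longrightarrow> partials is F x = partials is G x"
  using assms(2)
proof (induction "is" arbitrary: x)
  case (Cons i "is")
  then show ?case
    unfolding partials_Cons by (intro partial_cong[OF V]) auto
qed (use assms in auto)

lemma smooth_onD:
  assumes "smooth_on n V F" "set is \<subseteq> {..<n}"
  shows "continuous_on V (partials is F)"
    and "x \<in> V \<Longrightarrow> i < n \<Longrightarrow> (\<lambda>t. partials is F (x(i := t))) differentiable at (x i)"
  using assms unfolding smooth_on_def by auto

lemma smooth_on_partials:
  assumes "smooth_on n V F" "set js \<subseteq> {..<n}"
  shows "smooth_on n V (partials js F)"
  using assms unfolding smooth_on_def partials_append[symmetric] by simp

lemma smooth_on_partial: "smooth_on n V F \<Longrightarrow> i < n \<Longrightarrow> smooth_on n V (partial i F)"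
  using smooth_on_partials[of n V F "[i]"] by (simp add: partials_Cons)

lemma smooth_on_const: "smooth_on n V (\<lambda>_. c)"
proof -
  have "partials is (\<lambda>_. c) = (\<lambda>_. if is = [] then c else 0)" for "is" :: "nat list"
    by (induction "is") (auto simp: partials_Cons partial_def fun_eq_iff)
  then show ?thesis unfolding smooth_on_def by simp
qed

lemma has_vector_derivative_partial:
  assumes "smooth_on n V F" "x \<in> V" "i < n"
  shows "((\<lambda>t. F (x(i := t))) has_vector_derivative partial i F x) (at (x i))"
  using smooth_onD(2)[of n V F "[]" x i] assms unfolding partial_def
  by (simp add: vector_derivative_works)

lemma partial_sum_list_mult:
  fixes us :: "(((nat \<Rightarrow> real) \<Rightarrow> 'v::real_normed_algebra) \<times> ((nat \<Rightarrow> real) \<Rightarrow> 'v)) list"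
  assumes "\<And>u v. (u, v) \<in> set us \<Longrightarrow> smooth_on n V u \<and> smooth_on n V v" "x \<in> V" "i < n"
  shows "((\<lambda>t. \<Sum>(u, v)\<leftarrow>us. u (x(i := t)) * v (x(i := t))) has_vector_derivative
          (\<Sum>(u, v)\<leftarrow>us. u x * partial i v x + partial i u x * v x)) (at (x i))"
  using assms(1)
proof (induction us)
  case (Cons uv us)
  obtain u v where uv: "uv = (u, v)" by force
  have "smooth_on n V u" "smooth_on n V v" using Cons(2)[of u v] uv by auto
  note * = has_vector_derivative_mult[OF this[THEN has_vector_derivative_partial, OF assms(2,3)]]
  have "((\<lambda>t. \<Sum>(u, v)\<leftarrow>us. u (x(i := t)) * v (x(i := t))) has_vector_derivative
          (\<Sum>(u, v)\<leftarrow>us. u x * partial i v x + partial i u x * v x)) (at (x i))"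
    by (rule Cons(1)) (use Cons(2) in auto)
  from has_vector_derivative_add[OF * this] show ?case
    unfolding uv by (simp only: list.map sum_list.Cons case_prod_conv fun_upd_triv)
qed auto

text \<open>The class \<open>P\<close> of finite sums of products of smooth functions is, by the Leibniz rule, closed under
  partial derivatives. Smoothness of sums and of products follows at once, without a formula for
  iterated derivatives.\<close>

lemma smooth_on_sum_list_mult:
  fixes us :: "(((nat \<Rightarrow> real) \<Rightarrow> 'v::real_normed_algebra) \<times> ((nat \<Rightarrow> real) \<Rightarrow> 'v)) list"
  assumes V: "openin (Euclidean_space n) V"
    and us: "\<And>u v. (u, v) \<in> set us \<Longrightarrow> smooth_on n V u \<and> smooth_on n V v"
    and F: "\<And>x. x \<in> V \<Longrightarrow> F x = (\<Sum>(u, v)\<leftarrow>us. u x * v x)"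
  shows "smooth_on n V F"
proof -
  define P where "P F \<longleftrightarrow> (\<exists>us. (\<forall>(u, v)\<in>set us. smooth_on n V u \<and> smooth_on n V v) \<and>
     (\<forall>x\<in>V. F x = (\<Sum>(u, v)\<leftarrow>us. u x * v x)))" for F :: "(nat \<Rightarrow> real) \<Rightarrow> 'v"
  have diff: "(\<lambda>t. F (x(i := t))) differentiable at (x i)" if "P F" "x \<in> V" "i < n" for F x i
  proof -
    obtain us where us: "\<forall>(u, v)\<in>set us. smooth_on n V u \<and> smooth_on n V v"
      "\<forall>x\<in>V. F x = (\<Sum>(u, v)\<leftarrow>us. u x * v x)" using \<open>P F\<close> P_def by auto
    show ?thesis
      by (rule differentiable_cong_openin[OF V \<open>x \<in> V\<close> \<open>i < n\<close>, of F "\<lambda>x. \<Sum>(u, v)\<leftarrow>us. u x * v x"])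
        (use us differentiableI_vector[OF partial_sum_list_mult[OF _ \<open>x \<in> V\<close> \<open>i < n\<close>, of us]] in auto)
  qed
  have cont: "continuous_on V F" if "P F" for F
  proof -
    obtain us where us: "\<forall>(u, v)\<in>set us. smooth_on n V u \<and> smooth_on n V v"
      "\<forall>x\<in>V. F x = (\<Sum>(u, v)\<leftarrow>us. u x * v x)" using \<open>P F\<close> P_def by auto
    have "continuous_on V (\<lambda>x. \<Sum>(u, v)\<leftarrow>us. u x * v x)" using us(1)
    proof (induction us)
      case (Cons uv us)
      then show ?case
        using smooth_onD(1)[of n V _ "[]"] by (auto intro!: continuous_intros simp: case_prod_beta)
    qed auto
    then show ?thesis using us(2) by (simp cong: continuous_on_cong)
  qed
  have part: "P (partial i F)" if "P F" "i < n" for F i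
  proof -
    obtain us where us: "\<forall>(u, v)\<in>set us. smooth_on n V u \<and> smooth_on n V v"
      "\<forall>x\<in>V. F x = (\<Sum>(u, v)\<leftarrow>us. u x * v x)" using \<open>P F\<close> P_def by auto
    have "partial i F x = (\<Sum>(u, v)\<leftarrow>us. u x * partial i v x + partial i u x * v x)" if "x \<in> V" for x
    proof -
      have "partial i F x = partial i (\<lambda>x. \<Sum>(u, v)\<leftarrow>us. u x * v x) x"
        by (rule partial_cong[OF V \<open>x \<in> V\<close> \<open>i < n\<close>]) (use us in auto)
      also have "\<dots> = (\<Sum>(u, v)\<leftarrow>us. u x * partial i v x + partial i u x * v x)"
        unfolding partial_def[of i "\<lambda>x. \<Sum>(u, v)\<leftarrow>us. u x * v x"]
        by (rule vector_derivative_at, rule partial_sum_list_mult[OF _ \<open>x \<in> V\<close> \<open>i < n\<close>]) (use us in auto)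
      finally show ?thesis .
    qed
    moreover have "(\<Sum>(u, v)\<leftarrow>us. u x * partial i v x + partial i u x * v x) =
      (\<Sum>(u, v)\<leftarrow>map (\<lambda>(u, v). (u, partial i v)) us @ map (\<lambda>(u, v). (partial i u, v)) us. u x * v x)" for x
      by (induction us) (auto simp: algebra_simps)
    ultimately show ?thesis
      unfolding P_def using us(1) \<open>i < n\<close>
      by (intro exI[of _ "map (\<lambda>(u, v). (u, partial i v)) us @ map (\<lambda>(u, v). (partial i u, v)) us"])
        (auto intro: smooth_on_partial)
  qed
  have "P F" unfolding P_def using us F by blast
  then have "set is \<subseteq> {..<n} \<Longrightarrow> P (partials is F)" for "is"
    by (induction "is") (auto simp: partials_Cons part)
  then show ?thesis unfolding smooth_on_def using diff cont by blast
qed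

lemma smooth_on_mult:
  fixes u v :: "(nat \<Rightarrow> real) \<Rightarrow> 'v::real_normed_algebra"
  assumes "openin (Euclidean_space n) V" "smooth_on n V u" "smooth_on n V v"
  shows "smooth_on n V (\<lambda>x. u x * v x)"
  by (rule smooth_on_sum_list_mult[OF assms(1), of "[(u, v)]"]) (use assms in auto)

lemma smooth_on_add:
  fixes u v :: "(nat \<Rightarrow> real) \<Rightarrow> 'v::real_normed_algebra_1"
  assumes "openin (Euclidean_space n) V" "smooth_on n V u" "smooth_on n V v"
  shows "smooth_on n V (\<lambda>x. u x + v x)"
  by (rule smooth_on_sum_list_mult[OF assms(1), of "[(u, \<lambda>_. 1), (v, \<lambda>_. 1)]"])
    (use assms in \<open>auto simp: smooth_on_const\<close>)

lemma partials_add: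
  fixes u v :: "(nat \<Rightarrow> real) \<Rightarrow> 'v::real_normed_vector"
  assumes V: "openin (Euclidean_space n) V" and uv: "smooth_on n V u" "smooth_on n V v"
  shows "set is \<subseteq> {..<n} \<Longrightarrow> x \<in> V \<Longrightarrow> partials is (\<lambda>x. u x + v x) x = partials is u x + partials is v x"
proof (induction "is" arbitrary: x)
  case (Cons i "is")
  then have i: "i < n" and "is": "set is \<subseteq> {..<n}" by auto
  have "partials (i # is) (\<lambda>x. u x + v x) x = partial i (\<lambda>x. partials is u x + partials is v x) x"
    unfolding partials_Cons by (rule partial_cong[OF V Cons.prems(2) i]) (rule Cons.IH[OF "is"])
  also have "\<dots> = partial i (partials is u) x + partial i (partials is v) x"
    unfolding partial_def[of i "\<lambda>x. partials is u x + partials is v x"]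
    by (intro vector_derivative_at has_vector_derivative_add has_vector_derivative_partial[OF _ Cons.prems(2) i]
        smooth_on_partials uv "is")
  finally show ?case by (simp add: partials_Cons)
qed auto

lemma partials_scale:
  fixes u :: "(nat \<Rightarrow> real) \<Rightarrow> 'v::real_normed_algebra"
  assumes V: "openin (Euclidean_space n) V" and u: "smooth_on n V u"
  shows "set is \<subseteq> {..<n} \<Longrightarrow> x \<in> V \<Longrightarrow> partials is (\<lambda>x. r * u x) x = r * partials is u x"
proof (induction "is" arbitrary: x)
  case (Cons i "is")
  then have i: "i < n" and "is": "set is \<subseteq> {..<n}" by auto
  have "partials (i # is) (\<lambda>x. r * u x) x = partial i (\<lambda>x. r * partials is u x) x"
    unfolding partials_Cons by (rule partial_cong[OF V Cons.prems(2) i]) (rule Cons.IH[OF "is"])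
  also have "\<dots> = r * partial i (partials is u) x"
    unfolding partial_def[of i "\<lambda>x. r * partials is u x"]
    by (intro vector_derivative_at bounded_linear.has_vector_derivative[OF bounded_linear_mult_right]
        has_vector_derivative_partial[OF _ Cons.prems(2) i] smooth_on_partials u "is")
  finally show ?case by (simp add: partials_Cons)
qed auto

lemma smooth_on_sum:
  fixes u :: "'i \<Rightarrow> (nat \<Rightarrow> real) \<Rightarrow> 'v::real_normed_algebra_1"
  assumes "openin (Euclidean_space n) V" "\<And>i. i \<in> I \<Longrightarrow> smooth_on n V (u i)"
  shows "smooth_on n V (\<lambda>x. \<Sum>i\<in>I. u i x)"
  using assms(2) by (induction I rule: infinite_finite_induct) (auto simp: smooth_on_const smooth_on_add[OF assms(1)])

text \<open>Lists, rather than finitely supported families of coefficients, turn the Leibniz rule into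
  concatenation.\<close>

definition diff_op :: "(((nat \<Rightarrow> real) \<Rightarrow> 'v) \<times> nat list) list \<Rightarrow> ((nat \<Rightarrow> real) \<Rightarrow> 'v) \<Rightarrow> (nat \<Rightarrow> real) \<Rightarrow> 'v::real_normed_field" where
  "diff_op as u x = (\<Sum>(a, is)\<leftarrow>as. a x * partials is u x)"

text \<open>The coefficients of the new operator do not depend on the function \<open>u\<close>; this uniformity is what
  estimates of \<open>partials ks (diff_op as u)\<close> need.\<close>

lemma partials_diff_op:
  fixes as :: "(((nat \<Rightarrow> real) \<Rightarrow> 'v::real_normed_field) \<times> nat list) list"
  assumes V: "openin (Euclidean_space n) V" and ks: "set ks \<subseteq> {..<n}"
    and as: "\<And>a is. (a, is) \<in> set as \<Longrightarrow> smooth_on n V a \<and> set is \<subseteq> {..<n}"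
  obtains bs where "\<And>b is. (b, is) \<in> set bs \<Longrightarrow> smooth_on n V b \<and> set is \<subseteq> {..<n}"
    and "\<And>u x. smooth_on n V u \<Longrightarrow> x \<in> V \<Longrightarrow> partials ks (diff_op as u) x = diff_op bs u x"
proof -
  have "\<exists>bs. (\<forall>(b, is)\<in>set bs. smooth_on n V b \<and> set is \<subseteq> {..<n}) \<and>
    (\<forall>u. smooth_on n V u \<longrightarrow> (\<forall>x\<in>V. partials ks (diff_op as u) x = diff_op bs u x))"
    using ks
  proof (induction ks)
    case Nil
    show ?case using as by (intro exI[of _ as]) auto
  next
    case (Cons k ks)
    then have k: "k < n" by auto
    obtain bs where bs: "\<forall>(b, is)\<in>set bs. smooth_on n V b \<and> set is \<subseteq> {..<n}"
      and eq: "\<And>u x. smooth_on n V u \<Longrightarrow> x \<in> V \<Longrightarrow> partials ks (diff_op as u) x = diff_op bs u x"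
      using Cons by auto
    define cs where "cs = map (\<lambda>(b, is). (b, k # is)) bs @ map (\<lambda>(b, is). (partial k b, is)) bs"
    have "partials (k # ks) (diff_op as u) x = diff_op cs u x" if u: "smooth_on n V u" and x: "x \<in> V" for u x
    proof -
      have "partials (k # ks) (diff_op as u) x = partial k (diff_op bs u) x"
        unfolding partials_Cons by (rule partial_cong[OF V x k]) (rule eq[OF u])
      also have "\<dots> = partial k (\<lambda>x. \<Sum>(b, v)\<leftarrow>map (\<lambda>(b, is). (b, partials is u)) bs. b x * v x) x"
        unfolding diff_op_def[abs_def] by (simp add: case_prod_unfold o_def)
      also have "\<dots> = (\<Sum>(b, v)\<leftarrow>map (\<lambda>(b, is). (b, partials is u)) bs. b x * partial k v x + partial k b x * v x)"
        unfolding partial_def[of k "\<lambda>x. \<Sum>(u, v)\<leftarrow>_. u x * v x"]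
        by (rule vector_derivative_at, rule partial_sum_list_mult[OF _ x k])
          (use bs u in \<open>auto intro: smooth_on_partials\<close>)
      also have "\<dots> = diff_op cs u x"
        unfolding diff_op_def cs_def by (induction bs) (auto simp: algebra_simps partials_Cons)
      finally show ?thesis .
    qed
    then show ?case
      using bs k by (intro exI[of _ cs]) (fastforce simp: cs_def smooth_on_partial)
  qed
  then show ?thesis using that by (metis (no_types, lifting) case_prodD)
qed

section \<open>Smooth functions on a manifold and their Frechet topology\<close>

lemma local_rep_apply: "local_rep c f x = f (inv_into (fst c) (snd c) x)"
  by (simp add: local_rep_def)

lemma smooth_atlasD:
  assumes "smooth_atlas n A" "c \<in> A"
  shows "openin (Euclidean_space n) (snd c ` fst c)"
    and "inj_on (snd c) (fst c)"
    and "continuous_on (fst c) (snd c)"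
proof -
  have "chart_on n c" using assms by (simp add: smooth_atlas_def)
  then have o: "openin (Euclidean_space n) (snd c ` fst c)"
    and h: "homeomorphic_map (top_of_set (fst c)) (subtopology (Euclidean_space n) (snd c ` fst c)) (snd c)"
    unfolding chart_on_def by (auto simp: case_prod_beta)
  show "openin (Euclidean_space n) (snd c ` fst c)" by fact
  show "inj_on (snd c) (fst c)"
    using homeomorphic_imp_injective_map[OF h] by simp
  have "continuous_map (top_of_set (fst c)) (powertop_real UNIV) (snd c)"
    using homeomorphic_imp_continuous_map[OF h]
    by (simp add: continuous_map_in_subtopology Euclidean_space_def)
  then show "continuous_on (fst c) (snd c)"
    by (simp add: euclidean_product_topology)
qed

lemma local_rep_chart: "inj_on (snd c) (fst c) \<Longrightarrow> m \<in> fst c \<Longrightarrow> local_rep c f (snd c m) = f m"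
  by (simp add: local_rep_def)

context
  fixes n :: nat and A :: "'m::{t2_space, second_countable_topology} chart set"
  assumes atlas: "smooth_atlas n A"
begin

lemmas chart_open = smooth_atlasD(1)[OF atlas]

lemma Cinf_const: "(\<lambda>_. c) \<in> Cinf n A"
  unfolding Cinf_def using smooth_on_const by (auto simp: local_rep_def o_def)

lemma Cinf_0 [simp]: "0 \<in> Cinf n A" and Cinf_1 [simp]: "1 \<in> Cinf n A"
  using Cinf_const[of 0] Cinf_const[of 1] by (simp_all add: zero_fun_def one_fun_def)

lemma Cinf_add:
  fixes f g :: "'m \<Rightarrow> 'v::real_normed_algebra_1"
  shows "f \<in> Cinf n A \<Longrightarrow> g \<in> Cinf n A \<Longrightarrow> f + g \<in> Cinf n A"
  unfolding Cinf_def using smooth_on_add[OF chart_open] by (fastforce simp: local_rep_def o_def)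

lemma Cinf_mult:
  fixes f g :: "'m \<Rightarrow> 'v::real_normed_algebra"
  shows "f \<in> Cinf n A \<Longrightarrow> g \<in> Cinf n A \<Longrightarrow> f * g \<in> Cinf n A"
  unfolding Cinf_def using smooth_on_mult[OF chart_open] by (fastforce simp: local_rep_def o_def)

lemma Cinf_fscale:
  fixes f :: "'m \<Rightarrow> 'v::real_normed_algebra"
  shows "f \<in> Cinf n A \<Longrightarrow> fscale r f \<in> Cinf n A"
  using Cinf_mult[OF Cinf_const[of r]] by (simp add: fscale_def times_fun_def)

lemma Cinf_partials_continuous:
  assumes "f \<in> Cinf n A" "c \<in> A" "set is \<subseteq> {..<n}" "C \<subseteq> fst c"
  shows "continuous_on C (\<lambda>m. partials is (local_rep c f) (snd c m))"
proof -
  have "continuous_on (snd c ` fst c) (partials is (local_rep c f))"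
    using assms(1,2) smooth_onD(1)[OF _ assms(3)] unfolding Cinf_def by auto
  then have "continuous_on (fst c) (\<lambda>m. partials is (local_rep c f) (snd c m))"
    by (rule continuous_on_compose2[OF _ smooth_atlasD(3)[OF atlas assms(2)]]) auto
  then show ?thesis using assms(4) continuous_on_subset by blast
qed

text \<open>Every smooth function lies in the basic open set that belongs to the empty compact set.\<close>

lemma topspace_Cinf_top: "topspace (Cinf_top n A :: ('m \<Rightarrow> 'v::real_normed_vector) topology) = Cinf n A"
proof -
  have "Cinf n A \<subseteq> topspace (Cinf_top n A :: ('m \<Rightarrow> 'v) topology)"
  proof
    fix f :: "'m \<Rightarrow> 'v" assume f: "f \<in> Cinf n A"
    obtain c where "c \<in> A" using atlas unfolding smooth_atlas_def by (metis UNIV_I UN_E)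
    then have "openin (Cinf_top n A) (Cinf n A :: ('m \<Rightarrow> 'v) set)"
      unfolding Cinf_top_def
      by (intro topology_generated_by_Basis CollectI exI[of _ f] exI[of _ c] exI[of _ "{}"]
          exI[of _ "[]"] exI[of _ 1]) (use f in auto)
    then show "f \<in> topspace (Cinf_top n A)" using f openin_subset by blast
  qed
  then show ?thesis unfolding Cinf_top_def topology_generated_by_topspace by blast
qed

lemma partials_local_rep_add:
  fixes f g :: "'m \<Rightarrow> 'v::real_normed_vector"
  assumes "c \<in> A" "set is \<subseteq> {..<n}" "f \<in> Cinf n A" "g \<in> Cinf n A" "x \<in> snd c ` fst c"
  shows "partials is (local_rep c (f + g)) x = partials is (local_rep c f) x + partials is (local_rep c g) x"
  using partials_add[OF chart_open[OF assms(1)] _ _ assms(2,5), of "local_rep c f" "local_rep c g"] assms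
  by (simp add: Cinf_def local_rep_def o_def)

text \<open>The basic open sets are centred at arbitrary functions. Since a strict inequality between continuous
  functions on a compact set leaves room for a neighbourhood, those centred at the values of the map
  suffice.\<close>

lemma continuous_map_Cinf_topI:
  fixes T :: "'x \<Rightarrow> 'm \<Rightarrow> 'v::real_normed_vector"
  assumes T: "\<And>x. x \<in> topspace X \<Longrightarrow> T x \<in> Cinf n A"
    and near: "\<And>x c C is \<epsilon>. x \<in> topspace X \<Longrightarrow> c \<in> A \<Longrightarrow> compact C \<Longrightarrow> C \<subseteq> fst c \<Longrightarrow> set is \<subseteq> {..<n} \<Longrightarrow>
      \<epsilon> > 0 \<Longrightarrow> \<exists>W. openin X W \<and> x \<in> W \<and> (\<forall>y\<in>W. \<forall>m\<in>C. norm (partials is (local_rep c (T y)) (snd c m)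
         - partials is (local_rep c (T x)) (snd c m)) < \<epsilon>)"
  shows "continuous_map X (Cinf_top n A) T"
  unfolding Cinf_top_def
proof (rule continuous_on_generated_topo)
  fix U :: "('m \<Rightarrow> 'v) set"
  assume "U \<in> {{g \<in> Cinf n A. \<forall>m\<in>C. norm (partials is (local_rep c g) (snd c m)
                               - partials is (local_rep c f) (snd c m)) < \<epsilon>}
      | f c C is \<epsilon>. f \<in> Cinf n A \<and> c \<in> A \<and> compact C \<and> C \<subseteq> fst c \<and> set is \<subseteq> {..<n} \<and> \<epsilon> > (0::real)}"
  then obtain f c C "is" \<epsilon> where f: "f \<in> Cinf n A" and c: "c \<in> A" and C: "compact C" "C \<subseteq> fst c"
    and "is": "set is \<subseteq> {..<n}" and \<epsilon>: "\<epsilon> > 0"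
    and U: "U = {g \<in> Cinf n A. \<forall>m\<in>C. norm (partials is (local_rep c g) (snd c m)
                               - partials is (local_rep c f) (snd c m)) < \<epsilon>}"
    by blast
  show "openin X (T -` U \<inter> topspace X)"
  proof (subst openin_subopen, rule ballI)
    fix x assume x: "x \<in> T -` U \<inter> topspace X"
    define G where "G m = norm (partials is (local_rep c (T x)) (snd c m) - partials is (local_rep c f) (snd c m))" for m
    have "\<exists>M<\<epsilon>. \<forall>m\<in>C. G m \<le> M"
    proof (cases "C = {}")
      case False
      have "continuous_on C G"
        unfolding G_def by (intro continuous_intros Cinf_partials_continuous c "is" C f T) (use x in auto)
      then obtain m where "m \<in> C" "\<forall>m'\<in>C. G m' \<le> G m"
        using continuous_attains_sup[OF C(1) False] by blast
      moreover have "G m < \<epsilon>" using x \<open>m \<in> C\<close> unfolding U G_def by auto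
      ultimately show ?thesis by blast
    qed (use \<epsilon> in \<open>auto intro: exI[of _ 0]\<close>)
    then obtain M where M: "M < \<epsilon>" "\<And>m. m \<in> C \<Longrightarrow> G m \<le> M" by blast
    obtain W where W: "openin X W" "x \<in> W" "\<And>y m. y \<in> W \<Longrightarrow> m \<in> C \<Longrightarrow>
        norm (partials is (local_rep c (T y)) (snd c m) - partials is (local_rep c (T x)) (snd c m)) < \<epsilon> - M"
      using near[of x c C "is" "\<epsilon> - M"] x c C "is" M by auto
    have "W \<subseteq> T -` U \<inter> topspace X"
    proof
      fix y assume y: "y \<in> W"
      then have "y \<in> topspace X" using W(1) openin_subset by blast
      moreover have "norm (partials is (local_rep c (T y)) (snd c m) - partials is (local_rep c f) (snd c m)) < \<epsilon>"
        if "m \<in> C" for m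
        using W(3)[OF y that] M(2)[OF that] unfolding G_def by norm
      ultimately show "y \<in> T -` U \<inter> topspace X" using T unfolding U by auto
    qed
    then show "\<exists>W. openin X W \<and> x \<in> W \<and> W \<subseteq> T -` U \<inter> topspace X" using W by blast
  qed
next
  show "T ` topspace X \<subseteq> \<Union> {{g \<in> Cinf n A. \<forall>m\<in>C. norm (partials is (local_rep c g) (snd c m)
                               - partials is (local_rep c f) (snd c m)) < \<epsilon>}
      | f c C is \<epsilon>. f \<in> Cinf n A \<and> c \<in> A \<and> compact C \<and> C \<subseteq> fst c \<and> set is \<subseteq> {..<n} \<and> \<epsilon> > (0::real)}"
    using T topspace_Cinf_top[where ?'v='v] unfolding Cinf_top_def topology_generated_by_topspace by blast
qed

lemma openin_Cinf_nbhd: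
  assumes "f \<in> Cinf n A" "c \<in> A" "compact C" "C \<subseteq> fst c" "set is \<subseteq> {..<n}" "\<epsilon> > (0::real)"
  shows "openin (Cinf_top n A) {g \<in> Cinf n A. \<forall>m\<in>C. norm (partials is (local_rep c g) (snd c m)
                               - partials is (local_rep c f) (snd c m)) < \<epsilon>}"
  unfolding Cinf_top_def by (rule topology_generated_by_Basis) (use assms in blast)

text \<open>A derivative of the value is a finite sum of derivatives of the argument with bounded coefficients on
  the compact set, so that control of finitely many derivatives of the argument is enough.\<close>

lemma continuous_map_local_diff_op:
  fixes T :: "('m \<Rightarrow> 'v) \<Rightarrow> 'm \<Rightarrow> 'v::real_normed_field"
  assumes T: "\<And>f. f \<in> Cinf n A \<Longrightarrow> T f \<in> Cinf n A"
    and loc: "\<And>c. c \<in> A \<Longrightarrow> \<exists>as. (\<forall>(a, is)\<in>set as. smooth_on n (snd c ` fst c) a \<and> set is \<subseteq> {..<n}) \<and>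
       (\<forall>f\<in>Cinf n A. \<forall>x\<in>snd c ` fst c. local_rep c (T f) x = diff_op as (local_rep c f) x)"
  shows "continuous_map (Cinf_top n A) (Cinf_top n A) T"
proof (rule continuous_map_Cinf_topI)
  fix f :: "'m \<Rightarrow> 'v" and c and C :: "'m set" and ks and \<epsilon> :: real
  assume "f \<in> topspace (Cinf_top n A)" and c: "c \<in> A" and C: "compact C" "C \<subseteq> fst c"
    and ks: "set ks \<subseteq> {..<n}" and \<epsilon>: "\<epsilon> > 0"
  then have f: "f \<in> Cinf n A" by (simp add: topspace_Cinf_top)
  let ?V = "snd c ` fst c"
  obtain as where as: "\<And>a is. (a, is) \<in> set as \<Longrightarrow> smooth_on n ?V a \<and> set is \<subseteq> {..<n}"
    and eq: "\<And>f x. f \<in> Cinf n A \<Longrightarrow> x \<in> ?V \<Longrightarrow> local_rep c (T f) x = diff_op as (local_rep c f) x"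
    using loc[OF c] by (metis (no_types, lifting) case_prodD)
  obtain bs where bs: "\<And>b is. (b, is) \<in> set bs \<Longrightarrow> smooth_on n ?V b \<and> set is \<subseteq> {..<n}"
    and eq2: "\<And>u x. smooth_on n ?V u \<Longrightarrow> x \<in> ?V \<Longrightarrow> partials ks (diff_op as u) x = diff_op bs u x"
    using partials_diff_op[OF chart_open[OF c] ks, of as] as by metis
  have val: "partials ks (local_rep c (T g)) (snd c m) = diff_op bs (local_rep c g) (snd c m)"
    if "g \<in> Cinf n A" "m \<in> C" for g m
  proof -
    have "smooth_on n ?V (local_rep c g)" using that c by (auto simp: Cinf_def)
    moreover have "snd c m \<in> ?V" using that C by auto
    moreover from this have "partials ks (local_rep c (T g)) (snd c m) =
        partials ks (diff_op as (local_rep c g)) (snd c m)"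
      by (intro partials_cong[OF chart_open[OF c] ks] eq[OF that(1)])
    ultimately show ?thesis using eq2 by simp
  qed
  have est: "\<exists>W. openin (Cinf_top n A) W \<and> f \<in> W \<and>
    (\<forall>g\<in>W. g \<in> Cinf n A \<and> (\<forall>m\<in>C. norm (diff_op bs (local_rep c g) (snd c m) - diff_op bs (local_rep c f) (snd c m)) < \<delta>))"
    if "\<delta> > 0" for \<delta> :: real
    using bs that
  proof (induction bs arbitrary: \<delta>)
    case Nil
    show ?case
      by (rule exI[of _ "Cinf n A"]) (use f Nil openin_topspace[of "Cinf_top n A"] in \<open>auto simp: diff_op_def topspace_Cinf_top\<close>)
  next
    case (Cons bi bs)
    obtain b "is" where bi: "bi = (b, is)" by force
    have b: "smooth_on n ?V b" and "is": "set is \<subseteq> {..<n}" using Cons.prems(1)[of b "is"] bi by auto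
    obtain W where W: "openin (Cinf_top n A) W" "f \<in> W" "\<And>g. g \<in> W \<Longrightarrow> g \<in> Cinf n A"
      "\<And>g m. g \<in> W \<Longrightarrow> m \<in> C \<Longrightarrow>
        norm (diff_op bs (local_rep c g) (snd c m) - diff_op bs (local_rep c f) (snd c m)) < \<delta> / 2"
      using Cons.IH[of "\<delta> / 2"] Cons.prems by fastforce
    have "continuous_on C (\<lambda>m. b (snd c m))"
      by (rule continuous_on_compose2[OF smooth_onD(1)[OF b, of "[]", simplified]
            continuous_on_subset[OF smooth_atlasD(3)[OF atlas c] C(2)]]) (use C in auto)
    then have "bounded ((\<lambda>m. b (snd c m)) ` C)"
      using compact_continuous_image C(1) compact_imp_bounded by blast
    then obtain M where M: "M > 0" "\<And>m. m \<in> C \<Longrightarrow> norm (b (snd c m)) \<le> M"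
      by (auto simp: bounded_pos)
    let ?N = "{g \<in> Cinf n A. \<forall>m\<in>C. norm (partials is (local_rep c g) (snd c m)
                               - partials is (local_rep c f) (snd c m)) < \<delta> / 2 / M}"
    have N: "openin (Cinf_top n A) ?N" "f \<in> ?N"
      using openin_Cinf_nbhd[OF f c C "is"] \<open>M > 0\<close> Cons.prems(2) f by auto
    have "norm (diff_op (bi # bs) (local_rep c g) (snd c m) - diff_op (bi # bs) (local_rep c f) (snd c m)) < \<delta>"
      if "g \<in> W" "g \<in> ?N" "m \<in> C" for g m
    proof -
      let ?p = "\<lambda>g. partials is (local_rep c g) (snd c m)"
      have "norm (b (snd c m) * (?p g - ?p f)) \<le> M * norm (?p g - ?p f)"
        unfolding norm_mult by (rule mult_right_mono) (use M that in auto)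
      also have "\<dots> < \<delta> / 2" using that \<open>M > 0\<close> by (auto simp: field_simps)
      finally show ?thesis
        using W(4)[OF that(1,3)] unfolding bi diff_op_def by (simp add: algebra_simps) norm
    qed
    then show ?case
      using W N by (intro exI[of _ "W \<inter> ?N"]) (auto intro: openin_Int)
  qed
  show "\<exists>W. openin (Cinf_top n A) W \<and> f \<in> W \<and> (\<forall>y\<in>W. \<forall>m\<in>C. norm (partials ks (local_rep c (T y)) (snd c m)
         - partials ks (local_rep c (T f)) (snd c m)) < \<epsilon>)"
    using est[OF \<epsilon>] by (metis val f)
qed (auto simp: T topspace_Cinf_top)

lemma continuous_map_Cinf_mult:
  fixes f :: "'m \<Rightarrow> 'v::real_normed_field"
  assumes f: "f \<in> Cinf n A"
  shows "continuous_map (Cinf_top n A) (Cinf_top n A) (\<lambda>g. f * g)"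
proof (rule continuous_map_local_diff_op)
  show "\<exists>as. (\<forall>(a, is)\<in>set as. smooth_on n (snd c ` fst c) a \<and> set is \<subseteq> {..<n}) \<and>
       (\<forall>g\<in>Cinf n A. \<forall>x\<in>snd c ` fst c. local_rep c (f * g) x = diff_op as (local_rep c g) x)" if "c \<in> A" for c
    by (rule exI[of _ "[(local_rep c f, [])]"])
      (use f that in \<open>auto simp: diff_op_def local_rep_def Cinf_def\<close>)
qed (use f Cinf_mult in auto)

lemma continuous_map_Cinf_fscale:
  "continuous_map (Cinf_top n A) (Cinf_top n A) (fscale r :: _ \<Rightarrow> 'm \<Rightarrow> 'v::real_normed_field)"
  using continuous_map_Cinf_mult[OF Cinf_const[of r]] by (simp add: fscale_def[abs_def] times_fun_def)

lemma continuous_map_Cinf_add: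
  fixes S T :: "'x \<Rightarrow> 'm \<Rightarrow> 'v::real_normed_field"
  assumes S: "continuous_map X (Cinf_top n A) S" and T: "continuous_map X (Cinf_top n A) T"
  shows "continuous_map X (Cinf_top n A) (\<lambda>x. S x + T x)"
proof (rule continuous_map_Cinf_topI)
  have ST: "S x \<in> Cinf n A" "T x \<in> Cinf n A" if "x \<in> topspace X" for x
    using S T that by (auto simp: continuous_map_def topspace_Cinf_top)
  then show "S x + T x \<in> Cinf n A" if "x \<in> topspace X" for x using that by (auto intro: Cinf_add)
  fix x c and C :: "'m set" and "is" and \<epsilon> :: real
  assume x: "x \<in> topspace X" and c: "c \<in> A" and C: "compact C" "C \<subseteq> fst c"
    and "is": "set is \<subseteq> {..<n}" and \<epsilon>: "\<epsilon> > 0"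
  have lin: "partials is (local_rep c (S y + T y)) (snd c m) =
     partials is (local_rep c (S y)) (snd c m) + partials is (local_rep c (T y)) (snd c m)"
    if "y \<in> topspace X" "m \<in> C" for y m
    using that C by (intro partials_local_rep_add[OF c "is"] ST) auto
  show "\<exists>W. openin X W \<and> x \<in> W \<and> (\<forall>y\<in>W. \<forall>m\<in>C. norm (partials is (local_rep c (S y + T y)) (snd c m)
         - partials is (local_rep c (S x + T x)) (snd c m)) < \<epsilon>)"
  proof -
    let ?N = "\<lambda>f. {g \<in> Cinf n A. \<forall>m\<in>C. norm (partials is (local_rep c g) (snd c m)
                               - partials is (local_rep c f) (snd c m)) < \<epsilon> / 2}"
    let ?W = "{y \<in> topspace X. S y \<in> ?N (S x)} \<inter> {y \<in> topspace X. T y \<in> ?N (T x)}"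
    have "openin X ?W"
      by (intro openin_Int openin_continuous_map_preimage[OF S] openin_continuous_map_preimage[OF T]
          openin_Cinf_nbhd c C "is" ST x) (use \<epsilon> in auto)
    moreover have "x \<in> ?W" using x ST \<epsilon> by auto
    moreover have "norm (partials is (local_rep c (S y + T y)) (snd c m)
         - partials is (local_rep c (S x + T x)) (snd c m)) < \<epsilon>" if y: "y \<in> ?W" and m: "m \<in> C" for y m
    proof -
      let ?d = "\<lambda>f g. partials is (local_rep c f) (snd c m) - partials is (local_rep c g) (snd c m)"
      have "norm (?d (S y) (S x)) < \<epsilon> / 2" "norm (?d (T y) (T x)) < \<epsilon> / 2" using y m by auto
      then have "norm (?d (S y) (S x) + ?d (T y) (T x)) < \<epsilon>" by norm
      moreover have "y \<in> topspace X" using y by blast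
      ultimately show ?thesis using lin[OF _ m] x by (simp add: algebra_simps)
    qed
    ultimately show ?thesis by blast
  qed
qed

lemma partials_local_rep_fscale:
  fixes f :: "'m \<Rightarrow> 'v::real_normed_algebra"
  assumes "c \<in> A" "set is \<subseteq> {..<n}" "f \<in> Cinf n A" "x \<in> snd c ` fst c"
  shows "partials is (local_rep c (fscale r f)) x = r * partials is (local_rep c f) x"
  using partials_scale[OF chart_open[OF assms(1)] _ assms(2,4), of "local_rep c f" r] assms
  by (simp add: Cinf_def local_rep_def fscale_def o_def)

lemma fun_eq_chartI:
  assumes "\<And>c x. c \<in> A \<Longrightarrow> x \<in> snd c ` fst c \<Longrightarrow> local_rep c f x = local_rep c g x"
  shows "f = (g :: 'm \<Rightarrow> 'v)"
proof
  fix m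
  obtain c where c: "c \<in> A" "m \<in> fst c" using atlas unfolding smooth_atlas_def by (metis UNIV_I UN_E)
  then show "f m = g m"
    using assms[OF c(1), of "snd c m"] local_rep_chart[OF smooth_atlasD(2)[OF atlas c(1)] c(2)]
    by (metis image_eqI)
qed

definition multi_indices :: "nat \<Rightarrow> nat list set" where
  "multi_indices k = {is. set is \<subseteq> {..<n} \<and> length is \<le> k}"

definition local_bidiff ::
  "(('m \<Rightarrow> 'v) \<Rightarrow> ('m \<Rightarrow> 'v) \<Rightarrow> 'm \<Rightarrow> 'v::real_normed_field) \<Rightarrow> 'm chart \<Rightarrow> nat \<Rightarrow>
    (nat list \<Rightarrow> nat list \<Rightarrow> (nat \<Rightarrow> real) \<Rightarrow> 'v) \<Rightarrow> bool" where
  "local_bidiff b c k w \<longleftrightarrow> (\<forall>is js. smooth_on n (snd c ` fst c) (w is js)) \<and>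
     (\<forall>f\<in>Cinf n A. \<forall>g\<in>Cinf n A. \<forall>x\<in>snd c ` fst c. local_rep c (b f g) x =
        (\<Sum>is\<in>multi_indices k. \<Sum>js\<in>multi_indices k.
           w is js x * partials is (local_rep c f) x * partials js (local_rep c g) x))"

lemma bidifferential_iff:
  "bidifferential n A b \<longleftrightarrow>
    (\<forall>f\<in>Cinf n A. \<forall>g\<in>Cinf n A. b f g \<in> Cinf n A) \<and> (\<exists>k. \<forall>c\<in>A. \<exists>w. local_bidiff b c k w)"
  unfolding bidifferential_def local_bidiff_def multi_indices_def by (rule refl)

lemma local_bidiffD:
  assumes "local_bidiff b c k w"
  shows "smooth_on n (snd c ` fst c) (w is js)"
    and "f \<in> Cinf n A \<Longrightarrow> g \<in> Cinf n A \<Longrightarrow> x \<in> snd c ` fst c \<Longrightarrow> local_rep c (b f g) x =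
        (\<Sum>is\<in>multi_indices k. \<Sum>js\<in>multi_indices k.
           w is js x * partials is (local_rep c f) x * partials js (local_rep c g) x)"
  using assms unfolding local_bidiff_def by blast+

lemma bidifferential_flip:
  fixes b :: "('m \<Rightarrow> 'v) \<Rightarrow> ('m \<Rightarrow> 'v) \<Rightarrow> 'm \<Rightarrow> 'v::real_normed_field"
  assumes b: "bidifferential n A b"
  shows "bidifferential n A (\<lambda>f g. b g f)"
proof -
  have "local_bidiff (\<lambda>f g. b g f) c k (\<lambda>is js. w js is)" if q: "local_bidiff b c k w" for c k w
    unfolding local_bidiff_def
  proof (intro conjI ballI)
    show "\<forall>is js. smooth_on n (snd c ` fst c) (w js is)" using local_bidiffD(1)[OF q] by simp
    fix f g :: "'m \<Rightarrow> 'v" and x assume fgx: "f \<in> Cinf n A" "g \<in> Cinf n A" "x \<in> snd c ` fst c"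
    show "local_rep c (b g f) x = (\<Sum>is\<in>multi_indices k. \<Sum>js\<in>multi_indices k.
        w js is x * partials is (local_rep c f) x * partials js (local_rep c g) x)"
      unfolding local_bidiffD(2)[OF q fgx(2,1,3)] by (subst sum.swap) (simp add: mult_ac)
  qed
  then show ?thesis using b unfolding bidifferential_iff by blast
qed

text \<open>The local coefficients absorb the derivatives of the fixed function \<open>g\<close>, which leaves a differential
  operator in \<open>f\<close>; continuity and linearity are read off from its local form.\<close>

lemma bidifferential_left:
  fixes b :: "('m \<Rightarrow> 'v::real_normed_field) \<Rightarrow> ('m \<Rightarrow> 'v) \<Rightarrow> 'm \<Rightarrow> 'v"
  assumes b: "bidifferential n A b" and g: "g \<in> Cinf n A"
  shows "continuous_map (Cinf_top n A) (Cinf_top n A) (\<lambda>f. b f g)"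
    and "f \<in> Cinf n A \<Longrightarrow> f' \<in> Cinf n A \<Longrightarrow> b (f + f') g = b f g + b f' g"
    and "f \<in> Cinf n A \<Longrightarrow> b (fscale r f) g = fscale r (b f g)"
proof -
  have loc: "\<exists>as. (\<forall>(a, is)\<in>set as. smooth_on n (snd c ` fst c) a \<and> set is \<subseteq> {..<n}) \<and>
       (\<forall>f\<in>Cinf n A. \<forall>x\<in>snd c ` fst c. local_rep c (b f g) x = diff_op as (local_rep c f) x)"
    if c: "c \<in> A" for c
  proof -
    obtain k w where w: "local_bidiff b c k w"
      using b c unfolding bidifferential_iff by blast
    have "finite (multi_indices k)" unfolding multi_indices_def by (rule finite_lists_length_le) simp
    then obtain xs where xs: "distinct xs" "set xs = multi_indices k" using finite_distinct_list by blast
    define a where "a is x = (\<Sum>js\<in>multi_indices k. w is js x * partials js (local_rep c g) x)" for "is" x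
    have g': "smooth_on n (snd c ` fst c) (local_rep c g)" using g c by (simp add: Cinf_def)
    have "smooth_on n (snd c ` fst c) (a is)" for "is"
      unfolding a_def
      by (intro smooth_on_sum smooth_on_mult smooth_on_partials chart_open c local_bidiffD(1)[OF w] g') (auto simp: multi_indices_def)
    moreover have "local_rep c (b f g) x = diff_op (map (\<lambda>is. (a is, is)) xs) (local_rep c f) x"
      if "f \<in> Cinf n A" "x \<in> snd c ` fst c" for f x
      unfolding local_bidiffD(2)[OF w that(1) g that(2)] diff_op_def a_def
      by (simp add: o_def sum_list_distinct_conv_sum_set xs sum_distrib_left sum_distrib_right mult_ac)
    ultimately show ?thesis
      by (intro exI[of _ "map (\<lambda>is. (a is, is)) xs"]) (use xs in \<open>auto simp: multi_indices_def\<close>)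
  qed
  show "continuous_map (Cinf_top n A) (Cinf_top n A) (\<lambda>f. b f g)"
    by (rule continuous_map_local_diff_op[OF _ loc]) (use b g in \<open>auto simp: bidifferential_def\<close>)
  show "b (f + f') g = b f g + b f' g" if f: "f \<in> Cinf n A" "f' \<in> Cinf n A"
  proof (rule fun_eq_chartI)
    fix c x assume c: "c \<in> A" and x: "x \<in> snd c ` fst c"
    obtain as where as: "\<And>a is. (a, is) \<in> set as \<Longrightarrow> set is \<subseteq> {..<n}"
      and eq: "\<And>f. f \<in> Cinf n A \<Longrightarrow> local_rep c (b f g) x = diff_op as (local_rep c f) x"
      using loc[OF c] x by (metis (no_types, lifting) case_prodD)
    have "diff_op as (local_rep c (f + f')) x = diff_op as (local_rep c f) x + diff_op as (local_rep c f') x"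
      using as
    proof (induction as)
      case (Cons ai as)
      obtain a "is" where ai: "ai = (a, is)" by force
      have "set is \<subseteq> {..<n}" using Cons(2) ai by auto
      moreover have "diff_op as (local_rep c (f + f')) x = diff_op as (local_rep c f) x + diff_op as (local_rep c f') x"
        by (rule Cons(1)) (use Cons(2) in auto)
      ultimately show ?case
        unfolding ai diff_op_def
        by (simp only: list.map sum_list.Cons case_prod_conv partials_local_rep_add[OF c _ f x]) (simp add: distrib_left)
    qed (simp add: diff_op_def)
    then show "local_rep c (b (f + f') g) x = local_rep c (b f g + b f' g) x"
      using eq[OF Cinf_add[OF f]] eq[OF f(1)] eq[OF f(2)] by (simp add: local_rep_apply)
  qed
  show "b (fscale r f) g = fscale r (b f g)" if f: "f \<in> Cinf n A"
  proof (rule fun_eq_chartI)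
    fix c x assume c: "c \<in> A" and x: "x \<in> snd c ` fst c"
    obtain as where as: "\<And>a is. (a, is) \<in> set as \<Longrightarrow> set is \<subseteq> {..<n}"
      and eq: "\<And>f. f \<in> Cinf n A \<Longrightarrow> local_rep c (b f g) x = diff_op as (local_rep c f) x"
      using loc[OF c] x by (metis (no_types, lifting) case_prodD)
    have "diff_op as (local_rep c (fscale r f)) x = r * diff_op as (local_rep c f) x"
      using as
    proof (induction as)
      case (Cons ai as)
      obtain a "is" where ai: "ai = (a, is)" by force
      have "set is \<subseteq> {..<n}" using Cons(2) ai by auto
      moreover have "diff_op as (local_rep c (fscale r f)) x = r * diff_op as (local_rep c f) x"
        by (rule Cons(1)) (use Cons(2) in auto)
      ultimately show ?case
        unfolding ai diff_op_def
        by (simp only: list.map sum_list.Cons case_prod_conv partials_local_rep_fscale[OF c _ f x])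
          (simp add: distrib_left)
    qed (simp add: diff_op_def)
    then show "local_rep c (b (fscale r f) g) x = local_rep c (fscale r (b f g)) x"
      using eq[OF Cinf_fscale[OF f, of r]] eq[OF f] by (simp add: local_rep_apply fscale_def)
  qed
qed

end

section \<open>Ghost and antighost operators\<close>

lemma sum_additive:
  fixes h :: "'a::comm_monoid_add \<Rightarrow> 'b::comm_monoid_add"
  assumes "h 0 = 0" "\<And>x y. h (x + y) = h x + h y"
  shows "h (\<Sum>a\<in>I. x a) = (\<Sum>a\<in>I. h (x a))"
  by (induction I rule: infinite_finite_induct) (auto simp: assms)

text \<open>The operators below are additive only on elements with smooth coefficients. The domain is required
  to be closed under sums, so that additivity extends to finite sums.\<close>

definition additive_over :: "'a set \<Rightarrow> ('a::comm_monoid_add \<Rightarrow> 'b::comm_monoid_add) \<Rightarrow> bool" where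
  "additive_over W h \<longleftrightarrow> 0 \<in> W \<and> h 0 = 0 \<and> (\<forall>x\<in>W. \<forall>y\<in>W. x + y \<in> W \<and> h (x + y) = h x + h y)"

lemma sum_additive_over:
  assumes h: "additive_over W h" and x: "\<And>a. a \<in> I \<Longrightarrow> x a \<in> W"
  shows "(\<Sum>a\<in>I. x a) \<in> W" and "h (\<Sum>a\<in>I. x a) = (\<Sum>a\<in>I. h (x a))"
proof -
  have "(\<Sum>a\<in>I. x a) \<in> W \<and> h (\<Sum>a\<in>I. x a) = (\<Sum>a\<in>I. h (x a))"
    using x h by (induction I rule: infinite_finite_induct) (auto simp: additive_over_def)
  then show "(\<Sum>a\<in>I. x a) \<in> W" "h (\<Sum>a\<in>I. x a) = (\<Sum>a\<in>I. h (x a))" by auto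
qed

lemma sum2_additive_over:
  assumes h: "additive_over W h" and x: "\<And>a b. a \<in> I \<Longrightarrow> b \<in> K \<Longrightarrow> x a b \<in> W"
  shows "(\<Sum>a\<in>I. \<Sum>b\<in>K. x a b) \<in> W" and "h (\<Sum>a\<in>I. \<Sum>b\<in>K. x a b) = (\<Sum>a\<in>I. \<Sum>b\<in>K. h (x a b))"
proof -
  have b: "(\<Sum>b\<in>K. x a b) \<in> W" "h (\<Sum>b\<in>K. x a b) = (\<Sum>b\<in>K. h (x a b))" if "a \<in> I" for a
    using sum_additive_over[OF h, of K "x a"] x that by auto
  show "(\<Sum>a\<in>I. \<Sum>b\<in>K. x a b) \<in> W" by (rule sum_additive_over(1)[OF h b(1)])
  show "h (\<Sum>a\<in>I. \<Sum>b\<in>K. x a b) = (\<Sum>a\<in>I. \<Sum>b\<in>K. h (x a b))"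
    using sum_additive_over(2)[OF h b(1), of I "\<lambda>a. a"] by (simp add: b(2))
qed

lemma sum3_additive_over:
  assumes h: "additive_over W h" and x: "\<And>a b c. a \<in> I \<Longrightarrow> b \<in> K \<Longrightarrow> c \<in> L \<Longrightarrow> x a b c \<in> W"
  shows "(\<Sum>a\<in>I. \<Sum>b\<in>K. \<Sum>c\<in>L. x a b c) \<in> W"
    and "h (\<Sum>a\<in>I. \<Sum>b\<in>K. \<Sum>c\<in>L. x a b c) = (\<Sum>a\<in>I. \<Sum>b\<in>K. \<Sum>c\<in>L. h (x a b c))"
proof -
  have c: "(\<Sum>b\<in>K. \<Sum>c\<in>L. x a b c) \<in> W" "h (\<Sum>b\<in>K. \<Sum>c\<in>L. x a b c) = (\<Sum>b\<in>K. \<Sum>c\<in>L. h (x a b c))" if "a \<in> I" for a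
    using sum2_additive_over[OF h, of K L "x a"] x that by auto
  show "(\<Sum>a\<in>I. \<Sum>b\<in>K. \<Sum>c\<in>L. x a b c) \<in> W" by (rule sum_additive_over(1)[OF h c(1)])
  show "h (\<Sum>a\<in>I. \<Sum>b\<in>K. \<Sum>c\<in>L. x a b c) = (\<Sum>a\<in>I. \<Sum>b\<in>K. \<Sum>c\<in>L. h (x a b c))"
    using sum_additive_over(2)[OF h c(1), of I "\<lambda>a. a"] by (simp add: c(2))
qed

lemma minus_one_power_fun [simp]: "((-1) ^ k :: 'a \<Rightarrow> 'c::comm_ring_1) T = (-1) ^ k"
  by (simp add: minus_one_power_iff)

definition below :: "nat \<Rightarrow> nat set \<Rightarrow> nat" where
  "below i S = card {s \<in> S. s < i}"

lemma gder_altdef: "gder i x = (\<lambda>S. if i \<in> S then 0 else (-1) ^ below i S * x (insert i S))"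
  and gwedge_altdef: "gwedge i x = (\<lambda>S. if i \<in> S then (-1) ^ below i S * x (S - {i}) else 0)"
  unfolding gder_def gwedge_def below_def by (rule refl)+

lemma below_insert: "k \<notin> S \<Longrightarrow> below i (insert k S) = (if k < i then Suc (below i S) else below i S)"
proof -
  assume "k \<notin> S"
  moreover have "{s \<in> insert k S. s < i} = (if k < i then insert k {s \<in> S. s < i} else {s \<in> S. s < i})" by auto
  moreover have "finite {s \<in> S. s < i}" by (rule finite_subset[of _ "{..<i}"]) auto
  ultimately show ?thesis by (simp add: below_def)
qed

lemma below_remove: "k \<in> S \<Longrightarrow> below i S = (if k < i then Suc (below i (S - {k})) else below i (S - {k}))"
  using below_insert[of k "S - {k}" i] by (simp add: insert_absorb)

lemma gder_add: "gder i (x + y) = gder i x + gder i y"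
  and gwedge_add: "gwedge i (x + y) = gwedge i x + gwedge i y"
  and gder_minus: "gder i (- x) = - gder i x"
  and gwedge_minus: "gwedge i (- x) = - gwedge i x"
  and gder_0 [simp]: "gder i 0 = 0"
  and gwedge_0 [simp]: "gwedge i 0 = 0"
  by (auto simp: gder_altdef gwedge_altdef fun_eq_iff algebra_simps)

lemma gder_diff: "gder i (x - y) = gder i x - gder i y"
  and gwedge_diff: "gwedge i (x - y) = gwedge i x - gwedge i y"
  by (auto simp: gder_altdef gwedge_altdef fun_eq_iff algebra_simps)

lemma gder_sum: "gder i (\<Sum>a\<in>I. x a) = (\<Sum>a\<in>I. gder i (x a))"
  by (rule sum_additive[of "gder i"]) (simp, rule gder_add)

lemma gwedge_sum: "gwedge i (\<Sum>a\<in>I. x a) = (\<Sum>a\<in>I. gwedge i (x a))"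
  by (rule sum_additive[of "gwedge i"]) (simp, rule gwedge_add)

text \<open>The canonical anticommutation relations; products with the BRST charge are computed from these.\<close>

lemma gder_gder: "gder i (gder k x) = - gder k (gder i x)"
  by (cases i k rule: linorder_cases)
    (auto simp: gder_altdef fun_eq_iff below_insert insert_commute)

lemma gder_same [simp]: "gder i (gder i x) = 0"
  by (auto simp: gder_altdef fun_eq_iff)

lemma gwedge_gwedge: "gwedge i (gwedge k x) = - gwedge k (gwedge i x)"
proof
  fix S
  consider "i \<notin> S \<or> k \<notin> S" | "i = k" | "i \<in> S" "k \<in> S" "i < k" | "i \<in> S" "k \<in> S" "k < i" by linarith
  then show "gwedge i (gwedge k x) S = (- gwedge k (gwedge i x)) S"
    by cases (auto simp: gwedge_altdef below_remove[of i S k] below_remove[of k S i] Diff_insert2[symmetric] insert_commute)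
qed

lemma gder_gwedge: "gder i (gwedge k x) = (if i = k then x else 0) - gwedge k (gder i x)"
proof
  fix S
  consider (eq_in) "i = k" "i \<in> S" | (eq_out) "i = k" "i \<notin> S" | (triv) "i \<noteq> k" "i \<in> S \<or> k \<notin> S"
    | (lt) "i < k" "i \<notin> S" "k \<in> S" | (gt) "k < i" "i \<notin> S" "k \<in> S" by linarith
  then show "gder i (gwedge k x) S = ((if i = k then x else 0) - gwedge k (gder i x)) S"
  proof cases
    case eq_in
    then show ?thesis
      using below_remove[of i S i] by (simp add: gder_altdef gwedge_altdef insert_absorb)
  next
    case eq_out
    then show ?thesis by (simp add: gder_altdef gwedge_altdef below_insert)
  next
    case triv
    then show ?thesis by (auto simp: gder_altdef gwedge_altdef)
  next
    case lt
    then have "insert i S - {k} = insert i (S - {k})" by auto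
    then show ?thesis
      using lt below_remove[of k S i] by (simp add: gder_altdef gwedge_altdef below_insert)
  next
    case gt
    then have "insert i S - {k} = insert i (S - {k})" by auto
    then show ?thesis
      using gt below_remove[of k S i] by (simp add: gder_altdef gwedge_altdef below_insert)
  qed
qed

lemma gder_gemb [simp]: "gder i (gemb y) = 0"
  by (auto simp: gder_altdef gemb_def fun_eq_iff)

definition smul :: "'c \<Rightarrow> (nat set \<Rightarrow> 'c) \<Rightarrow> nat set \<Rightarrow> 'c::comm_ring_1" where
  "smul k x = (\<lambda>S. k * x S)"

lemma smul_apply: "smul k x S = k * x S"
  by (simp add: smul_def)

lemma gder_smul: "gder i (smul k x) = smul k (gder i x)"
  and gwedge_smul: "gwedge i (smul k x) = smul k (gwedge i x)"
  by (auto simp: gder_altdef gwedge_altdef smul_def fun_eq_iff)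

lemma module_smul: "module smul"
  by unfold_locales (auto simp: smul_def fun_eq_iff algebra_simps)

text \<open>The parity operator. Infinite sets are assigned even cardinality, so it anticommutes
  with the odd operators only on elements supported on finite monomials.\<close>

definition gsign :: "(nat set \<Rightarrow> 'c) \<Rightarrow> nat set \<Rightarrow> 'c::comm_ring_1" where
  "gsign x = (\<lambda>S. (-1) ^ card S * x S)"

definition finite_support :: "(nat set \<Rightarrow> 'c::zero) \<Rightarrow> bool" where
  "finite_support x \<longleftrightarrow> (\<forall>S. infinite S \<longrightarrow> x S = 0)"

lemma finite_support_gder: "finite_support x \<Longrightarrow> finite_support (gder i x)"
  and finite_support_gwedge: "finite_support x \<Longrightarrow> finite_support (gwedge i x)"
  and finite_support_gsign: "finite_support x \<Longrightarrow> finite_support (gsign x)"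
  and finite_support_gemb: "finite_support (gemb y)"
  by (auto simp: finite_support_def gder_altdef gwedge_altdef gsign_def gemb_def)

lemma gsign_gsign [simp]: "gsign (gsign x) = x"
  by (simp add: gsign_def)

lemma gsign_add: "gsign (x + y) = gsign x + gsign y"
  and gsign_minus: "gsign (- x) = - gsign x"
  and gsign_diff: "gsign (x - y) = gsign x - gsign y"
  and gsign_0 [simp]: "gsign 0 = 0"
  and gsign_smul: "gsign (smul k x) = smul k (gsign x)"
  by (auto simp: gsign_def smul_def fun_eq_iff algebra_simps)

lemma gsign_sum: "gsign (\<Sum>a\<in>I. x a) = (\<Sum>a\<in>I. gsign (x a))"
  by (rule sum_additive[of "gsign"]) (simp, rule gsign_add)

lemma gsign_gemb [simp]: "gsign (gemb y) = gemb y"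
  by (auto simp: gsign_def gemb_def fun_eq_iff)

lemma gsign_gwedge: "finite_support x \<Longrightarrow> gsign (gwedge i x) = - gwedge i (gsign x)"
proof
  fix S assume "finite_support x"
  show "gsign (gwedge i x) S = (- gwedge i (gsign x)) S"
  proof (cases "finite S")
    case True
    show ?thesis
    proof (cases "i \<in> S")
      case i: True
      then have "card S = Suc (card (S - {i}))" by (metis True card_Suc_Diff1)
      then show ?thesis using i by (simp add: gsign_def gwedge_altdef minus_one_power_iff)
    qed (simp add: gsign_def gwedge_altdef)
  qed (use \<open>finite_support x\<close> in \<open>auto simp: gsign_def gwedge_altdef finite_support_def\<close>)
qed

lemma gsign_gder: "finite_support x \<Longrightarrow> gsign (gder i x) = - gder i (gsign x)"
proof
  fix S assume "finite_support x"
  show "gsign (gder i x) S = (- gder i (gsign x)) S"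
    by (cases "finite S")
      (use \<open>finite_support x\<close> in \<open>auto simp: gsign_def gder_altdef finite_support_def minus_one_power_iff\<close>)
qed

section \<open>The Grassmann product\<close>

text \<open>Tensors are elements with coefficients in the ring of elements, so that the ghost operators
  act on the first slot of a tensor; the following act on the second slot.\<close>

definition gwedge2 :: "nat \<Rightarrow> (nat set \<Rightarrow> nat set \<Rightarrow> 'c) \<Rightarrow> nat set \<Rightarrow> nat set \<Rightarrow> 'c::comm_ring_1" where
  "gwedge2 i t = (\<lambda>S. gwedge i (t S))"

definition gder2 :: "nat \<Rightarrow> (nat set \<Rightarrow> nat set \<Rightarrow> 'c) \<Rightarrow> nat set \<Rightarrow> nat set \<Rightarrow> 'c::comm_ring_1" where
  "gder2 i t = (\<lambda>S. gder i (t S))"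

definition gemb2 :: "(nat set \<Rightarrow> 'c) \<Rightarrow> nat set \<Rightarrow> nat set \<Rightarrow> 'c::zero" where
  "gemb2 x = (\<lambda>S. gemb (x S))"

definition inversions :: "nat set \<Rightarrow> nat set \<Rightarrow> nat" where
  "inversions S T = card {(s, s'). s \<in> S \<and> s' \<in> T \<and> s' < s}"

lemma gmult_altdef: "gmult t U = (\<Sum>S\<in>Pow U. (-1) ^ inversions S (U - S) * t S (U - S))"
  by (simp add: gmult_def inversions_def)

lemma finite_inversions: "finite S \<Longrightarrow> finite T \<Longrightarrow> finite {(s, s'). s \<in> S \<and> s' \<in> T \<and> s' < s}"
  by (rule finite_subset[of _ "S \<times> T"]) auto

lemma inversions_insert_left:
  assumes "finite S" "finite T" "a \<notin> S"
  shows "inversions (insert a S) T = below a T + inversions S T"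
proof -
  have "{(s, s'). s \<in> insert a S \<and> s' \<in> T \<and> s' < s} = Pair a ` {s \<in> T. s < a} \<union> {(s, s'). s \<in> S \<and> s' \<in> T \<and> s' < s}"
    by auto
  moreover have "card (Pair a ` {s \<in> T. s < a} \<union> {(s, s'). s \<in> S \<and> s' \<in> T \<and> s' < s}) =
      card (Pair a ` {s \<in> T. s < a}) + card {(s, s'). s \<in> S \<and> s' \<in> T \<and> s' < s}"
    by (rule card_Un_disjoint) (use assms finite_inversions[of S T] in auto)
  ultimately show ?thesis
    by (simp add: inversions_def below_def card_image inj_on_def)
qed

lemma inversions_insert_right:
  assumes "finite S" "finite T" "a \<notin> T"
  shows "inversions S (insert a T) = card {s \<in> S. a < s} + inversions S T"
proof -
  have "{(s, s'). s \<in> S \<and> s' \<in> insert a T \<and> s' < s} = (\<lambda>s. (s, a)) ` {s \<in> S. a < s} \<union> {(s, s'). s \<in> S \<and> s' \<in> T \<and> s' < s}"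
    by auto
  moreover have "card ((\<lambda>s. (s, a)) ` {s \<in> S. a < s} \<union> {(s, s'). s \<in> S \<and> s' \<in> T \<and> s' < s}) =
      card ((\<lambda>s. (s, a)) ` {s \<in> S. a < s}) + card {(s, s'). s \<in> S \<and> s' \<in> T \<and> s' < s}"
    by (rule card_Un_disjoint) (use assms finite_inversions[of S T] in auto)
  ultimately show ?thesis
    by (simp add: inversions_def card_image inj_on_def)
qed

lemma gmult_infinite: "infinite U \<Longrightarrow> gmult t U = 0"
  by (simp add: gmult_altdef)

lemma sum_Pow_remove:
  fixes F :: "nat set \<Rightarrow> 'c::comm_monoid_add"
  assumes "a \<in> U"
  shows "(\<Sum>S\<in>{S \<in> Pow U. a \<in> S}. F S) = (\<Sum>S\<in>Pow (U - {a}). F (insert a S))"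
  by (rule sum.reindex_bij_witness[of _ "insert a" "\<lambda>S. S - {a}"]) (use assms in \<open>auto simp: insert_absorb\<close>)

lemma gmult_gwedge: "gmult (gwedge a t) = gwedge a (gmult t)"
proof
  fix U
  show "gmult (gwedge a t) U = gwedge a (gmult t) U"
  proof (cases "finite U \<and> a \<in> U")
    case False
    then show ?thesis
      by (auto simp: gmult_infinite gwedge_altdef) (auto simp: gmult_altdef gwedge_altdef intro!: sum.neutral)
  next
    case True
    then have U: "finite U" "a \<in> U" by auto
    have "gmult (gwedge a t) U =
        (\<Sum>S\<in>{S \<in> Pow U. a \<in> S}. (-1) ^ inversions S (U - S) * gwedge a t S (U - S))"
      unfolding gmult_altdef by (rule sum.mono_neutral_right) (use U in \<open>auto simp: gwedge_altdef\<close>)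
    also have "\<dots> = (\<Sum>S\<in>Pow (U - {a}). (-1) ^ inversions (insert a S) (U - insert a S) * gwedge a t (insert a S) (U - insert a S))"
      by (rule sum_Pow_remove[OF U(2)])
    also have "\<dots> = (\<Sum>S\<in>Pow (U - {a}). (-1) ^ below a (U - {a}) *
        ((-1) ^ inversions S (U - {a} - S) * t S (U - {a} - S)))"
    proof (rule sum.cong)
      fix S assume S: "S \<in> Pow (U - {a})"
      then have fin: "finite S" "finite (U - {a} - S)" "a \<notin> S" using U by (auto intro: finite_subset)
      have "{s \<in> U - {a}. s < a} = {s \<in> U - {a} - S. s < a} \<union> {s \<in> S. s < a}" using S by auto
      then have "below a (U - {a}) = below a (U - {a} - S) + below a S"
        using fin by (simp add: below_def card_Un_disjoint disjoint_iff)
      moreover have "U - insert a S = U - {a} - S" "insert a S - {a} = S" using fin by auto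
      ultimately show "(-1) ^ inversions (insert a S) (U - insert a S) * gwedge a t (insert a S) (U - insert a S) =
        (-1) ^ below a (U - {a}) * ((-1) ^ inversions S (U - {a} - S) * t S (U - {a} - S))"
        using inversions_insert_left[OF fin] fin by (simp add: gwedge_altdef below_insert power_add mult_ac)
    qed simp
    also have "\<dots> = gwedge a (gmult t) U"
      using U below_remove[of a U a] by (simp add: gwedge_altdef gmult_altdef sum_distrib_left)
    finally show ?thesis .
  qed
qed

text \<open>To reach the front, a generator of the second slot passes the whole first slot; this sign is the
  parity operator.\<close>

lemma gmult_gwedge2: "gmult (gwedge2 a t) = gwedge a (gmult (gsign t))"
proof
  fix U
  show "gmult (gwedge2 a t) U = gwedge a (gmult (gsign t)) U"
  proof (cases "finite U \<and> a \<in> U")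
    case False
    then show ?thesis
      by (auto simp: gmult_infinite gwedge_altdef) (auto simp: gmult_altdef gwedge2_def gwedge_altdef intro!: sum.neutral)
  next
    case True
    then have U: "finite U" "a \<in> U" by auto
    have "gmult (gwedge2 a t) U =
        (\<Sum>S\<in>Pow (U - {a}). (-1) ^ inversions S (U - S) * gwedge a (t S) (U - S))"
      unfolding gmult_altdef gwedge2_def by (rule sum.mono_neutral_right) (use U in \<open>auto simp: gwedge_altdef\<close>)
    also have "\<dots> = (\<Sum>S\<in>Pow (U - {a}). (-1) ^ below a (U - {a}) *
        ((-1) ^ inversions S (U - {a} - S) * gsign t S (U - {a} - S)))"
    proof (rule sum.cong)
      fix S assume S: "S \<in> Pow (U - {a})"
      then have fin: "finite S" "finite (U - {a} - S)" "a \<notin> U - {a} - S" using U by (auto intro: finite_subset)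
      have "{s \<in> U - {a}. s < a} = {s \<in> U - {a} - S. s < a} \<union> {s \<in> S. s < a}" using S by auto
      then have 1: "below a (U - {a}) = below a (U - {a} - S) + below a S"
        using fin by (simp add: below_def card_Un_disjoint disjoint_iff)
      have "card S = card ({s \<in> S. a < s} \<union> {s \<in> S. s < a})"
        by (rule arg_cong[of _ _ card]) (use S in auto)
      also have "\<dots> = card {s \<in> S. a < s} + below a S"
        unfolding below_def by (rule card_Un_disjoint) (use fin in auto)
      finally have 2: "card S = card {s \<in> S. a < s} + below a S" .
      have 3: "U - S = insert a (U - {a} - S)" "insert a (U - {a} - S) - {a} = U - {a} - S" using U S by auto
      have "gwedge a (t S) (U - S) = (-1) ^ below a (U - {a} - S) * t S (U - {a} - S)"
        unfolding 3(1) gwedge_altdef using 3(2) below_insert[OF fin(3), of a] by simp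
      moreover have "inversions S (U - S) = card {s \<in> S. a < s} + inversions S (U - {a} - S)"
        unfolding 3(1) by (rule inversions_insert_right[OF fin])
      ultimately show "(-1) ^ inversions S (U - S) * gwedge a (t S) (U - S) =
        (-1) ^ below a (U - {a}) * ((-1) ^ inversions S (U - {a} - S) * gsign t S (U - {a} - S))"
        unfolding 1 by (simp add: gsign_def power_add 2 mult_ac)
    qed simp
    also have "\<dots> = gwedge a (gmult (gsign t)) U"
      using U below_remove[of a U a] by (simp add: gwedge_altdef gmult_altdef sum_distrib_left)
    finally show ?thesis .
  qed
qed

lemma gmult_gemb: "finite_support x \<Longrightarrow> gmult (gemb x) = x"
proof
  fix U assume x: "finite_support x"
  show "gmult (gemb x) U = x U"
  proof (cases "finite U")
    case True
    then have "gmult (gemb x) U = (\<Sum>S\<in>{{}}. (-1) ^ inversions S (U - S) * gemb x S (U - S))"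
      unfolding gmult_altdef by (intro sum.mono_neutral_right) (auto simp: gemb_def)
    then show ?thesis by (simp add: gemb_def inversions_def)
  qed (use x in \<open>simp add: gmult_infinite finite_support_def\<close>)
qed

lemma gmult_gemb2: "finite_support x \<Longrightarrow> gmult (gemb2 x) = x"
proof
  fix U assume x: "finite_support x"
  show "gmult (gemb2 x) U = x U"
  proof (cases "finite U")
    case True
    then have "gmult (gemb2 x) U = (\<Sum>S\<in>{U}. (-1) ^ inversions S (U - S) * gemb2 x S (U - S))"
      unfolding gmult_altdef by (intro sum.mono_neutral_right) (auto simp: gemb_def gemb2_def)
    then show ?thesis by (simp add: gemb_def gemb2_def inversions_def)
  qed (use x in \<open>simp add: gmult_infinite finite_support_def\<close>)
qed

lemma gmult_add: "gmult (t + t') = gmult t + gmult t'"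
  and gmult_minus: "gmult (- t) = - gmult t"
  and gmult_0 [simp]: "gmult 0 = 0"
  by (auto simp: gmult_altdef fun_eq_iff algebra_simps sum.distrib sum_negf)

lemma gmult_diff: "gmult (t - t') = gmult t - gmult t'"
  by (auto simp: gmult_altdef fun_eq_iff algebra_simps sum_subtractf)

definition smul2 :: "'c \<Rightarrow> (nat set \<Rightarrow> nat set \<Rightarrow> 'c) \<Rightarrow> nat set \<Rightarrow> nat set \<Rightarrow> 'c::comm_ring_1" where
  "smul2 k t = (\<lambda>S. smul k (t S))"

lemma gmult_smul2: "gmult (smul2 k t) = smul k (gmult t)"
  by (auto simp: gmult_altdef fun_eq_iff smul2_def smul_def sum_distrib_left mult_ac)

section \<open>Cubic elements of Clifford algebras\<close>

text \<open>The setting shared by multiplication with the BRST charge from the left and from the right: \<open>c\<close> and \<open>\<Lambda>\<close>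
  are the actions of dual odd generators, and \<open>g\<close> are multiples of the structure constants. Antisymmetry
  arguments yield \<open>x + x = 0\<close> and cyclic ones \<open>x + x + x = 0\<close>, whence the two conditions on torsion.\<close>

locale clifford = module scale
  for scale :: "'c::comm_ring_1 \<Rightarrow> 'v::ab_group_add \<Rightarrow> 'v" (infixr \<open>\<cdot>\<close> 75) +
  fixes l :: nat and c \<Lambda> :: "nat \<Rightarrow> 'v \<Rightarrow> 'v" and \<kappa> :: 'c and g :: "nat \<Rightarrow> nat \<Rightarrow> nat \<Rightarrow> 'c"
  assumes c_add: "c a (x + y) = c a x + c a y" and \<Lambda>_add: "\<Lambda> a (x + y) = \<Lambda> a x + \<Lambda> a y"
    and c_scale: "c a (k \<cdot> x) = k \<cdot> c a x" and \<Lambda>_scale: "\<Lambda> a (k \<cdot> x) = k \<cdot> \<Lambda> a x"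
    and c_c: "a < l \<Longrightarrow> b < l \<Longrightarrow> c a (c b x) = - c b (c a x)"
    and \<Lambda>_\<Lambda>: "a < l \<Longrightarrow> b < l \<Longrightarrow> \<Lambda> a (\<Lambda> b x) = - \<Lambda> b (\<Lambda> a x)"
    and \<Lambda>_c: "a < l \<Longrightarrow> b < l \<Longrightarrow> \<Lambda> a (c b x) = (if a = b then \<kappa> \<cdot> x else 0) - c b (\<Lambda> a x)"
    and antisym: "a < l \<Longrightarrow> b < l \<Longrightarrow> e < l \<Longrightarrow> g a b e = - g b a e"
    and jacobi: "a < l \<Longrightarrow> b < l \<Longrightarrow> d < l \<Longrightarrow> e < l \<Longrightarrow>
      (\<Sum>s<l. g a b s * g s d e) + (\<Sum>s<l. g b d s * g s a e) + (\<Sum>s<l. g d a s * g s b e) = 0"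
    and torsion2: "x + x = (0::'v) \<Longrightarrow> x = 0" and torsion3: "x + x + x = (0::'v) \<Longrightarrow> x = 0"
begin

lemma c_0 [simp]: "c a 0 = 0" and \<Lambda>_0 [simp]: "\<Lambda> a 0 = 0"
  using c_add[of a 0 0] \<Lambda>_add[of a 0 0] by simp_all

lemma c_minus: "c a (- x) = - c a x" and \<Lambda>_minus: "\<Lambda> a (- x) = - \<Lambda> a x"
  using c_add[of a x "- x"] \<Lambda>_add[of a x "- x"] by (simp_all add: eq_neg_iff_add_eq_0 add.commute)

lemma c_diff: "c a (x - y) = c a x - c a y" and \<Lambda>_diff: "\<Lambda> a (x - y) = \<Lambda> a x - \<Lambda> a y"
  using c_add[of a x "- y"] \<Lambda>_add[of a x "- y"] by (simp_all add: c_minus \<Lambda>_minus)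

lemma c_sum: "c a (\<Sum>i\<in>I. x i) = (\<Sum>i\<in>I. c a (x i))"
  and \<Lambda>_sum: "\<Lambda> a (\<Sum>i\<in>I. x i) = (\<Sum>i\<in>I. \<Lambda> a (x i))"
  by (rule sum_additive; simp add: c_add \<Lambda>_add)+

definition cubic :: "'v \<Rightarrow> 'v" where
  "cubic x = (\<Sum>a<l. \<Sum>b<l. \<Sum>e<l. g a b e \<cdot> c a (c b (\<Lambda> e x)))"

definition trace_part :: "'v \<Rightarrow> 'v" where
  "trace_part x = (\<Sum>a<l. (\<Sum>b<l. g a b b) \<cdot> c a x)"

definition quad :: "nat \<Rightarrow> 'v \<Rightarrow> 'v" where
  "quad e x = (\<Sum>a<l. \<Sum>b<l. g a b e \<cdot> c a (c b x))"

lemma cubic_linear: "cubic (x + y) = cubic x + cubic y" "cubic (k \<cdot> x) = k \<cdot> cubic x" "cubic 0 = 0"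
    "cubic (x - y) = cubic x - cubic y"
  by (simp_all add: cubic_def c_add \<Lambda>_add c_diff \<Lambda>_diff c_scale \<Lambda>_scale scale_right_distrib scale_right_diff_distrib
      sum.distrib sum_subtractf scale_sum_right mult.commute)

lemma trace_linear: "trace_part (x + y) = trace_part x + trace_part y" "trace_part (k \<cdot> x) = k \<cdot> trace_part x"
    "trace_part 0 = 0" "trace_part (x - y) = trace_part x - trace_part y"
  by (simp_all add: trace_part_def c_add c_diff c_scale scale_right_distrib scale_right_diff_distrib
      sum.distrib sum_subtractf scale_sum_right mult.commute)

lemma cubic_sum: "cubic (\<Sum>i\<in>I. x i) = (\<Sum>i\<in>I. cubic (x i))"
  and trace_sum: "trace_part (\<Sum>i\<in>I. x i) = (\<Sum>i\<in>I. trace_part (x i))"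
  by (rule sum_additive; simp add: cubic_linear trace_linear)+

lemma quad_c: "e < l \<Longrightarrow> d < l \<Longrightarrow> quad e (c d x) = c d (quad e x)"
  unfolding quad_def c_sum c_scale
  by (intro sum.cong refl) (simp add: c_c[of _ d] c_minus)

text \<open>Of the three factors only \<open>\<Lambda> d\<close> fails to anticommute with \<open>c d\<close>, and it leaves the quadratic element
  behind.\<close>

lemma cubic_c:
  assumes d: "d < l" shows "cubic (c d x) = \<kappa> \<cdot> quad d x - c d (cubic x)"
proof -
  have "c a (c b (\<Lambda> e (c d x))) = (if e = d then \<kappa> \<cdot> c a (c b x) else 0) - c d (c a (c b (\<Lambda> e x)))"
    if "a < l" "b < l" "e < l" for a b e
    using that d by (cases "e = d") (simp_all add: \<Lambda>_c c_diff c_add c_scale c_c[of _ d] c_minus)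
  then have "cubic (c d x) = (\<Sum>a<l. \<Sum>b<l. \<Sum>e<l. g a b e \<cdot>
      ((if e = d then \<kappa> \<cdot> c a (c b x) else 0) - c d (c a (c b (\<Lambda> e x)))))"
    unfolding cubic_def by (intro sum.cong refl) auto
  also have "\<dots> = (\<Sum>a<l. \<Sum>b<l. \<Sum>e<l. if e = d then \<kappa> \<cdot> g a b e \<cdot> c a (c b x) else 0) - c d (cubic x)"
    unfolding cubic_def c_sum c_scale sum_subtractf[symmetric]
    by (intro sum.cong refl) (simp add: scale_right_diff_distrib mult.commute)
  also have "(\<Sum>a<l. \<Sum>b<l. \<Sum>e<l. if e = d then \<kappa> \<cdot> g a b e \<cdot> c a (c b x) else 0) = \<kappa> \<cdot> quad d x"
    unfolding quad_def scale_sum_right using d by simp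
  finally show ?thesis .
qed

lemma trace_c:
  assumes d: "d < l" shows "trace_part (c d x) = - c d (trace_part x)"
  unfolding trace_part_def c_sum c_scale sum_negf[symmetric]
  by (intro sum.cong refl) (simp add: c_c[of _ d] assms)

text \<open>Three times the sum equals the sum with the cyclically averaged coefficients.\<close>

lemma cyclic_sum_zero:
  assumes cyc: "\<And>a b d. a < l \<Longrightarrow> b < l \<Longrightarrow> d < l \<Longrightarrow> w b d a = w a b d"
    and X: "\<And>a b d. a < l \<Longrightarrow> b < l \<Longrightarrow> d < l \<Longrightarrow> X a b d + X b d a + X d a b = (0::'c)"
  shows "(\<Sum>a<l. \<Sum>b<l. \<Sum>d<l. X a b d \<cdot> w a b d) = 0" (is "?Y = 0")
proof -
  have 1: "?Y = (\<Sum>a<l. \<Sum>b<l. \<Sum>d<l. X b d a \<cdot> w a b d)"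
  proof -
    have "?Y = (\<Sum>b<l. \<Sum>a<l. \<Sum>d<l. X b d a \<cdot> w b d a)"
      by (rule sum.cong[OF refl], rule sum.swap)
    also have "\<dots> = (\<Sum>a<l. \<Sum>b<l. \<Sum>d<l. X b d a \<cdot> w b d a)" by (rule sum.swap)
    also have "\<dots> = (\<Sum>a<l. \<Sum>b<l. \<Sum>d<l. X b d a \<cdot> w a b d)"
      by (intro sum.cong refl) (use cyc in auto)
    finally show ?thesis .
  qed
  have 2: "?Y = (\<Sum>a<l. \<Sum>b<l. \<Sum>d<l. X d a b \<cdot> w a b d)"
  proof -
    have "?Y = (\<Sum>a<l. \<Sum>d<l. \<Sum>b<l. X d a b \<cdot> w d a b)" by (rule sum.swap)
    also have "\<dots> = (\<Sum>a<l. \<Sum>b<l. \<Sum>d<l. X d a b \<cdot> w d a b)"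
      by (rule sum.cong[OF refl], rule sum.swap)
    also have "\<dots> = (\<Sum>a<l. \<Sum>b<l. \<Sum>d<l. X d a b \<cdot> w a b d)"
      by (intro sum.cong refl) (use cyc[symmetric] in auto)
    finally show ?thesis .
  qed
  have "?Y + ?Y + ?Y = (\<Sum>a<l. \<Sum>b<l. \<Sum>d<l. (X a b d + X b d a + X d a b) \<cdot> w a b d)"
    unfolding scale_left_distrib sum.distrib 1[symmetric] 2[symmetric] ..
  also have "\<dots> = 0" using X by simp
  finally show ?thesis by (rule torsion3)
qed

lemma sum_swap_neg_zero:
  fixes F :: "'i \<Rightarrow> 'i \<Rightarrow> 'v"
  assumes "\<And>i k. i \<in> I \<Longrightarrow> k \<in> I \<Longrightarrow> F i k = - F k i"
  shows "(\<Sum>i\<in>I. \<Sum>k\<in>I. F i k) = 0"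
proof (rule torsion2)
  have "(\<Sum>i\<in>I. \<Sum>k\<in>I. F i k) = (\<Sum>i\<in>I. \<Sum>k\<in>I. F k i)" by (rule sum.swap)
  also have "\<dots> = - (\<Sum>i\<in>I. \<Sum>k\<in>I. F i k)"
    unfolding sum_negf[symmetric] by (intro sum.cong refl assms)
  finally show "(\<Sum>i\<in>I. \<Sum>k\<in>I. F i k) + (\<Sum>i\<in>I. \<Sum>k\<in>I. F i k) = 0"
    by (simp only: eq_neg_iff_add_eq_0)
qed

lemma trace_trace: "trace_part (trace_part x) = 0"
proof -
  have "trace_part (trace_part x) =
      (\<Sum>a<l. \<Sum>d<l. ((\<Sum>b<l. g a b b) * (\<Sum>b<l. g d b b)) \<cdot> c a (c d x))"
    by (simp add: trace_part_def c_sum c_scale scale_sum_right)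
  also have "\<dots> = 0"
  proof (rule sum_swap_neg_zero)
    fix a d assume "a \<in> {..<l}" "d \<in> {..<l}"
    then have "c a (c d x) = - c d (c a x)" by (intro c_c) auto
    then show "((\<Sum>b<l. g a b b) * (\<Sum>b<l. g d b b)) \<cdot> c a (c d x) =
        - (((\<Sum>b<l. g d b b) * (\<Sum>b<l. g a b b)) \<cdot> c d (c a x))"
      by (simp add: mult.commute)
  qed
  finally show ?thesis .
qed

text \<open>The map \<open>x \<mapsto> tr (ad x)\<close> is a character, being the trace of a representation. Here this is the trace of
  the Jacobi identity over its last two indices.\<close>

lemma trace_character:
  assumes "a < l" "b < l"
  shows "(\<Sum>s<l. g a b s * (\<Sum>d<l. g s d d)) = 0"
proof -
  have "(\<Sum>s<l. g a b s * (\<Sum>d<l. g s d d)) = (\<Sum>d<l. \<Sum>s<l. g a b s * g s d d)"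
    by (subst sum.swap) (simp add: sum_distrib_left)
  also have "\<dots> = (\<Sum>d<l. - (\<Sum>s<l. g b d s * g s a d) - (\<Sum>s<l. g d a s * g s b d))"
    by (rule sum.cong) (use jacobi[OF assms] in \<open>auto simp: algebra_simps eq_neg_iff_add_eq_0\<close>)
  also have "\<dots> = - (\<Sum>d<l. \<Sum>s<l. g b d s * g s a d) - (\<Sum>d<l. \<Sum>s<l. g d a s * g s b d)"
    by (simp add: sum_subtractf sum_negf)
  also have "(\<Sum>d<l. \<Sum>s<l. g d a s * g s b d) = (\<Sum>d<l. \<Sum>s<l. g s a d * g d b s)"
    by (rule sum.swap)
  also have "\<dots> = - (\<Sum>d<l. \<Sum>s<l. g b d s * g s a d)"
    unfolding sum_negf[symmetric]
  proof (intro sum.cong refl)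
    fix d s assume "d \<in> {..<l}" "s \<in> {..<l}"
    then have "g d b s = - g b d s" using antisym[of d b s] assms by auto
    then show "g s a d * g d b s = - (g b d s * g s a d)" by (simp add: mult.commute)
  qed
  finally show ?thesis by simp
qed

text \<open>The anticommutator contracts the character \<open>tr \<circ> ad\<close> with the bracket, and a character vanishes on brackets.\<close>

lemma cubic_trace: "cubic (trace_part x) + trace_part (cubic x) = 0"
proof -
  have "cubic (trace_part x) + trace_part (cubic x) = \<kappa> \<cdot> (\<Sum>d<l. (\<Sum>b<l. g d b b) \<cdot> quad d x)"
    unfolding trace_part_def[of x] trace_part_def[of "cubic x"] cubic_sum cubic_linear sum.distrib[symmetric] scale_sum_right
    by (intro sum.cong refl) (simp add: cubic_c scale_right_diff_distrib mult.commute)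
  also have "(\<Sum>d<l. (\<Sum>b<l. g d b b) \<cdot> quad d x) =
      (\<Sum>d<l. \<Sum>a<l. \<Sum>b<l. ((\<Sum>s<l. g d s s) * g a b d) \<cdot> c a (c b x))"
    by (simp add: quad_def scale_sum_right)
  also have "\<dots> = (\<Sum>a<l. \<Sum>b<l. \<Sum>d<l. ((\<Sum>s<l. g d s s) * g a b d) \<cdot> c a (c b x))"
    by (subst sum.swap, rule sum.cong[OF refl], rule sum.swap)
  also have "\<dots> = (\<Sum>a<l. \<Sum>b<l. (\<Sum>d<l. g a b d * (\<Sum>s<l. g d s s)) \<cdot> c a (c b x))"
    by (simp add: scale_sum_left mult.commute)
  also have "\<dots> = 0" using trace_character by simp
  finally show ?thesis by simp
qed

text \<open>The summands change sign when the two index triples are exchanged: the pairs of \<open>c\<close> commute, the two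
  \<open>\<Lambda>\<close> anticommute.\<close>

lemma quad_cubic_swap: "(\<Sum>a<l. \<Sum>b<l. \<Sum>e<l. g a b e \<cdot> c a (c b (cubic (\<Lambda> e x)))) = 0"
proof -
  let ?I = "{..<l} \<times> {..<l} \<times> {..<l}"
  define F where "F = (\<lambda>(a, b, e) (a', b', e'). (g a b e * g a' b' e') \<cdot> c a (c b (c a' (c b' (\<Lambda> e' (\<Lambda> e x))))))"
  have "F i k = - F k i" if "i \<in> ?I" "k \<in> ?I" for i k
  proof -
    obtain a b e a' b' e' where ik: "i = (a, b, e)" "k = (a', b', e')" by (cases i, cases k) auto
    then have m: "a < l" "b < l" "e < l" "a' < l" "b' < l" "e' < l" using that by auto
    have "c a (c b (c a' (c b' y))) = c a' (c b' (c a (c b y)))" for y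
    proof -
      have "c a (c b (c a' (c b' y))) = c a' (c a (c b (c b' y)))"
        using m by (simp add: c_c[of b a'] c_c[of a a'] c_minus)
      also have "\<dots> = c a' (c b' (c a (c b y)))"
        using m by (simp add: c_c[of b b'] c_c[of a b'] c_minus)
      finally show ?thesis .
    qed
    moreover have "\<Lambda> e' (\<Lambda> e x) = - \<Lambda> e (\<Lambda> e' x)" using m \<Lambda>_\<Lambda> by blast
    ultimately show ?thesis unfolding ik F_def by (simp add: c_minus mult.commute)
  qed
  then have "(\<Sum>i\<in>?I. \<Sum>k\<in>?I. F i k) = 0" by (rule sum_swap_neg_zero)
  moreover have "(\<Sum>a<l. \<Sum>b<l. \<Sum>e<l. g a b e \<cdot> c a (c b (cubic (\<Lambda> e x)))) = (\<Sum>i\<in>?I. \<Sum>k\<in>?I. F i k)"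
    by (simp add: cubic_def c_sum c_scale scale_sum_right F_def sum.cartesian_product')
  ultimately show ?thesis by simp
qed

text \<open>Moving the outer cubic element through \<open>c a\<close> and \<open>c b\<close> leaves terms with one contraction and a term with
  none. The latter vanishes by symmetry. In the former the product of three \<open>c\<close> is cyclically symmetric,
  so that only the cyclic sum of \<open>g g\<close> counts, which is zero by the Jacobi identity.\<close>

lemma cubic_cubic: "cubic (cubic x) = 0"
proof -
  have "cubic (cubic x) = (\<Sum>a<l. \<Sum>b<l. \<Sum>e<l. g a b e \<cdot> cubic (c a (c b (\<Lambda> e x))))"
    unfolding cubic_def[of x] cubic_sum cubic_linear ..
  also have "\<dots> = (\<Sum>a<l. \<Sum>b<l. \<Sum>e<l. g a b e \<cdot> \<kappa> \<cdot> (quad a (c b (\<Lambda> e x)) - quad b (c a (\<Lambda> e x))))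
      + (\<Sum>a<l. \<Sum>b<l. \<Sum>e<l. g a b e \<cdot> c a (c b (cubic (\<Lambda> e x))))"
    unfolding sum.distrib[symmetric]
    by (intro sum.cong refl)
      (simp add: cubic_c c_diff c_scale quad_c scale_right_diff_distrib scale_right_distrib algebra_simps)
  also have "(\<Sum>a<l. \<Sum>b<l. \<Sum>e<l. g a b e \<cdot> \<kappa> \<cdot> (quad a (c b (\<Lambda> e x)) - quad b (c a (\<Lambda> e x)))) =
      \<kappa> \<cdot> ((\<Sum>a<l. \<Sum>b<l. \<Sum>e<l. g a b e \<cdot> quad a (c b (\<Lambda> e x)))
        + (\<Sum>a<l. \<Sum>b<l. \<Sum>e<l. g a b e \<cdot> quad a (c b (\<Lambda> e x))))"
  proof -
    have "(\<Sum>a<l. \<Sum>b<l. \<Sum>e<l. g a b e \<cdot> quad b (c a (\<Lambda> e x))) =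
      (\<Sum>a<l. \<Sum>b<l. \<Sum>e<l. g b a e \<cdot> quad a (c b (\<Lambda> e x)))" by (rule sum.swap)
    also have "\<dots> = - (\<Sum>a<l. \<Sum>b<l. \<Sum>e<l. g a b e \<cdot> quad a (c b (\<Lambda> e x)))"
      unfolding sum_negf[symmetric]
    proof (intro sum.cong refl)
      fix a b e assume "a \<in> {..<l}" "b \<in> {..<l}" "e \<in> {..<l}"
      then have "g b a e = - g a b e" by (intro antisym) auto
      then show "g b a e \<cdot> quad a (c b (\<Lambda> e x)) = - (g a b e \<cdot> quad a (c b (\<Lambda> e x)))" by simp
    qed
    finally have *: "(\<Sum>a<l. \<Sum>b<l. \<Sum>e<l. g a b e \<cdot> quad b (c a (\<Lambda> e x))) =
      - (\<Sum>a<l. \<Sum>b<l. \<Sum>e<l. g a b e \<cdot> quad a (c b (\<Lambda> e x)))" .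
    have "(\<Sum>a<l. \<Sum>b<l. \<Sum>e<l. g a b e \<cdot> \<kappa> \<cdot> (quad a (c b (\<Lambda> e x)) - quad b (c a (\<Lambda> e x)))) =
      \<kappa> \<cdot> ((\<Sum>a<l. \<Sum>b<l. \<Sum>e<l. g a b e \<cdot> quad a (c b (\<Lambda> e x)))
        - (\<Sum>a<l. \<Sum>b<l. \<Sum>e<l. g a b e \<cdot> quad b (c a (\<Lambda> e x))))"
      by (simp add: scale_sum_right scale_right_diff_distrib sum_subtractf mult.commute)
    then show ?thesis unfolding * by simp
  qed
  also have "(\<Sum>a<l. \<Sum>b<l. \<Sum>e<l. g a b e \<cdot> quad a (c b (\<Lambda> e x))) = 0"
  proof -
    have "(\<Sum>a<l. \<Sum>b<l. \<Sum>e<l. g a b e \<cdot> quad a (c b (\<Lambda> e x))) =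
      (\<Sum>e<l. \<Sum>a'<l. \<Sum>b'<l. \<Sum>b<l. (\<Sum>a<l. g a' b' a * g a b e) \<cdot> c a' (c b' (c b (\<Lambda> e x))))"
    proof -
      have "(\<Sum>a<l. \<Sum>b<l. \<Sum>e<l. g a b e \<cdot> quad a (c b (\<Lambda> e x))) =
        (\<Sum>a<l. \<Sum>b<l. \<Sum>e<l. \<Sum>a'<l. \<Sum>b'<l. (g a' b' a * g a b e) \<cdot> c a' (c b' (c b (\<Lambda> e x))))"
        by (simp add: quad_def scale_sum_right mult.commute)
      also have "\<dots> = (\<Sum>(a, b, e, a', b')\<in>{..<l} \<times> {..<l} \<times> {..<l} \<times> {..<l} \<times> {..<l}.
          (g a' b' a * g a b e) \<cdot> c a' (c b' (c b (\<Lambda> e x))))"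
        by (simp add: sum.cartesian_product)
      also have "\<dots> = (\<Sum>(e, a', b', b, a)\<in>{..<l} \<times> {..<l} \<times> {..<l} \<times> {..<l} \<times> {..<l}.
          (g a' b' a * g a b e) \<cdot> c a' (c b' (c b (\<Lambda> e x))))"
        by (rule sum.reindex_bij_witness[of _ "\<lambda>(e, a', b', b, a). (a, b, e, a', b')" "\<lambda>(a, b, e, a', b'). (e, a', b', b, a)"]) auto
      also have "\<dots> = (\<Sum>e<l. \<Sum>a'<l. \<Sum>b'<l. \<Sum>b<l. (\<Sum>a<l. g a' b' a * g a b e) \<cdot> c a' (c b' (c b (\<Lambda> e x))))"
        by (simp add: sum.cartesian_product scale_sum_left)
      finally show ?thesis .
    qed
    also have "\<dots> = 0"
    proof (rule sum.neutral, rule ballI)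
      fix e assume e: "e \<in> {..<l}"
      show "(\<Sum>a'<l. \<Sum>b'<l. \<Sum>b<l. (\<Sum>a<l. g a' b' a * g a b e) \<cdot> c a' (c b' (c b (\<Lambda> e x)))) = 0"
      proof (rule cyclic_sum_zero)
        fix a b d assume m: "a < l" "b < l" "d < l"
        then show "c b (c d (c a (\<Lambda> e x))) = c a (c b (c d (\<Lambda> e x)))"
          by (simp add: c_c[of d a] c_c[of b a] c_minus)
        show "(\<Sum>s<l. g a b s * g s d e) + (\<Sum>s<l. g b d s * g s a e) + (\<Sum>s<l. g d a s * g s b e) = 0"
          using jacobi m e by auto
      qed
    qed
    finally show ?thesis .
  qed
  finally show ?thesis unfolding quad_cubic_swap by simp
qed

text \<open>The trace is the correction for the ordering of the cubic term: the symmetric ordering lies half-way between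
  the two extreme ones (\<open>cubic_reordered\<close>). As \<open>tr \<circ> ad\<close> is a character, it does not spoil the square.\<close>

definition charge :: "'v \<Rightarrow> 'v" where
  "charge x = cubic x - \<kappa> \<cdot> trace_part x"

lemma charge_charge: "charge (charge x) = 0"
proof -
  have "charge (charge x) = cubic (cubic x) - \<kappa> \<cdot> (cubic (trace_part x) + trace_part (cubic x))
      + \<kappa> \<cdot> \<kappa> \<cdot> trace_part (trace_part x)"
    by (simp add: charge_def cubic_linear trace_linear scale_right_diff_distrib scale_right_distrib algebra_simps)
  then show ?thesis by (simp add: cubic_cubic cubic_trace trace_trace)
qed

lemma charge_c: "d < l \<Longrightarrow> charge (c d x) = \<kappa> \<cdot> quad d x - c d (charge x)"
  by (simp add: charge_def cubic_c trace_c c_diff c_scale)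

lemma charge_add: "charge (x + y) = charge x + charge y"
  by (simp add: charge_def cubic_linear trace_linear scale_right_distrib)

lemma charge_sum: "charge (\<Sum>i\<in>I. x i) = (\<Sum>i\<in>I. charge (x i))"
  by (rule sum_additive) (simp_all add: charge_add, simp add: charge_def cubic_linear trace_linear)

text \<open>This is the ordering that right multiplication by the BRST charge produces. The contractions of \<open>\<Lambda> e\<close>
  with \<open>c a\<close> and with \<open>c b\<close> contribute one trace each.\<close>

lemma cubic_reordered:
  "(\<Sum>a<l. \<Sum>b<l. \<Sum>e<l. g a b e \<cdot> \<Lambda> e (c a (c b x))) = cubic x - \<kappa> \<cdot> trace_part x - \<kappa> \<cdot> trace_part x"
proof -
  have eq: "g a b e \<cdot> \<Lambda> e (c a (c b x)) =
      g a b e \<cdot> c a (c b (\<Lambda> e x)) + (if e = a then \<kappa> \<cdot> g a b a \<cdot> c b x else 0) - (if e = b then \<kappa> \<cdot> g a b b \<cdot> c a x else 0)"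
    if "a < l" "b < l" "e < l" for a b e
    using that by (auto simp: \<Lambda>_c c_diff c_scale c_minus scale_right_diff_distrib scale_right_distrib mult.commute)
  have "(\<Sum>a<l. \<Sum>b<l. \<Sum>e<l. g a b e \<cdot> \<Lambda> e (c a (c b x))) =
    (\<Sum>a<l. \<Sum>b<l. \<Sum>e<l. g a b e \<cdot> c a (c b (\<Lambda> e x)) + (if e = a then \<kappa> \<cdot> g a b a \<cdot> c b x else 0)
       - (if e = b then \<kappa> \<cdot> g a b b \<cdot> c a x else 0))"
    by (intro sum.cong refl) (use eq in auto)
  also have "\<dots> = cubic x + (\<Sum>a<l. \<Sum>b<l. \<kappa> \<cdot> g a b a \<cdot> c b x) - (\<Sum>a<l. \<Sum>b<l. \<kappa> \<cdot> g a b b \<cdot> c a x)"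
    by (simp add: cubic_def sum.distrib sum_subtractf)
  also have "(\<Sum>a<l. \<Sum>b<l. \<kappa> \<cdot> g a b b \<cdot> c a x) = \<kappa> \<cdot> trace_part x"
    by (simp add: trace_part_def scale_sum_left scale_sum_right)
  also have "(\<Sum>a<l. \<Sum>b<l. \<kappa> \<cdot> g a b a \<cdot> c b x) = (\<Sum>b<l. \<Sum>a<l. \<kappa> \<cdot> g a b a \<cdot> c b x)" by (rule sum.swap)
  also have "\<dots> = (\<Sum>b<l. \<Sum>a<l. - (\<kappa> \<cdot> g b a a \<cdot> c b x))"
  proof (intro sum.cong refl)
    fix a b assume "a \<in> {..<l}" "b \<in> {..<l}"
    then have "g a b a = - g b a a" by (intro antisym) auto
    then show "\<kappa> \<cdot> g a b a \<cdot> c b x = - (\<kappa> \<cdot> g b a a \<cdot> c b x)" by simp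
  qed
  also have "\<dots> = - (\<kappa> \<cdot> trace_part x)"
    by (simp add: trace_part_def scale_sum_left scale_sum_right sum_negf)
  finally show ?thesis by simp
qed

text \<open>The square of the cubic part vanishes by itself. Its anticommutator with \<open>\<Sum> c\<^sub>a G\<^sub>a\<close> is quadratic in \<open>c\<close>, and
  this is compensated by the commutators of the \<open>G\<^sub>a\<close>, as in the classical Koszul-BRST differential.\<close>

lemma moment_charge_square:
  assumes G_charge: "\<And>a. a < l \<Longrightarrow> G a (charge x) = charge (G a x)"
    and G_sum: "\<And>a. a < l \<Longrightarrow> G a (charge x + (\<Sum>b<l. c b (G b x))) = G a (charge x) + (\<Sum>b<l. c b (G a (G b x)))"
    and G_G: "\<And>a b. a < l \<Longrightarrow> b < l \<Longrightarrow>
      G a (G b x) - G b (G a x) = - (\<kappa> \<cdot> (\<Sum>e<l. g a b e \<cdot> G e x) + \<kappa> \<cdot> (\<Sum>e<l. g a b e \<cdot> G e x))"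
  shows "charge (charge x + (\<Sum>a<l. c a (G a x))) + (\<Sum>a<l. c a (G a (charge x + (\<Sum>a<l. c a (G a x))))) = 0"
proof -
  have 1: "charge (charge x + (\<Sum>a<l. c a (G a x))) = (\<Sum>a<l. \<kappa> \<cdot> quad a (G a x)) - (\<Sum>a<l. c a (charge (G a x)))"
    by (simp add: charge_add charge_charge charge_sum charge_c sum_subtractf)
  have 2: "(\<Sum>a<l. c a (G a (charge x + (\<Sum>a<l. c a (G a x))))) =
      (\<Sum>a<l. c a (charge (G a x))) + (\<Sum>a<l. \<Sum>b<l. c a (c b (G a (G b x))))"
    by (simp add: G_sum G_charge c_add c_sum sum.distrib)
  have 3: "(\<Sum>a<l. \<kappa> \<cdot> quad a (G a x)) + (\<Sum>a<l. \<Sum>b<l. c a (c b (G a (G b x)))) = 0" (is "?A + ?B = 0")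
  proof (rule torsion2)
    have "?B = (\<Sum>a<l. \<Sum>b<l. c b (c a (G b (G a x))))" by (rule sum.swap)
    also have "\<dots> = - (\<Sum>a<l. \<Sum>b<l. c a (c b (G b (G a x))))"
      unfolding sum_negf[symmetric] by (intro sum.cong refl) (auto intro: c_c)
    finally have "?B + ?B = (\<Sum>a<l. \<Sum>b<l. c a (c b (G a (G b x) - G b (G a x))))"
      by (simp add: c_diff sum_subtractf)
    also have "\<dots> = - ((\<Sum>a<l. \<Sum>b<l. \<Sum>e<l. \<kappa> \<cdot> g a b e \<cdot> c a (c b (G e x))) +
        (\<Sum>a<l. \<Sum>b<l. \<Sum>e<l. \<kappa> \<cdot> g a b e \<cdot> c a (c b (G e x))))"
      by (simp add: G_G c_minus c_add c_diff c_scale c_sum sum_negf sum.distrib sum_subtractf scale_sum_right)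
    also have "(\<Sum>a<l. \<Sum>b<l. \<Sum>e<l. \<kappa> \<cdot> g a b e \<cdot> c a (c b (G e x))) = ?A"
    proof -
      have "(\<Sum>a<l. \<Sum>b<l. \<Sum>e<l. \<kappa> \<cdot> g a b e \<cdot> c a (c b (G e x))) =
         (\<Sum>a<l. \<Sum>e<l. \<Sum>b<l. \<kappa> \<cdot> g a b e \<cdot> c a (c b (G e x)))"
        by (rule sum.cong[OF refl], rule sum.swap)
      also have "\<dots> = (\<Sum>e<l. \<Sum>a<l. \<Sum>b<l. \<kappa> \<cdot> g a b e \<cdot> c a (c b (G e x)))" by (rule sum.swap)
      finally show ?thesis by (simp add: quad_def scale_sum_right)
    qed
    finally show "?A + ?B + (?A + ?B) = 0" by (simp add: algebra_simps)
  qed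
  show ?thesis unfolding 1 2 using 3 by (simp add: add.assoc[symmetric])
qed

lemma charge_scale: "charge (k \<cdot> x) = k \<cdot> charge x"
  by (simp add: charge_def cubic_linear trace_linear scale_right_diff_distrib mult.commute)

text \<open>The charge is an odd polynomial in the generators.\<close>

lemma charge_anticommute:
  assumes T_add: "\<And>x y. T (x + y) = T x + T y" and T_scale: "\<And>k x. T (k \<cdot> x) = k \<cdot> T x"
    and T_c: "\<And>a x. a < l \<Longrightarrow> T (c a x) = - c a (T x)" and T_\<Lambda>: "\<And>a x. a < l \<Longrightarrow> T (\<Lambda> a x) = - \<Lambda> a (T x)"
  shows "T (charge x) = - charge (T x)"
proof -
  have T_0: "T 0 = 0" using T_add[of 0 0] by simp
  have T_minus: "T (- x) = - T x" for x
    using T_add[of x "- x"] by (simp add: T_0 eq_neg_iff_add_eq_0 add.commute)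
  have T_diff: "T (x - y) = T x - T y" for x y
    using T_add[of x "- y"] by (simp add: T_minus)
  have T_sum: "T (\<Sum>i\<in>I. y i) = (\<Sum>i\<in>I. T (y i))" for I :: "nat set" and y
    by (rule sum_additive[of T]) (auto simp: T_0 T_add)
  have "T (cubic x) = - cubic (T x)"
    unfolding cubic_def T_sum T_scale sum_negf[symmetric]
    by (intro sum.cong refl) (simp add: T_c T_\<Lambda> T_minus c_minus)
  moreover have "T (trace_part x) = - trace_part (T x)"
    unfolding trace_part_def T_sum T_scale sum_negf[symmetric]
    by (intro sum.cong refl) (simp add: T_c)
  ultimately show ?thesis by (simp add: charge_def T_diff T_scale)
qed

end

section \<open>Formal series of continuous operators\<close>

definition slice :: "(nat set \<Rightarrow> 'a::zero fps) \<Rightarrow> nat \<Rightarrow> nat set \<Rightarrow> 'a" where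
  "slice x m = (\<lambda>S. fps_nth (x S) m)"

lemma slice_apply: "slice x m S = fps_nth (x S) m"
  by (simp add: slice_def)

lemma slice_add: "slice (x + y) m = slice x m + slice y m"
  and slice_diff: "slice (x' - y') m = slice x' m - slice y' m"
  by (auto simp: slice_def fun_eq_iff)

lemma slice_eqI: "(\<And>m. slice x m = slice y m) \<Longrightarrow> x = y"
  by (rule ext, rule fps_ext) (metis slice_apply)

lemma sum_apply: "(\<Sum>i\<in>I. F i) S = (\<Sum>i\<in>I. F i S)"
  by (induction I rule: infinite_finite_induct) auto

lemma sum_triangle_swap:
  fixes F :: "nat \<Rightarrow> nat \<Rightarrow> 'c::comm_monoid_add"
  shows "(\<Sum>i\<le>n. \<Sum>q\<le>n - i. F i q) = (\<Sum>q\<le>n. \<Sum>i\<le>n - q. F i q)"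
  unfolding sum.Sigma[OF finite_atMost ballI[OF finite_atMost]]
  by (rule sum.reindex_bij_witness[of _ "\<lambda>(q, i). (i, q)" "\<lambda>(i, q). (q, i)"]) auto

lemma sum_triangle:
  fixes F :: "nat \<Rightarrow> nat \<Rightarrow> 'c::comm_monoid_add"
  shows "(\<Sum>i\<le>n. \<Sum>q\<le>n - i. F i q) = (\<Sum>m\<le>n. \<Sum>i\<le>m. F i (m - i))"
  unfolding sum.Sigma[OF finite_atMost ballI[OF finite_atMost]]
  by (rule sum.reindex_bij_witness[of _ "\<lambda>(m, i). (i, m - i)" "\<lambda>(i, q). (i + q, i)"]) auto

lemma topspace_gtop: "topspace (gtop X I) = gelems (topspace X) I"
  by (auto simp: gtop_def gelems_def)

lemma continuous_map_gtop_iff: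
  "continuous_map W (gtop Y K) T \<longleftrightarrow>
    (\<forall>S. continuous_map W Y (\<lambda>x. T x S)) \<and> (\<forall>x\<in>topspace W. \<forall>S. S \<notin> K \<longrightarrow> T x S = 0)"
  unfolding gtop_def continuous_map_in_subtopology continuous_map_componentwise_UNIV
  by (auto simp: image_subset_iff)

lemma continuous_map_gtop_component: "continuous_map (gtop X I) X (\<lambda>x. x S)"
  using continuous_map_gtop_iff[of "gtop X I" X I "\<lambda>x. x"] continuous_map_id[of "gtop X I"]
  by (simp add: id_def)

locale function_space =
  fixes n :: nat and A :: "'m::{t2_space, second_countable_topology} chart set" and l :: nat
  assumes atlas: "smooth_atlas n A"
begin

abbreviation CT :: "('m \<Rightarrow> 'k::real_normed_field) topology" where "CT \<equiv> Cinf_top n A"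
abbreviation AM :: "nat set set" where "AM \<equiv> all_monomials l"

lemmas topspace_CT [simp] = topspace_Cinf_top[OF atlas]
lemmas C_0 [simp] = Cinf_0[OF atlas]
lemmas C_1 [simp] = Cinf_1[OF atlas]
lemmas C_add = Cinf_add[OF atlas]
lemmas C_fscale = Cinf_fscale[OF atlas]
lemmas C_mult = Cinf_mult[OF atlas]

lemma C_uminus: "f \<in> Cinf n A \<Longrightarrow> - f \<in> Cinf n A" for f :: "'m \<Rightarrow> 'k::real_normed_field"
  using C_fscale[of f "-1"] by (simp add: fscale_def fun_Compl_def)

lemma C_diff: "f \<in> Cinf n A \<Longrightarrow> g \<in> Cinf n A \<Longrightarrow> f - g \<in> Cinf n A" for f :: "'m \<Rightarrow> 'k::real_normed_field"
  using C_add[of f "- g"] C_uminus[of g] by simp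

lemma C_sum:
  fixes F :: "'i \<Rightarrow> 'm \<Rightarrow> 'k::real_normed_field"
  shows "(\<And>i. i \<in> I \<Longrightarrow> F i \<in> Cinf n A) \<Longrightarrow> (\<Sum>i\<in>I. F i) \<in> Cinf n A"
proof (induction I rule: infinite_finite_induct)
  case (insert x F')
  then have "F x \<in> Cinf n A" "(\<Sum>i\<in>F'. F i) \<in> Cinf n A" by auto
  then show ?case by (simp only: sum.insert[OF insert(1,2)] C_add)
qed (simp_all only: sum.infinite sum.empty C_0 not_False_eq_True)

text \<open>The codomain is always the full algebra over the smooth functions, so that such maps can be composed,
  while the domain is left open: it is the same algebra or that of cochains on \<open>Z\<close>.\<close>

definition cont_op :: "('m \<Rightarrow> 'k) topology \<Rightarrow> nat set set \<Rightarrow> ((nat set \<Rightarrow> 'm \<Rightarrow> 'k) \<Rightarrow> nat set \<Rightarrow> 'm \<Rightarrow> 'k::real_normed_field) \<Rightarrow> bool" where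
  "cont_op X I T \<longleftrightarrow> linear_map_on gscale gscale (gelems (topspace X) I) (gelems (Cinf n A) AM) T \<and>
     continuous_map (gtop X I) (gtop CT AM) T"

lemma cont_opI:
  assumes "\<And>x S. x \<in> gelems (topspace X) I \<Longrightarrow> S \<notin> AM \<Longrightarrow> T x S = 0"
    and "\<And>S. continuous_map (gtop X I) CT (\<lambda>x. T x S)"
    and "\<And>x y S. x \<in> gelems (topspace X) I \<Longrightarrow> y \<in> gelems (topspace X) I \<Longrightarrow> T (x + y) S = T x S + T y S"
    and "\<And>r x S. x \<in> gelems (topspace X) I \<Longrightarrow> T (gscale r x) S = fscale r (T x S)"
  shows "cont_op X I T"
  unfolding cont_op_def linear_map_on_def
proof (intro conjI ballI allI)
  show cont: "continuous_map (gtop X I) (gtop CT AM) T"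
    unfolding continuous_map_gtop_iff topspace_gtop using assms by blast
  then show "T x \<in> gelems (Cinf n A) AM" if "x \<in> gelems (topspace X) I" for x
    using continuous_map_image_subset_topspace[OF cont] that by (auto simp: topspace_gtop)
qed (use assms in \<open>auto simp: fun_eq_iff gscale_def\<close>)

lemma cont_opD:
  assumes "cont_op X I T"
  shows "x \<in> gelems (topspace X) I \<Longrightarrow> S \<notin> AM \<Longrightarrow> T x S = 0"
    and "continuous_map (gtop X I) CT (\<lambda>x. T x S)"
    and "x \<in> gelems (topspace X) I \<Longrightarrow> y \<in> gelems (topspace X) I \<Longrightarrow> T (x + y) = T x + T y"
    and "x \<in> gelems (topspace X) I \<Longrightarrow> T (gscale r x) = gscale r (T x)"
    and "x \<in> gelems (topspace X) I \<Longrightarrow> T x \<in> gelems (Cinf n A) AM"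
proof -
  show "continuous_map (gtop X I) CT (\<lambda>x. T x S)"
    using assms unfolding cont_op_def continuous_map_gtop_iff by blast
  show "x \<in> gelems (topspace X) I \<Longrightarrow> S \<notin> AM \<Longrightarrow> T x S = 0"
    using assms unfolding cont_op_def linear_map_on_def gelems_def by blast
qed (use assms in \<open>unfold cont_op_def linear_map_on_def, blast+\<close>)

lemma fscale_simps: "fscale r (f + g) = fscale r f + fscale r g" "fscale r (- f) = - fscale r f"
   "fscale r (0::'m \<Rightarrow> 'k) = 0" "fscale 1 f = (f :: 'm \<Rightarrow> 'k::real_normed_field)"
   "fscale r (fscale q f) = fscale q (fscale r f)" "fscale (-1) f = - f" "fscale r (f - g) = fscale r f - fscale r g"
  by (auto simp: fscale_def fun_eq_iff algebra_simps)

lemma gscale_simps: "gscale r (x + y) = gscale r x + gscale r y" "gscale r (- x) = - gscale r x"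
   "gscale r (0 :: nat set \<Rightarrow> 'm \<Rightarrow> 'k) = 0" "gscale (-1) x = - (x :: nat set \<Rightarrow> 'm \<Rightarrow> 'k::real_normed_field)"
  by (auto simp: gscale_def fscale_def fun_eq_iff algebra_simps)

lemma fscale_sum: "fscale r (\<Sum>i\<in>I. F i) = (\<Sum>i\<in>I. fscale r (F i))" for F :: "'i \<Rightarrow> 'm \<Rightarrow> 'k::real_normed_field"
  by (rule sum_additive[of "fscale r"]) (simp_all only: fscale_simps)

lemma gscale_sum: "gscale r (\<Sum>i\<in>I. F i) = (\<Sum>i\<in>I. gscale r (F i))" for F :: "'i \<Rightarrow> nat set \<Rightarrow> 'm \<Rightarrow> 'k::real_normed_field"
  by (rule sum_additive[of "gscale r"]) (simp_all only: gscale_simps)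

lemma cont_op_zero: "cont_op X I (\<lambda>_. 0)"
  by (rule cont_opI) (auto simp: fscale_simps)

lemma cont_op_add:
  assumes T: "cont_op X I T" and T': "cont_op X I T'"
  shows "cont_op X I (\<lambda>x. T x + T' x)"
proof (rule cont_opI)
  show "continuous_map (gtop X I) CT (\<lambda>x. (T x + T' x) S)" for S
    using continuous_map_Cinf_add[OF atlas cont_opD(2)[OF T, of S] cont_opD(2)[OF T', of S]] by simp
  show "(T (gscale r x) + T' (gscale r x)) S = fscale r ((T x + T' x) S)"
    if "x \<in> gelems (topspace X) I" for r x S
    unfolding cont_opD(4)[OF T that] cont_opD(4)[OF T' that] by (simp only: plus_fun_apply gscale_def fscale_simps)
  show "(T x + T' x) S = 0" if "x \<in> gelems (topspace X) I" "S \<notin> AM" for x S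
    using cont_opD(1)[OF T that] cont_opD(1)[OF T' that] by (simp only: plus_fun_apply add_0)
qed (simp only: cont_opD(3)[OF T] cont_opD(3)[OF T'] plus_fun_apply ac_simps)

lemma continuous_map_fscale:
  fixes T :: "'x \<Rightarrow> 'm \<Rightarrow> 'k::real_normed_field"
  shows "continuous_map X CT T \<Longrightarrow> continuous_map X CT (\<lambda>x. fscale r (T x))"
  using continuous_map_compose[OF _ continuous_map_Cinf_fscale[OF atlas, of r], of X T] by (simp add: o_def)

lemma cont_op_scale:
  assumes T: "cont_op X I T"
  shows "cont_op X I (\<lambda>x. gscale r (T x))"
proof (rule cont_opI)
  show "continuous_map (gtop X I) CT (\<lambda>x. gscale r (T x) S)" for S
    unfolding gscale_def by (rule continuous_map_fscale[OF cont_opD(2)[OF T]])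
  show "gscale r (T (gscale q x)) S = fscale q (gscale r (T x) S)" if "x \<in> gelems (topspace X) I" for q x S
    unfolding cont_opD(4)[OF T that] by (simp only: gscale_def fscale_simps(5)[of r q])
  show "gscale r (T x) S = 0" if "x \<in> gelems (topspace X) I" "S \<notin> AM" for x S
    using cont_opD(1)[OF T that] by (simp only: gscale_def fscale_simps)
qed (simp only: cont_opD(3)[OF T] plus_fun_apply gscale_def fscale_simps)

lemma cont_op_uminus: "cont_op X I T \<Longrightarrow> cont_op X I (\<lambda>x. - T x)"
  using cont_op_scale[of X I T "-1"] by (simp add: gscale_simps)

lemma cont_op_sum: "(\<And>i. i \<in> J \<Longrightarrow> cont_op X I (T i)) \<Longrightarrow> cont_op X I (\<lambda>x. \<Sum>i\<in>J. T i x)"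
proof (induction J rule: infinite_finite_induct)
  case (insert i J)
  then have "cont_op X I (\<lambda>x. T i x + (\<Sum>i\<in>J. T i x))" by (intro cont_op_add) auto
  then show ?case using insert by (simp only: sum.insert not_False_eq_True)
qed (simp_all only: sum.infinite sum.empty cont_op_zero not_False_eq_True)

lemma cont_op_comp: "cont_op X I T \<Longrightarrow> cont_op CT AM T' \<Longrightarrow> cont_op X I (\<lambda>x. T' (T x))"
  unfolding cont_op_def linear_map_on_def
  using continuous_map_compose[of "gtop X I" "gtop CT AM" T "gtop CT AM" T'] by (auto simp: o_def)

lemma cont_op_id: "cont_op CT AM (\<lambda>x. x)"
  by (rule cont_opI) (auto simp: gelems_def gscale_def continuous_map_gtop_component)

lemma gelems_C:
  fixes x y :: "nat set \<Rightarrow> 'm \<Rightarrow> 'k::real_normed_field"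
  shows "x \<in> gelems (Cinf n A) I \<Longrightarrow> y \<in> gelems (Cinf n A) I \<Longrightarrow> x + y \<in> gelems (Cinf n A) I"
    "x \<in> gelems (Cinf n A) I \<Longrightarrow> y \<in> gelems (Cinf n A) I \<Longrightarrow> x - y \<in> gelems (Cinf n A) I"
    "x \<in> gelems (Cinf n A) I \<Longrightarrow> - x \<in> gelems (Cinf n A) I"
    "x \<in> gelems (Cinf n A) I \<Longrightarrow> gscale r x \<in> gelems (Cinf n A) I" "0 \<in> gelems (Cinf n A :: ('m \<Rightarrow> 'k) set) I"
  by (auto simp: gelems_def gscale_def fscale_simps C_add C_diff C_fscale C_uminus)

text \<open>The coefficients are carried along because those of composites and inverses are computed from them.\<close>

definition expansion :: "('m \<Rightarrow> 'k) topology \<Rightarrow> nat set set \<Rightarrow> (nat \<Rightarrow> (nat set \<Rightarrow> 'm \<Rightarrow> 'k) \<Rightarrow> nat set \<Rightarrow> 'm \<Rightarrow> 'k) \<Rightarrow>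
   ((nat set \<Rightarrow> ('m \<Rightarrow> 'k) fps) \<Rightarrow> nat set \<Rightarrow> ('m \<Rightarrow> 'k::real_normed_field) fps) \<Rightarrow> bool" where
  "expansion X I Ts T \<longleftrightarrow> (\<forall>i. cont_op X I (Ts i)) \<and>
     (\<forall>x\<in>gelems (series_in (topspace X)) I. \<forall>m. slice (T x) m = (\<Sum>i\<le>m. Ts i (slice x (m - i))))"

definition series_op :: "('m \<Rightarrow> 'k) topology \<Rightarrow> nat set set \<Rightarrow>
   ((nat set \<Rightarrow> ('m \<Rightarrow> 'k) fps) \<Rightarrow> nat set \<Rightarrow> ('m \<Rightarrow> 'k::real_normed_field) fps) \<Rightarrow> bool" where
  "series_op X I T \<longleftrightarrow> (\<exists>Ts. expansion X I Ts T)"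

lemma series_op_series_of_continuous: "series_op X I T \<Longrightarrow> series_of_continuous X I CT AM T"
  unfolding series_op_def expansion_def series_of_continuous_def cont_op_def
  by (auto simp: slice_def fun_eq_iff sum_apply)

lemma slice_gelems: "x \<in> gelems (series_in V) I \<Longrightarrow> slice x m \<in> gelems V I"
  by (auto simp: gelems_def series_in_def slice_def)

lemma gelems_sliceI: "(\<And>m. slice x m \<in> gelems V I) \<Longrightarrow> x \<in> gelems (series_in V) I"
  unfolding gelems_def series_in_def slice_def by (auto simp: fps_eq_iff)

lemma expansionD:
  assumes "expansion X I Ts T"
  shows "cont_op X I (Ts i)"
    and "x \<in> gelems (series_in (topspace X)) I \<Longrightarrow> slice (T x) m = (\<Sum>i\<le>m. Ts i (slice x (m - i)))"
  using assms unfolding expansion_def by blast+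

lemma gelems_C_sum:
  fixes F :: "'i \<Rightarrow> nat set \<Rightarrow> 'm \<Rightarrow> 'k::real_normed_field"
  shows "(\<And>i. i \<in> J \<Longrightarrow> F i \<in> gelems (Cinf n A) I) \<Longrightarrow> (\<Sum>i\<in>J. F i) \<in> gelems (Cinf n A) I"
proof (induction J rule: infinite_finite_induct)
  case (insert i J)
  then have "F i \<in> gelems (Cinf n A) I" "(\<Sum>i\<in>J. F i) \<in> gelems (Cinf n A) I" by auto
  then show ?case by (simp only: sum.insert[OF insert(1,2)] gelems_C(1))
qed (auto simp: gelems_def)

lemma series_op_closed:
  assumes T: "series_op X I T" and x: "x \<in> gelems (series_in (topspace X)) I"
  shows "T x \<in> gelems (series_in (Cinf n A)) AM"
proof (rule gelems_sliceI)
  fix m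
  obtain Ts where Ts: "expansion X I Ts T" using T unfolding series_op_def by blast
  show "slice (T x) m \<in> gelems (Cinf n A) AM"
    unfolding expansionD(2)[OF Ts x]
    by (intro gelems_C_sum cont_opD(5)[OF expansionD(1)[OF Ts]] slice_gelems[OF x])
qed

lemma series_op_add_arg:
  assumes T: "series_op X I T" and x: "x \<in> gelems (series_in (topspace X)) I" "y \<in> gelems (series_in (topspace X)) I"
    and xy: "x + y \<in> gelems (series_in (topspace X)) I"
  shows "T (x + y) = T x + T y"
proof (rule slice_eqI)
  fix m
  obtain Ts where Ts: "expansion X I Ts T" using T unfolding series_op_def by blast
  show "slice (T (x + y)) m = slice (T x + T y) m"
    unfolding slice_add expansionD(2)[OF Ts x(1)] expansionD(2)[OF Ts x(2)] expansionD(2)[OF Ts xy]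
    unfolding sum.distrib[symmetric]
    by (intro sum.cong refl cont_opD(3)[OF expansionD(1)[OF Ts]] slice_gelems x)
qed

text \<open>Operators that do not involve \<open>\<nu>\<close>.\<close>

lemma series_op_const:
  assumes T0: "cont_op X I T0" and T: "\<And>x m. x \<in> gelems (series_in (topspace X)) I \<Longrightarrow> slice (T x) m = T0 (slice x m)"
  shows "expansion X I (\<lambda>i. if i = 0 then T0 else (\<lambda>_. 0)) T"
  unfolding expansion_def
proof (intro conjI ballI allI)
  show "cont_op X I (if i = 0 then T0 else (\<lambda>_. 0))" for i by (simp add: T0 cont_op_zero)
  fix x m assume x: "x \<in> gelems (series_in (topspace X)) I"
  have "(\<Sum>i\<le>m. (if i = 0 then T0 else (\<lambda>_. 0)) (slice x (m - i))) =
    (\<Sum>i\<in>{0}. (if i = 0 then T0 else (\<lambda>_. 0)) (slice x (m - i)))"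
    by (rule sum.mono_neutral_right) auto
  then show "slice (T x) m = (\<Sum>i\<le>m. (if i = 0 then T0 else (\<lambda>_. 0)) (slice x (m - i)))"
    using T[OF x] by simp
qed

lemma expansion_add:
  assumes "expansion X I Ts T" "expansion X I Ts' T'"
  shows "expansion X I (\<lambda>i x. Ts i x + Ts' i x) (\<lambda>x. T x + T' x)"
  using assms unfolding expansion_def by (simp add: cont_op_add slice_add sum.distrib)

text \<open>The coefficients of the composite are given by the Cauchy product.\<close>

lemma expansion_comp:
  assumes T: "expansion X I Ts T" and T': "expansion CT AM Ts' T'"
  shows "expansion X I (\<lambda>m x. \<Sum>i\<le>m. Ts' i (Ts (m - i) x)) (\<lambda>x. T' (T x))"
  unfolding expansion_def
proof (intro conjI ballI allI)
  show "cont_op X I (\<lambda>x. \<Sum>i\<le>m. Ts' i (Ts (m - i) x))" for m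
    by (rule cont_op_sum, rule cont_op_comp[OF expansionD(1)[OF T] expansionD(1)[OF T']])
  fix x m assume x: "x \<in> gelems (series_in (topspace X)) I"
  have "T x \<in> gelems (series_in (topspace CT)) AM" using series_op_closed[of X I T x] T x by (auto simp: series_op_def)
  then have "slice (T' (T x)) m = (\<Sum>i\<le>m. Ts' i (slice (T x) (m - i)))" by (rule expansionD(2)[OF T'])
  also have "\<dots> = (\<Sum>i\<le>m. \<Sum>q\<le>m - i. Ts' i (Ts q (slice x (m - i - q))))"
  proof (rule sum.cong[OF refl])
    fix i
    have in_C: "Ts q (slice x (m - i - q)) \<in> gelems (topspace CT) AM" for q
      using cont_opD(5)[OF expansionD(1)[OF T] slice_gelems[OF x]] by simp
    have "Ts' i (\<Sum>q\<in>J. Ts q (slice x (m - i - q))) = (\<Sum>q\<in>J. Ts' i (Ts q (slice x (m - i - q))))" if "finite J" for J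
      using that
    proof (induction J)
      case empty
      have "Ts' i 0 = Ts' i (gscale 0 0)" by (simp add: gscale_simps)
      also have "\<dots> = gscale 0 (Ts' i 0)" by (rule cont_opD(4)[OF expansionD(1)[OF T']]) (simp add: gelems_def)
      also have "\<dots> = 0" by (simp add: gscale_def fscale_def fun_eq_iff)
      finally show ?case by (simp only: sum.empty)
    next
      case (insert q J)
      have "(\<Sum>q\<in>J. Ts q (slice x (m - i - q))) \<in> gelems (topspace CT) AM"
        unfolding topspace_CT by (rule gelems_C_sum) (use in_C in simp)
      then have "Ts' i (Ts q (slice x (m - i - q)) + (\<Sum>q\<in>J. Ts q (slice x (m - i - q)))) =
         Ts' i (Ts q (slice x (m - i - q))) + Ts' i (\<Sum>q\<in>J. Ts q (slice x (m - i - q)))"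
        by (rule cont_opD(3)[OF expansionD(1)[OF T'] in_C])
      then show ?case using insert by (simp only: sum.insert not_False_eq_True)
    qed
    then show "Ts' i (slice (T x) (m - i)) = (\<Sum>q\<le>m - i. Ts' i (Ts q (slice x (m - i - q))))"
      unfolding expansionD(2)[OF T x] by blast
  qed
  also have "\<dots> = (\<Sum>k\<le>m. \<Sum>i\<le>k. Ts' i (Ts (k - i) (slice x (m - i - (k - i)))))"
    by (rule sum_triangle)
  also have "\<dots> = (\<Sum>k\<le>m. \<Sum>i\<le>k. Ts' i (Ts (k - i) (slice x (m - k))))"
    by (intro sum.cong refl) simp
  finally show "slice (T' (T x)) m = (\<Sum>k\<le>m. \<Sum>i\<le>k. Ts' i (Ts (k - i) (slice x (m - k))))" .
qed

lemma series_op_comp: "series_op X I T \<Longrightarrow> series_op CT AM T' \<Longrightarrow> series_op X I (\<lambda>x. T' (T x))"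
  unfolding series_op_def using expansion_comp by blast

lemma series_op_add: "series_op X I T \<Longrightarrow> series_op X I T' \<Longrightarrow> series_op X I (\<lambda>x. T x + T' x)"
  unfolding series_op_def using expansion_add by blast

lemma series_op_zero: "series_op X I (\<lambda>_. 0)"
  unfolding series_op_def by (rule exI, rule series_op_const[OF cont_op_zero]) (auto simp: slice_def)

lemma series_op_sum: "(\<And>i. i \<in> J \<Longrightarrow> series_op X I (T i)) \<Longrightarrow> series_op X I (\<lambda>x. \<Sum>i\<in>J. T i x)"
proof (induction J rule: infinite_finite_induct)
  case (insert i J)
  then have "series_op X I (\<lambda>x. T i x + (\<Sum>i\<in>J. T i x))" by (intro series_op_add) auto
  then show ?case using insert by (simp only: sum.insert not_False_eq_True)
qed (simp_all only: sum.infinite sum.empty series_op_zero not_False_eq_True)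

lemma expansion_cong:
  "expansion X I Ts T \<Longrightarrow> (\<And>x. x \<in> gelems (series_in (topspace X)) I \<Longrightarrow> T' x = T x) \<Longrightarrow> expansion X I Ts T'"
  unfolding expansion_def by simp

lemma series_op_cong:
  "series_op X I T \<Longrightarrow> (\<And>x. x \<in> gelems (series_in (topspace X)) I \<Longrightarrow> T' x = T x) \<Longrightarrow> series_op X I T'"
  unfolding series_op_def by (meson expansion_cong)

text \<open>Multiplication with a generator and its derivative only permute the coefficients and change signs, which
  is continuous for the product topology.\<close>

lemma cont_op_reindex:
  assumes "\<And>S. S \<notin> AM \<Longrightarrow> P S \<Longrightarrow> \<rho> S \<notin> AM"
  shows "cont_op CT AM (\<lambda>x S. if P S then fscale (c S) (x (\<rho> S)) else (0 :: 'm \<Rightarrow> 'k::real_normed_field))"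
proof (rule cont_opI)
  show "continuous_map (gtop CT AM) CT (\<lambda>x :: nat set \<Rightarrow> 'm \<Rightarrow> 'k. if P S then fscale (c S) (x (\<rho> S)) else 0)" for S
    by (cases "P S") (auto intro!: continuous_map_fscale continuous_map_gtop_component)
qed (use assms in \<open>auto simp: gelems_def fscale_simps gscale_def\<close>)

lemma series_op_gder: "series_op CT AM (gder i :: _ \<Rightarrow> _ \<Rightarrow> ('m \<Rightarrow> 'k::real_normed_field) fps)"
  unfolding series_op_def
  by (rule exI, rule series_op_const[OF cont_op_reindex[of "\<lambda>S. i \<notin> S" "insert i" "\<lambda>S. (-1) ^ below i S"]])
    (auto simp: all_monomials_def gder_altdef slice_def fun_eq_iff fscale_def minus_one_power_iff)

lemma series_op_gwedge: "i < 2 * l \<Longrightarrow> series_op CT AM (gwedge i :: _ \<Rightarrow> _ \<Rightarrow> ('m \<Rightarrow> 'k::real_normed_field) fps)"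
  unfolding series_op_def
  by (rule exI, rule series_op_const[OF cont_op_reindex[of "\<lambda>S. i \<in> S" "\<lambda>S. S - {i}" "\<lambda>S. (-1) ^ below i S"]])
    (auto simp: all_monomials_def gwedge_altdef slice_def fun_eq_iff fscale_def minus_one_power_iff)

lemma cst_mult_nth: "fps_nth (cst r * F) m = fscale r (fps_nth F m)" for F :: "('m \<Rightarrow> 'k::real_normed_field) fps"
  unfolding cst_def fps_mult_left_const_nth by (simp add: fscale_def fun_eq_iff)

lemma series_op_cst: "series_op CT AM (smul (cst r :: ('m \<Rightarrow> 'k::real_normed_field) fps))"
  unfolding series_op_def
  by (rule exI, rule series_op_const[OF cont_op_scale[OF cont_op_id, of r]])
    (auto simp: slice_def smul_def cst_mult_nth gscale_def)

lemma series_op_X: "series_op CT AM (smul (fps_X :: ('m \<Rightarrow> 'k::real_normed_field) fps))"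
  unfolding series_op_def
proof (rule exI[of _ "\<lambda>i. if i = 1 then (\<lambda>x. x) else (\<lambda>_. 0)"], unfold expansion_def, intro conjI ballI allI)
  show "cont_op CT AM (if i = 1 then (\<lambda>x. x) else (\<lambda>_. 0))" for i :: nat by (simp add: cont_op_id cont_op_zero)
  fix x :: "nat set \<Rightarrow> ('m \<Rightarrow> 'k) fps" and m
  have "(\<Sum>i\<le>m. (if i = 1 then (\<lambda>x. x) else (\<lambda>_. 0)) (slice x (m - i))) = (if m = 0 then 0 else slice x (m - 1))"
  proof (cases m)
    case (Suc q)
    have "(\<Sum>i\<le>m. (if i = 1 then (\<lambda>x. x) else (\<lambda>_. 0)) (slice x (m - i))) =
      (\<Sum>i\<in>{1}. (if i = 1 then (\<lambda>x. x) else (\<lambda>_. 0)) (slice x (m - i)))"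
      by (rule sum.mono_neutral_right) (use Suc in auto)
    then show ?thesis using Suc by simp
  qed simp
  then show "slice (smul fps_X x) m = (\<Sum>i\<le>m. (if i = 1 then (\<lambda>x. x) else (\<lambda>_. 0)) (slice x (m - i)))"
    by (auto simp: slice_def smul_def fun_eq_iff)
qed

lemma series_op_smul:
  fixes T :: "_ \<Rightarrow> _ \<Rightarrow> ('m \<Rightarrow> 'k::real_normed_field) fps"
  shows "series_op X I T \<Longrightarrow> series_op X I (\<lambda>x. smul (cst r) (T x))" "series_op X I T \<Longrightarrow> series_op X I (\<lambda>x. smul fps_X (T x))"
  using series_op_comp series_op_cst series_op_X by blast+

lemma series_op_uminus:
  fixes T :: "_ \<Rightarrow> _ \<Rightarrow> ('m \<Rightarrow> 'k::real_normed_field) fps"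
  assumes "series_op X I T" shows "series_op X I (\<lambda>x. - T x)"
proof -
  have "smul (cst (-1)) x = - x" for x :: "nat set \<Rightarrow> ('m \<Rightarrow> 'k) fps"
    by (auto simp: smul_def cst_mult_nth fun_eq_iff fps_eq_iff fscale_simps)
  then show ?thesis using series_op_smul(1)[OF assms, of "-1"] by simp
qed

lemma series_op_diff:
  fixes T :: "_ \<Rightarrow> _ \<Rightarrow> ('m \<Rightarrow> 'k::real_normed_field) fps"
  shows "series_op X I T \<Longrightarrow> series_op X I T' \<Longrightarrow> series_op X I (\<lambda>x. T x - T' x)"
  using series_op_add[of X I T "\<lambda>x. - T' x"] series_op_uminus[of X I T'] by simp

text \<open>The analogue of an expansion for maps acting on a single coefficient of an element.\<close>

definition coeff_op :: "(nat \<Rightarrow> ('m \<Rightarrow> 'k) \<Rightarrow> 'm \<Rightarrow> 'k) \<Rightarrow> (('m \<Rightarrow> 'k) fps \<Rightarrow> ('m \<Rightarrow> 'k::real_normed_field) fps) \<Rightarrow> bool" where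
  "coeff_op \<phi>s \<phi> \<longleftrightarrow> (\<forall>i. linear_map_on fscale fscale (Cinf n A) (Cinf n A) (\<phi>s i) \<and> continuous_map CT CT (\<phi>s i)) \<and>
     (\<forall>F\<in>series_in (Cinf n A). \<forall>m. fps_nth (\<phi> F) m = (\<Sum>i\<le>m. \<phi>s i (fps_nth F (m - i))))"

lemma expansion_coeff_op:
  fixes \<phi> :: "('m \<Rightarrow> 'k::real_normed_field) fps \<Rightarrow> ('m \<Rightarrow> 'k) fps"
  assumes "coeff_op \<phi>s \<phi>"
  shows "expansion CT AM (\<lambda>i x S. \<phi>s i (x S)) (\<lambda>x S. \<phi> (x S))"
  unfolding expansion_def
proof (intro conjI ballI allI)
  fix i
  have lin: "linear_map_on fscale fscale (Cinf n A) (Cinf n A) (\<phi>s i)" and cont: "continuous_map CT CT (\<phi>s i)"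
    using assms unfolding coeff_op_def by auto
  have "\<phi>s i 0 = \<phi>s i (fscale 0 0)" by (simp add: fscale_simps)
  also have "\<dots> = fscale 0 (\<phi>s i 0)" using lin unfolding linear_map_on_def by (metis C_0)
  finally have 0: "\<phi>s i 0 = 0" by (auto simp: fscale_def fun_eq_iff)
  show "cont_op CT AM (\<lambda>x S. \<phi>s i (x S))"
  proof (rule cont_opI)
    show "continuous_map (gtop CT AM) CT (\<lambda>x. \<phi>s i (x S))" for S
      using continuous_map_compose[OF continuous_map_gtop_component cont] by (simp add: o_def)
  qed (use lin 0 in \<open>auto simp: gelems_def linear_map_on_def gscale_def\<close>)
next
  fix x :: "nat set \<Rightarrow> ('m \<Rightarrow> 'k) fps" and m
  assume "x \<in> gelems (series_in (topspace CT)) AM"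
  then have "x S \<in> series_in (Cinf n A)" for S by (simp add: gelems_def)
  then have "fps_nth (\<phi> (x S)) m = (\<Sum>i\<le>m. \<phi>s i (fps_nth (x S) (m - i)))" for S
    using assms unfolding coeff_op_def by blast
  then show "slice (\<lambda>S. \<phi> (x S)) m = (\<Sum>i\<le>m. (\<lambda>S. \<phi>s i (slice x (m - i) S)))"
    unfolding fun_eq_iff by (simp add: slice_apply sum_apply)
qed

text \<open>The solution \<open>U\<^sub>m\<close> of \<open>(id + T) (\<Sum> \<nu>\<^sup>m U\<^sub>m) = id\<close>, where \<open>U\<close> is the inverse of the part of order zero.\<close>

fun inverse_series :: "('v \<Rightarrow> 'v) \<Rightarrow> (nat \<Rightarrow> 'v \<Rightarrow> 'v) \<Rightarrow> nat \<Rightarrow> 'v \<Rightarrow> 'v::ab_group_add" where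
  "inverse_series U Ts m = (if m = 0 then U else (\<lambda>x. - U (\<Sum>i<m. Ts (m - i) (inverse_series U Ts i x))))"

declare inverse_series.simps [simp del]

lemma telescope_step:
  fixes a b g d x :: "'v::ab_group_add"
  shows "a + b = x - g \<Longrightarrow> (a + g) + (b + d) = x - (- d)"
  by (simp add: algebra_simps)

text \<open>Modulo \<open>\<nu>\<close> the inverse is the finite geometric series \<open>U0\<close>, the higher orders follow by recursion. This yields
  a right inverse; it is also a left inverse because \<open>id + T\<close> is injective: by induction on the order, the
  coefficient of order \<open>m\<close> of \<open>x\<close> is determined by \<open>x + T x\<close> and the lower coefficients through \<open>U0\<close>.\<close>

lemma series_op_inverse:
  fixes T :: "(nat set \<Rightarrow> ('m \<Rightarrow> 'k::real_normed_field) fps) \<Rightarrow> nat set \<Rightarrow> ('m \<Rightarrow> 'k) fps"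
  assumes T: "expansion CT AM Ts T"
    and nil: "\<And>x. x \<in> gelems (Cinf n A) AM \<Longrightarrow> (Ts 0 ^^ q) x = 0"
  obtains U where "series_op CT AM U"
    and "\<And>x. x \<in> gelems (series_in (Cinf n A)) AM \<Longrightarrow> U x + T (U x) = x"
    and "\<And>x. x \<in> gelems (series_in (Cinf n A)) AM \<Longrightarrow> U (x + T x) = x"
proof -
  let ?E = "gelems (Cinf n A :: ('m \<Rightarrow> 'k) set) AM"
  let ?V = "gelems (series_in (Cinf n A :: ('m \<Rightarrow> 'k) set)) AM"
  note cont_op_Ts = expansionD(1)[OF T]
  define N where "N = Ts 0"
  have N: "cont_op CT AM N" unfolding N_def by (rule cont_op_Ts)
  have N_closed: "x \<in> ?E \<Longrightarrow> N x \<in> ?E" for x :: "nat set \<Rightarrow> 'm \<Rightarrow> 'k" using cont_opD(5)[OF N, of x] by simp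
  have N_add: "x \<in> ?E \<Longrightarrow> y \<in> ?E \<Longrightarrow> N (x + y) = N x + N y" for x y :: "nat set \<Rightarrow> 'm \<Rightarrow> 'k" using cont_opD(3)[OF N, of x y] by simp
  have N_neg: "x \<in> ?E \<Longrightarrow> N (- x) = - N x" for x :: "nat set \<Rightarrow> 'm \<Rightarrow> 'k" using cont_opD(4)[OF N, of x "-1"] by (simp add: gscale_simps)
  have N_pow: "x \<in> ?E \<Longrightarrow> (N ^^ k) x \<in> ?E" for x :: "nat set \<Rightarrow> 'm \<Rightarrow> 'k" and k by (induction k) (auto simp: N_closed)
  have cont_op_pow: "cont_op CT AM (N ^^ k)" for k
    by (induction k) (auto simp: cont_op_id[unfolded id_def[symmetric]] o_def cont_op_comp[OF _ N] id_def cont_op_id)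
  define U0 where "U0 x = (\<Sum>k<q. gscale ((-1) ^ k) ((N ^^ k) x))" for x :: "nat set \<Rightarrow> 'm \<Rightarrow> 'k"
  have cont_op_U0: "cont_op CT AM U0" unfolding U0_def by (intro cont_op_sum cont_op_scale cont_op_pow)
  have U0_closed: "x \<in> ?E \<Longrightarrow> U0 x \<in> ?E" for x :: "nat set \<Rightarrow> 'm \<Rightarrow> 'k" using cont_opD(5)[OF cont_op_U0, of x] by simp
  have N_U0: "U0 x + N (U0 x) = x" and U0_N: "U0 (x + N x) = x" if x: "x \<in> ?E" for x :: "nat set \<Rightarrow> 'm \<Rightarrow> 'k"
  proof -
    \<comment> \<open>telescoping of the alternating geometric series\<close>
    have tele: "(\<Sum>k<q'. gscale ((-1) ^ k) ((N ^^ k) x)) + (\<Sum>k<q'. gscale ((-1) ^ k) ((N ^^ Suc k) x)) =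
       x - gscale ((-1) ^ q') ((N ^^ q') x)" for q'
    proof (induction q')
      case (Suc q')
      have "gscale ((-1) ^ Suc q') y = - gscale ((-1) ^ q') y" for y :: "nat set \<Rightarrow> 'm \<Rightarrow> 'k"
        by (auto simp: gscale_def fscale_def fun_eq_iff)
      then show ?case unfolding sum.lessThan_Suc by (simp only: telescope_step[OF Suc])
    qed (auto simp: gscale_def fscale_def fun_eq_iff)
    have N_sum: "N (\<Sum>k<q'. gscale ((-1) ^ k) ((N ^^ k) x)) = (\<Sum>k<q'. gscale ((-1) ^ k) ((N ^^ Suc k) x))" for q'
    proof (induction q')
      case 0
      have "(0 :: nat set \<Rightarrow> 'm \<Rightarrow> 'k) \<in> ?E" by (simp add: gelems_def)
      then have "N 0 = 0" using N_add[of 0 0] by (simp only: add_0 add_cancel_right_right)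
      then show ?case by (simp only: lessThan_0 sum.empty)
    next
      case (Suc q')
      have "N (gscale ((-1) ^ q') ((N ^^ q') x)) = gscale ((-1) ^ q') ((N ^^ Suc q') x)"
        using cont_opD(4)[OF N] N_pow[OF x] by simp
      moreover have "(\<Sum>k<q'. gscale ((-1) ^ k) ((N ^^ k) x)) \<in> ?E" "gscale ((-1) ^ q') ((N ^^ q') x) \<in> ?E"
        by (intro gelems_C_sum gelems_C(4) N_pow x)+
      ultimately show ?case using Suc by (simp only: sum.lessThan_Suc N_add)
    qed
    show "U0 x + N (U0 x) = x"
      unfolding U0_def N_sum tele using nil[OF x] by (simp add: N_def gscale_simps)
    have "(N ^^ k) (x + N x) = (N ^^ k) x + (N ^^ Suc k) x" for k
      using cont_opD(3)[OF cont_op_pow, of x "N x"] x N_closed[OF x] by (simp add: funpow_swap1)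
    then have "U0 (x + N x) = (\<Sum>k<q. gscale ((-1) ^ k) ((N ^^ k) x)) + (\<Sum>k<q. gscale ((-1) ^ k) ((N ^^ Suc k) x))"
      unfolding U0_def by (simp only: gscale_simps sum.distrib)
    then show "U0 (x + N x) = x"
      unfolding tele using nil[OF x] by (simp add: N_def gscale_simps)
  qed
  define Us where "Us = inverse_series U0 Ts"
  have Us_0: "Us 0 = U0" unfolding Us_def by (subst inverse_series.simps) simp
  have Us_Suc: "Us m x = - U0 (\<Sum>i<m. Ts (m - i) (Us i x))" if "m > 0" for m and x :: "nat set \<Rightarrow> 'm \<Rightarrow> 'k"
    unfolding Us_def by (subst inverse_series.simps) (use that in simp)
  have cont_op_Us: "cont_op CT AM (Us m)" for m
  proof (induction m rule: less_induct)
    case (less m)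
    show ?case
    proof (cases "m = 0")
      case False
      then have "Us m = (\<lambda>x. - U0 (\<Sum>i<m. Ts (m - i) (Us i x)))" using Us_Suc by auto
      then show ?thesis
        by (simp only:) (intro cont_op_uminus cont_op_comp[OF _ cont_op_U0] cont_op_sum cont_op_comp[OF _ cont_op_Ts] less, simp)
    qed (simp add: Us_0 cont_op_U0)
  qed
  have Us_closed: "x \<in> ?E \<Longrightarrow> Us m x \<in> ?E" for x :: "nat set \<Rightarrow> 'm \<Rightarrow> 'k" and m using cont_opD(5)[OF cont_op_Us, of x] by simp
  define U where "U x S = Abs_fps (\<lambda>m. \<Sum>i\<le>m. Us i (slice x (m - i)) S)" for x :: "nat set \<Rightarrow> ('m \<Rightarrow> 'k) fps" and S
  have U: "expansion CT AM Us U"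
    unfolding expansion_def
  proof (intro conjI ballI allI cont_op_Us)
    fix x m
    show "slice (U x) m = (\<Sum>i\<le>m. Us i (slice x (m - i)))"
      by (rule ext) (simp add: slice_apply U_def sum_apply)
  qed
  then have series_op_U: "series_op CT AM U" unfolding series_op_def by blast
  have U_closed: "x \<in> ?V \<Longrightarrow> U x \<in> ?V" for x :: "nat set \<Rightarrow> ('m \<Rightarrow> 'k) fps" using series_op_closed[OF series_op_U, of x] by simp
  have right: "U x + T (U x) = x" if x: "x \<in> ?V" for x :: "nat set \<Rightarrow> ('m \<Rightarrow> 'k) fps"
  proof (rule slice_eqI)
    fix m
    have x': "x \<in> gelems (series_in (topspace CT)) AM" using x by simp
    have "slice (U x + T (U x)) m = (\<Sum>k\<le>m. Us k (slice x (m - k)) + (\<Sum>i\<le>k. Ts i (Us (k - i) (slice x (m - k)))))"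
      unfolding slice_add expansionD(2)[OF U x'] expansionD(2)[OF expansion_comp[OF U T] x'] sum.distrib ..
    also have "\<dots> = (\<Sum>k\<in>{0}. slice x (m - k))"
    proof (rule sum.mono_neutral_cong_right)
      have y: "slice x (m - k) \<in> ?E" for k by (rule slice_gelems[OF x])
      show "\<forall>k\<in>{..m} - {0}. Us k (slice x (m - k)) + (\<Sum>i\<le>k. Ts i (Us (k - i) (slice x (m - k)))) = 0"
      proof
        fix k assume k: "k \<in> {..m} - {0}"
        let ?y = "slice x (m - k)"
        define R where "R = (\<Sum>i<k. Ts (k - i) (Us i ?y))"
        have "Ts (k - i) (Us i ?y) \<in> ?E" for i
          using cont_opD(5)[OF cont_op_Ts, of "Us i ?y"] Us_closed[OF y] by simp
        then have R: "R \<in> ?E" unfolding R_def by (intro gelems_C_sum)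
        have Usk: "Us k ?y = - U0 R" using Us_Suc[of k] k unfolding R_def by auto
        have "(\<Sum>i\<le>k. Ts i (Us (k - i) ?y)) = (\<Sum>i\<le>k. Ts (k - i) (Us i ?y))"
          by (rule sum.reindex_bij_witness[of _ "\<lambda>i. k - i" "\<lambda>i. k - i"]) auto
        also have "\<dots> = R + N (Us k ?y)"
          unfolding R_def N_def by (simp only: lessThan_Suc_atMost[symmetric] sum.lessThan_Suc diff_self_eq_0)
        finally have "Us k ?y + (\<Sum>i\<le>k. Ts i (Us (k - i) ?y)) = - (U0 R + N (U0 R)) + R"
          unfolding Usk N_neg[OF U0_closed[OF R]] by simp
        then show "Us k ?y + (\<Sum>i\<le>k. Ts i (Us (k - i) ?y)) = 0"
          unfolding N_U0[OF R] by simp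
      qed
      fix k assume "k \<in> {0::nat}"
      then show "Us k (slice x (m - k)) + (\<Sum>i\<le>k. Ts i (Us (k - i) (slice x (m - k)))) = slice x (m - k)"
        using N_U0[OF y[of 0]] by (simp add: Us_0 N_def)
    qed auto
    finally show "slice (U x + T (U x)) m = slice x m" by simp
  qed
  \<comment> \<open>injectivity, by induction on the order in \<open>\<nu>\<close>\<close>
  have inj: "x = y" if x: "x \<in> ?V" and y: "y \<in> ?V" and eq: "x + T x = y + T y" for x y :: "nat set \<Rightarrow> ('m \<Rightarrow> 'k) fps"
  proof (rule slice_eqI)
    fix m show "slice x m = slice y m"
    proof (induction m rule: less_induct)
      case (less m)
      have *: "slice (z + T z) m = (slice z m + N (slice z m)) + (\<Sum>i<m. Ts (Suc i) (slice z (m - Suc i)))"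
        if "z \<in> ?V" for z :: "nat set \<Rightarrow> ('m \<Rightarrow> 'k) fps"
      proof -
        have "z \<in> gelems (series_in (topspace CT)) AM" using that by simp
        from expansionD(2)[OF T this] have "slice (T z) m = (\<Sum>i<Suc m. Ts i (slice z (m - i)))"
          by (simp only: lessThan_Suc_atMost)
        also have "\<dots> = N (slice z m) + (\<Sum>i<m. Ts (Suc i) (slice z (m - Suc i)))"
          unfolding N_def by (simp only: sum.lessThan_Suc_shift diff_zero)
        finally show ?thesis unfolding slice_add by (simp only: add.assoc)
      qed
      define R where "R = (\<Sum>i<m. Ts (Suc i) (slice y (m - Suc i)))"
      have R: "(\<Sum>i<m. Ts (Suc i) (slice x (m - Suc i))) = R"
        unfolding R_def by (intro sum.cong refl) (simp add: less)
      have "slice (x + T x) m = slice (y + T y) m" by (simp only: eq)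
      then have "(slice x m + N (slice x m)) + R = (slice y m + N (slice y m)) + R"
        unfolding *[OF x] *[OF y] R R_def[symmetric] .
      then have "slice x m + N (slice x m) = slice y m + N (slice y m)" by (rule add_right_imp_eq)
      then have "U0 (slice x m + N (slice x m)) = U0 (slice y m + N (slice y m))" by (rule arg_cong)
      then show ?case unfolding U0_N[OF slice_gelems[OF x]] U0_N[OF slice_gelems[OF y]] .
    qed
  qed
  have T_closed: "x \<in> ?V \<Longrightarrow> T x \<in> ?V" for x :: "nat set \<Rightarrow> ('m \<Rightarrow> 'k) fps" using series_op_closed[of CT AM T x] T by (auto simp: series_op_def)
  have V_add: "x \<in> ?V \<Longrightarrow> y \<in> ?V \<Longrightarrow> x + y \<in> ?V" for x y :: "nat set \<Rightarrow> ('m \<Rightarrow> 'k) fps"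
    by (rule gelems_sliceI) (simp only: slice_add gelems_C(1) slice_gelems)
  have "U (x + T x) = x" if x: "x \<in> ?V" for x :: "nat set \<Rightarrow> ('m \<Rightarrow> 'k) fps"
    by (rule inj[OF U_closed x right]) (intro V_add T_closed x)+
  with series_op_U right show ?thesis by (rule that)
qed

lemma slice_smul_cst: "slice (smul (cst r) x) m = gscale r (slice x m)" for x :: "_ \<Rightarrow> ('m \<Rightarrow> 'k::real_normed_field) fps"
  by (auto simp: slice_def smul_def gscale_def cst_mult_nth)

lemma series_op_cst_arg:
  fixes T :: "(nat set \<Rightarrow> ('m \<Rightarrow> 'k::real_normed_field) fps) \<Rightarrow> nat set \<Rightarrow> ('m \<Rightarrow> 'k) fps"
  assumes T: "series_op CT AM T" and x: "x \<in> gelems (series_in (Cinf n A)) AM"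
  shows "T (smul (cst r) x) = smul (cst r) (T x)"
proof (rule slice_eqI)
  fix m
  obtain Ts where Ts: "expansion CT AM Ts T" using T unfolding series_op_def by blast
  have x': "x \<in> gelems (series_in (topspace CT)) AM" using x by simp
  have rx: "smul (cst r) x \<in> gelems (series_in (topspace CT)) AM"
    unfolding topspace_CT by (rule gelems_sliceI) (simp only: slice_smul_cst gelems_C(4)[OF slice_gelems[OF x]])
  have "slice (T (smul (cst r) x)) m = (\<Sum>i\<le>m. gscale r (Ts i (slice x (m - i))))"
    unfolding expansionD(2)[OF Ts rx] slice_smul_cst
    by (intro sum.cong refl cont_opD(4)[OF expansionD(1)[OF Ts]] slice_gelems[OF x'])
  then show "slice (T (smul (cst r) x)) m = slice (smul (cst r) (T x)) m"
    unfolding slice_smul_cst expansionD(2)[OF Ts x'] gscale_sum .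
qed

lemma slice_nuscale: "slice (nuscale c x) m = (\<Sum>q\<le>m. gscale (fps_nth c q) (slice x (m - q)))"
  for x :: "nat set \<Rightarrow> ('m \<Rightarrow> 'k::real_normed_field) fps"
proof (rule ext, rule ext)
  fix S p
  show "slice (nuscale c x) m S p = (\<Sum>q\<le>m. gscale (fps_nth c q) (slice x (m - q))) S p"
    by (simp add: slice_def nuscale_def fps_mult_nth sum_apply gscale_def fscale_def atLeast0AtMost)
qed

text \<open>Linearity over the scalars is all that is required of the coefficients of an expansion. Linearity over the
  formal power series follows, since both act on slices by Cauchy products, which commute.\<close>

lemma series_op_nuscale:
  fixes T :: "(nat set \<Rightarrow> ('m \<Rightarrow> 'k::real_normed_field) fps) \<Rightarrow> nat set \<Rightarrow> ('m \<Rightarrow> 'k) fps"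
  assumes T: "series_op X I T" and x: "x \<in> gelems (series_in (topspace X)) I"
    and add: "\<And>u v. u \<in> topspace X \<Longrightarrow> v \<in> topspace X \<Longrightarrow> u + v \<in> topspace X"
    and scale: "\<And>r u. u \<in> topspace X \<Longrightarrow> fscale r u \<in> topspace X"
  shows "nuscale c x \<in> gelems (series_in (topspace X)) I" "T (nuscale c x) = nuscale c (T x)"
proof -
  let ?G = "gelems (topspace X) I"
  obtain Ts where Ts: "expansion X I Ts T" using T unfolding series_op_def by blast
  have G_scale: "gscale r y \<in> ?G" if "y \<in> ?G" for r and y :: "nat set \<Rightarrow> 'm \<Rightarrow> 'k"
    using that scale by (auto simp: gelems_def gscale_def fscale_simps)
  have G_add: "y + y' \<in> ?G" if "y \<in> ?G" "y' \<in> ?G" for y y' :: "nat set \<Rightarrow> 'm \<Rightarrow> 'k"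
    using that add by (auto simp: gelems_def)
  have sums: "(\<Sum>q\<le>m. gscale (r q) (y q)) \<in> ?G \<and>
      Ts i (\<Sum>q\<le>m. gscale (r q) (y q)) = (\<Sum>q\<le>m. gscale (r q) (Ts i (y q)))"
    if y: "\<And>q. y q \<in> ?G" for m i and r :: "nat \<Rightarrow> 'k" and y :: "nat \<Rightarrow> nat set \<Rightarrow> 'm \<Rightarrow> 'k"
  proof (induction m)
    case 0
    show ?case using y G_scale cont_opD(4)[OF expansionD(1)[OF Ts] y] by simp
  next
    case (Suc m)
    then have IH: "(\<Sum>q\<le>m. gscale (r q) (y q)) \<in> ?G"
      "Ts i (\<Sum>q\<le>m. gscale (r q) (y q)) = (\<Sum>q\<le>m. gscale (r q) (Ts i (y q)))" by auto
    show ?case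
      unfolding sum.atMost_Suc cont_opD(3)[OF expansionD(1)[OF Ts] IH(1) G_scale[OF y]] IH(2)
        cont_opD(4)[OF expansionD(1)[OF Ts] y]
      by (intro conjI refl G_add IH(1) G_scale y)
  qed
  have xs: "slice x q \<in> ?G" for q by (rule slice_gelems[OF x])
  show nx: "nuscale c x \<in> gelems (series_in (topspace X)) I"
    by (rule gelems_sliceI) (unfold slice_nuscale, rule conjunct1[OF sums[OF xs]])
  show "T (nuscale c x) = nuscale c (T x)"
  proof (rule slice_eqI)
    fix m
    have "slice (T (nuscale c x)) m = (\<Sum>i\<le>m. \<Sum>q\<le>m - i. gscale (fps_nth c q) (Ts i (slice x (m - i - q))))"
      unfolding expansionD(2)[OF Ts nx] slice_nuscale
      by (rule sum.cong[OF refl]) (rule conjunct2[OF sums[OF xs]])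
    also have "\<dots> = (\<Sum>q\<le>m. \<Sum>i\<le>m - q. gscale (fps_nth c q) (Ts i (slice x (m - i - q))))"
      by (rule sum_triangle_swap)
    also have "\<dots> = (\<Sum>q\<le>m. gscale (fps_nth c q) (slice (T x) (m - q)))"
      unfolding expansionD(2)[OF Ts x] gscale_sum by (simp only: diff_diff_left add.commute)
    finally show "slice (T (nuscale c x)) m = slice (nuscale c (T x)) m" unfolding slice_nuscale .
  qed
qed

lemma series_op_linear_map:
  fixes T :: "(nat set \<Rightarrow> ('m \<Rightarrow> 'k::real_normed_field) fps) \<Rightarrow> nat set \<Rightarrow> ('m \<Rightarrow> 'k) fps"
  assumes T: "series_op X I T"
    and add: "\<And>u v. u \<in> topspace X \<Longrightarrow> v \<in> topspace X \<Longrightarrow> u + v \<in> topspace X"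
    and scale: "\<And>r u. u \<in> topspace X \<Longrightarrow> fscale r u \<in> topspace X"
  shows "linear_map_on nuscale nuscale (gelems (series_in (topspace X)) I) (gelems (series_in (Cinf n A)) AM) T"
  unfolding linear_map_on_def
proof (intro conjI ballI allI)
  fix x y :: "nat set \<Rightarrow> ('m \<Rightarrow> 'k) fps" and c
  assume x: "x \<in> gelems (series_in (topspace X)) I"
  show "T x \<in> gelems (series_in (Cinf n A)) AM" by (rule series_op_closed[OF T x])
  show "T (nuscale c x) = nuscale c (T x)" by (rule series_op_nuscale(2)[OF T x add scale])
  assume y: "y \<in> gelems (series_in (topspace X)) I"
  have "x + y \<in> gelems (series_in (topspace X)) I"
    using x y add by (auto simp: gelems_def series_in_def)
  then show "T (x + y) = T x + T y" by (rule series_op_add_arg[OF T x y])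
qed

end

section \<open>Star multiplication as a series of continuous operators\<close>

locale star_functions = function_space n A l
  for n :: nat and A :: "'m::{t2_space, second_countable_topology} chart set" and l :: nat +
  fixes \<mu> :: "nat \<Rightarrow> ('m \<Rightarrow> 'k::real_normed_field) \<Rightarrow> ('m \<Rightarrow> 'k) \<Rightarrow> 'm \<Rightarrow> 'k"
  assumes \<mu>_0: "f \<in> Cinf n A \<Longrightarrow> g \<in> Cinf n A \<Longrightarrow> \<mu> 0 f g = f * g"
    and \<mu>_bidiff: "i \<ge> 1 \<Longrightarrow> bidifferential n A (\<mu> i)"
    and star_assoc: "F \<in> series_in (Cinf n A) \<Longrightarrow> G \<in> series_in (Cinf n A) \<Longrightarrow> H \<in> series_in (Cinf n A) \<Longrightarrow>
      star \<mu> (star \<mu> F G) H = star \<mu> F (star \<mu> G H)"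
    and star_1: "F \<in> series_in (Cinf n A) \<Longrightarrow> star \<mu> 1 F = F" "F \<in> series_in (Cinf n A) \<Longrightarrow> star \<mu> F 1 = F"
begin

abbreviation CS :: "('m \<Rightarrow> 'k) fps set" where "CS \<equiv> series_in (Cinf n A)"

abbreviation V :: "(nat set \<Rightarrow> ('m \<Rightarrow> 'k) fps) set" where "V \<equiv> gelems CS AM"

lemma CS_add: "F \<in> CS \<Longrightarrow> G \<in> CS \<Longrightarrow> F + G \<in> CS"
  and CS_diff: "F \<in> CS \<Longrightarrow> G \<in> CS \<Longrightarrow> F - G \<in> CS"
  and CS_uminus: "F \<in> CS \<Longrightarrow> - F \<in> CS"
  and CS_0: "0 \<in> CS" and CS_1: "1 \<in> CS"
  and CS_shift: "F \<in> CS \<Longrightarrow> fps_shift 1 F \<in> CS"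
  and CS_X: "F \<in> CS \<Longrightarrow> fps_X * F \<in> CS"
  by (auto simp: series_in_def C_add C_diff C_uminus)

lemma CS_cst: "F \<in> CS \<Longrightarrow> cst r * F \<in> CS"
  by (auto simp: series_in_def cst_mult_nth C_fscale)

lemma CS_cst_1: "cst r \<in> CS"
  using CS_cst[OF CS_1, of r] by simp

lemma CS_sign: "F \<in> CS \<Longrightarrow> (-1) ^ k * F \<in> CS"
  by (cases "even k") (auto simp: CS_uminus)

lemma CS_sum: "(\<And>i. i \<in> I \<Longrightarrow> F i \<in> CS) \<Longrightarrow> (\<Sum>i\<in>I. F i) \<in> CS"
  by (induction I rule: infinite_finite_induct) (auto simp: CS_add CS_0)

lemma coeff_op_add:
  assumes "coeff_op \<phi>s \<phi>" "F \<in> CS" "G \<in> CS"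
  shows "\<phi> (F + G) = \<phi> F + \<phi> G"
proof (rule fps_ext)
  fix m
  have "fps_nth (\<phi> (F + G)) m = (\<Sum>i\<le>m. \<phi>s i (fps_nth (F + G) (m - i)))"
    using assms CS_add unfolding coeff_op_def by blast
  also have "\<dots> = (\<Sum>i\<le>m. \<phi>s i (fps_nth F (m - i)) + \<phi>s i (fps_nth G (m - i)))"
    using assms unfolding coeff_op_def linear_map_on_def series_in_def by (intro sum.cong refl) simp
  also have "\<dots> = fps_nth (\<phi> F + \<phi> G) m"
    unfolding sum.distrib using assms unfolding coeff_op_def by simp
  finally show "fps_nth (\<phi> (F + G)) m = fps_nth (\<phi> F + \<phi> G) m" .
qed

lemma coeff_op_cst:
  assumes "coeff_op \<phi>s \<phi>" "F \<in> CS"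
  shows "\<phi> (cst r * F) = cst r * \<phi> F"
proof (rule fps_ext)
  fix m
  have "fps_nth (\<phi> (cst r * F)) m = (\<Sum>i\<le>m. \<phi>s i (fps_nth (cst r * F) (m - i)))"
    using assms CS_cst unfolding coeff_op_def by blast
  also have "\<dots> = (\<Sum>i\<le>m. fscale r (\<phi>s i (fps_nth F (m - i))))"
    using assms unfolding coeff_op_def linear_map_on_def series_in_def cst_mult_nth by (intro sum.cong refl) simp
  also have "\<dots> = fps_nth (cst r * \<phi> F) m"
    unfolding fscale_sum[symmetric] cst_mult_nth using assms unfolding coeff_op_def by simp
  finally show "fps_nth (\<phi> (cst r * F)) m = fps_nth (cst r * \<phi> F) m" .
qed

lemma coeff_op_0: "coeff_op \<phi>s \<phi> \<Longrightarrow> \<phi> 0 = 0" for \<phi> :: "('m \<Rightarrow> 'k) fps \<Rightarrow> ('m \<Rightarrow> 'k) fps"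
  using coeff_op_add[of \<phi>s \<phi> 0 0] CS_0 by simp

lemma coeff_op_X:
  assumes \<phi>: "coeff_op \<phi>s \<phi>" and F: "F \<in> CS"
  shows "\<phi> (fps_X * F) = fps_X * \<phi> F"
proof (rule fps_ext)
  fix m
  have \<phi>s0: "\<phi>s i 0 = 0" for i
  proof -
    have "\<phi>s i 0 + \<phi>s i 0 = \<phi>s i (0 + 0)"
      using \<phi> C_0 unfolding coeff_op_def linear_map_on_def by metis
    then show ?thesis by (simp only: add_0 add_cancel_left_left)
  qed
  have "fps_nth (\<phi> (fps_X * F)) m = (\<Sum>i\<le>m. \<phi>s i (fps_nth (fps_X * F) (m - i)))"
    using assms CS_X unfolding coeff_op_def by blast
  also have "\<dots> = fps_nth (fps_X * \<phi> F) m"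
  proof (cases m)
    case (Suc q)
    have "(\<Sum>i\<le>m. \<phi>s i (fps_nth (fps_X * F) (m - i))) = (\<Sum>i\<le>q. \<phi>s i (fps_nth F (q - i))) + \<phi>s (Suc q) 0"
      unfolding Suc sum.atMost_Suc by (intro arg_cong2[of _ _ _ _ "(+)"] sum.cong refl) (auto simp: Suc_diff_le)
    also have "\<dots> = fps_nth (fps_X * \<phi> F) m"
      using \<phi> F unfolding \<phi>s0 coeff_op_def by (simp add: Suc)
    finally show ?thesis .
  qed (simp add: \<phi>s0)
  finally show "fps_nth (\<phi> (fps_X * F)) m = fps_nth (fps_X * \<phi> F) m" .
qed

lemma coeff_op_closed:
  assumes "coeff_op \<phi>s \<phi>" "F \<in> CS" shows "\<phi> F \<in> CS"
proof -
  have "fps_nth (\<phi> F) m \<in> Cinf n A" for m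
  proof -
    have "fps_nth (\<phi> F) m = (\<Sum>i\<le>m. \<phi>s i (fps_nth F (m - i)))" using assms unfolding coeff_op_def by blast
    moreover have "\<phi>s i (fps_nth F k) \<in> Cinf n A" for i k
      using assms unfolding coeff_op_def linear_map_on_def series_in_def by blast
    ultimately show ?thesis by (simp only: C_sum)
  qed
  then show ?thesis by (simp add: series_in_def)
qed

lemma coeff_op_uminus: "coeff_op \<phi>s \<phi> \<Longrightarrow> F \<in> CS \<Longrightarrow> \<phi> (- F) = - \<phi> F"
  using coeff_op_add[of \<phi>s \<phi> F "- F"] coeff_op_0[of \<phi>s \<phi>] CS_uminus[of F] by (simp add: eq_neg_iff_add_eq_0 add.commute)

lemma coeff_op_diff: "coeff_op \<phi>s \<phi> \<Longrightarrow> F \<in> CS \<Longrightarrow> G \<in> CS \<Longrightarrow> \<phi> (F - G) = \<phi> F - \<phi> G"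
  using coeff_op_add[of \<phi>s \<phi> F "- G"] coeff_op_uminus[of \<phi>s \<phi> G] CS_uminus[of G] by simp

lemma coeff_op_sign: "coeff_op \<phi>s \<phi> \<Longrightarrow> F \<in> CS \<Longrightarrow> \<phi> ((-1) ^ k * F) = (-1) ^ k * \<phi> F"
  by (cases "even k") (auto simp: coeff_op_uminus)

lemma coeff_op_sum:
  assumes \<phi>: "coeff_op \<phi>s \<phi>" and F: "\<And>i. i \<in> I \<Longrightarrow> F i \<in> CS"
  shows "\<phi> (\<Sum>i\<in>I. F i) = (\<Sum>i\<in>I. \<phi> (F i))"
  using F by (induction I rule: infinite_finite_induct) (auto simp: coeff_op_0[OF \<phi>] coeff_op_add[OF \<phi>] CS_sum)

lemma \<mu>_left:
  assumes g: "g \<in> Cinf n A"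
  shows "linear_map_on fscale fscale (Cinf n A) (Cinf n A) (\<lambda>f. \<mu> i f g)"
    and "continuous_map CT CT (\<lambda>f. \<mu> i f g)"
proof -
  show "linear_map_on fscale fscale (Cinf n A) (Cinf n A) (\<lambda>f. \<mu> i f g)"
  proof (cases "i = 0")
    case True
    then show ?thesis
      unfolding linear_map_on_def using g by (simp add: \<mu>_0 C_mult C_add C_fscale) (auto simp: fscale_def fun_eq_iff algebra_simps)
  next
    case False
    then have b: "bidifferential n A (\<mu> i)" using \<mu>_bidiff by simp
    then have "f \<in> Cinf n A \<Longrightarrow> \<mu> i f g \<in> Cinf n A" for f using g by (auto simp: bidifferential_def)
    then show ?thesis unfolding linear_map_on_def using bidifferential_left(2,3)[OF atlas b g] by blast
  qed
  show "continuous_map CT CT (\<lambda>f. \<mu> i f g)"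
  proof (cases "i = 0")
    case True
    show ?thesis
      by (rule continuous_map_eq[OF continuous_map_Cinf_mult[OF atlas g]]) (use True g in \<open>auto simp: \<mu>_0 mult.commute\<close>)
  next
    case False
    then show ?thesis using bidifferential_left(1)[OF atlas _ g] \<mu>_bidiff by simp
  qed
qed

lemma \<mu>_right:
  assumes f: "f \<in> Cinf n A"
  shows "linear_map_on fscale fscale (Cinf n A) (Cinf n A) (\<lambda>g. \<mu> i f g)"
    and "continuous_map CT CT (\<lambda>g. \<mu> i f g)"
proof -
  show "linear_map_on fscale fscale (Cinf n A) (Cinf n A) (\<lambda>g. \<mu> i f g)"
  proof (cases "i = 0")
    case True
    then show ?thesis
      unfolding linear_map_on_def using f by (simp add: \<mu>_0 C_mult C_add C_fscale) (auto simp: fscale_def fun_eq_iff algebra_simps)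
  next
    case False
    then have b: "bidifferential n A (\<lambda>g f. \<mu> i f g)" using bidifferential_flip[OF atlas \<mu>_bidiff] by simp
    then have "g \<in> Cinf n A \<Longrightarrow> \<mu> i f g \<in> Cinf n A" for g using f by (auto simp: bidifferential_def)
    then show ?thesis unfolding linear_map_on_def using bidifferential_left(2,3)[OF atlas b f] by blast
  qed
  show "continuous_map CT CT (\<lambda>g. \<mu> i f g)"
  proof (cases "i = 0")
    case True
    show ?thesis
      by (rule continuous_map_eq[OF continuous_map_Cinf_mult[OF atlas f]]) (use True f in \<open>auto simp: \<mu>_0\<close>)
  next
    case False
    then show ?thesis using bidifferential_left(1)[OF atlas bidifferential_flip[OF atlas \<mu>_bidiff] f] by simp
  qed
qed

lemma continuous_linear_sum:
  fixes \<phi> :: "'i \<Rightarrow> ('m \<Rightarrow> 'k) \<Rightarrow> 'm \<Rightarrow> 'k"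
  assumes "\<And>i. i \<in> I \<Longrightarrow> linear_map_on fscale fscale (Cinf n A) (Cinf n A) (\<phi> i)"
    "\<And>i. i \<in> I \<Longrightarrow> continuous_map CT CT (\<phi> i)"
  shows "linear_map_on fscale fscale (Cinf n A) (Cinf n A) (\<lambda>f. \<Sum>i\<in>I. \<phi> i f) \<and> continuous_map CT CT (\<lambda>f. \<Sum>i\<in>I. \<phi> i f)"
  using assms
proof (induction I rule: infinite_finite_induct)
  case (insert i I)
  have IH: "linear_map_on fscale fscale (Cinf n A) (Cinf n A) (\<lambda>f. \<Sum>i\<in>I. \<phi> i f)"
    "continuous_map CT CT (\<lambda>f. \<Sum>i\<in>I. \<phi> i f)" using insert by auto
  have i: "linear_map_on fscale fscale (Cinf n A) (Cinf n A) (\<phi> i)" "continuous_map CT CT (\<phi> i)"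
    using insert by auto
  have "linear_map_on fscale fscale (Cinf n A) (Cinf n A) (\<lambda>f. \<phi> i f + (\<Sum>i\<in>I. \<phi> i f))"
    using IH(1) i(1) unfolding linear_map_on_def by (simp add: C_add fscale_simps(1) add_ac)
  then show ?case
    unfolding sum.insert[OF insert(1,2)] using continuous_map_Cinf_add[OF atlas i(2) IH(2)] by blast
qed (auto simp: linear_map_on_def fscale_simps(3))

definition left_coeff :: "('m \<Rightarrow> 'k) fps \<Rightarrow> nat \<Rightarrow> ('m \<Rightarrow> 'k) \<Rightarrow> 'm \<Rightarrow> 'k" where
  "left_coeff F m g = (\<Sum>a\<le>m. \<mu> a (fps_nth F (m - a)) g)"

definition right_coeff :: "('m \<Rightarrow> 'k) fps \<Rightarrow> nat \<Rightarrow> ('m \<Rightarrow> 'k) \<Rightarrow> 'm \<Rightarrow> 'k" where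
  "right_coeff F m g = (\<Sum>a\<le>m. \<mu> a g (fps_nth F (m - a)))"

text \<open>The terms of the product are grouped by the power of \<open>\<nu>\<close> that comes from \<open>\<mu>\<close> and from \<open>F\<close>.\<close>

lemma coeff_op_left:
  assumes F: "F \<in> CS" shows "coeff_op (left_coeff F) (star \<mu> F)"
  unfolding coeff_op_def
proof (intro conjI ballI allI)
  have *: "linear_map_on fscale fscale (Cinf n A) (Cinf n A) (left_coeff F m) \<and> continuous_map CT CT (left_coeff F m)" for m
    unfolding left_coeff_def[abs_def] by (rule continuous_linear_sum) (use F in \<open>auto simp: series_in_def intro!: \<mu>_right\<close>)
  show "linear_map_on fscale fscale (Cinf n A) (Cinf n A) (left_coeff F m)" "continuous_map CT CT (left_coeff F m)" for m
    using * by auto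
  fix G m
  have "fps_nth (star \<mu> F G) m = (\<Sum>i\<le>m. \<Sum>j\<le>m - i. \<mu> i (fps_nth F j) (fps_nth G (m - i - j)))"
    by (simp add: star_def)
  also have "\<dots> = (\<Sum>k\<le>m. \<Sum>i\<le>k. \<mu> i (fps_nth F (k - i)) (fps_nth G (m - i - (k - i))))"
    by (rule sum_triangle)
  also have "\<dots> = (\<Sum>k\<le>m. left_coeff F k (fps_nth G (m - k)))"
    unfolding left_coeff_def by (intro sum.cong refl) auto
  finally show "fps_nth (star \<mu> F G) m = (\<Sum>k\<le>m. left_coeff F k (fps_nth G (m - k)))" .
qed

lemma coeff_op_right:
  assumes F: "F \<in> CS" shows "coeff_op (right_coeff F) (\<lambda>G. star \<mu> G F)"
  unfolding coeff_op_def
proof (intro conjI ballI allI)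
  have *: "linear_map_on fscale fscale (Cinf n A) (Cinf n A) (right_coeff F m) \<and> continuous_map CT CT (right_coeff F m)" for m
    unfolding right_coeff_def[abs_def] by (rule continuous_linear_sum) (use F in \<open>auto simp: series_in_def intro!: \<mu>_left\<close>)
  show "linear_map_on fscale fscale (Cinf n A) (Cinf n A) (right_coeff F m)" "continuous_map CT CT (right_coeff F m)" for m
    using * by auto
  fix G m
  have "fps_nth (star \<mu> G F) m = (\<Sum>i\<le>m. \<Sum>j\<le>m - i. \<mu> i (fps_nth G j) (fps_nth F (m - i - j)))"
    by (simp add: star_def)
  also have "\<dots> = (\<Sum>i\<le>m. \<Sum>j\<le>m - i. \<mu> i (fps_nth G (m - i - j)) (fps_nth F j))"
  proof (rule sum.cong[OF refl])
    fix i
    show "(\<Sum>j\<le>m - i. \<mu> i (fps_nth G j) (fps_nth F (m - i - j))) = (\<Sum>j\<le>m - i. \<mu> i (fps_nth G (m - i - j)) (fps_nth F j))"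
      by (rule sum.reindex_bij_witness[of _ "\<lambda>j. m - i - j" "\<lambda>j. m - i - j"]) (auto simp del: diff_diff_left)
  qed
  also have "\<dots> = (\<Sum>k\<le>m. \<Sum>i\<le>k. \<mu> i (fps_nth G (m - i - (k - i))) (fps_nth F (k - i)))"
    by (rule sum_triangle)
  also have "\<dots> = (\<Sum>k\<le>m. right_coeff F k (fps_nth G (m - k)))"
    unfolding right_coeff_def by (intro sum.cong refl) auto
  finally show "fps_nth (star \<mu> G F) m = (\<Sum>k\<le>m. right_coeff F k (fps_nth G (m - k)))" .
qed

lemmas star_closed = coeff_op_closed[OF coeff_op_left]

lemma star_cst_left: "F \<in> CS \<Longrightarrow> star \<mu> (cst r) F = cst r * F"
  using coeff_op_cst[OF coeff_op_right, of F 1 r] star_1 CS_1 by simp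

lemma star_cst_right: "F \<in> CS \<Longrightarrow> star \<mu> F (cst r) = cst r * F"
  using coeff_op_cst[OF coeff_op_left, of F 1 r] star_1 CS_1 by simp

lemma fps_nth_star_0: "F \<in> CS \<Longrightarrow> G \<in> CS \<Longrightarrow> fps_nth (star \<mu> F G) 0 = fps_nth F 0 * fps_nth G 0"
  by (simp add: star_def \<mu>_0 series_in_def)

text \<open>The commutator has no constant term, so that the shift divides by \<open>\<nu>\<close> (\<open>X_inner_der\<close>).\<close>

definition inner_der :: "('m \<Rightarrow> 'k) fps \<Rightarrow> ('m \<Rightarrow> 'k) fps \<Rightarrow> ('m \<Rightarrow> 'k) fps" where
  "inner_der F G = fps_shift 1 (star \<mu> F G - star \<mu> G F)"

lemma X_inner_der: "F \<in> CS \<Longrightarrow> G \<in> CS \<Longrightarrow> fps_X * inner_der F G = star \<mu> F G - star \<mu> G F"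
  unfolding inner_der_def
proof (rule fps_ext)
  fix m assume "F \<in> CS" "G \<in> CS"
  then show "fps_nth (fps_X * fps_shift 1 (star \<mu> F G - star \<mu> G F)) m = fps_nth (star \<mu> F G - star \<mu> G F) m"
    by (cases m) (auto simp: fps_nth_star_0 mult.commute)
qed

lemma continuous_linear_diff:
  fixes \<phi> \<psi> :: "('m \<Rightarrow> 'k) \<Rightarrow> 'm \<Rightarrow> 'k"
  assumes "linear_map_on fscale fscale (Cinf n A) (Cinf n A) \<phi>" "continuous_map CT CT \<phi>"
    "linear_map_on fscale fscale (Cinf n A) (Cinf n A) \<psi>" "continuous_map CT CT \<psi>"
  shows "linear_map_on fscale fscale (Cinf n A) (Cinf n A) (\<lambda>f. \<phi> f - \<psi> f)" "continuous_map CT CT (\<lambda>f. \<phi> f - \<psi> f)"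
proof -
  show "linear_map_on fscale fscale (Cinf n A) (Cinf n A) (\<lambda>f. \<phi> f - \<psi> f)"
    using assms(1,3) unfolding linear_map_on_def by (simp add: C_diff fscale_simps(7) add_diff_add)
  have "continuous_map CT CT (\<lambda>f. \<phi> f + fscale (-1) (\<psi> f))"
    by (intro continuous_map_Cinf_add[OF atlas] continuous_map_fscale assms)
  then show "continuous_map CT CT (\<lambda>f. \<phi> f - \<psi> f)" by (simp only: fscale_simps(6)) simp
qed

text \<open>Division by \<open>\<nu>\<close> shifts the coefficients by one. The lost coefficient is zero, since the star product is
  commutative modulo \<open>\<nu>\<close>.\<close>

lemma coeff_op_inner_der:
  assumes F: "F \<in> CS"
  shows "coeff_op (\<lambda>m g. left_coeff F (Suc m) g - right_coeff F (Suc m) g) (inner_der F)"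
  unfolding coeff_op_def
proof (intro conjI ballI allI)
  note L = coeff_op_left[OF F, unfolded coeff_op_def] and R = coeff_op_right[OF F, unfolded coeff_op_def]
  show "linear_map_on fscale fscale (Cinf n A) (Cinf n A) (\<lambda>g. left_coeff F (Suc m) g - right_coeff F (Suc m) g)"
    "continuous_map CT CT (\<lambda>g. left_coeff F (Suc m) g - right_coeff F (Suc m) g)" for m
    using L R by (auto intro!: continuous_linear_diff)
  fix G m assume G: "G \<in> CS"
  have "fps_nth (inner_der F G) m = (\<Sum>i\<le>Suc m. left_coeff F i (fps_nth G (Suc m - i))) - (\<Sum>i\<le>Suc m. right_coeff F i (fps_nth G (Suc m - i)))"
    using L R G by (simp add: inner_der_def)
  also have "\<dots> = (\<Sum>i\<le>Suc m. left_coeff F i (fps_nth G (Suc m - i)) - right_coeff F i (fps_nth G (Suc m - i)))"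
    by (simp only: sum_subtractf)
  also have "\<dots> = (left_coeff F 0 (fps_nth G (Suc m)) - right_coeff F 0 (fps_nth G (Suc m))) +
      (\<Sum>i\<le>m. left_coeff F (Suc i) (fps_nth G (m - i)) - right_coeff F (Suc i) (fps_nth G (m - i)))"
    by (subst sum.atMost_Suc_shift) (simp only: diff_zero diff_Suc_Suc)
  also have "left_coeff F 0 (fps_nth G (Suc m)) - right_coeff F 0 (fps_nth G (Suc m)) = 0"
    using F G by (simp add: left_coeff_def right_coeff_def \<mu>_0 series_in_def mult.commute)
  finally show "fps_nth (inner_der F G) m =
      (\<Sum>i\<le>m. left_coeff F (Suc i) (fps_nth G (m - i)) - right_coeff F (Suc i) (fps_nth G (m - i)))"
    by (simp only: add_0)
qed

lemma V_coeff: "x \<in> V \<Longrightarrow> x S \<in> CS"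
  by (simp add: gelems_def)

lemma V_add: "x \<in> V \<Longrightarrow> y \<in> V \<Longrightarrow> x + y \<in> V"
  and V_diff: "x \<in> V \<Longrightarrow> y \<in> V \<Longrightarrow> x - y \<in> V"
  and V_uminus: "x \<in> V \<Longrightarrow> - x \<in> V"
  and V_0: "0 \<in> V"
  and V_X: "x \<in> V \<Longrightarrow> smul fps_X x \<in> V"
  and V_cst: "x \<in> V \<Longrightarrow> smul (cst r) x \<in> V"
  and V_gder: "x \<in> V \<Longrightarrow> gder i x \<in> V"
  and V_gsign: "x \<in> V \<Longrightarrow> gsign x \<in> V"
  by (auto simp: gelems_def CS_add CS_diff CS_uminus CS_0 CS_X CS_cst CS_sign smul_def gder_def gsign_def all_monomials_def)

lemma V_gwedge: "x \<in> V \<Longrightarrow> i < 2 * l \<Longrightarrow> gwedge i x \<in> V"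
proof -
  assume x: "x \<in> V" and i: "i < 2 * l"
  have "S - {i} \<notin> AM" if "S \<notin> AM" for S using that i by (auto simp: all_monomials_def)
  then show ?thesis using x by (auto simp: gelems_def CS_0 CS_sign gwedge_def)
qed

lemma V_sum: "(\<And>i. i \<in> I \<Longrightarrow> x i \<in> V) \<Longrightarrow> (\<Sum>i\<in>I. x i) \<in> V"
proof (induction I rule: infinite_finite_induct)
  case (insert i I)
  then have "x i \<in> V" "(\<Sum>i\<in>I. x i) \<in> V" by auto
  then show ?case by (simp only: sum.insert[OF insert(1,2)] V_add)
qed (auto simp: V_0 simp flip: zero_fun_def)

lemma V_finite_support: "x \<in> V \<Longrightarrow> finite_support x"
  unfolding gelems_def finite_support_def all_monomials_def using finite_subset by blast

definition lift :: "(('m \<Rightarrow> 'k) fps \<Rightarrow> ('m \<Rightarrow> 'k) fps) \<Rightarrow> (nat set \<Rightarrow> ('m \<Rightarrow> 'k) fps) \<Rightarrow> nat set \<Rightarrow> ('m \<Rightarrow> 'k) fps" where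
  "lift \<phi> x = (\<lambda>S. \<phi> (x S))"

lemma series_op_lift: "coeff_op \<phi>s \<phi> \<Longrightarrow> series_op CT AM (lift \<phi>)"
  unfolding series_op_def lift_def[abs_def] using expansion_coeff_op by blast

lemma lift_V:
  assumes \<phi>: "coeff_op \<phi>s \<phi>" and x: "x \<in> V" shows "lift \<phi> x \<in> V"
  using x coeff_op_closed[OF \<phi>] coeff_op_0[OF \<phi>] by (auto simp: gelems_def lift_def)

text \<open>Maps on the coefficients do not see the monomials and commute with signs.\<close>

lemma lift_linear:
  assumes \<phi>: "coeff_op \<phi>s \<phi>" and x: "x \<in> V"
  shows "y \<in> V \<Longrightarrow> lift \<phi> (x + y) = lift \<phi> x + lift \<phi> y"
    and "y \<in> V \<Longrightarrow> lift \<phi> (x - y) = lift \<phi> x - lift \<phi> y"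
    and "lift \<phi> (smul fps_X x) = smul fps_X (lift \<phi> x)"
    and "lift \<phi> (smul (cst r) x) = smul (cst r) (lift \<phi> x)"
    and "lift \<phi> (gder i x) = gder i (lift \<phi> x)"
    and "lift \<phi> (gwedge i x) = gwedge i (lift \<phi> x)"
    and "lift \<phi> (gsign x) = gsign (lift \<phi> x)"
  using V_coeff[OF x] V_coeff[of y]
  by (auto simp: lift_def fun_eq_iff smul_def gder_def gwedge_def gsign_def coeff_op_add[OF \<phi>] coeff_op_diff[OF \<phi>]
      coeff_op_X[OF \<phi>] coeff_op_cst[OF \<phi>] coeff_op_sign[OF \<phi>] coeff_op_0[OF \<phi>])

lemma lift_additive: "coeff_op \<phi>s \<phi> \<Longrightarrow> additive_over V (lift \<phi>)"
  using V_0 V_add lift_linear(1) unfolding additive_over_def by (auto simp: lift_def coeff_op_0 zero_fun_def)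

lemmas lift_sum = sum_additive_over(2)[OF lift_additive]
lemmas lift_sum3 = sum3_additive_over(2)[OF lift_additive]

end

section \<open>Contractions in the ghost product\<close>

lemma contract_altdef: "contract l t = (\<Sum>d<l. gder (l + d) (gsign (gder2 d t)))"
proof -
  have "(\<lambda>S T. gder (l + a) (\<lambda>S'. (-1) ^ card S' * gder a (t S') T) S) = gder (l + a) (gsign (gder2 a t))" for a
    by (rule ext, rule ext) (simp add: gder_def gsign_def gder2_def)
  then show ?thesis unfolding contract_def by simp
qed

lemma gder2_add: "gder2 d (t + t') = gder2 d t + gder2 d t'"
  and gder2_0 [simp]: "gder2 d 0 = 0"
  and gder2_minus: "gder2 d (- t) = - gder2 d t"
  by (auto simp: gder2_def gder_altdef fun_eq_iff algebra_simps)

lemma contract_add: "contract l (t + t') = contract l t + contract l t'"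
  by (simp only: contract_altdef gder2_add gsign_add gder_add sum.distrib)

lemma contract_0 [simp]: "contract l 0 = 0"
  using contract_add[of l 0 0] by (simp only: add_0 add_cancel_right_right)

lemma contract_minus: "contract l (- t) = - contract l t"
  by (simp only: contract_altdef gder2_minus gsign_minus gder_minus sum_negf)

lemma contract_diff: "contract l (t - t') = contract l t - contract l t'"
  using contract_add[of l t "- t'"] by (simp only: contract_minus add_uminus_conv_diff)

lemma gder2_gwedge: "gder2 d (gwedge i t) = gwedge i (gder2 d t)"
  and gder2_gder: "gder2 d (gder i t) = gder i (gder2 d t)"
  and gder2_gsign: "gder2 d (gsign t) = gsign (gder2 d t)"
  and gder2_gemb: "gder2 d (gemb y) = gemb (gder d y)"
  by (auto simp: gder2_def gwedge_altdef gder_altdef gsign_def gemb_def fun_eq_iff minus_one_power_iff)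

lemma gwedge2_gder: "gwedge2 d (gder i t) = gder i (gwedge2 d t)"
  and gwedge2_gsign: "gwedge2 d (gsign t) = gsign (gwedge2 d t)"
  by (auto simp: gwedge2_def gwedge_altdef gder_altdef gsign_def fun_eq_iff minus_one_power_iff)

lemma gemb2_gder: "gemb2 (gder i y) = gder i (gemb2 y)"
  and gemb2_gsign: "gemb2 (gsign y) = gsign (gemb2 y)"
  and gder2_gemb2 [simp]: "gder2 i (gemb2 y) = 0"
  by (auto simp: gemb2_def gder_altdef gder2_def gsign_def gemb_def fun_eq_iff minus_one_power_iff)

lemma gder2_gwedge2: "gder2 i (gwedge2 k t) = (if i = k then t else 0) - gwedge2 k (gder2 i t)"
  by (rule ext) (simp add: gder2_def gwedge2_def gder_gwedge)

lemma gwedge2_0 [simp]: "gwedge2 i 0 = 0"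
  by (simp add: gwedge2_def fun_eq_iff)

lemma gder2_same [simp]: "gder2 i (gder2 i t) = 0"
  by (simp add: gder2_def fun_eq_iff)

lemma gder_gwedge_other: "i \<noteq> k \<Longrightarrow> gder i (gwedge k x) = - gwedge k (gder i x)"
  by (simp add: gder_gwedge)

lemma gsign_gwedge_gemb:
  "gsign (gwedge a (gemb y)) = - gwedge a (gemb y)"
  "gsign (gwedge a (gwedge b (gemb y))) = gwedge a (gwedge b (gemb y))"
  "gsign (gwedge a (gwedge b (gwedge e (gemb y)))) = - gwedge a (gwedge b (gwedge e (gemb y)))"
  by (simp_all add: gsign_gwedge finite_support_gwedge finite_support_gemb gwedge_minus)

lemma contract_left_linear:
  assumes "a < l" shows "contract l (gwedge a (gemb y)) = 0"
  unfolding contract_altdef gder2_gwedge gder2_gemb gsign_gwedge_gemb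
  by (rule sum.neutral) (use assms in \<open>auto simp: gder_minus gder_gwedge_other\<close>)

lemma contract_left_quad:
  assumes "a < l" "b < l" shows "contract l (gwedge a (gwedge b (gemb y))) = 0"
  unfolding contract_altdef gder2_gwedge gder2_gemb gsign_gwedge_gemb
  by (rule sum.neutral) (use assms in \<open>auto simp: gwedge_minus gder_gwedge_other\<close>)

text \<open>A term of the BRST charge contains at most one antighost, so that at most one contraction is possible if
  it is the left factor.\<close>

lemma contract_left_cubic:
  assumes "a < l" "b < l" "c < l"
  shows "contract l (gwedge a (gwedge b (gwedge (l + c) (gemb y)))) = - gwedge a (gwedge b (gemb (gder c y)))"
proof -
  have "gder (l + d) (gsign (gder2 d (gwedge a (gwedge b (gwedge (l + c) (gemb y)))))) =
      (if d = c then - gwedge a (gwedge b (gemb (gder d y))) else 0)" for d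
  proof -
    have "gder (l + d) (gwedge a (gwedge b (gwedge (l + c) (gemb z)))) =
        (if d = c then gwedge a (gwedge b (gemb z)) else 0)" for z :: "nat set \<Rightarrow> 'a"
    proof -
      have "l + d \<noteq> a" "l + d \<noteq> b" using assms by auto
      then have "gder (l + d) (gwedge a (gwedge b (gwedge (l + c) (gemb z)))) =
          gwedge a (gwedge b (gder (l + d) (gwedge (l + c) (gemb z))))"
        by (simp only: gder_gwedge_other gwedge_minus minus_minus not_False_eq_True)
      then show ?thesis by (simp add: gder_gwedge)
    qed
    then show ?thesis
      unfolding gder2_gwedge gder2_gemb gsign_gwedge_gemb gder_minus by simp
  qed
  then have "contract l (gwedge a (gwedge b (gwedge (l + c) (gemb y)))) =
      (\<Sum>d<l. if d = c then - gwedge a (gwedge b (gemb (gder d y))) else 0)"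
    unfolding contract_altdef by (simp only:)
  also have "\<dots> = - gwedge a (gwedge b (gemb (gder c y)))"
    using assms by (simp only: sum.delta finite_lessThan lessThan_iff if_True)
  finally show ?thesis .
qed

lemma contract_right_1:
  assumes "c \<ge> l" shows "contract l (gwedge2 c (gemb2 y)) = 0"
proof -
  have "gder2 d (gwedge2 c (gemb2 y)) = 0" if "d < l" for d
    using that assms by (simp add: gder2_gwedge2)
  then show ?thesis
    unfolding contract_altdef by (intro sum.neutral) simp
qed

lemma contract_right_ghost:
  assumes "a < l" "\<And>d. d < l \<Longrightarrow> gder2 d t = 0"
  shows "contract l (gwedge2 a t) = gder (l + a) (gsign t)"
proof -
  have "gder (l + d) (gsign (gder2 d (gwedge2 a t))) = (if d = a then gder (l + d) (gsign t) else 0)" if "d < l" for d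
    using assms that by (simp add: gder2_gwedge2)
  then have "contract l (gwedge2 a t) = (\<Sum>d<l. if d = a then gder (l + d) (gsign t) else 0)"
    unfolding contract_altdef by (intro sum.cong refl) simp
  also have "\<dots> = gder (l + a) (gsign t)"
    using assms by (simp only: sum.delta finite_lessThan lessThan_iff if_True)
  finally show ?thesis .
qed

lemma contract_right_2:
  assumes "b < l" "c \<ge> l"
  shows "contract l (gwedge2 b (gwedge2 c (gemb2 y))) = gwedge2 c (gemb2 (gder (l + b) (gsign y)))"
proof -
  have "contract l (gwedge2 b (gwedge2 c (gemb2 y))) = gder (l + b) (gsign (gwedge2 c (gemb2 y)))"
    by (rule contract_right_ghost) (use assms in \<open>auto simp: gder2_gwedge2\<close>)
  then show ?thesis by (simp only: gwedge2_gder gwedge2_gsign gemb2_gder gemb2_gsign)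
qed

lemma contract_right_linear:
  assumes "b < l"
  shows "contract l (gwedge2 b (gemb2 y)) = gemb2 (gder (l + b) (gsign y))"
proof -
  have "contract l (gwedge2 b (gemb2 y)) = gder (l + b) (gsign (gemb2 y))"
    by (rule contract_right_ghost) (use assms in auto)
  then show ?thesis by (simp only: gemb2_gder gemb2_gsign)
qed

lemma contract_gemb2 [simp]: "contract l (gemb2 y) = 0"
  unfolding contract_altdef by (intro sum.neutral) simp

text \<open>As a right factor, the cubic term of the BRST charge offers two ghosts and hence admits two contractions.\<close>

lemma contract_right_3:
  assumes "a < l" "b < l" "c \<ge> l"
  shows "contract l (gwedge2 a (gwedge2 b (gwedge2 c (gemb2 y)))) =
    gwedge2 b (gwedge2 c (gemb2 (gder (l + a) (gsign y)))) - gwedge2 a (gwedge2 c (gemb2 (gder (l + b) (gsign y))))"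
proof -
  have gd: "gder2 d (gwedge2 a (gwedge2 b (gwedge2 c (gemb2 y)))) =
     (if d = a then gwedge2 b (gwedge2 c (gemb2 y)) else 0) - (if d = b then gwedge2 a (gwedge2 c (gemb2 y)) else 0)"
    if "d < l" for d
    using that assms by (simp add: gder2_gwedge2)
  have "gder (l + d) (gsign (gder2 d (gwedge2 a (gwedge2 b (gwedge2 c (gemb2 y)))))) =
     (if d = a then gder (l + d) (gsign (gwedge2 b (gwedge2 c (gemb2 y)))) else 0)
     - (if d = b then gder (l + d) (gsign (gwedge2 a (gwedge2 c (gemb2 y)))) else 0)" if "d < l" for d
    unfolding gd[OF that] gsign_diff gder_diff by (cases "d = a"; cases "d = b") simp_all
  then have "contract l (gwedge2 a (gwedge2 b (gwedge2 c (gemb2 y)))) =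
     (\<Sum>d<l. (if d = a then gder (l + d) (gsign (gwedge2 b (gwedge2 c (gemb2 y)))) else 0)
     - (if d = b then gder (l + d) (gsign (gwedge2 a (gwedge2 c (gemb2 y)))) else 0))"
    unfolding contract_altdef by (intro sum.cong refl) simp
  also have "\<dots> = gder (l + a) (gsign (gwedge2 b (gwedge2 c (gemb2 y)))) - gder (l + b) (gsign (gwedge2 a (gwedge2 c (gemb2 y))))"
    using assms by (simp only: sum_subtractf sum.delta finite_lessThan lessThan_iff if_True)
  finally show ?thesis by (simp only: gwedge2_gder gwedge2_gsign gemb2_gder gemb2_gsign)
qed

text \<open>With a single ghost, the ghost derivative of the second slot can be taken only once.\<close>

lemma contract_contract_1: "contract 1 (contract 1 t) = 0" for t :: "nat set \<Rightarrow> nat set \<Rightarrow> 'c::comm_ring_1"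
proof -
  have c: "contract 1 t = gder 1 (gsign (gder2 0 t))" for t :: "nat set \<Rightarrow> nat set \<Rightarrow> 'c"
    unfolding contract_altdef by simp
  show ?thesis
    unfolding c gder2_gder gder2_gsign gder2_same by simp
qed

text \<open>The ghost product factors through the star tensor of its arguments; this is the second step, which is
  linear.\<close>

definition pair_prod :: "nat \<Rightarrow> (nat set \<Rightarrow> nat set \<Rightarrow> ('m \<Rightarrow> 'k) fps) \<Rightarrow> nat set \<Rightarrow> ('m \<Rightarrow> 'k::field_char_0) fps" where
  "pair_prod l t = gmult (exp_contract l t)"

lemma contract_pow_add: "(contract l ^^ k) (t + t') = (contract l ^^ k) t + (contract l ^^ k) t'"
  by (induction k) (simp_all only: funpow.simps id_apply comp_apply contract_add)

lemma pair_prod_add: "pair_prod l (t + t') = pair_prod l t + pair_prod l t'"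
proof -
  have "exp_contract l (t + t') = exp_contract l t + exp_contract l t'"
    unfolding exp_contract_def contract_pow_add sum.distrib[symmetric]
    by (intro sum.cong refl) (simp add: fun_eq_iff algebra_simps)
  then show ?thesis unfolding pair_prod_def by (simp only: gmult_add)
qed

lemma pair_prod_0 [simp]: "pair_prod l 0 = 0"
  using pair_prod_add[of l 0 0] by (simp only: add_0 add_cancel_right_right)

lemma pair_prod_minus: "pair_prod l (- t) = - pair_prod l t"
  using pair_prod_add[of l t "- t"] by (simp add: eq_neg_iff_add_eq_0 add.commute)

lemma pair_prod_sum: "pair_prod l (\<Sum>a\<in>I. t a) = (\<Sum>a\<in>I. pair_prod l (t a))"
  by (rule sum_additive[of "pair_prod l"]) (rule pair_prod_0, rule pair_prod_add)

text \<open>Of the exponential series three terms survive. For \<open>l < 2\<close> the series is truncated earlier, but then the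
  contractions in question vanish as well.\<close>

lemma pair_prod_expand:
  fixes t :: "nat set \<Rightarrow> nat set \<Rightarrow> ('m \<Rightarrow> 'k::field_char_0) fps"
  assumes t3: "contract l (contract l (contract l t)) = 0"
  shows "pair_prod l t = gmult t - smul (cst 2 * fps_X) (gmult (contract l t))
     + smul (cst 2 * fps_X ^ 2) (gmult (contract l (contract l t)))"
proof -
  define s where "s k = smul2 (cst ((-2) ^ k / fact k) * fps_X ^ k :: ('m \<Rightarrow> 'k) fps) ((contract l ^^ k) t)" for k
  have pow0: "(contract l ^^ k) t = 0" if "k \<ge> 3" for k
  proof -
    define q where "q = k - 3"
    have q: "k = q + 3" unfolding q_def using that by simp
    have "(contract l ^^ 3) t = 0" using t3 by (simp add: numeral_3_eq_3)
    moreover have "(contract l ^^ q) 0 = (0 :: nat set \<Rightarrow> nat set \<Rightarrow> ('m \<Rightarrow> 'k) fps)"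
      by (induction q) (simp_all only: funpow.simps id_apply comp_apply contract_0)
    ultimately show ?thesis unfolding q funpow_add comp_apply by simp
  qed
  \<comment> \<open>the terms that the truncation at \<open>l\<close> omits\<close>
  have pow_gt: "(contract l ^^ k) t = 0" if k: "k \<in> {..2} - {..l}" for k
  proof -
    have "k \<le> 2" "l < k" using k by auto
    then have "l = 0 \<and> k \<ge> 1 \<or> l = 1 \<and> k = 2" by arith
    then consider "l = 0" "k \<ge> 1" | "l = 1" "k = 2" by blast
    then show ?thesis
    proof cases
      case 1
      have "(contract l ^^ 1) t = 0" using 1 by (simp add: contract_def)
      moreover define q where "q = k - 1"
      have q: "k = q + 1" unfolding q_def using 1 by simp
      moreover have "(contract l ^^ q) 0 = (0 :: nat set \<Rightarrow> nat set \<Rightarrow> ('m \<Rightarrow> 'k) fps)"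
        by (induction q) (simp_all only: funpow.simps id_apply comp_apply contract_0)
      ultimately show ?thesis unfolding q funpow_add comp_apply by simp
    qed (simp add: numeral_2_eq_2 contract_contract_1[simplified])
  qed
  have s0: "s k = 0" if "(contract l ^^ k) t = 0" for k
    unfolding s_def that by (simp add: smul2_def smul_def fun_eq_iff)
  have "exp_contract l t = (\<Sum>k\<le>l. s k)"
    unfolding exp_contract_def s_def smul2_def smul_def ..
  also have "\<dots> = (\<Sum>k\<in>{..l} \<inter> {..2}. s k)"
    by (rule sum.mono_neutral_right) (auto intro!: s0 pow0)
  also have "\<dots> = (\<Sum>k\<le>2. s k)"
    by (rule sum.mono_neutral_left) (auto intro!: s0 pow_gt)
  also have "\<dots> = s 0 + s 1 + s 2"
    by (simp only: numeral_2_eq_2 sum.atMost_Suc atMost_0 sum.insert finite.emptyI empty_iff not_False_eq_True sum.empty add_0_right One_nat_def)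
  finally have e: "exp_contract l t = s 0 + s 1 + s 2" .
  have neg: "cst (- 2 :: 'k) = - cst 2" by (simp add: cst_def fps_eq_iff fun_eq_iff)
  have one: "cst 1 = (1 :: ('m \<Rightarrow> 'k) fps)" by (simp add: cst_def one_fun_def)
  have "gmult (s 0) = gmult t"
    unfolding s_def gmult_smul2 by (simp add: smul_def one)
  moreover have "gmult (s 1) = - smul (cst 2 * fps_X) (gmult (contract l t))"
    unfolding s_def gmult_smul2 by (simp add: smul_def neg fun_eq_iff)
  moreover have "gmult (s 2) = smul (cst 2 * fps_X ^ 2) (gmult (contract l (contract l t)))"
    unfolding s_def gmult_smul2 by (simp add: numeral_2_eq_2)
  ultimately show ?thesis
    unfolding pair_prod_def e gmult_add by simp
qed

text \<open>Left multiplication by \<open>\<xi>\<^sub>c\<close> and graded right multiplication by \<open>\<xi>\<^sup>a\<close> for the ghost product. With left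
  multiplication by \<open>\<xi>\<^sup>a\<close> and graded right multiplication by \<open>\<xi>\<^sub>c\<close>, which are the Grassmann ones, they form two mutually
  anticommuting Clifford families with opposite constants \<open>\<plusminus> 2 \<nu>\<close>.\<close>

definition left_antighost :: "nat \<Rightarrow> nat \<Rightarrow> (nat set \<Rightarrow> ('m \<Rightarrow> 'k) fps) \<Rightarrow> nat set \<Rightarrow> ('m \<Rightarrow> 'k::field_char_0) fps" where
  "left_antighost l c x = gwedge (l + c) x + smul (cst 2 * fps_X) (gder c x)"

definition right_ghost :: "nat \<Rightarrow> nat \<Rightarrow> (nat set \<Rightarrow> ('m \<Rightarrow> 'k) fps) \<Rightarrow> nat set \<Rightarrow> ('m \<Rightarrow> 'k::field_char_0) fps" where
  "right_ghost l a x = gwedge a x - smul (cst 2 * fps_X) (gder (l + a) x)"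

lemma smul_simps: "smul k (x + y) = smul k x + smul k y" "smul k (x - y) = smul k x - smul k y"
   "smul k (- x) = - smul k x" "smul k 0 = 0" "smul k (smul q x) = smul (k * q) x" "smul 1 x = x"
   "smul (- k) x = - smul k x" "smul (k + q) x = smul k x + smul q x"
  by (auto simp: smul_def fun_eq_iff algebra_simps)

lemma smul_sum: "smul k (\<Sum>i\<in>I. x i) = (\<Sum>i\<in>I. smul k (x i))"
  by (rule sum_additive[of "smul k"]) (rule smul_simps)+

lemma smul_sum_left: "smul (\<Sum>i\<in>I. k i) x = (\<Sum>i\<in>I. smul (k i) x)"
  by (rule sum_additive[of "\<lambda>k. smul k x"]) (auto simp: smul_simps, simp add: smul_def fun_eq_iff)

lemma cst_simps: "cst (r + q) = cst r + cst q" "cst (r * q) = cst r * cst q" "cst (- r) = - cst r" "cst 0 = 0" "cst 1 = 1"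
  for r q :: "'k::comm_ring_1"
  by (auto simp: cst_def fps_eq_iff fun_eq_iff one_fun_def)

lemma pair_prod_left_linear:
  assumes "a < l" "finite_support y"
  shows "pair_prod l (gwedge a (gemb y)) = gwedge a y"
  using pair_prod_expand[of l "gwedge a (gemb y)"] assms
  by (simp only: contract_left_linear contract_0 gmult_gwedge gmult_gemb gmult_0 smul_simps diff_0_right add_0_right)

lemma pair_prod_left_cubic:
  assumes "a < l" "b < l" "c < l" "finite_support y"
  shows "pair_prod l (gwedge a (gwedge b (gwedge (l + c) (gemb y)))) = gwedge a (gwedge b (left_antighost l c y))"
  using pair_prod_expand[of l "gwedge a (gwedge b (gwedge (l + c) (gemb y)))"] assms
  by (simp only: contract_left_cubic contract_left_quad contract_minus minus_zero contract_0 gmult_gwedge gmult_gemb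
      finite_support_gder gmult_minus gmult_0 smul_simps diff_minus_eq_add add_0_right left_antighost_def gwedge_add gwedge_smul)

lemma pair_prod_right_linear:
  assumes "a < l" "finite_support y"
  shows "pair_prod l (gwedge2 a (gemb2 (gsign y))) = right_ghost l a y"
  using pair_prod_expand[of l "gwedge2 a (gemb2 (gsign y))"] assms
  by (simp only: contract_right_linear contract_gemb2 contract_0 gmult_gwedge2 gemb2_gsign[symmetric] gsign_gsign gmult_gemb2
      finite_support_gder gmult_0 smul_simps add_0_right right_ghost_def)

text \<open>The parity operators make all signs of the second slot disappear, so that the three terms of the
  expansion are those of the product of two operators \<open>right_ghost\<close>.\<close>

lemma pair_prod_right_cubic:
  fixes y :: "nat set \<Rightarrow> ('m \<Rightarrow> 'k::field_char_0) fps"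
  assumes ab: "a < l" "b < l" "l \<le> c" and y: "finite_support y"
  shows "pair_prod l (gwedge2 a (gwedge2 b (gwedge2 c (gemb2 (gsign y))))) = gwedge c (right_ghost l a (right_ghost l b y))"
proof -
  let ?k = "cst 2 * fps_X :: ('m \<Rightarrow> 'k) fps"
  let ?A = "gder (l + a)" and ?B = "gder (l + b)"
  define t where "t = gwedge2 a (gwedge2 b (gwedge2 c (gemb2 (gsign y))))"
  have t1: "contract l t = gwedge2 b (gwedge2 c (gemb2 (?A y))) - gwedge2 a (gwedge2 c (gemb2 (?B y)))"
    unfolding t_def contract_right_3[OF ab] gsign_gsign ..
  have t2: "contract l (contract l t) = gwedge2 c (gemb2 (?B (gsign (?A y)))) - gwedge2 c (gemb2 (?A (gsign (?B y))))"
    unfolding t1 contract_diff contract_right_2[OF ab(2,3)] contract_right_2[OF ab(1,3)] ..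
  have t3: "contract l (contract l (contract l t)) = 0"
    unfolding t2 contract_diff contract_right_1[OF ab(3)] by simp
  note fs = finite_support_gder finite_support_gsign y
  have g0: "gmult t = gwedge a (gwedge b (gwedge c y))"
    unfolding t_def by (simp only: gmult_gwedge2 gwedge2_gsign[symmetric] gemb2_gsign[symmetric] gsign_gsign gmult_gemb2 fs)
  have g1: "gmult (contract l t) = gwedge b (gwedge c (?A y)) - gwedge a (gwedge c (?B y))"
    unfolding t1 by (simp only: gmult_diff gmult_gwedge2 gwedge2_gsign[symmetric] gemb2_gsign[symmetric] gsign_gsign gmult_gemb2 fs)
  have "gsign (?B (gsign (?A y))) = - ?B (?A y)" "gsign (?A (gsign (?B y))) = - ?A (?B y)"
    by (simp_all only: gsign_gder fs gsign_gsign gder_minus gsign_minus minus_minus)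
  then have "gsign (?B (gsign (?A y))) = - ?B (?A y)" "gsign (?A (gsign (?B y))) = - ?A (?B y)" .
  moreover have "gmult (gwedge2 c (gemb2 (?B (gsign (?A y))))) = gwedge c (gsign (?B (gsign (?A y))))"
    "gmult (gwedge2 c (gemb2 (?A (gsign (?B y))))) = gwedge c (gsign (?A (gsign (?B y))))"
    by (simp_all only: gmult_gwedge2 gemb2_gsign[symmetric] gmult_gemb2 fs)
  ultimately have g2: "gmult (contract l (contract l t)) = gwedge c (?A (?B y)) + gwedge c (?A (?B y))"
    unfolding t2 by (simp only: gmult_diff gder_gder[of "l + b" "l + a"] minus_minus gwedge_minus diff_minus_eq_add)
  have ne: "l + a \<noteq> b" using ab by auto
  have w1: "gwedge c (gwedge a (gwedge b y)) = gwedge a (gwedge b (gwedge c y))"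
    by (simp only: gwedge_gwedge[of c a] gwedge_gwedge[of c b] gwedge_minus minus_minus)
  have w2: "gwedge c (gwedge a (?B y)) = - gwedge a (gwedge c (?B y))" by (rule gwedge_gwedge)
  have w3: "gwedge c (?A (gwedge b y)) = gwedge b (gwedge c (?A y))"
    by (simp only: gder_gwedge_other[OF ne] gwedge_minus gwedge_gwedge[of c b] minus_minus)
  have k2: "cst 2 * fps_X ^ 2 + cst 2 * fps_X ^ 2 = ?k * ?k"
  proof -
    have "cst 2 + cst 2 = cst 2 * (cst 2 :: ('m \<Rightarrow> 'k) fps)"
      unfolding cst_simps(1,2)[symmetric] by simp
    then show ?thesis by (simp add: power2_eq_square algebra_simps flip: distrib_right)
  qed
  have "gwedge c (right_ghost l a (right_ghost l b y)) = gwedge a (gwedge b (gwedge c y))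
      + smul ?k (gwedge a (gwedge c (?B y))) - smul ?k (gwedge b (gwedge c (?A y))) + smul (?k * ?k) (gwedge c (?A (?B y)))"
    unfolding right_ghost_def
    by (simp only: gwedge_diff gder_diff gwedge_smul gder_smul smul_simps w1 w2 w3) (simp add: algebra_simps)
  also have "\<dots> = gmult t - smul ?k (gmult (contract l t)) + smul (cst 2 * fps_X ^ 2) (gmult (contract l (contract l t)))"
    unfolding g0 g1 g2 k2[symmetric] by (simp only: smul_simps) (simp add: algebra_simps)
  also have "\<dots> = pair_prod l t" by (rule pair_prod_expand[OF t3, symmetric])
  finally show ?thesis unfolding t_def by simp
qed

section \<open>Multiplication by the BRST charge\<close>

locale brst_data = star_functions n A l \<mu>
  for n :: nat and A :: "'m::{t2_space, second_countable_topology} chart set" and l :: nat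
    and \<mu> :: "nat \<Rightarrow> ('m \<Rightarrow> 'k::real_normed_field) \<Rightarrow> ('m \<Rightarrow> 'k) \<Rightarrow> 'm \<Rightarrow> 'k" +
  fixes f :: "nat \<Rightarrow> nat \<Rightarrow> nat \<Rightarrow> real" and Jb :: "nat \<Rightarrow> ('m \<Rightarrow> 'k) fps"
  assumes Jb_CS: "a < l \<Longrightarrow> Jb a \<in> series_in (Cinf n A)"
    and Jb_commutator: "a < l \<Longrightarrow> b < l \<Longrightarrow>
      star \<mu> (Jb a) (Jb b) - star \<mu> (Jb b) (Jb a) = fps_X * (\<Sum>c<l. cst (of_real (f a b c)) * Jb c)"
    and f_antisym: "a < l \<Longrightarrow> b < l \<Longrightarrow> c < l \<Longrightarrow> f a b c = - f b a c"
    and f_jacobi: "a < l \<Longrightarrow> b < l \<Longrightarrow> d < l \<Longrightarrow> e < l \<Longrightarrow>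
      (\<Sum>s<l. f a b s * f s d e) + (\<Sum>s<l. f b d s * f s a e) + (\<Sum>s<l. f d a s * f s b e) = 0"
begin

abbreviation \<kappa> :: "('m \<Rightarrow> 'k) fps" where "\<kappa> \<equiv> cst 2 * fps_X"

text \<open>The coefficients of the cubic term of \<open>\<theta>\<close>.\<close>

definition g :: "nat \<Rightarrow> nat \<Rightarrow> nat \<Rightarrow> ('m \<Rightarrow> 'k) fps" where
  "g a b c = cst (of_real (- f a b c / 4))"

lemma cst_sum: "(\<Sum>i\<in>I. cst (r i)) = (cst (\<Sum>i\<in>I. r i) :: ('m \<Rightarrow> 'k) fps)" for r :: "'i \<Rightarrow> 'k"
  by (rule sum_additive[of "cst :: 'k \<Rightarrow> ('m \<Rightarrow> 'k) fps", symmetric]) (rule cst_simps)+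

lemma g_antisym: "a < l \<Longrightarrow> b < l \<Longrightarrow> e < l \<Longrightarrow> g a b e = - g b a e"
  using f_antisym[of a b e] by (simp add: g_def cst_simps(3)[symmetric])

lemma g_jacobi:
  assumes "a < l" "b < l" "d < l" "e < l"
  shows "(\<Sum>s<l. g a b s * g s d e) + (\<Sum>s<l. g b d s * g s a e) + (\<Sum>s<l. g d a s * g s b e) = 0"
proof -
  have "(\<Sum>s<l. g a b s * g s d e) = cst (of_real ((\<Sum>s<l. f a b s * f s d e) / 16))" for a b d
    unfolding g_def cst_simps(2)[symmetric] cst_sum by (simp add: sum_divide_distrib)
  then have "(\<Sum>s<l. g a b s * g s d e) + (\<Sum>s<l. g b d s * g s a e) + (\<Sum>s<l. g d a s * g s b e) =
     cst (of_real ((\<Sum>s<l. f a b s * f s d e) / 16 + (\<Sum>s<l. f b d s * f s a e) / 16 + (\<Sum>s<l. f d a s * f s b e) / 16))"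
    by (simp only: cst_simps(1) of_real_add)
  also have "(\<Sum>s<l. f a b s * f s d e) / 16 + (\<Sum>s<l. f b d s * f s a e) / 16 + (\<Sum>s<l. f d a s * f s b e) / 16 = 0"
    using f_jacobi[OF assms] by (simp add: add_divide_distrib[symmetric])
  finally show ?thesis by (simp add: cst_simps)
qed

lemma torsion:
  fixes x :: "nat set \<Rightarrow> ('m \<Rightarrow> 'k) fps"
  shows "x + x = 0 \<Longrightarrow> x = 0" "x + x + x = 0 \<Longrightarrow> x = 0"
proof -
  have z: "fps_nth (x S) m p = 0" if "of_nat (Suc q) * fps_nth (x S) m p = (0::'k)" for S m p q
    using that by (simp only: mult_eq_0_iff of_nat_eq_0_iff) simp
  show "x = 0" if "x + x = 0"
  proof (rule ext, rule fps_ext, rule ext)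
    fix S m p
    have "fps_nth ((x + x) S) m p = 0" unfolding that by simp
    then show "fps_nth (x S) m p = fps_nth (0 S) m p" using z[of 1 S m p] by simp
  qed
  show "x = 0" if "x + x + x = 0"
  proof (rule ext, rule fps_ext, rule ext)
    fix S m p
    have "fps_nth ((x + x + x) S) m p = 0" unfolding that by simp
    moreover have "of_nat (Suc 2) * fps_nth (x S) m p = fps_nth ((x + x + x) S) m p" by simp
    ultimately show "fps_nth (x S) m p = fps_nth (0 S) m p" using z[of 2 S m p] by simp
  qed
qed

text \<open>The families by which \<open>\<theta>\<close> multiplies from the left and from the right. The former is contracted in the antighosts,
  the latter in the ghosts, which accounts for the opposite constants.\<close>

sublocale left: clifford smul l gwedge "left_antighost l" \<kappa> g
proof (intro clifford.intro module_smul clifford_axioms.intro)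
  show "left_antighost l a (left_antighost l b x) = - left_antighost l b (left_antighost l a x)" if "a < l" "b < l" for a b x
  proof -
    have ne: "a \<noteq> l + b" "b \<noteq> l + a" using that by auto
    show ?thesis
      unfolding left_antighost_def
      by (simp only: gwedge_add gder_add gwedge_smul gder_smul smul_simps gwedge_gwedge[of "l + a" "l + b"]
          gder_gder[of a b] gder_gwedge_other[OF ne(1)] gder_gwedge_other[OF ne(2)]) (simp add: algebra_simps)
  qed
  show "left_antighost l a (gwedge b x) = (if a = b then smul \<kappa> x else 0) - gwedge b (left_antighost l a x)" if "a < l" "b < l" for a b x
    unfolding left_antighost_def
    by (cases "a = b") (simp_all only: gwedge_add gder_gwedge gwedge_smul smul_simps gwedge_gwedge[of "l + a" b]
        gwedge_gwedge[of "l + b" b] if_True if_False diff_0 minus_add_distrib, simp_all add: smul_simps algebra_simps)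
qed (auto simp: left_antighost_def gwedge_add gder_add gwedge_smul gder_smul smul_simps mult.commute
    g_jacobi intro: gwedge_gwedge torsion g_antisym simp del: mult_minus_left)

lemma right_ghost_simps: "right_ghost l a (x + y) = right_ghost l a x + right_ghost l a y"
  "right_ghost l a (smul q x) = smul q (right_ghost l a x)"
  by (auto simp: right_ghost_def gwedge_add gder_add gwedge_smul gder_smul smul_simps mult.commute)

sublocale right: clifford smul l "right_ghost l" "\<lambda>a. gwedge (l + a)" "- \<kappa>" g
proof (intro clifford.intro module_smul clifford_axioms.intro)
  show "right_ghost l a (right_ghost l b x) = - right_ghost l b (right_ghost l a x)" if "a < l" "b < l" for a b x
  proof -
    have ne: "l + a \<noteq> b" "l + b \<noteq> a" using that by auto
    show ?thesis
      unfolding right_ghost_def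
      by (simp only: gwedge_diff gder_diff gwedge_smul gder_smul smul_simps gwedge_gwedge[of a b]
          gder_gder[of "l + a" "l + b"] gder_gwedge_other[OF ne(1)] gder_gwedge_other[OF ne(2)]) (simp add: algebra_simps)
  qed
  show "gwedge (l + a) (right_ghost l b x) = (if a = b then smul (- \<kappa>) x else 0) - right_ghost l b (gwedge (l + a) x)"
    if "a < l" "b < l" for a b x
  proof -
    have "gder (l + b) (gwedge (l + a) x) = (if a = b then x else 0) - gwedge (l + a) (gder (l + b) x)"
      by (simp add: gder_gwedge)
    then show ?thesis
      unfolding right_ghost_def
      by (cases "a = b") (simp_all only: gwedge_diff gwedge_smul smul_simps gwedge_gwedge[of "l + a" b]
          gwedge_gwedge[of "l + b" b] if_True if_False diff_0, simp_all add: smul_simps algebra_simps)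
  qed
qed (auto simp: right_ghost_simps gwedge_add gwedge_smul g_jacobi
    intro: gwedge_gwedge torsion g_antisym simp del: mult_minus_left)

text \<open>In the only case in which both operators carry a contraction, the two contributions cancel.\<close>

lemma left_right_anticommute:
  assumes "a < l" "b < l"
  shows "gwedge a (right_ghost l b x) = - right_ghost l b (gwedge a x)"
    and "left_antighost l a (right_ghost l b x) = - right_ghost l b (left_antighost l a x)"
    and "gwedge a (gwedge (l + b) x) = - gwedge (l + b) (gwedge a x)"
    and "left_antighost l a (gwedge (l + b) x) = - gwedge (l + b) (left_antighost l a x)"
proof -
  have ne: "l + b \<noteq> a" "a \<noteq> l + b" using assms by auto
  show "gwedge a (right_ghost l b x) = - right_ghost l b (gwedge a x)"
    unfolding right_ghost_def
    by (simp only: gwedge_diff gwedge_smul gwedge_gwedge[of a b] gder_gwedge_other[OF ne(1)] smul_simps) simp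
  show "gwedge a (gwedge (l + b) x) = - gwedge (l + b) (gwedge a x)" by (rule gwedge_gwedge)
  show "left_antighost l a (gwedge (l + b) x) = - gwedge (l + b) (left_antighost l a x)"
    unfolding left_antighost_def
    by (simp only: gwedge_add gwedge_smul gwedge_gwedge[of "l + a" "l + b"] gder_gwedge_other[OF ne(2)] smul_simps) simp
  have 1: "gder a (gwedge b x) = (if a = b then x else 0) - gwedge b (gder a x)" by (rule gder_gwedge)
  have 2: "gder (l + b) (gwedge (l + a) x) = (if a = b then x else 0) - gwedge (l + a) (gder (l + b) x)"
    by (simp add: gder_gwedge)
  show "left_antighost l a (right_ghost l b x) = - right_ghost l b (left_antighost l a x)"
    unfolding right_ghost_def left_antighost_def
    by (simp only: gwedge_diff gwedge_add gder_diff gder_add gwedge_smul gder_smul smul_simps 1 2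
        gwedge_gwedge[of "l + a" b] gder_gder[of a "l + b"]) (simp add: algebra_simps)
qed

abbreviation lmul :: "nat \<Rightarrow> (nat set \<Rightarrow> ('m \<Rightarrow> 'k) fps) \<Rightarrow> nat set \<Rightarrow> ('m \<Rightarrow> 'k) fps" where
  "lmul a \<equiv> lift (star \<mu> (Jb a))"

abbreviation rmul :: "nat \<Rightarrow> (nat set \<Rightarrow> ('m \<Rightarrow> 'k) fps) \<Rightarrow> nat set \<Rightarrow> ('m \<Rightarrow> 'k) fps" where
  "rmul a \<equiv> lift (\<lambda>F. star \<mu> F (Jb a))"

text \<open>Left and graded right multiplication by \<open>\<theta>\<close> in terms of the two Clifford families (\<open>theta_prod_left\<close>,
  \<open>theta_prod_right\<close>).\<close>

definition left_charge :: "(nat set \<Rightarrow> ('m \<Rightarrow> 'k) fps) \<Rightarrow> nat set \<Rightarrow> ('m \<Rightarrow> 'k) fps" where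
  "left_charge x = left.charge x + (\<Sum>a<l. gwedge a (lmul a x))"

definition right_charge :: "(nat set \<Rightarrow> ('m \<Rightarrow> 'k) fps) \<Rightarrow> nat set \<Rightarrow> ('m \<Rightarrow> 'k) fps" where
  "right_charge x = right.charge x + (\<Sum>a<l. right_ghost l a (rmul a x))"

lemmas lmul_op = coeff_op_left[OF Jb_CS] and rmul_op = coeff_op_right[OF Jb_CS]
lemmas lmul_V = lift_V[OF lmul_op] and rmul_V = lift_V[OF rmul_op]
lemmas lmul_linear = lift_linear[OF lmul_op] and rmul_linear = lift_linear[OF rmul_op]

lemma smul_assoc: "smul (k * q) x = smul k (smul q x)"
  by (simp add: smul_def mult.assoc)

lemma V_kappa: "x \<in> V \<Longrightarrow> smul \<kappa> x \<in> V"
  unfolding smul_assoc by (intro V_cst V_X)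

lemma lift_kappa: "coeff_op \<phi>s \<phi> \<Longrightarrow> x \<in> V \<Longrightarrow> lift \<phi> (smul \<kappa> x) = smul \<kappa> (lift \<phi> x)"
  unfolding smul_assoc by (simp only: lift_linear V_X)

lemma V_ghosts:
  assumes "x \<in> V" "a < l"
  shows "gwedge a x \<in> V" "gwedge (l + a) x \<in> V" "left_antighost l a x \<in> V" "right_ghost l a x \<in> V"
  using assms by (auto simp: left_antighost_def right_ghost_def intro!: V_gwedge V_add V_diff V_kappa V_gder)

lemma V_g: "x \<in> V \<Longrightarrow> smul (g a b c) x \<in> V"
  unfolding g_def by (rule V_cst)

lemma lift_ghosts:
  assumes \<phi>: "coeff_op \<phi>s \<phi>" and x: "x \<in> V" and a: "a < l"
  shows "lift \<phi> (left_antighost l a x) = left_antighost l a (lift \<phi> x)"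
    and "lift \<phi> (right_ghost l a x) = right_ghost l a (lift \<phi> x)"
  unfolding left_antighost_def right_ghost_def using x a
  by (simp_all only: lift_linear[OF \<phi>] lift_kappa[OF \<phi>] V_ghosts V_kappa V_gder)

lemma V_charge: "x \<in> V \<Longrightarrow> left.charge x \<in> V" "x \<in> V \<Longrightarrow> right.charge x \<in> V"
  unfolding left.charge_def left.cubic_def left.trace_part_def right.charge_def right.cubic_def right.trace_part_def
  by (auto intro!: V_diff V_add V_sum V_g V_ghosts V_kappa V_uminus
      simp: smul_sum_left smul_simps(7) simp del: mult_minus_left)

lemma lift_g: "coeff_op \<phi>s \<phi> \<Longrightarrow> x \<in> V \<Longrightarrow> lift \<phi> (smul (g a b c) x) = smul (g a b c) (lift \<phi> x)"
  unfolding g_def by (rule lift_linear(4))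

lemma lift_charge:
  assumes \<phi>: "coeff_op \<phi>s \<phi>" and x: "x \<in> V"
  shows "lift \<phi> (left.charge x) = left.charge (lift \<phi> x)"
    and "lift \<phi> (right.charge x) = right.charge (lift \<phi> x)"
proof -
  have "lift \<phi> (left.cubic x) = left.cubic (lift \<phi> x)"
    unfolding left.cubic_def
    by (subst lift_sum3[OF \<phi>])
      (auto intro!: sum.cong V_g V_ghosts x simp: lift_g[OF \<phi>] lift_linear[OF \<phi>] lift_ghosts[OF \<phi>] V_ghosts x)
  moreover have t: "lift \<phi> (\<Sum>a<l. smul (\<Sum>b<l. g a b b) (y a)) = (\<Sum>a<l. smul (\<Sum>b<l. g a b b) (lift \<phi> (y a)))"
    if "\<And>a. a < l \<Longrightarrow> y a \<in> V" for y
  proof -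
    have "lift \<phi> (\<Sum>a<l. smul (\<Sum>b<l. g a b b) (y a)) = (\<Sum>a<l. lift \<phi> (smul (\<Sum>b<l. g a b b) (y a)))"
      by (rule lift_sum[OF \<phi>]) (use that in \<open>auto simp: smul_sum_left intro!: V_sum V_g\<close>)
    also have "\<dots> = (\<Sum>a<l. smul (\<Sum>b<l. g a b b) (lift \<phi> (y a)))"
    proof (rule sum.cong[OF refl])
      fix a assume "a \<in> {..<l}"
      then have y: "y a \<in> V" using that by simp
      have "lift \<phi> (\<Sum>b<l. smul (g a b b) (y a)) = (\<Sum>b<l. lift \<phi> (smul (g a b b) (y a)))"
        by (rule lift_sum[OF \<phi>]) (rule V_g[OF y])
      then show "lift \<phi> (smul (\<Sum>b<l. g a b b) (y a)) = smul (\<Sum>b<l. g a b b) (lift \<phi> (y a))"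
        by (simp only: smul_sum_left lift_g[OF \<phi> y])
    qed
    finally show ?thesis .
  qed
  then have "lift \<phi> (left.trace_part x) = left.trace_part (lift \<phi> x)"
    unfolding left.trace_part_def by (simp add: V_ghosts x lift_linear[OF \<phi>])
  moreover have V1: "left.cubic x \<in> V" "left.trace_part x \<in> V"
    unfolding left.cubic_def left.trace_part_def smul_sum_left by (auto intro!: V_sum V_g V_ghosts x)
  ultimately show "lift \<phi> (left.charge x) = left.charge (lift \<phi> x)"
    unfolding left.charge_def by (simp only: lift_linear[OF \<phi>] lift_kappa[OF \<phi>] V_kappa)
  have "lift \<phi> (right.cubic x) = right.cubic (lift \<phi> x)"
    unfolding right.cubic_def
    by (subst lift_sum3[OF \<phi>])
      (auto intro!: sum.cong V_g V_ghosts x simp: lift_g[OF \<phi>] lift_linear[OF \<phi>] lift_ghosts[OF \<phi>] V_ghosts x)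
  moreover have "lift \<phi> (right.trace_part x) = right.trace_part (lift \<phi> x)"
    unfolding right.trace_part_def using t by (simp add: V_ghosts x lift_ghosts[OF \<phi>])
  moreover have "right.cubic x \<in> V" "right.trace_part x \<in> V"
    unfolding right.cubic_def right.trace_part_def smul_sum_left by (auto intro!: V_sum V_g V_ghosts x)
  ultimately show "lift \<phi> (right.charge x) = right.charge (lift \<phi> x)"
    unfolding right.charge_def
    by (simp only: smul_simps(7) diff_minus_eq_add lift_linear[OF \<phi>] lift_kappa[OF \<phi>] V_kappa)
qed

lemma lmul_rmul:
  assumes "x \<in> V" "a < l" "b < l"
  shows "lmul a (rmul b x) = rmul b (lmul a x)"
  using assms by (simp add: lift_def star_assoc Jb_CS V_coeff)

text \<open>With this normalisation \<open>moment_charge_square\<close> asks for the commutation relations of a quantum moment map.\<close>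

lemma kappa_g: "\<kappa> * g a b e + \<kappa> * g a b e = - (fps_X * cst (of_real (f a b e)))"
proof -
  have "cst 2 * g a b e + cst 2 * g a b e = cst (2 * of_real (- f a b e / 4) + 2 * of_real (- f a b e / 4))"
    unfolding g_def cst_simps(1,2) ..
  also have "2 * of_real (- f a b e / 4) + 2 * of_real (- f a b e / 4) = (- of_real (f a b e) :: 'k)"
    by (simp add: of_real_divide)
  finally have "cst 2 * g a b e + cst 2 * g a b e = - cst (of_real (f a b e))" by (simp only: cst_simps)
  then have "fps_X * (cst 2 * g a b e + cst 2 * g a b e) = fps_X * - cst (of_real (f a b e))" by simp
  then show ?thesis by (simp add: algebra_simps)
qed

lemma smul_kappa_g:
  "smul \<kappa> (\<Sum>e<l. smul (g a b e) (y e)) + smul \<kappa> (\<Sum>e<l. smul (g a b e) (y e)) =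
    - smul fps_X (\<Sum>e<l. smul (cst (of_real (f a b e))) (y e))"
  unfolding smul_sum smul_simps(5) sum.distrib[symmetric] smul_simps(8)[symmetric] kappa_g
  by (simp only: smul_simps(7) sum_negf)

lemma star_Jb_commutator:
  assumes "a < l" "b < l" "F \<in> CS"
  shows "star \<mu> (Jb a) (star \<mu> (Jb b) F) - star \<mu> (Jb b) (star \<mu> (Jb a) F) =
      fps_X * (\<Sum>c<l. cst (of_real (f a b c)) * star \<mu> (Jb c) F)"
    and "star \<mu> (star \<mu> F (Jb b)) (Jb a) - star \<mu> (star \<mu> F (Jb a)) (Jb b) =
      - (fps_X * (\<Sum>c<l. cst (of_real (f a b c)) * star \<mu> F (Jb c)))"
proof -
  have C: "Jb a \<in> CS" "Jb b \<in> CS" "star \<mu> (Jb a) (Jb b) \<in> CS" "star \<mu> (Jb b) (Jb a) \<in> CS"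
    using assms Jb_CS star_closed by auto
  note R = coeff_op_right[OF assms(3)] and L = coeff_op_left[OF assms(3)]
  have S: "\<And>c. c \<in> {..<l} \<Longrightarrow> cst (of_real (f a b c)) * Jb c \<in> CS" using Jb_CS CS_cst by auto
  have SS: "(\<Sum>c<l. cst (of_real (f a b c)) * Jb c) \<in> CS" by (rule CS_sum) (rule S)
  have "star \<mu> (Jb a) (star \<mu> (Jb b) F) - star \<mu> (Jb b) (star \<mu> (Jb a) F) =
      star \<mu> (star \<mu> (Jb a) (Jb b) - star \<mu> (Jb b) (Jb a)) F"
    using C assms by (simp add: coeff_op_diff[OF R] star_assoc)
  also have "\<dots> = fps_X * (\<Sum>c<l. cst (of_real (f a b c)) * star \<mu> (Jb c) F)"
    unfolding Jb_commutator[OF assms(1,2)]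
    unfolding coeff_op_X[OF R SS] coeff_op_sum[OF R S, of "{..<l}" "\<lambda>c. c", simplified]
    by (intro arg_cong[of _ _ "(*) fps_X"] sum.cong refl coeff_op_cst[OF R] Jb_CS) simp
  finally show "star \<mu> (Jb a) (star \<mu> (Jb b) F) - star \<mu> (Jb b) (star \<mu> (Jb a) F) =
      fps_X * (\<Sum>c<l. cst (of_real (f a b c)) * star \<mu> (Jb c) F)" .
  have "star \<mu> (star \<mu> F (Jb b)) (Jb a) - star \<mu> (star \<mu> F (Jb a)) (Jb b) =
      - star \<mu> F (star \<mu> (Jb a) (Jb b) - star \<mu> (Jb b) (Jb a))"
    using C assms by (simp add: coeff_op_diff[OF L] star_assoc)
  also have "star \<mu> F (star \<mu> (Jb a) (Jb b) - star \<mu> (Jb b) (Jb a)) = fps_X * (\<Sum>c<l. cst (of_real (f a b c)) * star \<mu> F (Jb c))"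
    unfolding Jb_commutator[OF assms(1,2)]
    unfolding coeff_op_X[OF L SS] coeff_op_sum[OF L S, of "{..<l}" "\<lambda>c. c", simplified]
    by (intro arg_cong[of _ _ "(*) fps_X"] sum.cong refl coeff_op_cst[OF L] Jb_CS) simp
  finally show "star \<mu> (star \<mu> F (Jb b)) (Jb a) - star \<mu> (star \<mu> F (Jb a)) (Jb b) =
      - (fps_X * (\<Sum>c<l. cst (of_real (f a b c)) * star \<mu> F (Jb c)))" .
qed

text \<open>Left star multiplication by the quantum moment map represents the Lie algebra up to the factor \<open>\<nu>\<close>, which is what
  \<open>moment_charge_square\<close> asks for.\<close>

lemma left_charge_square:
  assumes x: "x \<in> V" shows "left_charge (left_charge x) = 0"
proof -
  have V_l: "a < l \<Longrightarrow> lmul a x \<in> V" for a by (rule lmul_V[OF _ x])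
  have V_cl: "b \<in> {..<l} \<Longrightarrow> gwedge b (lmul b x) \<in> V" for b by (intro V_ghosts V_l) auto
  show ?thesis
    unfolding left_charge_def
  proof (rule left.moment_charge_square)
    fix a assume a: "a < l"
    show "lmul a (left.charge x) = left.charge (lmul a x)" by (rule lift_charge(1)[OF lmul_op[OF a] x])
    show "lmul a (left.charge x + (\<Sum>b<l. gwedge b (lmul b x))) = lmul a (left.charge x) + (\<Sum>b<l. gwedge b (lmul a (lmul b x)))"
    proof -
      have "lmul a (left.charge x + (\<Sum>b<l. gwedge b (lmul b x))) = lmul a (left.charge x) + lmul a (\<Sum>b<l. gwedge b (lmul b x))"
        by (rule lmul_linear(1)[OF a V_charge(1)[OF x]]) (rule V_sum, rule V_cl)
      also have "lmul a (\<Sum>b<l. gwedge b (lmul b x)) = (\<Sum>b<l. lmul a (gwedge b (lmul b x)))"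
        by (rule lift_sum[OF lmul_op[OF a]]) (rule V_cl)
      also have "\<dots> = (\<Sum>b<l. gwedge b (lmul a (lmul b x)))"
        by (intro sum.cong refl lmul_linear(6)[OF a] V_l) auto
      finally show ?thesis .
    qed
    fix b assume b: "b < l"
    have "lmul a (lmul b x) - lmul b (lmul a x) = smul fps_X (\<Sum>e<l. smul (cst (of_real (f a b e))) (lmul e x))"
      by (rule ext) (simp add: lift_def smul_def sum_apply star_Jb_commutator(1)[OF a b V_coeff[OF x]])
    then show "lmul a (lmul b x) - lmul b (lmul a x) =
        - (smul \<kappa> (\<Sum>e<l. smul (g a b e) (lmul e x)) + smul \<kappa> (\<Sum>e<l. smul (g a b e) (lmul e x)))"
      unfolding smul_kappa_g by simp
  qed
qed

text \<open>Right multiplications represent the opposite algebra; the sign is that of the constant \<open>- \<kappa>\<close>.\<close>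

lemma right_charge_square:
  assumes x: "x \<in> V" shows "right_charge (right_charge x) = 0"
proof -
  have V_r: "a < l \<Longrightarrow> rmul a x \<in> V" for a by (rule rmul_V[OF _ x])
  have V_cr: "b \<in> {..<l} \<Longrightarrow> right_ghost l b (rmul b x) \<in> V" for b by (intro V_ghosts V_r) auto
  show ?thesis
    unfolding right_charge_def
  proof (rule right.moment_charge_square)
    fix a assume a: "a < l"
    show "rmul a (right.charge x) = right.charge (rmul a x)" by (rule lift_charge(2)[OF rmul_op[OF a] x])
    show "rmul a (right.charge x + (\<Sum>b<l. right_ghost l b (rmul b x))) = rmul a (right.charge x) + (\<Sum>b<l. right_ghost l b (rmul a (rmul b x)))"
    proof -
      have "rmul a (right.charge x + (\<Sum>b<l. right_ghost l b (rmul b x))) =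
          rmul a (right.charge x) + rmul a (\<Sum>b<l. right_ghost l b (rmul b x))"
        by (rule rmul_linear(1)[OF a V_charge(2)[OF x]]) (rule V_sum, rule V_cr)
      also have "rmul a (\<Sum>b<l. right_ghost l b (rmul b x)) = (\<Sum>b<l. rmul a (right_ghost l b (rmul b x)))"
        by (rule lift_sum[OF rmul_op[OF a]]) (rule V_cr)
      also have "\<dots> = (\<Sum>b<l. right_ghost l b (rmul a (rmul b x)))"
        by (intro sum.cong refl lift_ghosts(2)[OF rmul_op[OF a]] V_r) auto
      finally show ?thesis .
    qed
    fix b assume b: "b < l"
    have "rmul a (rmul b x) - rmul b (rmul a x) = - smul fps_X (\<Sum>e<l. smul (cst (of_real (f a b e))) (rmul e x))"
      by (rule ext) (simp add: lift_def smul_def sum_apply star_Jb_commutator(2)[OF a b V_coeff[OF x]])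
    then show "rmul a (rmul b x) - rmul b (rmul a x) =
        - (smul (- \<kappa>) (\<Sum>e<l. smul (g a b e) (rmul e x)) + smul (- \<kappa>) (\<Sum>e<l. smul (g a b e) (rmul e x)))"
      by (simp only: smul_simps(7) minus_add_distrib minus_minus smul_kappa_g)
  qed
qed

text \<open>The Clifford generators of the two charges anticommute, and left star multiplications commute with right ones
  by associativity.\<close>

lemma left_right_charge:
  assumes x: "x \<in> V" shows "left_charge (right_charge x) = - right_charge (left_charge x)"
proof -
  let ?l = "\<lambda>x. \<Sum>a<l. gwedge a (lmul a x)" and ?r = "\<lambda>x. \<Sum>a<l. right_ghost l a (rmul a x)"
  have V_l: "a < l \<Longrightarrow> lmul a x \<in> V" for a by (rule lmul_V[OF _ x])
  have V_cl: "b \<in> {..<l} \<Longrightarrow> gwedge b (lmul b x) \<in> V" for b by (intro V_ghosts V_l) auto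
  have V_r: "a < l \<Longrightarrow> rmul a x \<in> V" for a by (rule rmul_V[OF _ x])
  have V_cr: "b \<in> {..<l} \<Longrightarrow> right_ghost l b (rmul b x) \<in> V" for b by (intro V_ghosts V_r) auto
  have anti_c: "right_ghost l a (left.charge y) = - left.charge (right_ghost l a y)"
    and anti_\<Lambda>: "gwedge (l + a) (left.charge y) = - left.charge (gwedge (l + a) y)" if a: "a < l" for a y
  proof -
    show "right_ghost l a (left.charge y) = - left.charge (right_ghost l a y)"
      by (rule left.charge_anticommute)
        (rule right_ghost_simps, rule right_ghost_simps, simp_all only: left_right_anticommute[OF _ a] minus_minus)
    show "gwedge (l + a) (left.charge y) = - left.charge (gwedge (l + a) y)"
      by (rule left.charge_anticommute)
        (rule gwedge_add, rule gwedge_smul, simp_all only: left_right_anticommute[OF _ a] minus_minus)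
  qed
  have qq: "left.charge (right.charge x) = - right.charge (left.charge x)"
    by (rule right.charge_anticommute)
      (rule left.charge_add, rule left.charge_scale, simp_all only: anti_c anti_\<Lambda> minus_minus)
  have anti_c': "gwedge a (right.charge y) = - right.charge (gwedge a y)" if a: "a < l" for a y
    by (rule right.charge_anticommute)
      (rule gwedge_add, rule gwedge_smul, simp_all only: left_right_anticommute[OF a])
  have qr: "left.charge (?r x) = - ?r (left.charge x)"
    unfolding left.charge_sum sum_negf[symmetric]
    by (intro sum.cong refl) (simp add: anti_c lift_charge(1)[OF rmul_op x])
  have lq: "?l (right.charge x) = - right.charge (?l x)"
    unfolding right.charge_sum sum_negf[symmetric]
    by (intro sum.cong refl) (simp add: anti_c' lift_charge(2)[OF lmul_op x])
  have lr: "?l (?r x) = - ?r (?l x)"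
  proof -
    have "?l (?r x) = (\<Sum>a<l. \<Sum>b<l. gwedge a (right_ghost l b (lmul a (rmul b x))))"
    proof (rule sum.cong[OF refl])
      fix a assume "a \<in> {..<l}"
      then have a: "a < l" by simp
      have "lmul a (?r x) = (\<Sum>b<l. right_ghost l b (lmul a (rmul b x)))"
      proof -
        have "lmul a (?r x) = (\<Sum>b<l. lmul a (right_ghost l b (rmul b x)))"
          by (rule lift_sum[OF lmul_op[OF a]]) (rule V_cr)
        also have "\<dots> = (\<Sum>b<l. right_ghost l b (lmul a (rmul b x)))"
          by (intro sum.cong refl lift_ghosts(2)[OF lmul_op[OF a]] V_r) auto
        finally show ?thesis .
      qed
      then show "gwedge a (lmul a (?r x)) = (\<Sum>b<l. gwedge a (right_ghost l b (lmul a (rmul b x))))"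
        by (simp only: gwedge_sum)
    qed
    also have "\<dots> = (\<Sum>b<l. \<Sum>a<l. gwedge a (right_ghost l b (lmul a (rmul b x))))" by (rule sum.swap)
    also have "\<dots> = (\<Sum>b<l. - right_ghost l b (rmul b (?l x)))"
    proof (rule sum.cong[OF refl])
      fix b assume "b \<in> {..<l}"
      then have b: "b < l" by simp
      have "rmul b (?l x) = (\<Sum>a<l. gwedge a (rmul b (lmul a x)))"
      proof -
        have "rmul b (?l x) = (\<Sum>a<l. rmul b (gwedge a (lmul a x)))"
          by (rule lift_sum[OF rmul_op[OF b]]) (rule V_cl)
        also have "\<dots> = (\<Sum>a<l. gwedge a (rmul b (lmul a x)))"
          by (intro sum.cong refl rmul_linear(6)[OF b] V_l) auto
        finally show ?thesis .
      qed
      then have "right_ghost l b (rmul b (?l x)) = (\<Sum>a<l. right_ghost l b (gwedge a (rmul b (lmul a x))))"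
        by (simp only: right.c_sum)
      then show "(\<Sum>a<l. gwedge a (right_ghost l b (lmul a (rmul b x)))) = - right_ghost l b (rmul b (?l x))"
        using b x by (simp add: sum_negf[symmetric] left_right_anticommute lmul_rmul)
    qed
    finally show ?thesis by (simp only: sum_negf)
  qed
  have l_add: "?l (right.charge x + ?r x) = ?l (right.charge x) + ?l (?r x)"
    unfolding sum.distrib[symmetric] gwedge_add[symmetric]
    by (intro sum.cong refl arg_cong[of _ _ "gwedge _"] lmul_linear(1) V_charge x V_sum V_cr) auto
  have r_add: "?r (left.charge x + ?l x) = ?r (left.charge x) + ?r (?l x)"
    unfolding sum.distrib[symmetric] right_ghost_simps(1)[symmetric]
    by (intro sum.cong refl arg_cong[of _ _ "right_ghost l _"] rmul_linear(1) V_charge x V_sum V_cl) auto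
  show ?thesis
    unfolding left_charge_def right_charge_def left.charge_add right.charge_add l_add r_add qq qr lq lr
    by simp
qed

definition tens :: "(nat set \<Rightarrow> ('m \<Rightarrow> 'k) fps) \<Rightarrow> (nat set \<Rightarrow> ('m \<Rightarrow> 'k) fps) \<Rightarrow> nat set \<Rightarrow> nat set \<Rightarrow> ('m \<Rightarrow> 'k) fps" where
  "tens x y = (\<lambda>S T. star \<mu> (x S) (y T))"

lemma brst_prod_tens: "brst_prod l \<mu> x y = pair_prod l (tens x y)"
  by (simp add: brst_prod_def pair_prod_def tens_def)

text \<open>Larger than \<open>V\<close>, so that the terms of \<open>\<theta>\<close> lie in it without bookkeeping of their monomials.\<close>

definition CS_valued :: "(nat set \<Rightarrow> ('m \<Rightarrow> 'k) fps) set" where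
  "CS_valued = {y. \<forall>S. y S \<in> CS}"

lemma V_CS_valued: "x \<in> V \<Longrightarrow> x \<in> CS_valued"
  by (simp add: gelems_def CS_valued_def)

lemma CS_valued_simps: "x \<in> CS_valued \<Longrightarrow> y \<in> CS_valued \<Longrightarrow> x + y \<in> CS_valued" "y \<in> CS_valued \<Longrightarrow> gwedge i y \<in> CS_valued" "F \<in> CS \<Longrightarrow> gemb F \<in> CS_valued" "0 \<in> CS_valued"
  by (auto simp: CS_valued_def CS_add CS_sign CS_0 gwedge_def gemb_def)

lemma CS_valued_sum: "(\<And>i. i \<in> I \<Longrightarrow> y i \<in> CS_valued) \<Longrightarrow> (\<Sum>i\<in>I. y i) \<in> CS_valued"
  by (auto simp: CS_valued_def sum_apply intro!: CS_sum)

lemma tens_add: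
  assumes "x \<in> CS_valued" "y \<in> CS_valued" "z \<in> CS_valued"
  shows "tens (x + y) z = tens x z + tens y z" "tens z (x + y) = tens z x + tens z y"
  using assms by (auto simp: tens_def CS_valued_def fun_eq_iff coeff_op_add[OF coeff_op_left] coeff_op_add[OF coeff_op_right])

lemma tens_0: "z \<in> CS_valued \<Longrightarrow> tens 0 z = 0" "z \<in> CS_valued \<Longrightarrow> tens z 0 = 0"
  by (auto simp: tens_def CS_valued_def fun_eq_iff coeff_op_0[OF coeff_op_left] coeff_op_0[OF coeff_op_right])

lemma tens_additive:
  assumes z: "z \<in> CS_valued"
  shows "additive_over CS_valued (\<lambda>x. tens x z)" "additive_over CS_valued (tens z)"
  unfolding additive_over_def by (intro conjI ballI CS_valued_simps(1,4) tens_0 tens_add z; assumption)+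

lemma tens_sums:
  assumes z: "z \<in> CS_valued" and X: "\<And>a b c. a < l \<Longrightarrow> b < l \<Longrightarrow> c < l \<Longrightarrow> X a b c \<in> CS_valued"
    and Y: "\<And>a. a < l \<Longrightarrow> Y a \<in> CS_valued" and W: "\<And>a b. a < l \<Longrightarrow> b < l \<Longrightarrow> W a b \<in> CS_valued"
  shows "tens ((\<Sum>a<l. \<Sum>b<l. \<Sum>c<l. X a b c) + (\<Sum>a<l. Y a) + (\<Sum>a<l. \<Sum>b<l. W a b)) z =
      (\<Sum>a<l. \<Sum>b<l. \<Sum>c<l. tens (X a b c) z) + (\<Sum>a<l. tens (Y a) z) + (\<Sum>a<l. \<Sum>b<l. tens (W a b) z)"
    and "tens z ((\<Sum>a<l. \<Sum>b<l. \<Sum>c<l. X a b c) + (\<Sum>a<l. Y a) + (\<Sum>a<l. \<Sum>b<l. W a b)) =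
      (\<Sum>a<l. \<Sum>b<l. \<Sum>c<l. tens z (X a b c)) + (\<Sum>a<l. tens z (Y a)) + (\<Sum>a<l. \<Sum>b<l. tens z (W a b))"
proof -
  note h = tens_additive[OF z]
  have C: "(\<Sum>a<l. \<Sum>b<l. \<Sum>c<l. X a b c) \<in> CS_valued" "(\<Sum>a<l. Y a) \<in> CS_valued" "(\<Sum>a<l. \<Sum>b<l. W a b) \<in> CS_valued"
    by (rule sum3_additive_over(1)[OF h(1)] sum_additive_over(1)[OF h(1)] sum2_additive_over(1)[OF h(1)]; use X Y W in simp)+
  show "tens ((\<Sum>a<l. \<Sum>b<l. \<Sum>c<l. X a b c) + (\<Sum>a<l. Y a) + (\<Sum>a<l. \<Sum>b<l. W a b)) z =
      (\<Sum>a<l. \<Sum>b<l. \<Sum>c<l. tens (X a b c) z) + (\<Sum>a<l. tens (Y a) z) + (\<Sum>a<l. \<Sum>b<l. tens (W a b) z)"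
    unfolding tens_add(1)[OF CS_valued_simps(1)[OF C(1,2)] C(3) z] tens_add(1)[OF C(1,2) z]
    by (intro arg_cong2[of _ _ _ _ "(+)"] sum3_additive_over(2)[OF h(1)] sum_additive_over(2)[OF h(1)]
        sum2_additive_over(2)[OF h(1)]) (use X Y W in auto)
  show "tens z ((\<Sum>a<l. \<Sum>b<l. \<Sum>c<l. X a b c) + (\<Sum>a<l. Y a) + (\<Sum>a<l. \<Sum>b<l. W a b)) =
      (\<Sum>a<l. \<Sum>b<l. \<Sum>c<l. tens z (X a b c)) + (\<Sum>a<l. tens z (Y a)) + (\<Sum>a<l. \<Sum>b<l. tens z (W a b))"
    unfolding tens_add(2)[OF CS_valued_simps(1)[OF C(1,2)] C(3) z] tens_add(2)[OF C(1,2) z]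
    by (intro arg_cong2[of _ _ _ _ "(+)"] sum3_additive_over(2)[OF h(2)] sum_additive_over(2)[OF h(2)]
        sum2_additive_over(2)[OF h(2)]) (use X Y W in auto)
qed

lemma tens_gwedge:
  assumes "y \<in> CS_valued" "x \<in> CS_valued"
  shows "tens (gwedge i y) x = gwedge i (tens y x)" "tens x (gwedge i y) = gwedge2 i (tens x y)"
  using assms by (auto simp: tens_def CS_valued_def fun_eq_iff gwedge_def gwedge2_def
      coeff_op_sign[OF coeff_op_left] coeff_op_sign[OF coeff_op_right] coeff_op_0[OF coeff_op_left] coeff_op_0[OF coeff_op_right])

lemma tens_gemb:
  assumes "F \<in> CS" "x \<in> CS_valued"
  shows "tens (gemb F) x = gemb (lift (star \<mu> F) x)" "tens x (gemb F) = gemb2 (lift (\<lambda>G. star \<mu> G F) x)"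
  using assms by (auto simp: tens_def CS_valued_def fun_eq_iff gemb_def gemb2_def lift_def coeff_op_0[OF coeff_op_left] coeff_op_0[OF coeff_op_right])

lemma lift_star_cst: "x \<in> CS_valued \<Longrightarrow> lift (star \<mu> (cst r)) x = smul (cst r) x"
    "x \<in> CS_valued \<Longrightarrow> lift (\<lambda>G. star \<mu> G (cst r)) x = smul (cst r) x"
  by (auto simp: lift_def smul_def CS_valued_def star_cst_left star_cst_right)

lemma lift_star_X_cst: "x \<in> CS_valued \<Longrightarrow> lift (star \<mu> (fps_X * cst r)) x = smul (fps_X * cst r) x"
    "x \<in> CS_valued \<Longrightarrow> lift (\<lambda>G. star \<mu> G (fps_X * cst r)) x = smul (fps_X * cst r) x"
  by (auto simp: lift_def smul_def CS_valued_def star_cst_left star_cst_right mult.assoc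
      coeff_op_X[OF coeff_op_left CS_cst_1] coeff_op_X[OF coeff_op_right CS_cst_1])

abbreviation tr_cst :: "nat \<Rightarrow> nat \<Rightarrow> ('m \<Rightarrow> 'k) fps" where
  "tr_cst a b \<equiv> fps_X * cst (of_real (f a b b / 2))"

lemma tr_cst: "tr_cst a b = - (\<kappa> * g a b b)"
proof -
  have "cst 2 * g a b b = cst (2 * of_real (- f a b b / 4))" unfolding g_def cst_simps(2) ..
  also have "2 * of_real (- f a b b / 4) = (- of_real (f a b b / 2) :: 'k)"
    by (simp add: of_real_divide)
  finally have "cst 2 * g a b b = - cst (of_real (f a b b / 2))" by (simp only: cst_simps)
  then have "fps_X * (cst 2 * g a b b) = fps_X * - cst (of_real (f a b b / 2))" by simp
  then show ?thesis by (simp add: mult_ac)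
qed

abbreviation \<theta> :: "nat set \<Rightarrow> ('m \<Rightarrow> 'k) fps" where "\<theta> \<equiv> theta l f Jb"

lemma theta_altdef: "\<theta> = (\<Sum>a<l. \<Sum>b<l. \<Sum>c<l. gwedge a (gwedge b (gwedge (l + c) (gemb (g a b c)))))
    + (\<Sum>a<l. gwedge a (gemb (Jb a))) + (\<Sum>a<l. \<Sum>b<l. gwedge a (gemb (tr_cst a b)))"
  unfolding theta_def g_def minus_divide_left ..

lemma theta_parts_CS_valued:
  "a < l \<Longrightarrow> gwedge a (gemb (Jb a)) \<in> CS_valued" "gwedge a (gemb (tr_cst a b)) \<in> CS_valued"
  "gwedge a (gwedge b (gwedge (l + c) (gemb (g a b c)))) \<in> CS_valued"
  unfolding g_def by (intro CS_valued_simps Jb_CS CS_X CS_cst_1, assumption?)+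

lemma theta_CS_valued: "\<theta> \<in> CS_valued"
  unfolding theta_altdef by (intro CS_valued_simps(1) CS_valued_sum theta_parts_CS_valued) simp

lemma sum3_cong: "(\<And>a b c. a < l \<Longrightarrow> b < l \<Longrightarrow> c < l \<Longrightarrow> X a b c = Y a b c) \<Longrightarrow>
    (\<Sum>a<l. \<Sum>b<l. \<Sum>c<l. X a b c) = (\<Sum>a<l. \<Sum>b<l. \<Sum>c<(l::nat). Y a b c)"
  by (intro sum.cong refl) auto

lemma trace_term: "(\<Sum>a<l. \<Sum>b<l. smul (tr_cst a b) (y a)) = - smul \<kappa> (\<Sum>a<l. smul (\<Sum>b<l. g a b b) (y a))"
  unfolding tr_cst smul_simps(7) sum_negf smul_sum_left smul_sum smul_simps(5) ..

lemma move_last: "c - k + r = c + r + - k" for c k r :: "'v::ab_group_add"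
  by simp

lemma diff_add3: "(a + b + c) - (a' + b' + c') = (a - a') + (b - b') + (c - c')" for a b c :: "'v::ab_group_add"
  by simp

lemma left_charge_altdef:
  "left_charge x = (\<Sum>a<l. \<Sum>b<l. \<Sum>c<l. smul (g a b c) (gwedge a (gwedge b (left_antighost l c x))))
      + (\<Sum>a<l. gwedge a (lmul a x)) + (\<Sum>a<l. \<Sum>b<l. smul (tr_cst a b) (gwedge a x))"
  unfolding trace_term left_charge_def left.charge_def left.cubic_def left.trace_part_def by (rule move_last)

lemma cancel_middle: "c + k + k + r + - k = c + k + (r :: 'v::ab_group_add)"
  by simp

lemma right_charge_altdef:
  "right_charge x = (\<Sum>a<l. \<Sum>b<l. \<Sum>c<l. smul (g a b c) (gwedge (l + c) (right_ghost l a (right_ghost l b x))))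
      + (\<Sum>a<l. right_ghost l a (rmul a x)) + (\<Sum>a<l. \<Sum>b<l. smul (tr_cst a b) (right_ghost l a x))"
  unfolding right.cubic_reordered trace_term
  unfolding right_charge_def right.charge_def right.trace_part_def[symmetric] smul_simps(7) diff_minus_eq_add
  by (simp only: cancel_middle)

text \<open>The trace term of \<open>\<theta>\<close> is exactly that of \<open>left.charge\<close>.\<close>

lemma theta_prod_left:
  assumes x: "x \<in> V" shows "brst_prod l \<mu> \<theta> x = left_charge x"
proof -
  note xC = V_CS_valued[OF x] and fin = V_finite_support
  have 1: "pair_prod l (tens (gwedge a (gwedge b (gwedge (l + c) (gemb (g a b c))))) x) =
      smul (g a b c) (gwedge a (gwedge b (left_antighost l c x)))" if "a < l" "b < l" "c < l" for a b c
  proof -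
    have "tens (gwedge a (gwedge b (gwedge (l + c) (gemb (g a b c))))) x =
        gwedge a (gwedge b (gwedge (l + c) (gemb (smul (g a b c) x))))"
      unfolding g_def by (simp only: tens_gwedge(1)[OF _ xC] tens_gemb(1)[OF _ xC] CS_valued_simps CS_cst_1 lift_star_cst[OF xC])
    then show ?thesis
      using pair_prod_left_cubic[OF that fin[OF V_g[OF x]]] by (simp only: left.\<Lambda>_scale left.c_scale)
  qed
  have 2: "pair_prod l (tens (gwedge a (gemb (Jb a))) x) = gwedge a (lmul a x)" if a: "a < l" for a
    unfolding tens_gwedge(1)[OF CS_valued_simps(3)[OF Jb_CS[OF a]] xC] tens_gemb(1)[OF Jb_CS[OF a] xC]
    by (rule pair_prod_left_linear[OF a fin[OF lmul_V[OF a x]]])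
  have 3: "pair_prod l (tens (gwedge a (gemb (tr_cst a b))) x) = smul (tr_cst a b) (gwedge a x)" if a: "a < l" for a b
  proof -
    have C: "tr_cst a b \<in> CS" by (intro CS_X CS_cst_1)
    have "smul (tr_cst a b) x \<in> V" unfolding smul_assoc by (intro V_X V_cst x)
    then show ?thesis
      unfolding tens_gwedge(1)[OF CS_valued_simps(3)[OF C] xC] tens_gemb(1)[OF C xC] lift_star_X_cst[OF xC]
      by (simp only: pair_prod_left_linear[OF a fin] gwedge_smul)
  qed
  have t: "tens \<theta> x = (\<Sum>a<l. \<Sum>b<l. \<Sum>c<l. tens (gwedge a (gwedge b (gwedge (l + c) (gemb (g a b c))))) x)
    + (\<Sum>a<l. tens (gwedge a (gemb (Jb a))) x) + (\<Sum>a<l. \<Sum>b<l. tens (gwedge a (gemb (tr_cst a b))) x)"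
    unfolding theta_altdef by (rule tens_sums(1)[OF xC]) (rule theta_parts_CS_valued, assumption?)+
  have "brst_prod l \<mu> \<theta> x = (\<Sum>a<l. \<Sum>b<l. \<Sum>c<l. smul (g a b c) (gwedge a (gwedge b (left_antighost l c x))))
      + (\<Sum>a<l. gwedge a (lmul a x)) + (\<Sum>a<l. \<Sum>b<l. smul (tr_cst a b) (gwedge a x))"
    unfolding brst_prod_tens t pair_prod_add pair_prod_sum
    by (intro arg_cong2[of _ _ _ _ "(+)"] sum3_cong sum.cong refl) (simp_all only: lessThan_iff 1 2 3)
  then show ?thesis unfolding left_charge_altdef .
qed

text \<open>Here the cubic term appears in the opposite order. Of its two additional traces (\<open>cubic_reordered\<close>) the trace
  term of \<open>\<theta>\<close> cancels one, which leaves \<open>right.charge\<close>.\<close>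

lemma theta_prod_right:
  assumes x: "x \<in> V" shows "brst_prod l \<mu> (gsign x) \<theta> = right_charge x"
proof -
  have xs: "gsign x \<in> V" by (rule V_gsign[OF x])
  note xC = V_CS_valued[OF xs] and fin = V_finite_support
  have 1: "pair_prod l (tens (gsign x) (gwedge a (gwedge b (gwedge (l + c) (gemb (g a b c)))))) =
      smul (g a b c) (gwedge (l + c) (right_ghost l a (right_ghost l b x)))" if "a < l" "b < l" "c < l" for a b c
  proof -
    have "tens (gsign x) (gwedge a (gwedge b (gwedge (l + c) (gemb (g a b c))))) =
        gwedge2 a (gwedge2 b (gwedge2 (l + c) (gemb2 (gsign (smul (g a b c) x)))))"
      unfolding g_def
      by (simp only: tens_gwedge(2)[OF _ xC] tens_gemb(2)[OF _ xC] CS_valued_simps CS_cst_1 lift_star_cst[OF xC] gsign_smul)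
    then show ?thesis
      using pair_prod_right_cubic[OF that(1,2) _ fin[OF V_g[OF x]], of "l + c"] by (simp only: right.\<Lambda>_scale right.c_scale le_add1)
  qed
  have 2: "pair_prod l (tens (gsign x) (gwedge a (gemb (Jb a)))) = right_ghost l a (rmul a x)" if a: "a < l" for a
    unfolding tens_gwedge(2)[OF CS_valued_simps(3)[OF Jb_CS[OF a]] xC] tens_gemb(2)[OF Jb_CS[OF a] xC] rmul_linear(7)[OF a x]
    by (rule pair_prod_right_linear[OF a fin[OF rmul_V[OF a x]]])
  have 3: "pair_prod l (tens (gsign x) (gwedge a (gemb (tr_cst a b)))) = smul (tr_cst a b) (right_ghost l a x)" if a: "a < l" for a b
  proof -
    have C: "tr_cst a b \<in> CS" by (intro CS_X CS_cst_1)
    have "smul (tr_cst a b) x \<in> V" unfolding smul_assoc by (intro V_X V_cst x)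
    then show ?thesis
      unfolding tens_gwedge(2)[OF CS_valued_simps(3)[OF C] xC] tens_gemb(2)[OF C xC] lift_star_X_cst[OF xC] gsign_smul[symmetric]
      by (simp only: pair_prod_right_linear[OF a fin] right.c_scale)
  qed
  have t: "tens (gsign x) \<theta> = (\<Sum>a<l. \<Sum>b<l. \<Sum>c<l. tens (gsign x) (gwedge a (gwedge b (gwedge (l + c) (gemb (g a b c))))))
    + (\<Sum>a<l. tens (gsign x) (gwedge a (gemb (Jb a)))) + (\<Sum>a<l. \<Sum>b<l. tens (gsign x) (gwedge a (gemb (tr_cst a b))))"
    unfolding theta_altdef by (rule tens_sums(2)[OF xC]) (rule theta_parts_CS_valued, assumption?)+
  have "brst_prod l \<mu> (gsign x) \<theta> = (\<Sum>a<l. \<Sum>b<l. \<Sum>c<l. smul (g a b c) (gwedge (l + c) (right_ghost l a (right_ghost l b x))))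
      + (\<Sum>a<l. right_ghost l a (rmul a x)) + (\<Sum>a<l. \<Sum>b<l. smul (tr_cst a b) (right_ghost l a x))"
    unfolding brst_prod_tens t pair_prod_add pair_prod_sum
    by (intro arg_cong2[of _ _ _ _ "(+)"] sum3_cong sum.cong refl) (simp_all only: lessThan_iff 1 2 3)
  then show ?thesis unfolding right_charge_altdef .
qed

lemma theta_odd: "parity_part 0 \<theta> = 0" "parity_part 1 \<theta> = \<theta>"
proof -
  have odd: "\<theta> S = 0" if "card S mod 2 = 0" for S
  proof -
    have S: "gsign \<theta> = - \<theta>"
      unfolding theta_altdef gsign_add gsign_sum gsign_gwedge_gemb sum_negf by simp
    have "(-1) ^ card S * \<theta> S = - \<theta> S" using fun_cong[OF S, of S] by (simp add: gsign_def)
    then have "\<theta> S + \<theta> S = 0" using that by (simp add: even_iff_mod_2_eq_zero eq_neg_iff_add_eq_0)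
    then have "(\<lambda>_. \<theta> S) + (\<lambda>_. \<theta> S) = (0 :: nat set \<Rightarrow> ('m \<Rightarrow> 'k) fps)" by (simp add: fun_eq_iff)
    then have "(\<lambda>_. \<theta> S) = (0 :: nat set \<Rightarrow> ('m \<Rightarrow> 'k) fps)" by (rule torsion)
    then show ?thesis by (simp add: fun_eq_iff)
  qed
  show "parity_part 0 \<theta> = 0" by (auto simp: parity_part_def fun_eq_iff odd)
  show "parity_part 1 \<theta> = \<theta>"
  proof
    fix S show "parity_part 1 \<theta> S = \<theta> S"
      using odd[of S] by (cases "card S mod 2 = 0") (auto simp: parity_part_def)
  qed
qed

text \<open>As \<open>\<theta>\<close> is odd, the sign in the commutator is the parity of the other argument.\<close>

lemma graded_commutator_theta:
  assumes x: "x \<in> V" shows "graded_commutator l \<mu> \<theta> x = left_charge x - right_charge x"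
proof -
  have V_p: "parity_part q x \<in> V" for q using x by (auto simp: parity_part_def gelems_def CS_0)
  have x01: "parity_part 0 x + parity_part 1 x = x"
    by (auto simp: parity_part_def fun_eq_iff)
  have xs: "gsign x = parity_part 0 x + - parity_part 1 x"
    by (rule ext) (auto simp: parity_part_def gsign_def minus_one_power_iff even_iff_mod_2_eq_zero)
  have zero: "brst_prod l \<mu> 0 y = 0" "brst_prod l \<mu> y 0 = 0" if "y \<in> V" for y
    unfolding brst_prod_tens tens_0[OF V_CS_valued[OF that]] by simp_all
  have "graded_commutator l \<mu> \<theta> x =
      (brst_prod l \<mu> \<theta> (parity_part 0 x) + brst_prod l \<mu> \<theta> (parity_part 1 x))
      - (brst_prod l \<mu> (parity_part 0 x) \<theta> - brst_prod l \<mu> (parity_part 1 x) \<theta>)"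
    unfolding graded_commutator_def by (simp add: theta_odd theta_odd[unfolded One_nat_def] zero[OF V_p])
  also have "brst_prod l \<mu> \<theta> (parity_part 0 x) + brst_prod l \<mu> \<theta> (parity_part 1 x) = brst_prod l \<mu> \<theta> x"
    unfolding brst_prod_tens pair_prod_add[symmetric] tens_add(2)[OF V_CS_valued[OF V_p] V_CS_valued[OF V_p] theta_CS_valued, symmetric] x01 ..
  also have "brst_prod l \<mu> (parity_part 0 x) \<theta> - brst_prod l \<mu> (parity_part 1 x) \<theta> = brst_prod l \<mu> (gsign x) \<theta>"
  proof -
    have "tens (- parity_part 1 x) \<theta> = - tens (parity_part 1 x) \<theta>"
      using V_CS_valued[OF V_p[of 1]] theta_CS_valued
      by (auto simp: tens_def CS_valued_def fun_eq_iff coeff_op_uminus[OF coeff_op_right])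
    then show ?thesis
      unfolding xs brst_prod_tens tens_add(1)[OF V_CS_valued[OF V_p] V_CS_valued[OF V_uminus[OF V_p]] theta_CS_valued] pair_prod_add
      by (simp only: pair_prod_minus) simp
  qed
  finally show ?thesis by (simp only: theta_prod_left[OF x] theta_prod_right[OF x])
qed

abbreviation D :: "(nat set \<Rightarrow> ('m \<Rightarrow> 'k) fps) \<Rightarrow> nat set \<Rightarrow> ('m \<Rightarrow> 'k) fps" where
  "D \<equiv> brst_differential l \<mu> f Jb"

abbreviation qk :: "(nat set \<Rightarrow> ('m \<Rightarrow> 'k) fps) \<Rightarrow> nat set \<Rightarrow> ('m \<Rightarrow> 'k) fps" where
  "qk \<equiv> quantum_koszul l \<mu> f Jb"

text \<open>The part of \<open>D\<close> that preserves the number of antighosts.\<close>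

definition delta :: "(nat set \<Rightarrow> ('m \<Rightarrow> 'k) fps) \<Rightarrow> nat set \<Rightarrow> ('m \<Rightarrow> 'k) fps" where
  "delta x = (\<Sum>a<l. gwedge a (lift (inner_der (Jb a)) x)) +
     (\<Sum>a<l. \<Sum>b<l. \<Sum>c<l. smul (cst 2 * g a b c) (gwedge a (gwedge b (gder c x))
        + gwedge b (gwedge (l + c) (gder (l + a) x)) - gwedge a (gwedge (l + c) (gder (l + b) x))))"

lemma qk_altdef: "qk x = (\<Sum>a<l. rmul a (gder (l + a) x)) + (\<Sum>a<l. \<Sum>b<l. smul (tr_cst a b) (gder (l + a) x))
     + (\<Sum>a<l. \<Sum>b<l. \<Sum>c<l. smul (fps_X * cst (of_real (f a b c / 2))) (gwedge (l + c) (gder (l + a) (gder (l + b) x))))"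
  unfolding quantum_koszul_def lift_def smul_def ..

lemma right_ghost_cubic:
  assumes "a < l" "b < l"
  shows "gwedge (l + c) (right_ghost l a (right_ghost l b x)) = gwedge a (gwedge b (gwedge (l + c) x))
      + smul \<kappa> (gwedge a (gwedge (l + c) (gder (l + b) x))) - smul \<kappa> (gwedge b (gwedge (l + c) (gder (l + a) x)))
      + smul (\<kappa> * \<kappa>) (gwedge (l + c) (gder (l + a) (gder (l + b) x)))"
proof -
  have ne: "l + a \<noteq> b" using assms by auto
  have w1: "gwedge (l + c) (gwedge a (gwedge b x)) = gwedge a (gwedge b (gwedge (l + c) x))"
    by (simp only: gwedge_gwedge[of "l + c" a] gwedge_gwedge[of "l + c" b] gwedge_minus minus_minus)
  have w2: "gwedge (l + c) (gwedge a (gder (l + b) x)) = - gwedge a (gwedge (l + c) (gder (l + b) x))" by (rule gwedge_gwedge)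
  have w3: "gwedge (l + c) (gder (l + a) (gwedge b x)) = gwedge b (gwedge (l + c) (gder (l + a) x))"
    by (simp only: gder_gwedge_other[OF ne] gwedge_minus gwedge_gwedge[of "l + c" b] minus_minus)
  show ?thesis
    unfolding right_ghost_def
    by (simp only: gwedge_diff gder_diff gwedge_smul gder_smul smul_simps w1 w2 w3) (simp add: algebra_simps)
qed

text \<open>The uncontracted terms of the two cubic expressions cancel. Their single contractions and the star
  commutators form \<open>delta\<close>; the contractions of the linear terms and the double contraction of the cubic
  term form the deformed Koszul differential.\<close>

lemma X_delta_qk:
  assumes x: "x \<in> V"
  shows "smul fps_X (delta x + smul (cst 2) (qk x)) = left_charge x - right_charge x"
proof -
  have gf: "- g a b c * \<kappa> * \<kappa> = fps_X * cst 2 * (fps_X * cst (of_real (f a b c / 2)))" for a b c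
  proof -
    have "- g a b c * cst 2 = cst (of_real (f a b c / 2))"
      unfolding g_def cst_simps(2,3)[symmetric] by (rule arg_cong[of _ _ cst]) (simp add: of_real_divide)
    then have "- g a b c * cst 2 * (fps_X * cst 2 * fps_X) = cst (of_real (f a b c / 2)) * (fps_X * cst 2 * fps_X)" by (simp only:)
    then show ?thesis by (simp only: mult_ac)
  qed
  have cubic: "smul (g a b c) (gwedge a (gwedge b (left_antighost l c x))) - smul (g a b c) (gwedge (l + c) (right_ghost l a (right_ghost l b x)))
      = smul fps_X (smul (cst 2 * g a b c) (gwedge a (gwedge b (gder c x))
        + gwedge b (gwedge (l + c) (gder (l + a) x)) - gwedge a (gwedge (l + c) (gder (l + b) x)))
        + smul (cst 2) (smul (fps_X * cst (of_real (f a b c / 2))) (gwedge (l + c) (gder (l + a) (gder (l + b) x)))))"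
    if "a < l" "b < l" for a b c
  proof -
    have "smul (g a b c) (gwedge a (gwedge b (left_antighost l c x))) - smul (g a b c) (gwedge (l + c) (right_ghost l a (right_ghost l b x)))
      = smul (g a b c * \<kappa>) (gwedge a (gwedge b (gder c x)) + gwedge b (gwedge (l + c) (gder (l + a) x)) - gwedge a (gwedge (l + c) (gder (l + b) x)))
        + smul (- g a b c * \<kappa> * \<kappa>) (gwedge (l + c) (gder (l + a) (gder (l + b) x)))"
      unfolding right_ghost_cubic[OF that] left_antighost_def gwedge_add gwedge_smul
      by (simp only: smul_simps mult_minus_left) (simp add: algebra_simps)
    then show ?thesis
      unfolding gf by (simp only: smul_simps mult_ac)
  qed
  have linear: "gwedge a (lmul a x) - right_ghost l a (rmul a x) =
      smul fps_X (gwedge a (lift (inner_der (Jb a)) x) + smul (cst 2) (rmul a (gder (l + a) x)))" if a: "a < l" for a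
  proof -
    have "smul fps_X (lift (inner_der (Jb a)) x) = lmul a x - rmul a x"
      by (rule ext) (simp add: smul_def lift_def X_inner_der[OF Jb_CS[OF a] V_coeff[OF x]])
    then have "gwedge a (smul fps_X (lift (inner_der (Jb a)) x)) = gwedge a (lmul a x) - gwedge a (rmul a x)"
      by (simp only: gwedge_diff)
    then show ?thesis
      unfolding right_ghost_def rmul_linear(5)[OF a x] gwedge_smul by (simp only: smul_simps mult.commute) simp
  qed
  have trace: "smul (tr_cst a b) (gwedge a x) - smul (tr_cst a b) (right_ghost l a x) =
      smul fps_X (smul (cst 2) (smul (tr_cst a b) (gder (l + a) x)))" for a b
    unfolding right_ghost_def by (simp only: smul_simps mult_ac) simp
  have "left_charge x - right_charge x =
      ((\<Sum>a<l. \<Sum>b<l. \<Sum>c<l. smul (g a b c) (gwedge a (gwedge b (left_antighost l c x)))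
          - smul (g a b c) (gwedge (l + c) (right_ghost l a (right_ghost l b x)))))
      + (\<Sum>a<l. gwedge a (lmul a x) - right_ghost l a (rmul a x))
      + (\<Sum>a<l. \<Sum>b<l. smul (tr_cst a b) (gwedge a x) - smul (tr_cst a b) (right_ghost l a x))"
    unfolding left_charge_altdef right_charge_altdef sum_subtractf by (rule diff_add3)
  also have "\<dots> = (\<Sum>a<l. \<Sum>b<l. \<Sum>c<l. smul fps_X (smul (cst 2 * g a b c) (gwedge a (gwedge b (gder c x))
        + gwedge b (gwedge (l + c) (gder (l + a) x)) - gwedge a (gwedge (l + c) (gder (l + b) x)))
        + smul (cst 2) (smul (fps_X * cst (of_real (f a b c / 2))) (gwedge (l + c) (gder (l + a) (gder (l + b) x))))))
      + (\<Sum>a<l. smul fps_X (gwedge a (lift (inner_der (Jb a)) x) + smul (cst 2) (rmul a (gder (l + a) x))))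
      + (\<Sum>a<l. \<Sum>b<l. smul fps_X (smul (cst 2) (smul (tr_cst a b) (gder (l + a) x))))"
    by (intro arg_cong2[of _ _ _ _ "(+)"] sum3_cong sum.cong refl) (simp_all only: lessThan_iff cubic linear trace)
  also have "\<dots> = smul fps_X (delta x + smul (cst 2) (qk x))"
    unfolding delta_def qk_altdef by (simp only: smul_sum smul_simps(1) sum.distrib add_ac)
  finally show ?thesis by (rule sym)
qed

lemma D_altdef:
  assumes x: "x \<in> V" shows "D x = delta x + smul (cst 2) (qk x)"
proof
  fix S
  have "graded_commutator l \<mu> \<theta> x S = smul fps_X (delta x + smul (cst 2) (qk x)) S"
    unfolding graded_commutator_theta[OF x] X_delta_qk[OF x] ..
  then show "D x S = (delta x + smul (cst 2) (qk x)) S"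
    by (simp only: brst_differential_def smul_apply) (rule fps_ext, simp)
qed

lemma X_D: "x \<in> V \<Longrightarrow> smul fps_X (D x) = left_charge x - right_charge x"
  by (simp only: D_altdef X_delta_qk)

lemma series_op_rmul: "a < l \<Longrightarrow> series_op CT AM (rmul a)" and series_op_lmul: "a < l \<Longrightarrow> series_op CT AM (lmul a)"
  by (rule series_op_lift[OF rmul_op], assumption, rule series_op_lift[OF lmul_op], assumption)

lemma series_op_gwedge': "i < 2 * l \<Longrightarrow> series_op X I T \<Longrightarrow> series_op X I (\<lambda>x. gwedge i (T x))" for T :: "_ \<Rightarrow> _ \<Rightarrow> ('m \<Rightarrow> 'k) fps"
  by (rule series_op_comp[OF _ series_op_gwedge])

lemma series_op_gder': "series_op X I T \<Longrightarrow> series_op X I (\<lambda>x. gder i (T x))" for T :: "_ \<Rightarrow> _ \<Rightarrow> ('m \<Rightarrow> 'k) fps"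
  by (rule series_op_comp[OF _ series_op_gder])

lemma series_op_delta: "series_op CT AM delta"
proof -
  have 1: "series_op CT AM (\<lambda>x :: nat set \<Rightarrow> ('m \<Rightarrow> 'k) fps. gwedge a (lift (inner_der (Jb a)) x))" if "a < l" for a
    by (rule series_op_gwedge'[OF _ series_op_lift[OF coeff_op_inner_der[OF Jb_CS[OF that]]]]) (use that in simp)
  have 2: "series_op CT AM (\<lambda>x :: nat set \<Rightarrow> ('m \<Rightarrow> 'k) fps. smul (cst 2 * g a b c) (gwedge a (gwedge b (gder c x))
        + gwedge b (gwedge (l + c) (gder (l + a) x)) - gwedge a (gwedge (l + c) (gder (l + b) x))))"
    if "a < l" "b < l" "c < l" for a b c
  proof -
    have i: "a < 2 * l" "b < 2 * l" "l + c < 2 * l" using that by auto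
    note s = series_op_gwedge'[OF i(1)] series_op_gwedge'[OF i(2)] series_op_gwedge'[OF i(3)]
    have "series_op CT AM (\<lambda>x :: nat set \<Rightarrow> ('m \<Rightarrow> 'k) fps. gwedge a (gwedge b (gder c x)))" by (rule s, rule s, rule series_op_gder)
    moreover have "series_op CT AM (\<lambda>x :: nat set \<Rightarrow> ('m \<Rightarrow> 'k) fps. gwedge b (gwedge (l + c) (gder (l + a) x)))" by (rule s, rule s, rule series_op_gder)
    moreover have "series_op CT AM (\<lambda>x :: nat set \<Rightarrow> ('m \<Rightarrow> 'k) fps. gwedge a (gwedge (l + c) (gder (l + b) x)))" by (rule s, rule s, rule series_op_gder)
    ultimately show ?thesis
      unfolding g_def cst_simps(2)[symmetric] by (rule series_op_smul(1)[OF series_op_diff[OF series_op_add]])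
  qed
  show ?thesis
    unfolding delta_def[abs_def]
    by (rule series_op_add; rule series_op_sum) (use 1 2 in \<open>auto intro!: series_op_sum\<close>)
qed

lemma series_op_qk: "series_op CT AM qk"
proof -
  have 1: "series_op CT AM (\<lambda>x :: nat set \<Rightarrow> ('m \<Rightarrow> 'k) fps. rmul a (gder (l + a) x))" if "a < l" for a
    by (rule series_op_comp[OF series_op_gder series_op_rmul[OF that]])
  have 2: "series_op CT AM (\<lambda>x :: nat set \<Rightarrow> ('m \<Rightarrow> 'k) fps. smul (tr_cst a b) (gder (l + a) x))" for a b
    unfolding smul_assoc by (rule series_op_smul(2)[OF series_op_smul(1)[OF series_op_gder]])
  have 3: "series_op CT AM (\<lambda>x :: nat set \<Rightarrow> ('m \<Rightarrow> 'k) fps. smul (fps_X * cst (of_real (f a b c / 2))) (gwedge (l + c) (gder (l + a) (gder (l + b) x))))"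
    if "c < l" for a b c
    unfolding smul_assoc using that
    by (intro series_op_smul(2)[OF series_op_smul(1)] series_op_gwedge' series_op_gder'[OF series_op_gder]) simp
  show ?thesis
    unfolding qk_altdef[abs_def]
    by (rule series_op_add, rule series_op_add; rule series_op_sum) (use 1 2 3 in \<open>auto intro!: series_op_sum\<close>)
qed

lemma series_op_D: "series_op CT AM D"
  by (rule series_op_cong[OF series_op_add[OF series_op_delta series_op_smul(1)[OF series_op_qk]]]) (simp add: D_altdef)

lemma D_V: "x \<in> V \<Longrightarrow> D x \<in> V"
  using series_op_closed[OF series_op_D, of x] by simp

lemma fps_X_mult_eq_0: "fps_X * F = 0 \<Longrightarrow> F = 0" for F :: "'a::comm_ring_1 fps"
proof (rule fps_ext)
  fix m assume "fps_X * F = 0"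
  then have "fps_nth (fps_X * F) (Suc m) = 0" by simp
  then show "fps_nth F m = fps_nth 0 m" by simp
qed

text \<open>The operator \<open>\<nu> D\<close> is the difference of two anticommuting operators of square zero.\<close>

lemma D_D:
  assumes x: "x \<in> V" shows "D (D x) = 0"
proof -
  have lr: "left_charge x \<in> V" "right_charge x \<in> V"
    unfolding left_charge_def right_charge_def
    by (auto intro!: V_add V_charge V_sum V_ghosts lmul_V rmul_V x)
  have lin: "left_charge (y - z) = left_charge y - left_charge z" "right_charge (y - z) = right_charge y - right_charge z"
    if y: "y \<in> V" and z: "z \<in> V" for y z
  proof -
    have "left_charge (y - z) = left.charge (y - z) + (\<Sum>a<l. gwedge a (lmul a y) - gwedge a (lmul a z))"
      unfolding left_charge_def
      by (intro arg_cong2[of _ _ _ _ "(+)"] sum.cong refl) (simp only: lessThan_iff lmul_linear(2)[OF _ y z] gwedge_diff)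
    also have "left.charge (y - z) = left.charge y - left.charge z"
      using left.charge_add[of "y - z" z] unfolding diff_add_cancel eq_diff_eq by (rule sym)
    finally show "left_charge (y - z) = left_charge y - left_charge z"
      unfolding left_charge_def sum_subtractf by (simp only: add_diff_add)
    have "right_charge (y - z) = right.charge (y - z) + (\<Sum>a<l. right_ghost l a (rmul a y) - right_ghost l a (rmul a z))"
      unfolding right_charge_def
      by (intro arg_cong2[of _ _ _ _ "(+)"] sum.cong refl) (simp only: lessThan_iff rmul_linear(2)[OF _ y z] right.c_diff)
    also have "right.charge (y - z) = right.charge y - right.charge z"
      using right.charge_add[of "y - z" z] unfolding diff_add_cancel eq_diff_eq by (rule sym)
    finally show "right_charge (y - z) = right_charge y - right_charge z"
      unfolding right_charge_def sum_subtractf by (simp only: add_diff_add)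
  qed
  have X: "left_charge (smul fps_X y) = smul fps_X (left_charge y)" "right_charge (smul fps_X y) = smul fps_X (right_charge y)"
    if y: "y \<in> V" for y
    unfolding left_charge_def right_charge_def left.charge_scale right.charge_scale smul_simps(1) smul_sum
    by (intro arg_cong2[of _ _ _ _ "(+)"] sum.cong refl;
        simp only: lessThan_iff lmul_linear(3)[OF _ y] rmul_linear(3)[OF _ y] gwedge_smul right.c_scale)+
  have "smul fps_X (smul fps_X (D (D x))) = left_charge (smul fps_X (D x)) - right_charge (smul fps_X (D x))"
    by (simp only: X_D[OF D_V[OF x]] X[OF D_V[OF x]] smul_simps(2))
  also have "\<dots> = 0"
    unfolding X_D[OF x] lin[OF lr] left_charge_square[OF x] right_charge_square[OF x] left_right_charge[OF x] by simp
  finally have "fps_X * (fps_X * D (D x) S) = 0" for S by (auto simp: smul_def fun_eq_iff)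
  then have "D (D x) S = 0" for S
    by (rule fps_X_mult_eq_0[OF fps_X_mult_eq_0])
  then show ?thesis by (simp add: fun_eq_iff)
qed

end

section \<open>The perturbation lemma\<close>

text \<open>The setting of the perturbation lemma: a contraction for \<open>D0\<close> with the side conditions, and a second
  differential \<open>D\<close> such that \<open>id + (D - D0) k\<close> is invertible with inverse \<open>U\<close>.\<close>

locale perturbation =
  fixes V :: "'a::ab_group_add set" and C :: "'c::ab_group_add set"
    and D D0 k U :: "'a \<Rightarrow> 'a" and i :: "'c \<Rightarrow> 'a" and r :: "'a \<Rightarrow> 'c"
  assumes V_add: "x \<in> V \<Longrightarrow> y \<in> V \<Longrightarrow> x + y \<in> V" and V_diff: "x \<in> V \<Longrightarrow> y \<in> V \<Longrightarrow> x - y \<in> V"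
    and D_V: "x \<in> V \<Longrightarrow> D x \<in> V" and D0_V: "x \<in> V \<Longrightarrow> D0 x \<in> V" and k_V: "x \<in> V \<Longrightarrow> k x \<in> V"
    and U_V: "x \<in> V \<Longrightarrow> U x \<in> V" and i_V: "z \<in> C \<Longrightarrow> i z \<in> V" and r_C: "x \<in> V \<Longrightarrow> r x \<in> C"
    and D_add: "x \<in> V \<Longrightarrow> y \<in> V \<Longrightarrow> D (x + y) = D x + D y"
    and D0_add: "x \<in> V \<Longrightarrow> y \<in> V \<Longrightarrow> D0 (x + y) = D0 x + D0 y"
    and k_add: "x \<in> V \<Longrightarrow> y \<in> V \<Longrightarrow> k (x + y) = k x + k y"
    and U_add: "x \<in> V \<Longrightarrow> y \<in> V \<Longrightarrow> U (x + y) = U x + U y"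
    and r_add: "x \<in> V \<Longrightarrow> y \<in> V \<Longrightarrow> r (x + y) = r x + r y"
    and i_0: "i 0 = 0"
    and D_D: "x \<in> V \<Longrightarrow> D (D x) = 0" and D0_D0: "x \<in> V \<Longrightarrow> D0 (D0 x) = 0"
    and r_D0: "x \<in> V \<Longrightarrow> r (D0 x) = 0" and D0_i: "z \<in> C \<Longrightarrow> D0 (i z) = 0"
    and r_i: "z \<in> C \<Longrightarrow> r (i z) = z"
    and homotopy: "x \<in> V \<Longrightarrow> x - i (r x) = D0 (k x) + k (D0 x)"
    and k_k: "x \<in> V \<Longrightarrow> k (k x) = 0" and k_i: "z \<in> C \<Longrightarrow> k (i z) = 0" and r_k: "x \<in> V \<Longrightarrow> r (k x) = 0"
    and U_right: "x \<in> V \<Longrightarrow> U x + (D (k (U x)) - D0 (k (U x))) = x"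
    and U_left: "x \<in> V \<Longrightarrow> U (x + (D (k x) - D0 (k x))) = x"
begin

definition "t x = D x - D0 x"
definition "H x = k (U x)"
definition "res x = r (U x)"
definition "\<Phi> z = i z - H (t (i z))"
definition "B x = x + t (k x)"

lemma additive_on:
  assumes "\<And>x y. x \<in> V \<Longrightarrow> y \<in> V \<Longrightarrow> F (x + y) = F x + (F y :: 'b::ab_group_add)" "x \<in> V" "y \<in> V"
  shows "F 0 = 0" "F (x - y) = F x - F y"
proof -
  have 0: "0 \<in> V" using V_diff[OF assms(2) assms(2)] by simp
  show "F 0 = 0" using assms(1)[OF 0 0] by simp
  show "F (x - y) = F x - F y" using assms(1)[OF V_diff[OF assms(2,3)] assms(3)] by simp
qed

lemma D_lin: "x \<in> V \<Longrightarrow> y \<in> V \<Longrightarrow> D 0 = 0" "x \<in> V \<Longrightarrow> y \<in> V \<Longrightarrow> D (x - y) = D x - D y"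
  by (rule additive_on[of D]; simp add: D_add)+

lemma k_lin: "x \<in> V \<Longrightarrow> y \<in> V \<Longrightarrow> k 0 = 0" "x \<in> V \<Longrightarrow> y \<in> V \<Longrightarrow> k (x - y) = k x - k y"
  by (rule additive_on[of k]; simp add: k_add)+

lemma U_lin: "x \<in> V \<Longrightarrow> y \<in> V \<Longrightarrow> U 0 = 0" "x \<in> V \<Longrightarrow> y \<in> V \<Longrightarrow> U (x - y) = U x - U y"
  by (rule additive_on[of U]; simp add: U_add)+

lemma r_lin: "x \<in> V \<Longrightarrow> y \<in> V \<Longrightarrow> r 0 = 0" "x \<in> V \<Longrightarrow> y \<in> V \<Longrightarrow> r (x - y) = r x - r y"
  by (rule additive_on[of r]; simp add: r_add)+

lemma D0_lin: "x \<in> V \<Longrightarrow> y \<in> V \<Longrightarrow> D0 0 = 0" "x \<in> V \<Longrightarrow> y \<in> V \<Longrightarrow> D0 (x - y) = D0 x - D0 y"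
  by (rule additive_on[of D0]; simp add: D0_add)+

lemma t_V: "x \<in> V \<Longrightarrow> t x \<in> V"
  by (simp add: t_def V_diff D_V D0_V)

lemma B_U: "x \<in> V \<Longrightarrow> B (U x) = x" and U_B: "x \<in> V \<Longrightarrow> U (B x) = x"
  by (simp_all add: B_def t_def U_right U_left)

lemma H_V: "x \<in> V \<Longrightarrow> H x \<in> V"
  by (simp add: H_def U_V k_V)

lemma \<Phi>_V: "z \<in> C \<Longrightarrow> \<Phi> z \<in> V"
  by (simp add: \<Phi>_def V_diff i_V H_V t_V)

lemma H_add: "x \<in> V \<Longrightarrow> y \<in> V \<Longrightarrow> H (x + y) = H x + H y"
  by (simp add: H_def U_add k_add U_V)

lemma res_add: "x \<in> V \<Longrightarrow> y \<in> V \<Longrightarrow> res (x + y) = res x + res y"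
  by (simp add: res_def U_add r_add U_V)

lemma B_altdef: "y \<in> V \<Longrightarrow> B y = D (k y) + (k (D0 y) + i (r y))"
  using homotopy[of y] by (simp add: B_def t_def algebra_simps)

text \<open>Up to the part that the perturbation induces on \<open>C\<close>, the operator \<open>B = id + t k\<close> intertwines \<open>D0\<close> and \<open>D\<close>. This
  is the heart of the perturbation lemma.\<close>

lemma D_B:
  assumes y: "y \<in> V"
  shows "D (B y) = B (D0 y) + t (i (r y))"
proof -
  note V = y D_V D0_V k_V i_V r_C V_add
  have "D (B y) = D (k (D0 y)) + D (i (r y))"
    unfolding B_altdef[OF y] by (simp add: D_add D_D V)
  moreover have "B (D0 y) = D (k (D0 y))"
    by (simp add: B_altdef V D0_D0 r_D0 i_0 k_lin(1)[OF y y])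
  moreover have "t (i (r y)) = D (i (r y))"
    by (simp add: t_def D0_i V)
  ultimately show ?thesis by simp
qed

text \<open>Writing \<open>x = B y\<close> turns every identity for the perturbed data into one for the unperturbed data.\<close>

lemma res_\<Phi>: "z \<in> C \<Longrightarrow> res (\<Phi> z) = z"
proof -
  assume z: "z \<in> C"
  define w where "w = U (t (i z))"
  have w: "w \<in> V" unfolding w_def by (intro U_V t_V i_V z)
  have t0: "t 0 = 0" by (simp add: t_def D_lin(1)[OF w w] D0_lin(1)[OF w w])
  have "U (i z) = i z" using U_B[of "i z"] z by (simp add: B_def k_i t0 i_V)
  moreover have "U (k w) = k w" using U_B[of "k w"] w by (simp add: B_def k_k t0 k_V)
  ultimately show ?thesis
    using z w by (simp add: res_def \<Phi>_def H_def w_def[symmetric] U_lin(2) i_V k_V r_lin(2) r_i r_k)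
qed

lemma res_D: "x \<in> V \<Longrightarrow> res (D x) = res (t (i (res x)))"
proof -
  assume x: "x \<in> V"
  define y where "y = U x"
  have y: "y \<in> V" "x = B y" using x by (simp_all add: y_def U_V B_U)
  have BV: "B (D0 y) \<in> V" using y by (simp add: B_def V_add t_V k_V D0_V)
  have "res (B (D0 y)) = 0" using y by (simp add: res_def U_B D0_V r_D0)
  then have "res (D x) = res (t (i (r y)))"
    unfolding y(2) D_B[OF y(1)] using y by (simp add: res_add BV t_V i_V r_C)
  then show ?thesis by (simp add: res_def y_def)
qed

lemma perturbed_homotopy: "x \<in> V \<Longrightarrow> x - \<Phi> (res x) = D (H x) + H (D x)"
proof -
  assume x: "x \<in> V"
  define y where "y = U x"
  have y: "y \<in> V" "x = B y" using x by (simp_all add: y_def U_V B_U)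
  have BV: "B (D0 y) \<in> V" using y by (simp add: B_def V_add t_V k_V D0_V)
  have "H (D x) = H (B (D0 y)) + H (t (i (r y)))"
    unfolding y(2) D_B[OF y(1)] using y by (simp add: H_add BV t_V i_V r_C)
  also have "H (B (D0 y)) = k (D0 y)" using y by (simp add: H_def U_B D0_V)
  finally have "D (H x) + H (D x) = D (k y) + (k (D0 y) + H (t (i (r y))))" by (simp add: H_def y_def)
  moreover have "x = D (k y) + (k (D0 y) + i (r y))" using y B_altdef by simp
  moreover have "\<Phi> (res x) = i (r y) - H (t (i (r y)))" by (simp add: \<Phi>_def res_def y_def)
  ultimately show ?thesis by simp
qed

text \<open>By the homotopy relation for \<open>\<Phi> z\<close> itself, \<open>D H D \<Phi> z = 0\<close>; then the relation for \<open>D \<Phi> z\<close> shows that it lies in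
  the image of \<open>\<Phi>\<close>.\<close>

lemma D_\<Phi>:
  assumes z: "z \<in> C"
  shows "D (\<Phi> z) = \<Phi> (res (t (i z)))"
proof -
  let ?x = "\<Phi> z"
  have x: "?x \<in> V" by (rule \<Phi>_V[OF z])
  have "H 0 = 0" by (rule additive_on(1)[of H, OF _ x x]) (rule H_add)
  then have 0: "H 0 = 0" "D 0 = 0" using D_lin(1)[OF x x] by auto
  have "D (H ?x) + H (D ?x) = 0" using perturbed_homotopy[OF x] by (simp add: res_\<Phi>[OF z])
  then have "D (D (H ?x) + H (D ?x)) = 0" using 0 by simp
  then have "D (H (D ?x)) = 0" using x by (simp add: D_add D_V H_V D_D)
  then have "D ?x = \<Phi> (res (D ?x))"
    using perturbed_homotopy[OF D_V[OF x]] x by (simp add: D_D 0)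
  then show ?thesis by (simp add: res_D[OF x] res_\<Phi>[OF z])
qed

theorem perturbed_contraction: "contraction V D C (\<lambda>z. res (t (i z))) res \<Phi> H"
  unfolding contraction_def
  using H_V \<Phi>_V res_D D_\<Phi> res_\<Phi> perturbed_homotopy by (auto simp: res_def r_C U_V)

end

section \<open>Homogeneous operators\<close>

definition proj :: "(nat set \<Rightarrow> int) \<Rightarrow> int \<Rightarrow> (nat set \<Rightarrow> 'c) \<Rightarrow> nat set \<Rightarrow> 'c::zero" where
  "proj w d x = (\<lambda>S. if w S = d then x S else 0)"

lemma proj_add: "proj w d (x + y) = proj w d x + proj w d y"
  and proj_diff: "proj w d (x' - y') = proj w d x' - proj w d y'"
  and proj_0 [simp]: "proj w d 0 = 0"
  for x y :: "_ \<Rightarrow> 'b::comm_monoid_add" and x' y' :: "_ \<Rightarrow> 'b2::ab_group_add"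
  by (auto simp: proj_def fun_eq_iff)

lemma proj_smul: "proj w d (smul k x) = smul k (proj w d x)"
  by (auto simp: proj_def smul_def fun_eq_iff)

lemma proj_sum: "proj w d (\<Sum>i\<in>I. x i) = (\<Sum>i\<in>I. proj w d (x i))" for x :: "_ \<Rightarrow> _ \<Rightarrow> 'b::comm_monoid_add"
  by (rule sum_additive[of "proj w d"]) (rule proj_0, rule proj_add)

definition acount :: "nat \<Rightarrow> nat set \<Rightarrow> int" where
  "acount l S = int (card (S \<inter> {l..}))"

lemma weights_insert:
  assumes "finite S" "s \<notin> S"
  shows "acount l (insert s S) = acount l S + (if s < l then 0 else 1)"
    and "gdeg l (insert s S) = gdeg l S + (if s < l then 1 else -1)"
proof -
  have "insert s S \<inter> {l..} = (if s < l then S \<inter> {l..} else insert s (S \<inter> {l..}))"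
    "insert s S \<inter> {..<l} = (if s < l then insert s (S \<inter> {..<l}) else S \<inter> {..<l})" by auto
  then show "acount l (insert s S) = acount l S + (if s < l then 0 else 1)"
    "gdeg l (insert s S) = gdeg l S + (if s < l then 1 else -1)"
    using assms by (auto simp: acount_def gdeg_def)
qed

context brst_data
begin

text \<open>Formulated with projections, homogeneity is inherited by composites and by inverses.\<close>

definition homog :: "(nat set \<Rightarrow> int) \<Rightarrow> int \<Rightarrow> ((nat set \<Rightarrow> ('m \<Rightarrow> 'k) fps) \<Rightarrow> nat set \<Rightarrow> ('m \<Rightarrow> 'k) fps) \<Rightarrow> bool" where
  "homog w q T \<longleftrightarrow> (\<forall>x\<in>V. T x \<in> V \<and> (\<forall>d. T (proj w d x) = proj w (d + q) (T x)))"

lemma homogD: "homog w q T \<Longrightarrow> x \<in> V \<Longrightarrow> T (proj w d x) = proj w (d + q) (T x)"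
  and homog_V: "homog w q T \<Longrightarrow> x \<in> V \<Longrightarrow> T x \<in> V"
  by (auto simp: homog_def)

lemma proj_V: "x \<in> V \<Longrightarrow> proj w d x \<in> V"
  by (auto simp: proj_def gelems_def CS_0)

lemma homog_id: "homog w 0 (\<lambda>x. x)"
  by (simp add: homog_def)

lemma homog_add: "homog w q S \<Longrightarrow> homog w q T \<Longrightarrow> homog w q (\<lambda>x. S x + T x)"
  by (simp only: homog_def proj_add) (auto intro: V_add)

lemma homog_diff: "homog w q S \<Longrightarrow> homog w q T \<Longrightarrow> homog w q (\<lambda>x. S x - T x)"
  by (simp only: homog_def proj_diff) (auto intro: V_diff)

lemma homog_sum: "(\<And>i. i \<in> I \<Longrightarrow> homog w q (T i)) \<Longrightarrow> homog w q (\<lambda>x. \<Sum>i\<in>I. T i x)"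
  by (simp only: homog_def proj_sum) (auto intro!: sum.cong V_sum)

lemma homog_comp: "homog w q T \<Longrightarrow> homog w p S \<Longrightarrow> homog w (q + p) (\<lambda>x. S (T x))"
  by (simp add: homog_def add.assoc)

lemma homog_smul: "homog w q T \<Longrightarrow> homog w q (\<lambda>x. smul (cst r) (T x))" "homog w q T \<Longrightarrow> homog w q (\<lambda>x. smul fps_X (T x))"
  by (simp_all only: homog_def proj_smul) (auto intro: V_cst V_X)

lemma homog_lift: "coeff_op \<phi>s \<phi> \<Longrightarrow> homog w 0 (lift \<phi>)"
  unfolding homog_def by (auto simp: lift_V, auto simp: lift_def proj_def coeff_op_0 fun_eq_iff)

lemma homog_gwedge:
  assumes i: "i < 2 * l" and w: "\<And>S. S \<in> AM \<Longrightarrow> i \<notin> S \<Longrightarrow> w (insert i S) = w S + q"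
  shows "homog w q (gwedge i)"
  unfolding homog_def
proof (intro ballI conjI allI)
  fix x d assume x: "x \<in> V"
  show "gwedge i x \<in> V" by (rule V_gwedge[OF x i])
  show "gwedge i (proj w d x) = proj w (d + q) (gwedge i x)"
  proof
    fix S
    show "gwedge i (proj w d x) S = proj w (d + q) (gwedge i x) S"
    proof (cases "i \<in> S \<and> S - {i} \<in> AM")
      case True
      then have "w S = w (S - {i}) + q" using w[of "S - {i}"] by (simp add: insert_absorb)
      then show ?thesis using True by (simp add: gwedge_altdef proj_def)
    next
      case False
      then show ?thesis using x by (auto simp: gwedge_altdef proj_def gelems_def)
    qed
  qed
qed

lemma homog_gder:
  assumes w: "\<And>S. S \<in> AM \<Longrightarrow> i \<notin> S \<Longrightarrow> w (insert i S) = w S - q"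
  shows "homog w q (gder i)"
  unfolding homog_def
proof (intro ballI conjI allI)
  fix x d assume x: "x \<in> V"
  show "gder i x \<in> V" by (rule V_gder[OF x])
  show "gder i (proj w d x) = proj w (d + q) (gder i x)"
  proof
    fix S
    show "gder i (proj w d x) S = proj w (d + q) (gder i x) S"
    proof (cases "i \<notin> S \<and> insert i S \<in> AM")
      case True
      then have "S \<in> AM" by (auto simp: all_monomials_def)
      then have "w (insert i S) = w S - q" using w True by blast
      then show ?thesis using True by (simp add: gder_altdef proj_def)
    next
      case False
      then show ?thesis using x by (auto simp: gder_altdef proj_def gelems_def)
    qed
  qed
qed

lemma AM_finite: "S \<in> AM \<Longrightarrow> finite S"
  unfolding all_monomials_def using finite_subset by blast

lemma homog_elementary:
  assumes a: "a < l"
  shows "homog (acount l) 0 (gwedge a)" "homog (acount l) 1 (gwedge (l + a))" "homog (acount l) 0 (gder a)" "homog (acount l) (-1) (gder (l + a))"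
    "homog (gdeg l) 1 (gwedge a)" "homog (gdeg l) (-1) (gwedge (l + a))" "homog (gdeg l) (-1) (gder a)" "homog (gdeg l) 1 (gder (l + a))"
  by (rule homog_gwedge homog_gder; use a AM_finite in \<open>simp add: weights_insert\<close>)+

lemma homog_delta: "homog (acount l) 0 delta" "homog (gdeg l) 1 delta"
proof -
  have i: "homog w 0 (lift (inner_der (Jb a)))" if "a < l" for w a
    by (rule homog_lift[OF coeff_op_inner_der[OF Jb_CS[OF that]]])
  have ac: "homog (acount l) 0 (\<lambda>x. smul (cst 2 * g a b c) (gwedge a (gwedge b (gder c x))
        + gwedge b (gwedge (l + c) (gder (l + a) x)) - gwedge a (gwedge (l + c) (gder (l + b) x))))"
    if m: "a < l" "b < l" "c < l" for a b c
  proof -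
    note e = homog_elementary(1-4)
    have 1: "homog (acount l) 0 (\<lambda>x. gwedge a (gwedge b (gder c x)))"
      using homog_comp[OF homog_comp[OF e(3)[OF m(3)] e(1)[OF m(2)]] e(1)[OF m(1)]] by simp
    have 2: "homog (acount l) 0 (\<lambda>x. gwedge b (gwedge (l + c) (gder (l + a) x)))" if "a < l" "b < l" for a b
      using homog_comp[OF homog_comp[OF e(4)[OF that(1)] e(2)[OF m(3)]] e(1)[OF that(2)]] by simp
    show ?thesis unfolding g_def cst_simps(2)[symmetric] by (intro homog_smul homog_diff homog_add 1 2 m)
  qed
  have gd: "homog (gdeg l) 1 (\<lambda>x. smul (cst 2 * g a b c) (gwedge a (gwedge b (gder c x))
        + gwedge b (gwedge (l + c) (gder (l + a) x)) - gwedge a (gwedge (l + c) (gder (l + b) x))))"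
    if m: "a < l" "b < l" "c < l" for a b c
  proof -
    note e = homog_elementary(5-8)
    have 1: "homog (gdeg l) 1 (\<lambda>x. gwedge a (gwedge b (gder c x)))"
      using homog_comp[OF homog_comp[OF e(3)[OF m(3)] e(1)[OF m(2)]] e(1)[OF m(1)]] by simp
    have 2: "homog (gdeg l) 1 (\<lambda>x. gwedge b (gwedge (l + c) (gder (l + a) x)))" if "a < l" "b < l" for a b
      using homog_comp[OF homog_comp[OF e(4)[OF that(1)] e(2)[OF m(3)]] e(1)[OF that(2)]] by simp
    show ?thesis unfolding g_def cst_simps(2)[symmetric] by (intro homog_smul homog_diff homog_add 1 2 m)
  qed
  have j: "homog (acount l) 0 (\<lambda>x. gwedge a (lift (inner_der (Jb a)) x))"
    "homog (gdeg l) 1 (\<lambda>x. gwedge a (lift (inner_der (Jb a)) x))" if a: "a < l" for a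
    using homog_comp[OF i[OF a] homog_elementary(1)[OF a]] homog_comp[OF i[OF a] homog_elementary(5)[OF a]] by simp_all
  show "homog (acount l) 0 delta" "homog (gdeg l) 1 delta"
    unfolding delta_def[abs_def]
    by (rule homog_add; rule homog_sum; use ac gd j in \<open>auto intro!: homog_sum\<close>)+
qed

lemma homog_qk: "homog (acount l) (-1) qk" "homog (gdeg l) 1 qk"
proof -
  have gen: "homog w q qk" if e: "\<And>a. a < l \<Longrightarrow> homog w q (gder (l + a))" "\<And>a. a < l \<Longrightarrow> homog w (- q) (gwedge (l + a))" for w q
  proof -
    have 1: "homog w q (\<lambda>x. rmul a (gder (l + a) x))" if "a < l" for a
      using homog_comp[OF e(1)[OF that] homog_lift[OF rmul_op[OF that]]] by simp
    have 2: "homog w q (\<lambda>x. smul (tr_cst a b) (gder (l + a) x))" if "a < l" for a b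
      unfolding smul_assoc by (intro homog_smul e that)
    have 3: "homog w q (\<lambda>x. smul (fps_X * cst (of_real (f a b c / 2))) (gwedge (l + c) (gder (l + a) (gder (l + b) x))))"
      if "a < l" "b < l" "c < l" for a b c
    proof -
      have "homog w q (\<lambda>x. gwedge (l + c) (gder (l + a) (gder (l + b) x)))"
        using homog_comp[OF homog_comp[OF e(1)[OF that(2)] e(1)[OF that(1)]] e(2)[OF that(3)]] by simp
      then show ?thesis unfolding smul_assoc by (intro homog_smul)
    qed
    show ?thesis
      unfolding qk_altdef[abs_def]
      by (rule homog_add, rule homog_add; rule homog_sum) (use 1 2 3 in \<open>auto intro!: homog_sum\<close>)
  qed
  show "homog (acount l) (-1) qk" "homog (gdeg l) 1 qk"
    using gen[of "acount l" "-1"] gen[of "gdeg l" 1] homog_elementary by simp_all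
qed

lemma homog_D: "homog (gdeg l) 1 D"
proof -
  have "homog (gdeg l) 1 (\<lambda>x. delta x + smul (cst 2) (qk x))"
    by (intro homog_add homog_smul homog_delta homog_qk)
  then show ?thesis unfolding homog_def by (simp add: D_altdef proj_V)
qed

end

section \<open>The Koszul contraction with ghosts\<close>

locale koszul_data = brst_data n A l \<mu> f Jb
  for n :: nat and A :: "'m::{t2_space, second_countable_topology} chart set" and l :: nat
    and \<mu> :: "nat \<Rightarrow> ('m \<Rightarrow> 'k::real_normed_field) \<Rightarrow> ('m \<Rightarrow> 'k) \<Rightarrow> 'm \<Rightarrow> 'k"
    and f :: "nat \<Rightarrow> nat \<Rightarrow> nat \<Rightarrow> real" and Jb :: "nat \<Rightarrow> ('m \<Rightarrow> 'k) fps" +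
  fixes j :: "nat \<Rightarrow> 'm \<Rightarrow> 'k" and Z :: "'m set" and prol :: "('m \<Rightarrow> 'k) \<Rightarrow> 'm \<Rightarrow> 'k"
    and h :: "nat \<Rightarrow> (nat set \<Rightarrow> 'm \<Rightarrow> 'k) \<Rightarrow> nat set \<Rightarrow> 'm \<Rightarrow> 'k"
  assumes Jb_0: "a < l \<Longrightarrow> fps_nth (Jb a) 0 = j a"
    and j_Z: "a < l \<Longrightarrow> m \<in> Z \<Longrightarrow> j a m = 0"
    and contraction_data: "koszul_contraction n A Z l j prol h"
begin

abbreviation E :: "(nat set \<Rightarrow> 'm \<Rightarrow> 'k) set" where "E \<equiv> gelems (Cinf n A) AM"
abbreviation AG :: "nat \<Rightarrow> nat set set" where "AG \<equiv> antighost_monomials l"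
abbreviation GM :: "nat set set" where "GM \<equiv> ghost_monomials l"
abbreviation K :: "nat \<Rightarrow> (nat set \<Rightarrow> 'm \<Rightarrow> 'k) set" where "K \<equiv> koszul_space n A l"

lemma h_linear: "linear_map_on gscale gscale (K i) (K (Suc i)) (h i)"
  and h_cont: "continuous_map (gtop CT (AG i)) (gtop CT (AG (Suc i))) (h i)"
  and prol_linear: "linear_map_on fscale fscale (CinfZ n A Z) (Cinf n A) prol"
  and prol_cont: "continuous_map (CinfZ_top n A Z) CT prol"
  and res_prol: "z \<in> CinfZ n A Z \<Longrightarrow> res0 Z (prol z) = z"
  and homotopy_0: "F \<in> Cinf n A \<Longrightarrow> gemb (F - prol (res0 Z F)) = koszul l j (h 0 (gemb F))"
  and homotopy_Suc: "v \<in> K (Suc i) \<Longrightarrow> v = koszul l j (h (Suc i) v) + h i (koszul l j v)"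
  and h_prol: "z \<in> CinfZ n A Z \<Longrightarrow> h 0 (gemb (prol z)) = 0"
  and h_h: "v \<in> K i \<Longrightarrow> h (Suc i) (h i v) = 0"
  using contraction_data unfolding koszul_contraction_def by blast+

lemma h_K: "v \<in> K i \<Longrightarrow> h i v \<in> K (Suc i)"
  and h_add: "v \<in> K i \<Longrightarrow> w \<in> K i \<Longrightarrow> h i (v + w) = h i v + h i w"
  and h_scale: "v \<in> K i \<Longrightarrow> h i (gscale r v) = gscale r (h i v)"
  using h_linear unfolding linear_map_on_def by blast+

lemma K_0: "0 \<in> K i"
  by (simp add: koszul_space_def gelems_def)

lemma h_0: "h i 0 = 0"
proof -
  have "h i (0 + 0) = h i 0 + h i 0" by (rule h_add[OF K_0 K_0])
  then show ?thesis by (simp only: add_0 add_cancel_right_right)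
qed

text \<open>The antighost component of degree \<open>i\<close> behind a fixed ghost monomial \<open>G\<close>; all operators of the
  Koszul complex act on these components up to the sign of moving past \<open>G\<close>.\<close>

definition part :: "(nat set \<Rightarrow> 'm \<Rightarrow> 'k) \<Rightarrow> nat set \<Rightarrow> nat \<Rightarrow> nat set \<Rightarrow> 'm \<Rightarrow> 'k" where
  "part x G i = (\<lambda>T. if T \<in> AG i then x (G \<union> T) else 0)"

lemma part_simps:
  "part (x + y) G i = part x G i + part y G i" "part (gscale r x) G i = gscale r (part x G i)" "part 0 G i = 0"
  "part (x - y) G i = part x G i - part y G i"
  by (auto simp: part_def gscale_def fscale_simps fun_eq_iff)

lemma part_K: "x \<in> E \<Longrightarrow> part x G i \<in> K i"
  by (auto simp: part_def koszul_space_def gelems_def)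

lemma AG_simps:
  assumes "T \<in> AG i" "G \<subseteq> {..<l}"
  shows "(G \<union> T) \<inter> {..<l} = G" "(G \<union> T) \<inter> {l..} = T" "G \<union> T \<in> AM" "card T = i" "finite T"
  using assms by (auto simp: antighost_monomials_def all_monomials_def intro: finite_subset)

lemma AM_split:
  assumes "S \<in> AM" shows "S \<inter> {..<l} \<subseteq> {..<l}" "S \<inter> {l..} \<in> AG (card (S \<inter> {l..}))" "S \<inter> {..<l} \<union> S \<inter> {l..} = S"
  using assms by (auto simp: antighost_monomials_def all_monomials_def)

lemma part_extI:
  assumes x: "x \<in> E" and y: "y \<in> E" and eq: "\<And>G i. G \<subseteq> {..<l} \<Longrightarrow> part x G i = part y G i"
  shows "x = y"
proof
  fix S
  show "x S = y S"
  proof (cases "S \<in> AM")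
    case True
    note s = AM_split[OF True]
    show ?thesis using fun_cong[OF eq[OF s(1), of "card (S \<inter> {l..})"], of "S \<inter> {l..}"] s(2,3) by (simp add: part_def)
  qed (use x y in \<open>auto simp: gelems_def\<close>)
qed

text \<open>The sign is that of moving the odd homotopy past the ghosts.\<close>

definition hext :: "(nat set \<Rightarrow> 'm \<Rightarrow> 'k) \<Rightarrow> nat set \<Rightarrow> 'm \<Rightarrow> 'k" where
  "hext x S = (if S \<in> AM \<and> S \<inter> {l..} \<noteq> {} then
     fscale ((-1) ^ card (S \<inter> {..<l}))
       (h (card (S \<inter> {l..}) - 1) (part x (S \<inter> {..<l}) (card (S \<inter> {l..}) - 1)) (S \<inter> {l..})) else 0)"

lemma part_hext_0: "G \<subseteq> {..<l} \<Longrightarrow> part (hext x) G 0 = 0"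
proof
  fix T assume G: "G \<subseteq> {..<l}"
  show "part (hext x) G 0 T = 0 T"
  proof (cases "T \<in> AG 0")
    case True
    then have "T = {}" using AG_simps[OF True G] by simp
    then show ?thesis using G by (auto simp: part_def hext_def)
  qed (simp add: part_def)
qed

lemma part_hext_Suc:
  assumes x: "x \<in> E" and G: "G \<subseteq> {..<l}"
  shows "part (hext x) G (Suc i) = gscale ((-1) ^ card G) (h i (part x G i))"
proof
  fix T
  show "part (hext x) G (Suc i) T = gscale ((-1) ^ card G) (h i (part x G i)) T"
  proof (cases "T \<in> AG (Suc i)")
    case True
    note s = AG_simps[OF True G]
    have "T \<noteq> {}" using s by auto
    then show ?thesis using True s by (simp add: part_def hext_def gscale_def)
  next
    case False
    then have "h i (part x G i) T = 0" using h_K[OF part_K[OF x]] by (simp add: koszul_space_def gelems_def)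
    then show ?thesis using False by (simp only: part_def gscale_def fscale_simps if_False)
  qed
qed

lemma koszul_altdef: "koszul l u x = (\<Sum>a<l. smul (u a) (gder (l + a) x))" for u :: "nat \<Rightarrow> 'c::comm_ring_1"
  by (simp add: koszul_def smul_def)

lemma koszul_apply: "koszul l u x S = (\<Sum>a<l. u a * gder (l + a) x S)" for u :: "nat \<Rightarrow> 'c::comm_ring_1"
  by (simp add: koszul_altdef sum_apply smul_def)

lemma koszul_smul: "koszul l u (smul k x) = smul k (koszul l u x)" for u :: "nat \<Rightarrow> 'c::comm_ring_1"
  by (simp only: koszul_altdef gder_smul smul_sum smul_simps(5) mult.commute)

lemma gscale_smul: "gscale r x = smul (\<lambda>_. r) x" for x :: "nat set \<Rightarrow> 'm \<Rightarrow> 'k"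
  by (auto simp: gscale_def fscale_def smul_def fun_eq_iff)

lemma koszul_gscale: "koszul l j (gscale r x) = gscale r (koszul l j x)"
  unfolding gscale_smul by (rule koszul_smul)

lemma j_C: "a < l \<Longrightarrow> j a \<in> Cinf n A"
proof -
  assume a: "a < l"
  show "j a \<in> Cinf n A"
    unfolding Jb_0[OF a, symmetric] using Jb_CS[OF a] by (simp add: series_in_def)
qed

lemma gder_E: "x \<in> E \<Longrightarrow> gder i x \<in> E"
proof -
  assume x: "x \<in> E"
  have "(-1) ^ q * F \<in> Cinf n A" if "F \<in> Cinf n A" for q and F :: "'m \<Rightarrow> 'k"
    using that C_uminus by (cases "even q") auto
  then show ?thesis using x by (auto simp: gelems_def gder_def all_monomials_def)
qed

lemma smul_j_E: "a < l \<Longrightarrow> x \<in> E \<Longrightarrow> smul (j a) x \<in> E"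
  by (auto simp: gelems_def smul_def intro!: C_mult j_C)

lemma koszul_E: "x \<in> E \<Longrightarrow> koszul l j x \<in> E"
  unfolding koszul_altdef by (intro gelems_C_sum smul_j_E gder_E) auto

text \<open>An antighost derivative passes the ghosts of \<open>G\<close> first, which costs one sign per ghost.\<close>

lemma part_koszul:
  assumes x: "x \<in> E" and G: "G \<subseteq> {..<l}"
  shows "part (koszul l j x) G i = gscale ((-1) ^ card G) (koszul l j (part x G (Suc i)))"
proof
  fix T
  have fin: "finite G" using G finite_subset by blast
  have g: "gder (l + a) (part x G (Suc i)) T = (if T \<in> AG i then (-1) ^ card G * gder (l + a) x (G \<union> T) else 0)"
    if a: "a < l" for a
  proof (cases "T \<in> AG i")
    case True
    note s = AG_simps[OF True G]
    show ?thesis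
    proof (cases "l + a \<in> T")
      case False
      have "insert (l + a) T \<in> AG (Suc i)" using True False s a by (auto simp: antighost_monomials_def)
      moreover have "l + a \<notin> G" using G by auto
      moreover have "below (l + a) (G \<union> T) = card G + below (l + a) T"
      proof -
        have "{s \<in> G \<union> T. s < l + a} = G \<union> {s \<in> T. s < l + a}" using G by auto
        moreover have "G \<inter> {s \<in> T. s < l + a} = {}"
          using G True by (fastforce simp: antighost_monomials_def)
        ultimately show ?thesis unfolding below_def using fin s(5) by (simp add: card_Un_disjoint)
      qed
      ultimately show ?thesis
        using True False by (simp add: gder_altdef part_def power_add mult.assoc)
    qed (use True in \<open>simp add: gder_altdef\<close>)
  next
    case False
    have "l + a \<in> T \<or> insert (l + a) T \<notin> AG (Suc i)"
    proof (rule ccontr)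
      assume "\<not> (l + a \<in> T \<or> insert (l + a) T \<notin> AG (Suc i))"
      then have "l + a \<notin> T" "insert (l + a) T \<subseteq> {l..<2 * l}" "card (insert (l + a) T) = Suc i"
        by (auto simp: antighost_monomials_def)
      moreover have "finite T" using \<open>insert (l + a) T \<subseteq> {l..<2 * l}\<close> by (auto intro: finite_subset)
      ultimately show False using False by (auto simp: antighost_monomials_def)
    qed
    then show ?thesis using False by (auto simp: gder_altdef part_def)
  qed
  show "part (koszul l j x) G i T = gscale ((-1) ^ card G) (koszul l j (part x G (Suc i))) T"
  proof (cases "T \<in> AG i")
    case True
    have "koszul l j (part x G (Suc i)) T = (\<Sum>a<l. j a * ((-1) ^ card G * gder (l + a) x (G \<union> T)))"
      unfolding koszul_apply by (rule sum.cong) (use g True in auto)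
    also have "\<dots> = (-1) ^ card G * koszul l j x (G \<union> T)"
      unfolding koszul_apply by (simp add: sum_distrib_left mult_ac)
    finally have "koszul l j (part x G (Suc i)) T = (-1) ^ card G * koszul l j x (G \<union> T)" .
    then show ?thesis using True
      by (auto simp: part_def gscale_def fscale_def fun_eq_iff minus_one_power_iff)
  next
    case False
    have "koszul l j (part x G (Suc i)) T = (\<Sum>a<l. 0)"
      unfolding koszul_apply by (rule sum.cong) (use g False in auto)
    then have "koszul l j (part x G (Suc i)) T = 0" by (simp only: sum.neutral_const)
    then show ?thesis using False by (simp only: part_def gscale_def fscale_simps if_False)
  qed
qed

lemma gscale_sign: "gscale ((-1) ^ q) (gscale ((-1) ^ q) x) = x" for x :: "nat set \<Rightarrow> 'm \<Rightarrow> 'k"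
  by (auto simp: gscale_def fscale_def fun_eq_iff)

definition prol_res :: "(nat set \<Rightarrow> 'm \<Rightarrow> 'k) \<Rightarrow> nat set \<Rightarrow> 'm \<Rightarrow> 'k" where
  "prol_res x S = (if S \<in> GM then prol (res0 Z (x S)) else 0)"

lemma cont_op_hext: "cont_op CT AM hext"
proof (rule cont_opI)
  show "hext x S = 0" if "S \<notin> AM" for x S using that by (simp add: hext_def)
  show "continuous_map (gtop CT AM) CT (\<lambda>x. hext x S)" for S
  proof (cases "S \<in> AM \<and> S \<inter> {l..} \<noteq> {}")
    case True
    let ?i = "card (S \<inter> {l..}) - 1" and ?G = "S \<inter> {..<l}"
    have "continuous_map (gtop CT AM) (gtop CT (AG ?i)) (\<lambda>x. part x ?G ?i)"
      unfolding continuous_map_gtop_iff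
    proof (intro conjI allI ballI impI)
      show "continuous_map (gtop CT AM) CT (\<lambda>x. part x ?G ?i T)" for T
        by (cases "T \<in> AG ?i") (auto simp: part_def continuous_map_gtop_component)
    qed (simp add: part_def)
    then have "continuous_map (gtop CT AM) (gtop CT (AG (Suc ?i))) (\<lambda>x. h ?i (part x ?G ?i))"
      using continuous_map_compose[OF _ h_cont] by (auto simp: o_def)
    then have "continuous_map (gtop CT AM) CT (\<lambda>x. h ?i (part x ?G ?i) (S \<inter> {l..}))"
      unfolding continuous_map_gtop_iff by blast
    then have "continuous_map (gtop CT AM) CT (\<lambda>x. fscale ((-1) ^ card ?G) (h ?i (part x ?G ?i) (S \<inter> {l..})))"
      by (rule continuous_map_fscale)
    moreover have "(\<lambda>x. hext x S) = (\<lambda>x. fscale ((-1) ^ card ?G) (h ?i (part x ?G ?i) (S \<inter> {l..})))"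
      using True by (simp add: hext_def fun_eq_iff)
    ultimately show ?thesis by simp
  next
    case False
    then have "(\<lambda>x. hext x S) = (\<lambda>x. 0)" by (auto simp: hext_def fun_eq_iff)
    then show ?thesis by simp
  qed
  show "hext (x + y) S = hext x S + hext y S"
    if "x \<in> gelems (topspace CT) AM" "y \<in> gelems (topspace CT) AM" for x y S
  proof (cases "S \<in> AM \<and> S \<inter> {l..} \<noteq> {}")
    case True
    have "x \<in> E" "y \<in> E" using that by simp_all
    then show ?thesis
      unfolding hext_def if_P[OF True] part_simps by (simp only: h_add[OF part_K part_K] plus_fun_apply fscale_simps)
  qed (auto simp: hext_def)
  show "hext (gscale r x) S = fscale r (hext x S)" if "x \<in> gelems (topspace CT) AM" for r x S
  proof (cases "S \<in> AM \<and> S \<inter> {l..} \<noteq> {}")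
    case True
    have "x \<in> E" using that by simp
    show ?thesis
      unfolding hext_def if_P[OF True] part_simps h_scale[OF part_K[OF \<open>x \<in> E\<close>]]
      unfolding gscale_def by (rule fscale_simps(5))
  next
    case False
    then show ?thesis unfolding hext_def by (simp only: if_False fscale_simps)
  qed
qed

lemma hext_E: "x \<in> E \<Longrightarrow> hext x \<in> E"
  using cont_opD(5)[OF cont_op_hext, of x] by simp

lemma part_0: "x \<in> E \<Longrightarrow> G \<subseteq> {..<l} \<Longrightarrow> part x G 0 = gemb (x G)"
proof
  fix T assume "x \<in> E" "G \<subseteq> {..<l}"
  have "T \<in> AG 0 \<longleftrightarrow> T = {}"
    by (auto simp: antighost_monomials_def dest: finite_subset[OF _ finite_atLeastLessThan])
  then show "part x G 0 T = gemb (x G) T" by (simp add: part_def gemb_def)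
qed

lemma res0_CinfZ: "F \<in> Cinf n A \<Longrightarrow> res0 Z F \<in> CinfZ n A Z"
  by (simp add: CinfZ_def)

lemma prol_C: "z \<in> CinfZ n A Z \<Longrightarrow> prol z \<in> Cinf n A"
  using prol_linear unfolding linear_map_on_def by blast

lemma res0_0: "res0 Z 0 = (0 :: 'm \<Rightarrow> 'k)"
  by (auto simp: res0_def fun_eq_iff)

lemma CinfZ_0: "(0 :: 'm \<Rightarrow> 'k) \<in> CinfZ n A Z"
  using res0_CinfZ[of "0 :: 'm \<Rightarrow> 'k"] by (simp add: res0_0)

lemma prol_0: "prol 0 = 0"
proof -
  have "prol (0 + 0) = prol 0 + prol 0"
    using prol_linear CinfZ_0 unfolding linear_map_on_def by blast
  then show ?thesis by (simp only: add_0 add_cancel_right_right)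
qed

lemma prol_res_E: "x \<in> E \<Longrightarrow> prol_res x \<in> E"
  by (auto simp: prol_res_def gelems_def ghost_monomials_def all_monomials_def intro!: prol_C res0_CinfZ)

lemma part_prol_res:
  assumes "G \<subseteq> {..<l}"
  shows "part (prol_res x) G i = (if i = 0 then gemb (prol (res0 Z (x G))) else 0)"
proof
  fix T
  show "part (prol_res x) G i T = (if i = 0 then gemb (prol (res0 Z (x G))) else 0) T"
  proof (cases "T \<in> AG i")
    case True
    note s = AG_simps[OF True assms]
    have "G \<union> T \<in> GM \<longleftrightarrow> T = {}"
      using assms True by (fastforce simp: ghost_monomials_def antighost_monomials_def)
    then show ?thesis using True s assms by (auto simp: part_def prol_res_def gemb_def ghost_monomials_def)
  next
    case False
    then have "i = 0 \<longrightarrow> T \<noteq> {}" by (auto simp: antighost_monomials_def)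
    then show ?thesis using False by (auto simp: part_def gemb_def)
  qed
qed

text \<open>Componentwise: the signs of \<open>hext\<close> and of the Koszul differential cancel, and what remains is one of the two
  given homotopy relations, in degree zero or in positive degrees.\<close>

lemma koszul_homotopy:
  assumes x: "x \<in> E"
  shows "x - prol_res x = koszul l j (hext x) + hext (koszul l j x)"
proof (rule part_extI)
  show "x - prol_res x \<in> E" by (intro gelems_C x prol_res_E)
  show "koszul l j (hext x) + hext (koszul l j x) \<in> E" by (intro gelems_C x koszul_E hext_E)
  fix G i assume G: "G \<subseteq> {..<l}"
  have k: "part (koszul l j (hext x)) G i = koszul l j (h i (part x G i))"
    unfolding part_koszul[OF hext_E[OF x] G] part_hext_Suc[OF x G] koszul_gscale gscale_sign ..
  show "part (x - prol_res x) G i = part (koszul l j (hext x) + hext (koszul l j x)) G i"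
  proof (cases i)
    case 0
    have "x G \<in> Cinf n A" using x by (simp add: gelems_def)
    moreover have "gemb (x G - prol (res0 Z (x G))) = gemb (x G) - gemb (prol (res0 Z (x G)))"
      by (auto simp: gemb_def fun_eq_iff)
    ultimately have "koszul l j (h 0 (gemb (x G))) = gemb (x G) - gemb (prol (res0 Z (x G)))"
      using homotopy_0[of "x G"] by simp
    then show ?thesis
      unfolding part_simps k unfolding 0 part_hext_0[OF G] part_0[OF x G] part_prol_res[OF G] by simp
  next
    case (Suc q)
    have "part (hext (koszul l j x)) G i = h q (koszul l j (part x G i))"
      unfolding Suc part_hext_Suc[OF koszul_E[OF x] G] part_koszul[OF x G]
    proof -
      have "koszul l j (part x G (Suc q)) \<in> K q"
      proof -
        have "gscale ((-1) ^ card G) (koszul l j (part x G (Suc q))) \<in> K q"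
          unfolding part_koszul[OF x G, symmetric] by (rule part_K[OF koszul_E[OF x]])
        then have "gscale ((-1) ^ card G) (gscale ((-1) ^ card G) (koszul l j (part x G (Suc q)))) \<in> K q"
          unfolding koszul_space_def by (rule gelems_C)
        then show ?thesis unfolding gscale_sign .
      qed
      then show "gscale ((-1) ^ card G) (h q (gscale ((-1) ^ card G) (koszul l j (part x G (Suc q))))) = h q (koszul l j (part x G (Suc q)))"
        by (simp only: h_scale gscale_sign)
    qed
    moreover have "part x G i = koszul l j (h i (part x G i)) + h q (koszul l j (part x G i))"
      using homotopy_Suc[of "part x G i" q] part_K[OF x, of G i] unfolding Suc by blast
    ultimately show ?thesis
      unfolding part_simps k part_prol_res[OF G] using Suc by simp
  qed
qed

lemma hext_hext: "x \<in> E \<Longrightarrow> hext (hext x) = 0"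
proof (rule part_extI)
  fix G i assume x: "x \<in> E" and G: "G \<subseteq> {..<l}"
  show "part (hext (hext x)) G i = part 0 G i"
  proof (cases i)
    case (Suc q)
    show ?thesis
    proof (cases q)
      case 0
      show ?thesis
        unfolding Suc part_hext_Suc[OF hext_E[OF x] G] part_simps unfolding 0 part_hext_0[OF G] h_0 by (rule gscale_simps)
    next
      case (Suc p)
      have "h (Suc p) (gscale ((-1) ^ card G) (h p (part x G p))) = 0"
        unfolding h_scale[OF h_K[OF part_K[OF x]]] h_h[OF part_K[OF x]] by (rule gscale_simps)
      then show ?thesis
        unfolding \<open>i = Suc q\<close> part_hext_Suc[OF hext_E[OF x] G] part_simps
        unfolding Suc part_hext_Suc[OF x G] by (simp only: gscale_simps)
    qed
  qed (simp add: part_hext_0[OF G] part_simps)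
qed (auto intro: hext_E simp: gelems_C)

lemma GM_AM: "S \<in> GM \<Longrightarrow> S \<in> AM"
  by (auto simp: ghost_monomials_def all_monomials_def)

lemma hext_prol:
  assumes z: "\<And>S. z S \<in> CinfZ n A Z" "\<And>S. S \<notin> GM \<Longrightarrow> z S = 0"
  shows "hext (\<lambda>S. prol (z S)) = 0"
proof (rule part_extI)
  have E: "(\<lambda>S. prol (z S)) \<in> E"
  proof -
    have "z S = 0" if "S \<notin> AM" for S using that z(2)[of S] GM_AM by blast
    then show ?thesis using z(1) by (simp add: gelems_def prol_C prol_0)
  qed
  then show "hext (\<lambda>S. prol (z S)) \<in> E" by (rule hext_E)
  fix G i assume G: "G \<subseteq> {..<l}"
  show "part (hext (\<lambda>S. prol (z S))) G i = part 0 G i"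
  proof (cases i)
    case (Suc q)
    have "part (\<lambda>S. prol (z S)) G q = (if q = 0 then gemb (prol (z G)) else 0)"
    proof (cases "q = 0")
      case True
      then show ?thesis using part_0[OF E G] by simp
    next
      case False
      have "part (\<lambda>S. prol (z S)) G q T = 0" for T
      proof (cases "T \<in> AG q")
        case True
        then obtain s where "s \<in> T" "l \<le> s"
          using False by (metis AG_simps(2,4) G Int_iff all_not_in_conv atLeast_iff card.empty)
        then have "G \<union> T \<notin> GM" by (auto simp: ghost_monomials_def)
        then show ?thesis by (simp add: part_def z prol_0)
      qed (simp add: part_def)
      then show ?thesis using False by (simp add: fun_eq_iff)
    qed
    then have "h q (part (\<lambda>S. prol (z S)) G q) = 0" using h_prol[OF z(1)] h_0 by auto
    then show ?thesis unfolding Suc part_hext_Suc[OF E G] part_simps by (simp only: gscale_simps)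
  qed (simp add: part_hext_0[OF G] part_simps)
qed (simp add: gelems_C)

section \<open>The Koszul contraction over formal power series\<close>

definition kext :: "(nat set \<Rightarrow> ('m \<Rightarrow> 'k) fps) \<Rightarrow> nat set \<Rightarrow> ('m \<Rightarrow> 'k) fps" where
  "kext x S = Abs_fps (\<lambda>m. hext (slice x m) S)"

text \<open>The factor \<open>1/2\<close> compensates the factor \<open>2\<close> of the Koszul part of the BRST differential.\<close>

definition k :: "(nat set \<Rightarrow> ('m \<Rightarrow> 'k) fps) \<Rightarrow> nat set \<Rightarrow> ('m \<Rightarrow> 'k) fps" where
  "k x = smul (cst (1 / 2)) (kext x)"

definition kS :: "(nat set \<Rightarrow> ('m \<Rightarrow> 'k) fps) \<Rightarrow> nat set \<Rightarrow> ('m \<Rightarrow> 'k) fps" where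
  "kS x = koszul l (\<lambda>a. fps_const (j a)) x"

definition D0 :: "(nat set \<Rightarrow> ('m \<Rightarrow> 'k) fps) \<Rightarrow> nat set \<Rightarrow> ('m \<Rightarrow> 'k) fps" where
  "D0 x = smul (cst 2) (kS x)"

definition prolS :: "(nat set \<Rightarrow> ('m \<Rightarrow> 'k) fps) \<Rightarrow> nat set \<Rightarrow> ('m \<Rightarrow> 'k) fps" where
  "prolS z = (\<lambda>S. fps_ext prol (z S))"

definition resS :: "(nat set \<Rightarrow> ('m \<Rightarrow> 'k) fps) \<Rightarrow> nat set \<Rightarrow> ('m \<Rightarrow> 'k) fps" where
  "resS x = (\<lambda>S. if S \<in> GM then fps_ext (res0 Z) (x S) else 0)"

abbreviation C :: "(nat set \<Rightarrow> ('m \<Rightarrow> 'k) fps) set" where "C \<equiv> cochains n A Z l"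

lemma slice_kext: "slice (kext x) m = hext (slice x m)"
  by (simp add: slice_def kext_def)

lemma slice_gder: "slice (gder i x) m = gder i (slice x m)" for x :: "nat set \<Rightarrow> ('m \<Rightarrow> 'k) fps"
  by (auto simp: slice_def gder_altdef fun_eq_iff minus_one_power_iff)

lemma slice_sum: "slice (\<Sum>i\<in>I. x i) m = (\<Sum>i\<in>I. slice (x i) m)" for x :: "'i \<Rightarrow> nat set \<Rightarrow> ('m \<Rightarrow> 'k) fps"
  by (rule sum_additive[of "\<lambda>x. slice x m"]) (auto simp: slice_def fun_eq_iff)

lemma slice_smul_const: "slice (smul (fps_const u) x) m = smul u (slice x m)" for x :: "nat set \<Rightarrow> ('m \<Rightarrow> 'k) fps"
  by (rule ext) (simp only: slice_apply smul_apply fps_mult_left_const_nth)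

lemma slice_kS: "slice (kS x) m = koszul l j (slice x m)"
  unfolding kS_def koszul_altdef slice_sum slice_smul_const slice_gder ..

lemma slice_prolS: "slice (prolS z) m = (\<lambda>S. prol (slice z m S))"
  by (simp add: slice_def prolS_def fps_ext_def)

lemma V_slice: "x \<in> V \<Longrightarrow> slice x m \<in> E"
  by (rule slice_gelems)

lemma C_slice:
  assumes "z \<in> C"
  shows "slice z m S \<in> CinfZ n A Z" "S \<notin> GM \<Longrightarrow> slice z m S = 0"
  using assms by (auto simp: cochains_def gelems_def series_in_def slice_def)

lemma cont_op_koszul: "cont_op CT AM (koszul l j)"
proof -
  have "cont_op CT AM (\<lambda>x. smul (j a) x)" if a: "a < l" for a
  proof (rule cont_opI)
    show "continuous_map (gtop CT AM) CT (\<lambda>x. smul (j a) x S)" for S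
      using continuous_map_compose[OF continuous_map_gtop_component continuous_map_Cinf_mult[OF atlas j_C[OF a]]]
      by (simp add: smul_def o_def)
  qed (auto simp: smul_def gelems_def gscale_def fscale_def fun_eq_iff algebra_simps)
  moreover have "cont_op CT AM (gder i :: _ \<Rightarrow> _ \<Rightarrow> 'm \<Rightarrow> 'k)" for i
  proof -
    have "(gder i :: _ \<Rightarrow> _ \<Rightarrow> 'm \<Rightarrow> 'k) = (\<lambda>x S. if i \<notin> S then fscale ((-1) ^ below i S) (x (insert i S)) else 0)"
      by (auto simp: gder_altdef fun_eq_iff fscale_def minus_one_power_iff)
    then show ?thesis
      using cont_op_reindex[of "\<lambda>S. i \<notin> S" "insert i" "\<lambda>S. (-1) ^ below i S"] by (auto simp: all_monomials_def)
  qed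
  ultimately have "cont_op CT AM (\<lambda>x. smul (j a) (gder (l + a) x))" if "a < l" for a
    using cont_op_comp that by blast
  then show ?thesis
    unfolding koszul_altdef[abs_def] by (intro cont_op_sum) auto
qed

lemma series_op_kS: "series_op CT AM kS"
  unfolding series_op_def by (rule exI, rule series_op_const[OF cont_op_koszul]) (rule slice_kS)

lemma series_op_kext: "series_op CT AM kext"
  unfolding series_op_def by (rule exI, rule series_op_const[OF cont_op_hext]) (rule slice_kext)

lemma series_op_k: "series_op CT AM k"
  unfolding k_def[abs_def] by (rule series_op_smul(1)[OF series_op_kext])

lemma series_op_D0: "series_op CT AM D0"
  unfolding D0_def[abs_def] by (rule series_op_smul(1)[OF series_op_kS])

lemma topspace_CinfZ_top: "topspace (CinfZ_top n A Z :: ('m \<Rightarrow> 'k) topology) = CinfZ n A Z"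
proof
  show "topspace (CinfZ_top n A Z) \<subseteq> (CinfZ n A Z :: ('m \<Rightarrow> 'k) set)"
    using openin_topspace[of "CinfZ_top n A Z"] unfolding openin_CinfZ_top by blast
  have "{F \<in> Cinf n A. res0 Z F \<in> CinfZ n A Z} = (topspace CT :: ('m \<Rightarrow> 'k) set)"
    using res0_CinfZ by auto
  then have "openin (CinfZ_top n A Z) (CinfZ n A Z :: ('m \<Rightarrow> 'k) set)"
    unfolding openin_CinfZ_top by (simp only: openin_topspace subset_refl simp_thms)
  then show "(CinfZ n A Z :: ('m \<Rightarrow> 'k) set) \<subseteq> topspace (CinfZ_top n A Z)" by (rule openin_subset)
qed

lemma series_op_prolS: "series_op (CinfZ_top n A Z) GM prolS"
  unfolding series_op_def
proof (rule exI, rule series_op_const)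
  show "cont_op (CinfZ_top n A Z) GM (\<lambda>x S. prol (x S))"
  proof (rule cont_opI)
    show "prol (x S) = 0" if "x \<in> gelems (topspace (CinfZ_top n A Z)) GM" "S \<notin> AM" for x S
    proof -
      have "x S = 0" using that GM_AM by (auto simp: gelems_def)
      then show ?thesis by (simp add: prol_0)
    qed
    show "continuous_map (gtop (CinfZ_top n A Z) GM) CT (\<lambda>x. prol (x S))" for S
      using continuous_map_compose[OF continuous_map_gtop_component prol_cont] by (simp add: o_def)
  qed (use prol_linear in \<open>auto simp: gelems_def linear_map_on_def topspace_CinfZ_top gscale_def\<close>)
qed (simp add: slice_prolS)

lemma C_altdef: "C = gelems (series_in (topspace (CinfZ_top n A Z))) GM"
  by (simp add: cochains_def topspace_CinfZ_top)

lemma half_double: "smul (cst 2) (smul (cst (1 / 2)) x) = x" for x :: "nat set \<Rightarrow> ('m \<Rightarrow> 'k) fps"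
proof -
  have "(cst 2 :: ('m \<Rightarrow> 'k) fps) * cst (1 / 2) = 1"
    unfolding cst_simps(2)[symmetric] by (simp add: cst_simps)
  then show ?thesis by (simp only: smul_simps)
qed

lemma D0_homotopy:
  assumes x: "x \<in> V" shows "x - prolS (resS x) = D0 (k x) + k (D0 x)"
proof (rule slice_eqI)
  fix m
  have kx: "kext x \<in> V" "kS x \<in> V" using series_op_closed[OF series_op_kext, of x] series_op_closed[OF series_op_kS, of x] x by simp_all
  have "D0 (k x) = kS (kext x)"
    unfolding D0_def k_def series_op_cst_arg[OF series_op_kS kx(1)] by (rule half_double)
  moreover have "k (D0 x) = kext (kS x)"
    unfolding D0_def k_def series_op_cst_arg[OF series_op_kext kx(2)]
    using half_double by (simp only: smul_simps(5) mult.commute)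
  moreover have "slice (prolS (resS x)) m = prol_res (slice x m)"
    unfolding slice_prolS by (rule ext) (simp add: prol_res_def resS_def slice_def fps_ext_def prol_0)
  ultimately show "slice (x - prolS (resS x)) m = slice (D0 (k x) + k (D0 x)) m"
    unfolding slice_add slice_diff using koszul_homotopy[OF V_slice[OF x]] by (simp only: slice_kS slice_kext)
qed

lemma slice_0: "slice 0 m = 0"
  by (simp add: slice_def fun_eq_iff)

lemma k_V: "x \<in> V \<Longrightarrow> k x \<in> V" and kext_V: "x \<in> V \<Longrightarrow> kext x \<in> V" and kS_V: "x \<in> V \<Longrightarrow> kS x \<in> V"
  and D0_V: "x \<in> V \<Longrightarrow> D0 x \<in> V" and qk_V: "x \<in> V \<Longrightarrow> qk x \<in> V"
  using series_op_closed[OF series_op_k, of x] series_op_closed[OF series_op_kext, of x] series_op_closed[OF series_op_kS, of x]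
    series_op_closed[OF series_op_D0, of x] series_op_closed[OF series_op_qk, of x] by simp_all

lemma kext_kext: "x \<in> V \<Longrightarrow> kext (kext x) = 0"
  by (rule slice_eqI) (simp only: slice_kext hext_hext V_slice slice_0)

lemma k_k: "x \<in> V \<Longrightarrow> k (k x) = 0"
  unfolding k_def by (simp only: series_op_cst_arg[OF series_op_kext kext_V] kext_kext smul_simps)

lemma k_prolS: "z \<in> C \<Longrightarrow> k (prolS z) = 0"
proof -
  assume z: "z \<in> C"
  have "kext (prolS z) = 0"
  proof (rule slice_eqI)
    fix m
    show "slice (kext (prolS z)) m = slice 0 m"
      unfolding slice_kext slice_prolS slice_0 by (rule hext_prol) (rule C_slice[OF z], erule C_slice(2)[OF z])
  qed
  then show ?thesis by (simp only: k_def smul_simps)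
qed

lemma res0_add: "res0 Z (F + G) = res0 Z F + res0 Z G" for F G :: "'m \<Rightarrow> 'k"
  by (auto simp: res0_def fun_eq_iff)

lemma resS_add: "resS (x + y) = resS x + resS y"
  by (auto simp: resS_def fps_ext_def fun_eq_iff fps_eq_iff res0_add)

lemma resS_smul_cst: "resS (smul (cst r) x) = smul (cst r) (resS x)"
  by (rule ext) (simp add: resS_def smul_def fps_eq_iff fps_ext_def cst_mult_nth, auto simp: res0_def fscale_def fun_eq_iff)

lemma resS_C: "x \<in> V \<Longrightarrow> resS x \<in> C"
  by (auto simp: resS_def cochains_def gelems_def series_in_def fps_ext_def intro!: res0_CinfZ CinfZ_0)

lemma resS_prolS: "z \<in> C \<Longrightarrow> resS (prolS z) = z"
proof -
  assume z: "z \<in> C"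
  show ?thesis
  proof (rule slice_eqI, rule ext)
    fix m S
    show "slice (resS (prolS z)) m S = slice z m S"
      using C_slice[OF z, where m = m and S = S] by (auto simp: slice_def resS_def prolS_def fps_ext_def res_prol)
  qed
qed

lemma resS_kext: "resS (kext x) = 0"
proof
  fix S
  have "S \<in> GM \<Longrightarrow> S \<inter> {l..} = {}" by (auto simp: ghost_monomials_def)
  then show "resS (kext x) S = 0 S"
    by (auto simp: resS_def kext_def hext_def fps_ext_def fps_eq_iff res0_0)
qed

lemma resS_k: "resS (k x) = 0"
  by (simp only: k_def resS_smul_cst resS_kext smul_simps)

lemma resS_D0: "resS (D0 x) = 0"
proof -
  have "resS (kS x) = 0"
  proof
    fix S
    have "fps_ext (res0 Z) (kS x S) = 0"
    proof (rule fps_ext)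
      fix m
      have "fps_nth (kS x S) m = koszul l j (slice x m) S"
        using fun_cong[OF slice_kS[of x m], of S] by (simp only: slice_apply)
      moreover have "res0 Z (koszul l j (slice x m) S) = 0"
        by (rule ext) (simp add: res0_def koszul_apply sum_apply j_Z)
      ultimately show "fps_nth (fps_ext (res0 Z) (kS x S)) m = fps_nth 0 m" by (simp add: fps_ext_def)
    qed
    then show "resS (kS x) S = 0 S" by (simp add: resS_def)
  qed
  then show ?thesis by (simp only: D0_def resS_smul_cst smul_simps)
qed

lemma fps_ext_prol_0: "fps_ext prol 0 = 0"
  by (simp add: fps_ext_def fps_eq_iff prol_0)

lemma gder_prolS: "z \<in> C \<Longrightarrow> gder (l + a) (prolS z) = 0"
proof
  fix S assume z: "z \<in> C"
  have "insert (l + a) S \<notin> GM" by (auto simp: ghost_monomials_def)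
  then have "z (insert (l + a) S) = 0" using z by (simp add: cochains_def gelems_def)
  then show "gder (l + a) (prolS z) S = 0 S"
    by (simp add: gder_altdef prolS_def fps_ext_prol_0)
qed

lemma D0_prolS: "z \<in> C \<Longrightarrow> D0 (prolS z) = 0"
  unfolding D0_def kS_def koszul_altdef by (simp only: gder_prolS smul_simps sum.neutral_const)

lemma koszul_koszul: "koszul l u (koszul l u x) = 0" if "\<And>y :: nat set \<Rightarrow> 'c. y + y = 0 \<Longrightarrow> y = 0" for u :: "nat \<Rightarrow> 'c::comm_ring_1"
proof -
  have "koszul l u (koszul l u x) = (\<Sum>a<l. \<Sum>b<l. smul (u a * u b) (gder (l + a) (gder (l + b) x)))"
    unfolding koszul_altdef gder_sum gder_smul smul_sum smul_simps(5) ..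
  also have "\<dots> = 0"
  proof (rule that)
    let ?F = "\<lambda>a b. smul (u a * u b) (gder (l + a) (gder (l + b) x))"
    have "(\<Sum>a<l. \<Sum>b<l. ?F a b) = (\<Sum>a<l. \<Sum>b<l. ?F b a)" by (rule sum.swap)
    also have "\<dots> = - (\<Sum>a<l. \<Sum>b<l. ?F a b)"
      unfolding sum_negf[symmetric]
    proof (intro sum.cong refl)
      fix a b
      show "?F b a = - ?F a b"
        unfolding gder_gder[of "l + b" "l + a"] smul_simps(3) by (simp only: mult.commute)
    qed
    finally show "(\<Sum>a<l. \<Sum>b<l. ?F a b) + (\<Sum>a<l. \<Sum>b<l. ?F a b) = 0"
      by (simp only: eq_neg_iff_add_eq_0)
  qed
  finally show ?thesis .
qed

lemma D0_D0: "D0 (D0 x) = 0"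
  unfolding D0_def kS_def koszul_smul by (simp only: koszul_koszul[OF torsion(1)] smul_simps)

section \<open>Inverting the perturbed identity\<close>

text \<open>The homotopy replaces the antighosts of a monomial by one antighost more and keeps the ghosts.\<close>

lemma homog_kext_weight:
  assumes w: "\<And>S T. S \<in> AM \<Longrightarrow> S \<inter> {l..} \<noteq> {} \<Longrightarrow> T \<in> AG (card (S \<inter> {l..}) - 1) \<Longrightarrow> w S = w (S \<inter> {..<l} \<union> T) + q"
  shows "homog w q kext"
  unfolding homog_def
proof (intro ballI conjI allI)
  fix x d assume x: "x \<in> V"
  show "kext x \<in> V" by (rule kext_V[OF x])
  show "kext (proj w d x) = proj w (d + q) (kext x)"
  proof (rule slice_eqI)
    fix m
    have s: "slice (proj w d' y) m = proj w d' (slice y m)" for d' y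
      by (auto simp: slice_def proj_def)
    have "hext (proj w d y) S = proj w (d + q) (hext y) S" for y S
    proof (cases "S \<in> AM \<and> S \<inter> {l..} \<noteq> {}")
      case True
      let ?i = "card (S \<inter> {l..}) - 1"
      have wT: "w (S \<inter> {..<l} \<union> T) = d \<longleftrightarrow> w S = d + q" if "T \<in> AG ?i" for T
        using w[of S T] True that by auto
      have "part (proj w d y) (S \<inter> {..<l}) ?i = (if w S = d + q then part y (S \<inter> {..<l}) ?i else 0)"
      proof
        fix T show "part (proj w d y) (S \<inter> {..<l}) ?i T = (if w S = d + q then part y (S \<inter> {..<l}) ?i else 0) T"
          using wT[of T] by (cases "T \<in> AG ?i") (auto simp: part_def proj_def)
      qed
      then show ?thesis
        using True by (simp add: hext_def proj_def h_0 fscale_simps)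
    qed (auto simp: hext_def proj_def)
    then show "slice (kext (proj w d x)) m = slice (proj w (d + q) (kext x)) m"
      unfolding s slice_kext by blast
  qed
qed

lemma homog_kext: "homog (acount l) 1 kext" "homog (gdeg l) (-1) kext"
proof -
  have s: "card (S \<inter> {l..}) = Suc (card T)" "(S \<inter> {..<l} \<union> T) \<inter> {..<l} = S \<inter> {..<l}" "(S \<inter> {..<l} \<union> T) \<inter> {l..} = T"
    if "S \<in> AM" "S \<inter> {l..} \<noteq> {}" "T \<in> AG (card (S \<inter> {l..}) - 1)" for S T
  proof -
    have "card (S \<inter> {l..}) \<noteq> 0" using that AM_finite[OF that(1)] by auto
    then show "card (S \<inter> {l..}) = Suc (card T)" using AG_simps[OF that(3), of "S \<inter> {..<l}"] by auto
    show "(S \<inter> {..<l} \<union> T) \<inter> {..<l} = S \<inter> {..<l}" "(S \<inter> {..<l} \<union> T) \<inter> {l..} = T"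
      using AG_simps[OF that(3), of "S \<inter> {..<l}"] by auto
  qed
  show "homog (acount l) 1 kext" "homog (gdeg l) (-1) kext"
  proof -
    show "homog (acount l) 1 kext"
    proof (rule homog_kext_weight)
      fix S T assume *: "S \<in> AM" "S \<inter> {l..} \<noteq> {}" "T \<in> AG (card (S \<inter> {l..}) - 1)"
      show "acount l S = acount l (S \<inter> {..<l} \<union> T) + 1" unfolding acount_def s(2)[OF *] s(3)[OF *] s(1)[OF *] by simp
    qed
    show "homog (gdeg l) (-1) kext"
    proof (rule homog_kext_weight)
      fix S T assume *: "S \<in> AM" "S \<inter> {l..} \<noteq> {}" "T \<in> AG (card (S \<inter> {l..}) - 1)"
      show "gdeg l S = gdeg l (S \<inter> {..<l} \<union> T) + - 1" unfolding gdeg_def s(2)[OF *] s(3)[OF *] s(1)[OF *] by simp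
    qed
  qed
qed

lemma homog_k: "homog (acount l) 1 k" "homog (gdeg l) (-1) k"
  unfolding k_def[abs_def] by (intro homog_smul homog_kext)+

lemma homog_kS: "homog (acount l) (-1) kS" "homog (gdeg l) 1 kS"
proof -
  have jV: "smul (fps_const (j a)) x \<in> V" if "a < l" "x \<in> V" for a x
    by (rule gelems_sliceI) (simp only: slice_smul_const smul_j_E[OF that(1) V_slice[OF that(2)]])
  have "homog w q (\<lambda>x. smul (fps_const (j a)) (gder (l + a) x))" if "homog w q (gder (l + a))" "a < l" for w q a
    using that jV unfolding homog_def by (simp add: proj_smul)
  then show "homog (acount l) (-1) kS" "homog (gdeg l) 1 kS"
    unfolding kS_def[abs_def] koszul_altdef using homog_elementary by (auto intro!: homog_sum)
qed

text \<open>The part of \<open>(D - D0) k\<close> that preserves the number of antighosts. It vanishes modulo \<open>\<nu>\<close>, because the deformed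
  Koszul differential is a deformation of the classical one (\<open>slice_P_0\<close>).\<close>

definition P :: "(nat set \<Rightarrow> ('m \<Rightarrow> 'k) fps) \<Rightarrow> nat set \<Rightarrow> ('m \<Rightarrow> 'k) fps" where
  "P x = qk (kext x) - kS (kext x)"

lemma perturbation_k:
  assumes x: "x \<in> V" shows "D (k x) - D0 (k x) = delta (k x) + P x"
proof -
  have "smul (cst 2) (qk (k x)) = qk (kext x)" "D0 (k x) = kS (kext x)"
    unfolding D0_def k_def series_op_cst_arg[OF series_op_qk kext_V[OF x]] series_op_cst_arg[OF series_op_kS kext_V[OF x]] by (rule half_double)+
  then show ?thesis unfolding D_altdef[OF k_V[OF x]] P_def by simp
qed

lemma series_op_P: "series_op CT AM P"
  unfolding P_def[abs_def] by (rule series_op_diff[OF series_op_comp[OF series_op_kext series_op_qk] series_op_comp[OF series_op_kext series_op_kS]])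

lemma homog_P: "homog (acount l) 0 P"
  using homog_diff[OF homog_comp[OF homog_kext(1) homog_qk(1)] homog_comp[OF homog_kext(1) homog_kS(1)]]
  by (simp add: P_def[abs_def])

lemma slice_qk_0:
  assumes x: "x \<in> V" shows "slice (qk x) 0 = koszul l j (slice x 0)"
proof -
  have 1: "slice (rmul a y) 0 = smul (j a) (slice y 0)" if a: "a < l" and y: "y \<in> V" for a y
    by (rule ext) (simp add: slice_def lift_def smul_def fps_nth_star_0[OF V_coeff[OF y] Jb_CS[OF a]] Jb_0[OF a] mult.commute)
  have 2: "slice (smul (fps_X * q) y) 0 = 0" for q and y :: "nat set \<Rightarrow> ('m \<Rightarrow> 'k) fps"
    by (rule ext) (simp add: slice_def smul_def mult.assoc)
  have "slice (qk x) 0 = (\<Sum>a<l. slice (rmul a (gder (l + a) x)) 0)"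
    unfolding qk_altdef slice_add slice_sum 2 by (simp only: sum.neutral_const add_0_right)
  also have "\<dots> = (\<Sum>a<l. smul (j a) (gder (l + a) (slice x 0)))"
    by (rule sum.cong[OF refl]) (simp add: 1[OF _ V_gder[OF x]] slice_gder)
  finally show ?thesis unfolding koszul_altdef .
qed

lemma slice_P_0: "x \<in> V \<Longrightarrow> slice (P x) 0 = 0"
  unfolding P_def slice_diff slice_kS slice_qk_0[OF kext_V] by simp

definition const_series :: "(nat set \<Rightarrow> 'm \<Rightarrow> 'k) \<Rightarrow> nat set \<Rightarrow> ('m \<Rightarrow> 'k) fps" where
  "const_series y = (\<lambda>S. fps_const (y S))"

lemma const_series_V: "y \<in> E \<Longrightarrow> const_series y \<in> V"
  by (auto simp: const_series_def gelems_def series_in_def fps_nth_fps_const)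

lemma slice_const_series: "slice (const_series y) 0 = y"
  by (simp add: slice_def const_series_def)

lemma expansion_leading:
  assumes T: "expansion CT AM Ts T" and y: "y \<in> E"
  shows "Ts 0 y = slice (T (const_series y)) 0"
  using expansionD(2)[OF T, of "const_series y" 0] const_series_V[OF y] by (simp add: slice_const_series)

lemma series_op_linear:
  assumes "series_op CT AM T" "x \<in> V" "y \<in> V" shows "T (x + y) = T x + T y"
  by (rule series_op_add_arg[OF assms(1)]) (use assms V_add in auto)

lemma series_op_zero_arg: "series_op CT AM T \<Longrightarrow> T 0 = 0" for T :: "(nat set \<Rightarrow> ('m \<Rightarrow> 'k) fps) \<Rightarrow> nat set \<Rightarrow> ('m \<Rightarrow> 'k) fps"
  using series_op_linear[of T 0 0] V_0 by simp

text \<open>Modulo \<open>\<nu>\<close> only \<open>delta \<circ> k\<close> remains of \<open>(D - D0) k\<close>. It raises the number of antighosts, of which there are at most \<open>l\<close>,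
  so that its power \<open>Suc l\<close> is zero.\<close>

lemma ex_inverse:
  obtains U where "series_op CT AM U" "\<And>x. x \<in> V \<Longrightarrow> U x + (delta (k (U x)) + P (U x)) = x"
    "\<And>x. x \<in> V \<Longrightarrow> U (x + (delta (k x) + P x)) = x"
proof -
  define T where "T x = delta (k x) + P x" for x
  have "series_op CT AM T"
    unfolding T_def[abs_def] by (rule series_op_add[OF series_op_comp[OF series_op_k series_op_delta] series_op_P])
  then obtain Ts where Ts: "expansion CT AM Ts T" unfolding series_op_def by blast
  define N where "N = Ts 0"
  have dk: "homog (acount l) 1 (\<lambda>x. delta (k x))"
    using homog_comp[OF homog_k(1) homog_delta(1)] by simp
  have N_E: "N y \<in> E" if "y \<in> E" for y
    using cont_opD(5)[OF expansionD(1)[OF Ts], of y] that by (simp add: N_def)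
  have N_eq: "N y = slice (delta (k (const_series y))) 0" if y: "y \<in> E" for y
    unfolding N_def expansion_leading[OF Ts y] T_def slice_add slice_P_0[OF const_series_V[OF y]] by simp
  have proj_E: "proj w d y \<in> E" if "y \<in> E" for w d y
    using that by (auto simp: proj_def gelems_def)
  have N_proj: "N (proj (acount l) d y) = proj (acount l) (d + 1) (N y)" if y: "y \<in> E" for d y
  proof -
    have "const_series (proj (acount l) d y) = proj (acount l) d (const_series y)"
      by (auto simp: const_series_def proj_def)
    then have "N (proj (acount l) d y) = slice (proj (acount l) (d + 1) (delta (k (const_series y)))) 0"
      unfolding N_eq[OF proj_E[OF y]] using homogD[OF dk const_series_V[OF y]] by simp
    also have "\<dots> = proj (acount l) (d + 1) (N y)"
      unfolding N_eq[OF y] by (auto simp: slice_def proj_def)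
    finally show ?thesis .
  qed
  have N_0: "N 0 = 0"
    using N_proj[of 0 0] cont_opD(3)[OF expansionD(1)[OF Ts], of 0 0 0] by (simp add: N_def gelems_def)
  have pow_E: "(N ^^ q) y \<in> E" if "y \<in> E" for q y using that by (induction q) (auto simp: N_E)
  have pow: "(N ^^ q) (proj (acount l) d y) = proj (acount l) (d + int q) ((N ^^ q) y)" if y: "y \<in> E" for q d y
    by (induction q) (simp_all add: N_proj[OF pow_E[OF y]] ac_simps)
  have pow_0: "(N ^^ q) 0 = 0" for q by (induction q) (simp_all only: funpow.simps id_apply comp_apply N_0)
  have nil: "(Ts 0 ^^ Suc l) y = 0" if y: "y \<in> E" for y
  proof
    fix S
    let ?z = "(N ^^ Suc l) y"
    have z: "?z \<in> E" by (rule pow_E[OF y])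
    have "?z S = 0"
    proof (cases "S \<in> AM")
      case True
      have "S \<inter> {l..} \<subseteq> {l..<2 * l}" using True by (auto simp: all_monomials_def)
      then have "card (S \<inter> {l..}) \<le> card {l..<2 * l}" by (rule card_mono[rotated]) simp
      then have neg: "acount l S - int (Suc l) < 0" by (simp add: acount_def)
      have y0: "proj (acount l) (acount l S - int (Suc l)) y = 0"
        using neg by (auto simp: proj_def acount_def fun_eq_iff)
      have "proj (acount l) (acount l S) ?z = 0"
        using pow[OF y, of "Suc l" "acount l S - int (Suc l)"] unfolding y0 pow_0 diff_add_cancel by (rule sym)
      then have "proj (acount l) (acount l S) ?z S = 0" by (simp only: zero_fun_apply)
      then show ?thesis by (simp add: proj_def)
    qed (use z in \<open>simp add: gelems_def\<close>)
    then show "(Ts 0 ^^ Suc l) y S = 0 S" by (simp add: N_def)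
  qed
  show ?thesis
    by (rule series_op_inverse[OF Ts nil]) (use that T_def in auto)
qed

section \<open>The deformed restriction\<close>

text \<open>The last term of the deformed Koszul differential creates an antighost and does not contribute at ghost
  monomials.\<close>

lemma qk_at:
  assumes "S \<in> GM"
  shows "qk y S = (\<Sum>a<l. star \<mu> (gder (l + a) y S) (Jb a)) + (\<Sum>a<l. \<Sum>b<l. tr_cst a b * gder (l + a) y S)"
proof -
  have "gwedge (l + c) z S = 0" for c and z :: "nat set \<Rightarrow> ('m \<Rightarrow> 'k) fps"
    using assms by (auto simp: gwedge_def ghost_monomials_def)
  then show ?thesis
    unfolding qk_altdef by (simp add: sum_apply[of _ _ S] smul_def lift_def del: of_real_divide)
qed

text \<open>The derivative and the homotopy both pass the ghosts in \<open>S\<close>, so that their signs cancel and the ghosts can be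
  dropped.\<close>

lemma gder_kext_at:
  assumes x: "x \<in> V" and S: "S \<in> GM" and a: "a < l"
  shows "gder (l + a) (kext x) S = gder (l + a) (\<lambda>S'. fps_ext (\<lambda>u. h 0 (gemb u) S') (x S)) {}"
proof (rule fps_ext)
  fix m
  have S': "S \<subseteq> {..<l}" "finite S" using S AM_finite[OF GM_AM[OF S]] by (auto simp: ghost_monomials_def)
  have i: "insert (l + a) S \<in> AM" "insert (l + a) S \<inter> {..<l} = S" "insert (l + a) S \<inter> {l..} = {l + a}" "l + a \<notin> S"
    using S' a by (auto simp: all_monomials_def)
  have b: "below (l + a) S = card S" "below (l + a) {} = 0"
  proof -
    have "{s \<in> S. s < l + a} = S" using S' by auto
    then show "below (l + a) S = card S" "below (l + a) {} = 0" by (simp_all add: below_def)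
  qed
  have "hext (slice x m) (insert (l + a) S) = fscale ((-1) ^ card S) (h 0 (gemb (slice x m S)) {l + a})"
    unfolding hext_def i(2,3) using i(1) part_0[OF V_slice[OF x] S'(1)] by simp
  then have "fps_nth (gder (l + a) (kext x) S) m = (-1) ^ card S * fscale ((-1) ^ card S) (h 0 (gemb (slice x m S)) {l + a})"
    using i(4) b(1) by (simp add: gder_altdef kext_def minus_one_power_iff)
  also have "\<dots> = h 0 (gemb (slice x m S)) {l + a}"
    by (auto simp: fscale_def fun_eq_iff)
  also have "\<dots> = fps_nth (gder (l + a) (\<lambda>S'. fps_ext (\<lambda>u. h 0 (gemb u) S') (x S)) {}) m"
    by (simp add: gder_altdef b(2) fps_ext_def slice_def)
  finally show "fps_nth (gder (l + a) (kext x) S) m = \<dots>" .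
qed

abbreviation res_op :: "('m \<Rightarrow> 'k) fps \<Rightarrow> ('m \<Rightarrow> 'k) fps" where
  "res_op \<equiv> res_operator l \<mu> f j Jb h"

lemma res_op_at:
  assumes x: "x \<in> V" and S: "S \<in> GM"
  shows "(x + P x) S = res_op (x S)"
proof -
  have e: "{} \<in> GM" by (simp add: ghost_monomials_def)
  define w where "w = (\<lambda>S'. fps_ext (\<lambda>u. h 0 (gemb u) S') (x S))"
  have g: "gder (l + a) (kext x) S = gder (l + a) w {}" if "a < l" for a
    unfolding w_def by (rule gder_kext_at[OF x S that])
  have "qk (kext x) S = qk w {}"
    unfolding qk_at[OF S] qk_at[OF e] by (intro arg_cong2[of _ _ _ _ "(+)"] sum.cong refl) (simp_all add: g)
  moreover have "kS (kext x) S = koszul l (\<lambda>a. fps_const (j a)) w {}"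
    unfolding kS_def koszul_apply by (rule sum.cong) (simp_all add: g)
  ultimately show ?thesis
    unfolding res_operator_def Let_def w_def[symmetric] P_def by simp
qed

lemma GM_acount: "S \<in> GM \<Longrightarrow> acount l S = 0"
proof -
  assume "S \<in> GM"
  then have "S \<inter> {l..} = {}" by (auto simp: ghost_monomials_def)
  then show ?thesis by (simp add: acount_def)
qed

lemma acount_GM: "S \<in> AM \<Longrightarrow> acount l S = 0 \<Longrightarrow> S \<in> GM"
proof -
  assume S: "S \<in> AM" "acount l S = 0"
  then have "S \<inter> {l..} = {}" using AM_finite[OF S(1)] by (simp add: acount_def)
  then show ?thesis by (auto simp: ghost_monomials_def disjoint_iff not_le)
qed

text \<open>The deformed restriction is defined by choosing preimages under this operator. By \<open>res_op_at\<close> it is the restriction of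
  \<open>id + P\<close> to elements of ghost and antighost number zero, and \<open>id + P\<close> is invertible because \<open>P\<close> vanishes
  modulo \<open>\<nu>\<close>.\<close>

lemma inj_res_op: "inj_on res_op CS"
proof
  fix F F' assume F: "F \<in> CS" "F' \<in> CS" and eq: "res_op F = res_op F'"
  obtain Ts where Ts: "expansion CT AM Ts P" using series_op_P unfolding series_op_def by blast
  have nil: "(Ts 0 ^^ 1) y = 0" if "y \<in> E" for y
    using expansion_leading[OF Ts that] slice_P_0[OF const_series_V[OF that]] by simp
  obtain U where U: "\<And>x. x \<in> V \<Longrightarrow> U (x + P x) = x"
    by (rule series_op_inverse[OF Ts nil]) (assumption, rule that)
  have V: "gemb F \<in> V" if "F \<in> CS" for F
    using that by (auto simp: gemb_def gelems_def CS_0 all_monomials_def)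
  have out: "(gemb F + P (gemb F)) S = 0" if F: "F \<in> CS" and S: "S \<notin> GM" for F S
  proof (cases "S \<in> AM")
    case True
    then have "acount l S \<noteq> 0" using acount_GM S by blast
    moreover have "proj (acount l) 0 (gemb F) = gemb F" by (auto simp: proj_def gemb_def acount_def)
    then have "P (gemb F) = proj (acount l) 0 (P (gemb F))"
      using homogD[OF homog_P V[OF F], of 0] by simp
    then have "P (gemb F) S = proj (acount l) 0 (P (gemb F)) S" by (rule fun_cong)
    ultimately show ?thesis by (auto simp: proj_def gemb_def acount_def)
  next
    case False
    have "gemb F + P (gemb F) \<in> V" by (intro V_add V F homog_V[OF homog_P])
    then show ?thesis using False by (simp add: gelems_def)
  qed
  have "gemb F + P (gemb F) = gemb F' + P (gemb F')"
  proof
    fix S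
    show "(gemb F + P (gemb F)) S = (gemb F' + P (gemb F')) S"
    proof (cases "S \<in> GM")
      case True
      show ?thesis
        unfolding res_op_at[OF V[OF F(1)] True] res_op_at[OF V[OF F(2)] True] using eq by (simp add: gemb_def)
    next
      case False
      show ?thesis unfolding out[OF F(1) False] out[OF F(2) False] ..
    qed
  qed
  then have "U (gemb F + P (gemb F)) = U (gemb F' + P (gemb F'))" by (rule arg_cong)
  then have "gemb F = gemb F'" unfolding U[OF V[OF F(1)]] U[OF V[OF F(2)]] .
  then have "gemb F {} = gemb F' {}" by simp
  then show "F = F'" by (simp add: gemb_def)
qed

abbreviation R :: "(nat set \<Rightarrow> ('m \<Rightarrow> 'k) fps) \<Rightarrow> nat set \<Rightarrow> ('m \<Rightarrow> 'k) fps" where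
  "R \<equiv> quantum_res_ext n A Z l \<mu> f j Jb h"

abbreviation \<rho> :: "('m \<Rightarrow> 'k) fps \<Rightarrow> ('m \<Rightarrow> 'k) fps" where
  "\<rho> \<equiv> quantum_res n A Z l \<mu> f j Jb h"

text \<open>Since \<open>delta \<circ> k\<close> produces antighosts, the equation \<open>U x + (D - D0) k (U x) = x\<close> says on ghost
  monomials that \<open>U x\<close> is the preimage of \<open>x\<close> used by the deformed restriction.\<close>

lemma R_altdef:
  assumes U: "series_op CT AM U" "\<And>x. x \<in> V \<Longrightarrow> U x + (delta (k (U x)) + P (U x)) = x" and x: "x \<in> V"
  shows "R x = resS (U x)"
proof
  fix S
  show "R x S = resS (U x) S"
  proof (cases "S \<in> GM")
    case S: True
    define y where "y = U x"
    have y: "y \<in> V" using series_op_closed[OF U(1), of x] x by (simp add: y_def)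
    have "homog (acount l) 1 (\<lambda>x. delta (k x))"
      using homog_comp[OF homog_k(1) homog_delta(1)] by simp
    then have "proj (acount l) 0 (delta (k y)) = delta (k (proj (acount l) (-1) y))"
      using homogD[of "acount l" 1 "\<lambda>x. delta (k x)" y "-1"] y by simp
    moreover have "proj (acount l) (-1) y = 0" by (auto simp: proj_def acount_def fun_eq_iff)
    moreover have "delta (k 0) = 0" by (simp only: series_op_zero_arg[OF series_op_k] series_op_zero_arg[OF series_op_delta])
    ultimately have "proj (acount l) 0 (delta (k y)) S = 0" by simp
    then have "delta (k y) S = 0" using GM_acount[OF S] by (simp add: proj_def)
    moreover have "x S = y S + (delta (k y) S + P y S)"
      using fun_cong[OF U(2)[OF x], of S] by (simp add: y_def)
    ultimately have "x S = res_op (y S)" using res_op_at[OF y S] by simp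
    then have "inv_into CS res_op (x S) = y S"
      using inv_into_f_f[OF inj_res_op V_coeff[OF y]] by simp
    then show ?thesis using S by (simp add: quantum_res_ext_def quantum_res_def resS_def y_def)
  qed (simp add: quantum_res_ext_def resS_def)
qed

section \<open>The perturbed contraction\<close>

lemma R_at: "R x S = (if S \<in> GM then \<rho> (x S) else 0)"
  by (simp add: quantum_res_ext_def)

text \<open>These facts are not visible in the definition by preimages; they are transported from \<open>U\<close>.\<close>

lemma R_linear:
  assumes x: "x \<in> V"
  shows "y \<in> V \<Longrightarrow> R (x + y) = R x + R y" and "R (smul (cst r) x) = smul (cst r) (R x)"
    and "z \<in> C \<Longrightarrow> R (prolS z) = z"
proof -
  obtain U where U: "series_op CT AM U" "\<And>x. x \<in> V \<Longrightarrow> U x + (delta (k (U x)) + P (U x)) = x"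
    "\<And>x. x \<in> V \<Longrightarrow> U (x + (delta (k x) + P x)) = x"
    by (rule ex_inverse) blast
  have R: "R x = resS (U x)" if "x \<in> V" for x
    by (rule R_altdef[OF U(1) _ that]) (rule U(2))
  show "R (x + y) = R x + R y" if y: "y \<in> V"
    unfolding R[OF V_add[OF x y]] R[OF x] R[OF y] series_op_linear[OF U(1) x y] by (rule resS_add)
  show "R (smul (cst r) x) = smul (cst r) (R x)"
    unfolding R[OF V_cst[OF x]] R[OF x] series_op_cst_arg[OF U(1) x] by (rule resS_smul_cst)
  show "R (prolS z) = z" if z: "z \<in> C"
  proof -
    have p: "prolS z \<in> V" using series_op_closed[OF series_op_prolS] z by (simp add: C_altdef)
    have "P (prolS z) = smul (cst 2) (qk (k (prolS z))) - D0 (k (prolS z))"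
      using perturbation_k[OF p] unfolding D_altdef[OF k_V[OF p]] by simp
    then have "P (prolS z) = 0"
      unfolding k_prolS[OF z] series_op_zero_arg[OF series_op_qk] series_op_zero_arg[OF series_op_D0] smul_simps by simp
    then have "U (prolS z) = prolS z"
      using U(3)[OF p] unfolding k_prolS[OF z] series_op_zero_arg[OF series_op_delta] by simp
    then show ?thesis unfolding R[OF p] by (simp only: resS_prolS[OF z])
  qed
qed

lemma prolS_V: "z \<in> C \<Longrightarrow> prolS z \<in> V"
  using series_op_closed[OF series_op_prolS] by (simp add: C_altdef)

lemma R_0: "R 0 = 0"
proof -
  have "R (0 + 0) = R 0 + R 0" by (rule R_linear(1)[OF V_0 V_0])
  then show ?thesis by (simp only: add_0 add_cancel_right_right)
qed

lemma R_additive: "additive_over V R"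
  using V_0 R_0 V_add R_linear(1) unfolding additive_over_def by blast

lemma \<rho>_linear:
  assumes F: "F \<in> CS"
  shows "\<rho> 0 = 0" and "\<rho> ((-1) ^ q * F) = (-1) ^ q * \<rho> F"
proof -
  have e: "{} \<in> GM" by (simp add: ghost_monomials_def)
  have V: "gemb F \<in> V" using F by (auto simp: gemb_def gelems_def CS_0 all_monomials_def)
  show "\<rho> 0 = 0" using fun_cong[OF R_0, of "{}"] e by (simp add: R_at)
  have "smul (cst (-1)) (gemb F) = gemb (- F)"
    by (auto simp: smul_def gemb_def fun_eq_iff cst_simps)
  then have "R (gemb (- F)) = smul (cst (-1)) (R (gemb F))" using R_linear(2)[OF V, of "-1"] by (simp only:)
  then have "R (gemb (- F)) {} = smul (cst (-1)) (R (gemb F)) {}" by (rule fun_cong)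
  then have "\<rho> (- F) = - \<rho> F" using e by (simp add: R_at smul_def gemb_def cst_simps)
  then show "\<rho> ((-1) ^ q * F) = (-1) ^ q * \<rho> F" by (cases "even q") auto
qed

lemma R_gwedge: "x \<in> V \<Longrightarrow> a < l \<Longrightarrow> R (gwedge a x) = gwedge a (R x)"
  and R_gder: "x \<in> V \<Longrightarrow> a < l \<Longrightarrow> R (gder a x) = gder a (R x)"
  by (auto simp: fun_eq_iff R_at gwedge_def gder_def \<rho>_linear[OF V_coeff] ghost_monomials_def)

lemma qk_prolS: "z \<in> C \<Longrightarrow> qk (prolS z) = 0"
proof -
  assume z: "z \<in> C"
  have "rmul a 0 = 0" if "a < l" for a
    using coeff_op_0[OF rmul_op[OF that]] by (simp add: lift_def fun_eq_iff)
  then have 1: "(\<Sum>a<l. rmul a 0) = 0" by (intro sum.neutral) simp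
  show ?thesis
    unfolding qk_altdef by (simp only: gder_prolS[OF z] smul_simps gder_0 gwedge_0 1 sum.neutral_const add_0)
qed

text \<open>On \<open>prolS z\<close> the terms of \<open>D\<close> with an antighost derivative vanish. The star commutators with the quantum moment map
  become the representation, and the term with two ghosts and one ghost derivative is already the other
  part of the Chevalley-Eilenberg differential.\<close>

lemma R_D_prolS:
  assumes z: "z \<in> C"
  shows "R (D (prolS z) - D0 (prolS z)) = ce_differential l f (\<lambda>a. quantum_rep n A Z l \<mu> f j Jb prol h (Jb a)) z"
proof -
  let ?p = "prolS z"
  note p = prolS_V[OF z]
  define u where "u a = gwedge a (lift (inner_der (Jb a)) ?p)" for a
  define v where "v a b c = smul (cst 2 * g a b c) (gwedge a (gwedge b (gder c ?p)))" for a b c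
  have L: "lift (inner_der (Jb a)) ?p \<in> V" if "a < l" for a
    by (rule lift_V[OF coeff_op_inner_der[OF Jb_CS[OF that]] p])
  have uV: "u a \<in> V" if "a < l" for a
    unfolding u_def using that by (intro V_gwedge L) auto
  have wV: "gwedge a (gwedge b (gder c ?p)) \<in> V" if "a < l" "b < l" for a b c
    using that by (intro V_gwedge V_gder p) auto
  have g2: "cst 2 * g a b c = cst (- (of_real (f a b c / 2)))" for a b c
    unfolding g_def cst_simps(2)[symmetric] by simp
  have vV: "v a b c \<in> V" if "a < l" "b < l" for a b c
    unfolding v_def g2 by (intro V_cst wV that)
  have "D ?p - D0 ?p = (\<Sum>a<l. u a) + (\<Sum>a<l. \<Sum>b<l. \<Sum>c<l. v a b c)"
    unfolding D_altdef[OF p] qk_prolS[OF z] D0_prolS[OF z] delta_def u_def v_def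
    by (simp only: gder_prolS[OF z] gwedge_0 smul_simps add_0_right diff_0_right)
  moreover have "R ((\<Sum>a<l. u a) + (\<Sum>a<l. \<Sum>b<l. \<Sum>c<l. v a b c)) =
      (\<Sum>a<l. R (u a)) + (\<Sum>a<l. \<Sum>b<l. \<Sum>c<l. R (v a b c))"
  proof -
    have C: "(\<Sum>a<l. u a) \<in> V" "(\<Sum>a<l. \<Sum>b<l. \<Sum>c<l. v a b c) \<in> V"
      by (rule sum3_additive_over(1)[OF R_additive] sum_additive_over(1)[OF R_additive]; use uV vV in simp)+
    show ?thesis
      unfolding R_linear(1)[OF C]
      by (intro arg_cong2[of _ _ _ _ "(+)"] sum3_additive_over(2)[OF R_additive] sum_additive_over(2)[OF R_additive])
        (use uV vV in auto)
  qed
  ultimately have "R (D ?p - D0 ?p) = (\<Sum>a<l. R (u a)) + (\<Sum>a<l. \<Sum>b<l. \<Sum>c<l. R (v a b c))"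
    by (simp only:)
  moreover have "R (u a) = gwedge a (\<lambda>S. quantum_rep n A Z l \<mu> f j Jb prol h (Jb a) (z S))" if a: "a < l" for a
  proof -
    have "R (lift (inner_der (Jb a)) ?p) S = quantum_rep n A Z l \<mu> f j Jb prol h (Jb a) (z S)" for S
    proof (cases "S \<in> GM")
      case False
      then have "z S = 0" using z by (simp add: cochains_def gelems_def)
      then have "quantum_rep n A Z l \<mu> f j Jb prol h (Jb a) (z S) = 0"
        using coeff_op_0[OF coeff_op_inner_der[OF Jb_CS[OF a]]] \<rho>_linear(1)[OF CS_0]
        by (simp add: quantum_rep_def fps_ext_prol_0 inner_der_def)
      then show ?thesis using False by (simp add: R_at)
    qed (simp add: R_at quantum_rep_def lift_def inner_der_def prolS_def)
    then show ?thesis unfolding u_def R_gwedge[OF L[OF a] a] by presburger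
  qed
  moreover have "R (v a b c) = - (\<lambda>S. cst (of_real (f a b c / 2)) * gwedge a (gwedge b (gder c z)) S)"
    if m: "a < l" "b < l" "c < l" for a b c
  proof -
    have "R (gwedge a (gwedge b (gder c ?p))) = gwedge a (gwedge b (gder c z))"
      using m by (simp add: R_gwedge R_gder V_gwedge V_gder p R_linear(3)[OF p z])
    then show ?thesis
      unfolding v_def g2 R_linear(2)[OF wV[OF m(1,2)]] by (auto simp: smul_def fun_eq_iff cst_simps)
  qed
  ultimately show ?thesis
    unfolding ce_differential_def by (simp add: sum_negf)
qed

lemma contraction_cong:
  assumes "contraction V D C d r \<Phi> H" "\<And>z. z \<in> C \<Longrightarrow> d z = d' z" "\<And>x. x \<in> V \<Longrightarrow> r x = r' x"
    and "\<And>x. x \<in> V \<Longrightarrow> D x \<in> V"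
  shows "contraction V D C d' r' \<Phi> H"
  using assms(1,4) unfolding contraction_def by (simp add: assms(2,3)[symmetric])

lemma brst_space_deg_altdef: "brst_space_deg n A l d = {x \<in> V. proj (gdeg l) d x = x}"
  by (force simp: brst_space_deg_def gelems_def proj_def fun_eq_iff)

theorem quantum_contraction:
  "\<exists>\<Phi> H.
     linear_map_on nuscale nuscale (cochains n A Z l) (brst_space n A l) \<Phi> \<and>
     linear_map_on nuscale nuscale (brst_space n A l) (brst_space n A l) H \<and>
     (\<forall>i. \<forall>z\<in>cochains_deg n A Z l i. \<Phi> z \<in> brst_space_deg n A l i) \<and>
     (\<forall>i. \<forall>x\<in>brst_space_deg n A l i. H x \<in> brst_space_deg n A l (i - 1)) \<and>
     series_of_continuous (CinfZ_top n A Z) (ghost_monomials l) (Cinf_top n A) (all_monomials l) \<Phi> \<and>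
     series_of_continuous (Cinf_top n A) (all_monomials l) (Cinf_top n A) (all_monomials l) H \<and>
     contraction (brst_space n A l) (brst_differential l \<mu> f Jb) (cochains n A Z l)
       (ce_differential l f (\<lambda>a. quantum_rep n A Z l \<mu> f j Jb prol h (Jb a))) R \<Phi> H"
proof -
  obtain U where U: "series_op CT AM U" "\<And>x. x \<in> V \<Longrightarrow> U x + (delta (k (U x)) + P (U x)) = x"
    "\<And>x. x \<in> V \<Longrightarrow> U (x + (delta (k x) + P x)) = x"
    by (rule ex_inverse) blast
  have UV: "U x \<in> V" if "x \<in> V" for x using series_op_closed[OF U(1)] that by simp
  interpret p: perturbation V C D D0 k U prolS resS
  proof
    show "prolS 0 = 0" by (simp add: prolS_def fps_ext_prol_0 fun_eq_iff)
    show "U x + (D (k (U x)) - D0 (k (U x))) = x" if "x \<in> V" for x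
      unfolding perturbation_k[OF UV[OF that]] by (rule U(2)[OF that])
    show "U (x + (D (k x) - D0 (k x))) = x" if "x \<in> V" for x
      unfolding perturbation_k[OF that] by (rule U(3)[OF that])
  qed (simp_all only: V_add V_diff D_V D0_V k_V UV prolS_V resS_C series_op_linear[OF series_op_D] series_op_linear[OF series_op_D0] series_op_linear[OF series_op_k]
      series_op_linear[OF U(1)] resS_add D_D D0_D0 resS_D0 D0_prolS resS_prolS D0_homotopy k_k k_prolS resS_k)
  have R: "R x = p.res x" if "x \<in> V" for x
    unfolding p.res_def by (rule R_altdef[OF U(1) _ that]) (rule U(2))
  have contr: "contraction V D C (ce_differential l f (\<lambda>a. quantum_rep n A Z l \<mu> f j Jb prol h (Jb a))) R p.\<Phi> p.H"
  proof (rule contraction_cong[OF p.perturbed_contraction])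
    show "p.res (p.t (prolS z)) = ce_differential l f (\<lambda>a. quantum_rep n A Z l \<mu> f j Jb prol h (Jb a)) z" if "z \<in> C" for z
      unfolding R[OF p.t_V[OF prolS_V[OF that]], symmetric] unfolding p.t_def by (rule R_D_prolS[OF that])
    show "p.res x = R x" if "x \<in> V" for x by (rule R[OF that, symmetric])
  qed (rule D_V)
  have series_op_H: "series_op CT AM p.H"
    unfolding p.H_def[abs_def] by (rule series_op_comp[OF U(1) series_op_k])
  have series_op_t: "series_op CT AM p.t"
    unfolding p.t_def[abs_def] by (rule series_op_diff[OF series_op_D series_op_D0])
  have series_op_\<Phi>: "series_op (CinfZ_top n A Z) GM p.\<Phi>"
    unfolding p.\<Phi>_def[abs_def] by (rule series_op_diff[OF series_op_prolS series_op_comp[OF series_op_comp[OF series_op_prolS series_op_t] series_op_H]])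
  have "homog (gdeg l) 0 (\<lambda>x. delta (k x))" "homog (gdeg l) 0 P"
    using homog_comp[OF homog_k(2) homog_delta(2)]
      homog_diff[OF homog_comp[OF homog_kext(2) homog_qk(2)] homog_comp[OF homog_kext(2) homog_kS(2)]]
    by (simp_all add: P_def[abs_def])
  then have B: "homog (gdeg l) 0 (\<lambda>x. x + (delta (k x) + P x))"
    by (intro homog_add homog_id)
  \<comment> \<open>\<open>U\<close> is homogeneous because its inverse is\<close>
  have "homog (gdeg l) 0 U"
    unfolding homog_def
  proof (intro ballI conjI allI)
    fix x d assume x: "x \<in> V"
    show "U x \<in> V" by (rule UV[OF x])
    have "proj (gdeg l) d x = proj (gdeg l) d (U x + (delta (k (U x)) + P (U x)))"
      unfolding U(2)[OF x] ..
    also have "\<dots> = proj (gdeg l) d (U x) + (delta (k (proj (gdeg l) d (U x))) + P (proj (gdeg l) d (U x)))"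
      using homogD[OF B UV[OF x], of d] by (simp only: add_0_right)
    finally show "U (proj (gdeg l) d x) = proj (gdeg l) (d + 0) (U x)"
      using U(3)[OF proj_V[OF UV[OF x]], of "gdeg l" d] by (simp only: add_0_right)
  qed
  then have homog_H: "homog (gdeg l) (-1) p.H"
    using homog_comp[OF _ homog_k(2)] unfolding p.H_def[abs_def] by fastforce
  have homog_t: "homog (gdeg l) 1 p.t"
  proof -
    have "homog (gdeg l) 1 D0" unfolding D0_def[abs_def] by (intro homog_smul homog_kS)
    then show ?thesis unfolding p.t_def[abs_def] by (intro homog_diff homog_D)
  qed
  have H_deg: "p.H x \<in> brst_space_deg n A l (d - 1)" if "x \<in> brst_space_deg n A l d" for x d
    using that homogD[OF homog_H, of x d] p.H_V[of x] by (simp add: brst_space_deg_altdef)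
  have t_deg: "p.t x \<in> brst_space_deg n A l (d + 1)" if "x \<in> brst_space_deg n A l d" for x d
    using that homogD[OF homog_t, of x d] p.t_V[of x] by (simp add: brst_space_deg_altdef)
  have \<Phi>_deg: "p.\<Phi> z \<in> brst_space_deg n A l d" if z: "z \<in> cochains_deg n A Z l d" for z d
  proof -
    have zC: "z \<in> C" using z by (auto simp: cochains_deg_def cochains_def gelems_def)
    have "prolS z \<in> brst_space_deg n A l d"
      using z prolS_V[OF zC] by (auto simp: cochains_deg_def brst_space_deg_altdef gelems_def proj_def prolS_def fps_ext_prol_0 fun_eq_iff)
    then show ?thesis
      using H_deg[OF t_deg, of "prolS z" d] unfolding p.\<Phi>_def brst_space_deg_altdef by (simp add: V_diff proj_diff)
  qed
  have CZ: "u + v \<in> CinfZ n A Z" "fscale r u \<in> CinfZ n A Z"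
    if uv: "u \<in> CinfZ n A Z" "v \<in> CinfZ n A Z" for u v :: "'m \<Rightarrow> 'k" and r
  proof -
    obtain F G where F: "F \<in> Cinf n A" "u = res0 Z F" "G \<in> Cinf n A" "v = res0 Z G"
      using uv unfolding CinfZ_def by blast
    have "fscale r u = res0 Z (fscale r F)" using F by (auto simp: res0_def fscale_def fun_eq_iff)
    then show "fscale r u \<in> CinfZ n A Z" using F by (simp add: res0_CinfZ C_fscale)
    show "u + v \<in> CinfZ n A Z" unfolding F res0_add[symmetric] by (intro res0_CinfZ C_add F)
  qed
  have "linear_map_on nuscale nuscale C V p.\<Phi>"
    unfolding C_altdef by (rule series_op_linear_map[OF series_op_\<Phi>]) (simp_all only: topspace_CinfZ_top CZ)
  moreover have "linear_map_on nuscale nuscale V V p.H"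
    using series_op_linear_map[OF series_op_H] by (simp add: C_add C_fscale)
  moreover note \<Phi>_deg H_deg series_op_series_of_continuous[OF series_op_\<Phi>] series_op_series_of_continuous[OF series_op_H] contr
  ultimately show ?thesis unfolding brst_space_def by blast
qed

end

section \<open>Structure constants of the Lie algebra\<close>

lemma vector_fieldD:
  assumes "X \<in> vector_fields n A"
  shows "u \<in> Cinf n A \<Longrightarrow> X u \<in> Cinf n A" and "u \<notin> Cinf n A \<Longrightarrow> X u = 0"
    and "u \<in> Cinf n A \<Longrightarrow> v \<in> Cinf n A \<Longrightarrow> X (u + v) = X u + X v"
    and "u \<in> Cinf n A \<Longrightarrow> X (fscale r u) = fscale r (X u)"
    and "u \<in> Cinf n A \<Longrightarrow> v \<in> Cinf n A \<Longrightarrow> X (u * v) = X u * v + u * X v"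
  using assms unfolding vector_fields_def fscale_def by blast+

lemma vf_scale_altdef: "vf_scale r X u = fscale r (X u)"
  by (simp add: vf_scale_def fscale_def)

text \<open>The differential depends on the Lie algebra only through its structure constants. Their antisymmetry and Jacobi
  identity are those of the bracket, by independence of the basis.\<close>

locale lie_data =
  fixes p :: nat and B :: "'g::{t2_space, second_countable_topology} chart set" and G :: "'g monoid"
    and l :: nat and e :: "nat \<Rightarrow> ('g \<Rightarrow> real) \<Rightarrow> 'g \<Rightarrow> real" and f :: "nat \<Rightarrow> nat \<Rightarrow> nat \<Rightarrow> real"
  assumes atlas: "smooth_atlas p B"
    and basis: "lie_basis (lie_algebra p B G) l e"
    and structure_constants:
      "a < l \<Longrightarrow> b < l \<Longrightarrow> vf_bracket (e a) (e b) = (\<Sum>c<l. vf_scale (f a b c) (e c))"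
begin

abbreviation W :: "('g \<Rightarrow> real) set" where "W \<equiv> Cinf p B"

lemma W_simps: "u \<in> W \<Longrightarrow> v \<in> W \<Longrightarrow> u + v \<in> W" "u \<in> W \<Longrightarrow> fscale r u \<in> W" "0 \<in> W"
  by (simp_all add: Cinf_add[OF atlas] Cinf_fscale[OF atlas] Cinf_0[OF atlas])

lemma e_L: "a < l \<Longrightarrow> e a \<in> lie_algebra p B G"
  and independent: "(\<Sum>a<l. vf_scale (r a) (e a)) = 0 \<Longrightarrow> a < l \<Longrightarrow> r a = 0"
  using basis unfolding lie_basis_def by blast+

lemma L_vf: "X \<in> lie_algebra p B G \<Longrightarrow> X \<in> vector_fields p B"
  by (simp add: lie_algebra_def)

lemma vf_zero: "X \<in> vector_fields p B \<Longrightarrow> X 0 = 0"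
proof -
  assume "X \<in> vector_fields p B"
  then have "X (0 + 0) = X 0 + X 0" using vector_fieldD(3)[of X p B 0 0] W_simps by blast
  then show ?thesis by (simp only: add_0 add_cancel_right_right)
qed

lemma vf_diff:
  assumes X: "X \<in> vector_fields p B" and u: "u \<in> W" "v \<in> W" shows "X (u - v) = X u - X v"
proof -
  have m: "- v = fscale (-1) v" for v :: "'g \<Rightarrow> real" by (auto simp: fscale_def)
  have "X (u + fscale (-1) v) = X u + fscale (-1) (X v)"
    using vector_fieldD(3,4)[OF X] u W_simps by simp
  then show ?thesis unfolding m[symmetric] by simp
qed

lemma lie_algebra_closed:
  "X \<in> lie_algebra p B G \<Longrightarrow> Y \<in> lie_algebra p B G \<Longrightarrow> X + Y \<in> lie_algebra p B G"
  "X \<in> lie_algebra p B G \<Longrightarrow> vf_scale r X \<in> lie_algebra p B G"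
  "0 \<in> lie_algebra p B G"
proof -
  show "0 \<in> lie_algebra p B G"
    using W_simps by (auto simp: lie_algebra_def vector_fields_def zero_fun_def)
  assume X: "X \<in> lie_algebra p B G"
  show "vf_scale r X \<in> lie_algebra p B G"
    unfolding lie_algebra_def vector_fields_def vf_scale_altdef[abs_def]
    using X W_simps vector_fieldD[OF L_vf[OF X]]
    by (auto simp: fscale_def lie_algebra_def fun_eq_iff algebra_simps)
  assume Y: "Y \<in> lie_algebra p B G"
  show "X + Y \<in> lie_algebra p B G"
    unfolding lie_algebra_def vector_fields_def
    using X Y W_simps vector_fieldD[OF L_vf[OF X]] vector_fieldD[OF L_vf[OF Y]]
    by (auto simp: fscale_def lie_algebra_def fun_eq_iff algebra_simps)
qed

lemma L_sum: "(\<And>i. i \<in> I \<Longrightarrow> X i \<in> lie_algebra p B G) \<Longrightarrow> (\<Sum>i\<in>I. vf_scale (r i) (X i)) \<in> lie_algebra p B G"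
proof (induction I rule: infinite_finite_induct)
  case (insert i I)
  then have "X i \<in> lie_algebra p B G" "(\<Sum>i\<in>I. vf_scale (r i) (X i)) \<in> lie_algebra p B G" by auto
  then show ?case by (simp only: sum.insert[OF insert(1,2)] lie_algebra_closed)
qed (simp_all only: sum.infinite sum.empty lie_algebra_closed not_False_eq_True)

lemma bracket_sum:
  assumes X: "\<And>i. i \<in> I \<Longrightarrow> X i \<in> lie_algebra p B G" and Y: "Y \<in> lie_algebra p B G"
  shows "vf_bracket (\<Sum>i\<in>I. vf_scale (r i) (X i)) Y = (\<Sum>i\<in>I. vf_scale (r i) (vf_bracket (X i) Y))"
  using X
proof (induction I rule: infinite_finite_induct)
  case (insert i I)
  define T where "T = (\<Sum>i\<in>I. vf_scale (r i) (X i))"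
  note Yv = L_vf[OF Y]
  have Xi: "X i \<in> vector_fields p B" and T: "T \<in> vector_fields p B"
    unfolding T_def using insert by (auto intro!: L_vf L_sum)
  have "vf_bracket (vf_scale (r i) (X i) + T) Y = vf_scale (r i) (vf_bracket (X i) Y) + vf_bracket T Y"
  proof
    fix u
    show "vf_bracket (vf_scale (r i) (X i) + T) Y u = (vf_scale (r i) (vf_bracket (X i) Y) + vf_bracket T Y) u"
    proof (cases "u \<in> W")
      case True
      then have "Y (fscale (r i) (X i u) + T u) = fscale (r i) (Y (X i u)) + Y (T u)"
        using vector_fieldD[OF Yv] vector_fieldD[OF Xi] vector_fieldD[OF T] W_simps by simp
      then show ?thesis
        by (auto simp: vf_bracket_def vf_scale_altdef fscale_def algebra_simps fun_eq_iff)
    next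
      case False
      have 0: "X i u = 0" "T u = 0" "Y u = 0" "X i 0 = 0" "T 0 = 0" "Y 0 = 0"
        by (rule vector_fieldD(2)[OF Xi False] vector_fieldD(2)[OF T False] vector_fieldD(2)[OF Yv False]
            vf_zero[OF Xi] vf_zero[OF T] vf_zero[OF Yv])+
      have s: "fscale (r i) 0 = (0 :: 'g \<Rightarrow> real)" by (simp add: fscale_def zero_fun_def)
      show ?thesis by (simp only: vf_bracket_def vf_scale_altdef plus_fun_apply 0 s add_0 diff_self)
    qed
  qed
  moreover have "vf_bracket T Y = (\<Sum>i\<in>I. vf_scale (r i) (vf_bracket (X i) Y))"
    unfolding T_def using insert by blast
  ultimately show ?case unfolding sum.insert[OF insert(1,2)] T_def by (simp only:)
next
  case empty
  show ?case using vf_zero[OF L_vf[OF Y]] by (auto simp: vf_bracket_def fun_eq_iff zero_fun_def)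
next
  case (infinite I)
  then show ?case using vf_zero[OF L_vf[OF Y]] by (auto simp: vf_bracket_def fun_eq_iff zero_fun_def)
qed

lemma vf_scale_sum: "(\<Sum>a\<in>I. vf_scale (r a) X) = vf_scale (\<Sum>a\<in>I. r a) X"
  by (induction I rule: infinite_finite_induct) (auto simp: vf_scale_def fun_eq_iff algebra_simps)

lemma f_antisym:
  assumes "a < l" "b < l" "c < l" shows "f a b c = - f b a c"
proof -
  have "vf_bracket (e a) (e b) + vf_bracket (e b) (e a) = 0"
    by (auto simp: vf_bracket_def fun_eq_iff)
  then have "(\<Sum>c<l. vf_scale (f a b c + f b a c) (e c)) = 0"
    unfolding structure_constants[OF assms(1,2)] structure_constants[OF assms(2,1)] sum.distrib[symmetric]
    by (simp add: vf_scale_def plus_fun_def algebra_simps)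
  then have "f a b c + f b a c = 0" using assms(3) by (rule independent)
  then show ?thesis by simp
qed

lemma double_bracket:
  assumes m: "a < l" "b < l" "d < l"
  shows "vf_bracket (vf_bracket (e a) (e b)) (e d) = (\<Sum>c<l. vf_scale (\<Sum>s<l. f a b s * f s d c) (e c))"
proof -
  have "vf_bracket (vf_bracket (e a) (e b)) (e d) = (\<Sum>s<l. vf_scale (f a b s) (\<Sum>c<l. vf_scale (f s d c) (e c)))"
    unfolding structure_constants[OF m(1,2)]
    using bracket_sum[of "{..<l}" e "e d" "f a b"] e_L m(3) by (simp add: structure_constants)
  also have "\<dots> = (\<Sum>s<l. \<Sum>c<l. vf_scale (f a b s * f s d c) (e c))"
  proof (rule sum.cong[OF refl])
    fix s
    have "vf_scale (f a b s) (\<Sum>c\<in>I. vf_scale (f s d c) (e c)) = (\<Sum>c\<in>I. vf_scale (f a b s * f s d c) (e c))" for I :: "nat set"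
      by (induction I rule: infinite_finite_induct) (auto simp: vf_scale_def fun_eq_iff algebra_simps)
    then show "vf_scale (f a b s) (\<Sum>c<l. vf_scale (f s d c) (e c)) = (\<Sum>c<l. vf_scale (f a b s * f s d c) (e c))" .
  qed
  also have "\<dots> = (\<Sum>c<l. \<Sum>s<l. vf_scale (f a b s * f s d c) (e c))" by (rule sum.swap)
  finally show ?thesis unfolding vf_scale_sum .
qed

lemma jacobi_bracket:
  assumes X: "X \<in> vector_fields p B" and Y: "Y \<in> vector_fields p B" and T: "T \<in> vector_fields p B"
  shows "vf_bracket (vf_bracket X Y) T + vf_bracket (vf_bracket Y T) X + vf_bracket (vf_bracket T X) Y = 0"
proof
  fix u
  show "(vf_bracket (vf_bracket X Y) T + vf_bracket (vf_bracket Y T) X + vf_bracket (vf_bracket T X) Y) u = 0 u"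
  proof (cases "u \<in> W")
    case True
    note XW = vector_fieldD(1)[OF X] and YW = vector_fieldD(1)[OF Y] and TW = vector_fieldD(1)[OF T]
    show ?thesis
      using True by (simp add: vf_bracket_def vf_diff[OF X] vf_diff[OF Y] vf_diff[OF T] XW YW TW)
  next
    case False
    then show ?thesis
      using vector_fieldD(2)[OF X] vector_fieldD(2)[OF Y] vector_fieldD(2)[OF T] vf_zero[OF X] vf_zero[OF Y] vf_zero[OF T]
      by (simp add: vf_bracket_def)
  qed
qed

lemma f_jacobi:
  assumes m: "a < l" "b < l" "d < l" "c < l"
  shows "(\<Sum>s<l. f a b s * f s d c) + (\<Sum>s<l. f b d s * f s a c) + (\<Sum>s<l. f d a s * f s b c) = 0"
proof -
  let ?q = "\<lambda>c. (\<Sum>s<l. f a b s * f s d c) + (\<Sum>s<l. f b d s * f s a c) + (\<Sum>s<l. f d a s * f s b c)"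
  have split: "vf_scale (r + r' + r'') X = vf_scale r X + vf_scale r' X + vf_scale r'' X" for r r' r'' X
    by (auto simp: vf_scale_def fun_eq_iff algebra_simps)
  have "(\<Sum>c<l. vf_scale (?q c) (e c)) = 0"
    unfolding split sum.distrib double_bracket[OF m(1,2,3), symmetric] double_bracket[OF m(2,3,1), symmetric]
      double_bracket[OF m(3,1,2), symmetric]
    by (rule jacobi_bracket; rule L_vf, rule e_L, rule m)
  then show ?thesis using m(4) by (rule independent)
qed

end

section \<open>Contraction of the quantum BRST complex\<close>

theorem theorem4p3p3:
  fixes n p l :: nat
    and A :: "'m::{t2_space, second_countable_topology} chart set"
    and \<omega> :: "(('m \<Rightarrow> real) \<Rightarrow> 'm \<Rightarrow> real) \<Rightarrow> (('m \<Rightarrow> real) \<Rightarrow> 'm \<Rightarrow> real) \<Rightarrow> 'm \<Rightarrow> real"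
    and B :: "'g::{t2_space, second_countable_topology} chart set"
    and G :: "'g monoid"
    and act :: "'g \<Rightarrow> 'm \<Rightarrow> 'm"
    and J :: "'m \<Rightarrow> (('g \<Rightarrow> real) \<Rightarrow> 'g \<Rightarrow> real) \<Rightarrow> real"
    and e :: "nat \<Rightarrow> ('g \<Rightarrow> real) \<Rightarrow> 'g \<Rightarrow> real"
    and f :: "nat \<Rightarrow> nat \<Rightarrow> nat \<Rightarrow> real"
    and j :: "nat \<Rightarrow> 'm \<Rightarrow> 'k::{real_normed_field, euclidean_space}"
    and Z :: "'m set"
    and prol :: "('m \<Rightarrow> 'k) \<Rightarrow> 'm \<Rightarrow> 'k"
    and h :: "nat \<Rightarrow> (nat set \<Rightarrow> 'm \<Rightarrow> 'k) \<Rightarrow> nat set \<Rightarrow> 'm \<Rightarrow> 'k"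
    and \<mu> :: "nat \<Rightarrow> ('m \<Rightarrow> 'k) \<Rightarrow> ('m \<Rightarrow> 'k) \<Rightarrow> 'm \<Rightarrow> 'k"
    and qJ :: "(('g \<Rightarrow> real) \<Rightarrow> 'g \<Rightarrow> real) \<Rightarrow> ('m \<Rightarrow> 'k) fps"
  defines "j \<equiv> \<lambda>a m. of_real (J m (e a))"
    and "Z \<equiv> {m. \<forall>X\<in>lie_algebra p B G. J m X = 0}"
  defines "Jb \<equiv> \<lambda>a. qJ (e a)"
  defines "D \<equiv> brst_differential l \<mu> f Jb"
    and "res \<equiv> quantum_res_ext n A Z l \<mu> f j Jb h"
    and "d \<equiv> ce_differential l f (\<lambda>a. quantum_rep n A Z l \<mu> f j Jb prol h (qJ (e a)))"
  assumes manifold: "smooth_atlas n A"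
    and symplectic: "symplectic_form n A \<omega>"
    and lie_group: "lie_group p B G"
    and compact: "compact (UNIV :: 'g set)"
    and connected: "connected (UNIV :: 'g set)"
    and action: "symplectic_action n A \<omega> p B G act"
    and moment_map: "equivariant_moment_map n A \<omega> p B G act J"
    and basis: "lie_basis (lie_algebra p B G) l e"
    and structure_constants:
      "\<And>a b. a < l \<Longrightarrow> b < l \<Longrightarrow> vf_bracket (e a) (e b) = (\<Sum>c<l. vf_scale (f a b c) (e c))"
    and poisson_J:
      "\<And>a b m. a < l \<Longrightarrow> b < l \<Longrightarrow>
         poisson n A \<omega> (\<lambda>x. J x (e a)) (\<lambda>x. J x (e b)) m = (\<Sum>c<l. f a b c * J m (e c))"
    and generating: "generates_ideal n A Z l j"
    and acyclic: "koszul_acyclic n A l j"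
    and contraction_data: "koszul_contraction n A Z l j prol h"
    and star_product: "star_product n A \<omega> \<mu>"
    and quantum_moment_map: "quantum_moment_map n A p B G J \<mu> qJ"
  shows "\<exists>\<Phi> H.
     linear_map_on nuscale nuscale (cochains n A Z l) (brst_space n A l) \<Phi> \<and>
     linear_map_on nuscale nuscale (brst_space n A l) (brst_space n A l) H \<and>
     (\<forall>i. \<forall>z\<in>cochains_deg n A Z l i. \<Phi> z \<in> brst_space_deg n A l i) \<and>
     (\<forall>i. \<forall>x\<in>brst_space_deg n A l i. H x \<in> brst_space_deg n A l (i - 1)) \<and>
     series_of_continuous (CinfZ_top n A Z) (ghost_monomials l) (Cinf_top n A) (all_monomials l) \<Phi> \<and>
     series_of_continuous (Cinf_top n A) (all_monomials l) (Cinf_top n A) (all_monomials l) H \<and>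
     contraction (brst_space n A l) D (cochains n A Z l) d res \<Phi> H"
proof -
  interpret lie: lie_data p B G l e f
    by unfold_locales (use lie_group basis structure_constants in \<open>simp_all add: lie_group_def\<close>)
  let ?L = "lie_algebra p B G"
  note q = quantum_moment_map[unfolded quantum_moment_map_def linear_map_on_def]
  have qJ_add: "qJ (X + Y) = qJ X + qJ Y" if "X \<in> ?L" "Y \<in> ?L" for X Y
    using q that by blast
  have qJ_scale: "qJ (vf_scale r X) = cst (of_real r) * qJ X" if "X \<in> ?L" for r X
    using q that by blast
  have qJ_CS: "qJ X \<in> series_in (Cinf n A)" if "X \<in> ?L" for X
    using q that by blast
  have qJ_0: "fps_nth (qJ X) 0 = (\<lambda>m. of_real (J m X))" if "X \<in> ?L" for X
    using q that by blast
  have qJ_bracket: "star \<mu> (qJ X) (qJ Y) - star \<mu> (qJ Y) (qJ X) = fps_X * qJ (vf_bracket X Y)"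
    if "X \<in> ?L" "Y \<in> ?L" for X Y
    using q that by blast
  have qJ_sum: "qJ (\<Sum>c\<in>I. vf_scale (r c) (e c)) = (\<Sum>c\<in>I. cst (of_real (r c)) * Jb c)" if "finite I" "I \<subseteq> {..<l}" for r I
    using that
  proof (induction I)
    case empty
    have "qJ (0 + 0) = qJ 0 + qJ 0" by (rule qJ_add) (rule lie.lie_algebra_closed)+
    then have "qJ 0 = 0" by (simp only: add_0 add_cancel_right_right)
    then show ?case by (simp only: sum.empty)
  next
    case (insert c I)
    have "e c \<in> ?L" using insert by (auto intro: lie.e_L)
    moreover have "(\<Sum>c\<in>I. vf_scale (r c) (e c)) \<in> ?L" using insert by (auto intro!: lie.L_sum lie.e_L)
    ultimately show ?case
      using insert unfolding sum.insert[OF insert(1,2)]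
      by (simp only: qJ_add lie.lie_algebra_closed qJ_scale insert_subset Jb_def simp_thms)
  qed
  interpret koszul_data n A l \<mu> f Jb j Z prol h
  proof unfold_locales
    show "star \<mu> (Jb a) (Jb b) - star \<mu> (Jb b) (Jb a) = fps_X * (\<Sum>c<l. cst (of_real (f a b c)) * Jb c)"
      if "a < l" "b < l" for a b
      using that unfolding Jb_def qJ_bracket[OF lie.e_L[OF that(1)] lie.e_L[OF that(2)]] structure_constants[OF that]
      using qJ_sum[of "{..<l}" "f a b"] by (simp add: Jb_def)
    show "smooth_atlas n A" by (rule manifold)
    note sp = star_product[unfolded star_product_def]
    show "\<mu> 0 u v = u * v" if "u \<in> Cinf n A" "v \<in> Cinf n A" for u v
      using sp that by blast
    show "bidifferential n A (\<mu> i)" if "1 \<le> i" for i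
      using sp that by blast
    show "star \<mu> (star \<mu> F G) H = star \<mu> F (star \<mu> G H)"
      if "F \<in> series_in (Cinf n A)" "G \<in> series_in (Cinf n A)" "H \<in> series_in (Cinf n A)" for F G H
      using sp that by blast
    show "star \<mu> 1 F = F" "star \<mu> F 1 = F" if "F \<in> series_in (Cinf n A)" for F
      using sp that by blast+
    show "Jb a \<in> series_in (Cinf n A)" "fps_nth (Jb a) 0 = j a" if "a < l" for a
      unfolding Jb_def j_def using qJ_CS qJ_0 lie.e_L[OF that] by blast+
    show "f a b c = - f b a c" if "a < l" "b < l" "c < l" for a b c
      using that by (rule lie.f_antisym)
    show "(\<Sum>s<l. f a b s * f s d c) + (\<Sum>s<l. f b d s * f s a c) + (\<Sum>s<l. f d a s * f s b c) = 0"
      if "a < l" "b < l" "d < l" "c < l" for a b d c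
      using that by (rule lie.f_jacobi)
    show "j a m = 0" if "a < l" "m \<in> Z" for a m
      using that lie.e_L unfolding j_def Z_def by simp
    show "koszul_contraction n A Z l j prol h" by (rule contraction_data)
  qed
  show ?thesis
    using quantum_contraction unfolding D_def d_def res_def Jb_def .
qed

end
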